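(* Let $a,\sigma_L,\sigma_M,\sigma_R>0$, and let $u_0^L$ on $(-\infty,-a)$, $u_0^M$ on $(-a,a)$, $u_0^R$ on $(a,\infty)$ be given initial data. Consider the heat transfer problem $$u^L_t=\sigma_L^2u^L_{xx}\ (-\infty<x<-a),\qquad u^M_t=\sigma_M^2u^M_{xx}\ (-a<x<a),\qquad u^R_t=\sigma_R^2u^R_{xx}\ (a<x<\infty),\qquad t>0,$$ with initial conditions $u^L(x,0)=u_0^L(x)$, $u^M(x,0)=u_0^M(x)$, $u^R(x,0)=u_0^R(x)$ on the respective intervals; asymptotic conditions $\lim_{x\to-\infty}u^L(x,t)=0$ and $\lim_{x\to\infty}u^R(x,t)=0$ for $t\ge0$; and continuity conditions, for $t\ge0$, $$u^L(-a,t)=u^M(-a,t),\quad u^M(a,t)=u^R(a,t),\quad \sigma_L^2u^L_x(-a,t)=\sigma_M^2u^M_x(-a,t),\quad \sigma_M^2u^M_x(a,t)=\sigma_R^2u_x^R(a,t).$$ The solution of this problem is: for $-\infty<x<-a$, $$\begin{aligned}u^L(x,t)=\;&\frac1{2\pi}\int_{-\infty}^\infty e^{ikx-(\sigma_Lk)^2t}\hat u_0^L(k)\,dk-\sigma_L(\sigma_M+\sigma_R)\int_{\partial D_0^-}\frac{e^{ik(x+a+3a\sigma_L/\sigma_M)-(\sigma_Lk)^2t}}{\Delta_L(k)}\hat u_0^M\left(\frac{k\sigma_L}{\sigma_M}\right)dk\\&-\frac12\int_{\partial D_0^-}\frac{e^{ik(x+2a)-(\sigma_Lk)^2t}}{\Delta_L(k)}\Big((\sigma_L+\sigma_M)(\sigma_M-\sigma_R)+e^{4ika\sigma_L/\sigma_M}(\sigma_L-\sigma_M)(\sigma_M+\sigma_R)\Big)\hat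 u_0^L(-k)\,dk\\&+\sigma_L(\sigma_R-\sigma_M)\int_{\partial D_0^-}\frac{e^{ik(x+a+a\sigma_L/\sigma_M)-(\sigma_Lk)^2t}}{\Delta_L(k)}\hat u_0^M\left(\frac{-k\sigma_L}{\sigma_M}\right)dk\\&-2\sigma_L\sigma_M\int_{\partial D_0^-}\frac{e^{ik(x+a+a\sigma_L/\sigma_R+2a\sigma_L/\sigma_M)-(\sigma_Lk)^2t}}{\Delta_L(k)}\hat u_0^R\left(\frac{k\sigma_L}{\sigma_R}\right)dk;\end{aligned}$$ for $-a<x<a$, $$\begin{aligned}u^M(x,t)=\;&\frac1{2\pi}\int_{-\infty}^\infty e^{ikx-(\sigma_Mk)^2t}\hat u_0^M(k)\,dk-\sigma_M(\sigma_M-\sigma_R)\int_{\partial D_0^-}\frac{e^{ik(x+a+a\sigma_M/\sigma_L)-(\sigma_Mk)^2t}}{\Delta_L(k\sigma_M/\sigma_L)}\hat u_0^L\left(\frac{-k\sigma_M}{\sigma_L}\right)dk\\&+\frac{(\sigma_L-\sigma_M)(\sigma_M-\sigma_R)}2\int_{\partial D_0^-}\frac{e^{ikx-(\sigma_Mk)^2t}}{\Delta_L(k\sigma_M/\sigma_L)}\hat u_0^M(k)\,dk\\&+\sigma_M(\sigma_M+\sigma_R)\int_{\partial D_0^+}\frac{e^{ik(x+a-a\sigma_M/\sigma_L)-(\sigma_Mk)^2t}}{\Delta_R(k\sigma_M/\sigma_R)}\hat u_0^L\left(\frac{k\sigma_M}{\sigma_L}\right)dk\\&-\sigma_M(\sigma_L+\sigma_M)\int_{\partial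 D_0^-}\frac{e^{ik(x+3a+a\sigma_M/\sigma_R)-(\sigma_Mk)^2t}}{\Delta_L(k\sigma_M/\sigma_L)}\hat u_0^R\left(\frac{k\sigma_M}{\sigma_R}\right)dk\\&-\frac{(\sigma_L+\sigma_M)(\sigma_M-\sigma_R)}2\int_{\partial D_0^-}\frac{e^{ik(x+2a)-(\sigma_Mk)^2t}}{\Delta_L(k\sigma_M/\sigma_L)}\hat u_0^M(-k)\,dk\\&+\frac{(\sigma_M-\sigma_L)(\sigma_M+\sigma_R)}2\int_{\partial D_0^+}\frac{e^{ik(x+2a)-(\sigma_Mk)^2t}}{\Delta_R(k\sigma_M/\sigma_R)}\hat u_0^M(k)\,dk\\&+\frac{(\sigma_M-\sigma_L)(\sigma_M-\sigma_R)}2\int_{\partial D_0^+}\frac{e^{ik(x+4a)-(\sigma_Mk)^2t}}{\Delta_R(k\sigma_M/\sigma_R)}\hat u_0^M(-k)\,dk\\&+\sigma_M(\sigma_M-\sigma_L)\int_{\partial D_0^+}\frac{e^{ik(x+3a-a\sigma_M/\sigma_R)-(\sigma_Mk)^2t}}{\Delta_R(k\sigma_M/\sigma_R)}\hat u_0^R\left(\frac{-k\sigma_M}{\sigma_R}\right)dk;\end{aligned}$$ and for $x>a$ the expression for $u^R(x,t)$ is identical to that for $u^L(x,t)$ with the replacements $a\leftrightarrow-a$, $R\leftrightarrow L$, $\partial D_0^-\leftrightarrow-\partial D_0^+$, that is, $$\begin{aligned}u^R(x,t)=\;&\frac1{2\pi}\int_{-\infty}^\infty e^{ikx-(\sigma_Rk)^2t}\hat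 u_0^R(k)\,dk+\sigma_R(\sigma_M+\sigma_L)\int_{\partial D_0^+}\frac{e^{ik(x-a-3a\sigma_R/\sigma_M)-(\sigma_Rk)^2t}}{\widetilde\Delta(k)}\hat u_0^M\left(\frac{k\sigma_R}{\sigma_M}\right)dk\\&+\frac12\int_{\partial D_0^+}\frac{e^{ik(x-2a)-(\sigma_Rk)^2t}}{\widetilde\Delta(k)}\Big((\sigma_R+\sigma_M)(\sigma_M-\sigma_L)+e^{-4ika\sigma_R/\sigma_M}(\sigma_R-\sigma_M)(\sigma_M+\sigma_L)\Big)\hat u_0^R(-k)\,dk\\&-\sigma_R(\sigma_L-\sigma_M)\int_{\partial D_0^+}\frac{e^{ik(x-a-a\sigma_R/\sigma_M)-(\sigma_Rk)^2t}}{\widetilde\Delta(k)}\hat u_0^M\left(\frac{-k\sigma_R}{\sigma_M}\right)dk\\&+2\sigma_R\sigma_M\int_{\partial D_0^+}\frac{e^{ik(x-a-a\sigma_R/\sigma_L-2a\sigma_R/\sigma_M)-(\sigma_Rk)^2t}}{\widetilde\Delta(k)}\hat u_0^L\left(\frac{k\sigma_R}{\sigma_L}\right)dk.\end{aligned}$$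
   Context: Notation: $\hat u_0^L(k)=\int_{-\infty}^{-a}e^{-ikx}u_0^L(x)\,dx$, $\hat u_0^M(k)=\int_{-a}^{a}e^{-ikx}u_0^M(x)\,dx$, $\hat u_0^R(k)=\int_a^\infty e^{-ikx}u_0^R(x)\,dx$, and $$\Delta_L(k)=\pi\left((\sigma_L-\sigma_M)(\sigma_M-\sigma_R)+e^{4iak\sigma_L/\sigma_M}(\sigma_L+\sigma_M)(\sigma_M+\sigma_R)\right),$$ $$\Delta_R(k)=\pi\left((\sigma_L+\sigma_M)(\sigma_M+\sigma_R)+e^{4iak\sigma_R/\sigma_M}(\sigma_L-\sigma_M)(\sigma_M-\sigma_R)\right).$$ $\widetilde\Delta$ denotes $\Delta_L$ after the replacements $a\leftrightarrow-a$, $R\leftrightarrow L$: $$\widetilde\Delta(k)=\pi\left((\sigma_R-\sigma_M)(\sigma_M-\sigma_L)+e^{-4iak\sigma_R/\sigma_M}(\sigma_R+\sigma_M)(\sigma_M+\sigma_L)\right)=e^{-4iak\sigma_R/\sigma_M}\Delta_R(k).$$ Contours: $D=\{k\in\mathbb{C}:\operatorname{Re}(k^2)<0\}=D^+\cup D^-$, where $D^\pm$ are the parts of $D$ in the upper/lower half-plane. $D_0^\pm$ is $D^\pm$ deformed near the origin so that its boundary avoids $k=0$. Boundaries are oriented with the region on the left: $\partial D_0^+$ runs from $\infty e^{3\pi i/4}$ to $\infty e^{i\pi/4}$, and $\partial D_0^-$ runs from $\infty e^{-i\pi/4}$ to $\infty e^{-3\pi i/4}$.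
   Formalization: In u^M the arguments k and -k of û_0^M are swapped in the ∂D_0^+ integrals with e^{ik(x+2a)}, e^{ik(x+4a)} (false as printed). Data: continuous up to ±a, integrable, vanishing at infinity; solutions: classical, bounded on [0,T]. *)

theory Defs
  imports "HOL-Complex_Analysis.Complex_Analysis"
begin

section \<open>The interface problem\<close>

definition heat_equation :: "real \<Rightarrow> real set \<Rightarrow> (real \<Rightarrow> real \<Rightarrow> real) \<Rightarrow> bool" where
  "heat_equation \<sigma> I u \<longleftrightarrow>
     (\<exists>u\<^sub>x. \<forall>x\<in>I. \<forall>t>0.
        ((\<lambda>y. u y t) has_real_derivative u\<^sub>x x t) (at x) \<and>
        (\<exists>u\<^sub>x\<^sub>x. ((\<lambda>y. u\<^sub>x y t) has_real_derivative u\<^sub>x\<^sub>x) (at x) \<and>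
               ((\<lambda>\<tau>. u x \<tau>) has_real_derivative \<sigma>\<^sup>2 * u\<^sub>x\<^sub>x) (at t)))"

(* Continuity of temperature and heat flux of three spatial profiles; the derivatives at the
   interfaces are one-sided. *)
definition interface_conditions ::
  "real \<Rightarrow> real \<Rightarrow> real \<Rightarrow> real \<Rightarrow> (real \<Rightarrow> real) \<Rightarrow> (real \<Rightarrow> real) \<Rightarrow> (real \<Rightarrow> real) \<Rightarrow> bool" where
  "interface_conditions a \<sigma>\<^sub>L \<sigma>\<^sub>M \<sigma>\<^sub>R v\<^sub>L v\<^sub>M v\<^sub>R \<longleftrightarrow>
     v\<^sub>L (- a) = v\<^sub>M (- a) \<and> v\<^sub>M a = v\<^sub>R a \<and>
     (\<exists>p q. (v\<^sub>L has_real_derivative p) (at (- a) within {..- a}) \<and>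
            (v\<^sub>M has_real_derivative q) (at (- a) within {- a..a}) \<and>
            \<sigma>\<^sub>L\<^sup>2 * p = \<sigma>\<^sub>M\<^sup>2 * q) \<and>
     (\<exists>p q. (v\<^sub>M has_real_derivative p) (at a within {- a..a}) \<and>
            (v\<^sub>R has_real_derivative q) (at a within {a..}) \<and>
            \<sigma>\<^sub>M\<^sup>2 * p = \<sigma>\<^sub>R\<^sup>2 * q)"

(* Classical regularity on a closed spatial interval I. The finitely many points of the set E,
   the interfaces, are exempt from continuity at time 0, so that the initial data may jump
   there. Boundedness on finite time intervals is the growth condition that excludes
   Tychonoff-type null solutions. *)
definition regular_up_to_boundary :: "real set \<Rightarrow> real set \<Rightarrow> (real \<Rightarrow> real \<Rightarrow> real) \<Rightarrow> bool" where
  "regular_up_to_boundary I E u \<longleftrightarrow>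
     continuous_on (I \<times> {0..} - E \<times> {0}) (\<lambda>(x, t). u x t) \<and>
     (\<forall>T\<ge>0. \<exists>C. \<forall>x\<in>I. \<forall>t\<in>{0..T}. \<bar>u x t\<bar> \<le> C)"

(* J is the set of times at which the interface conditions are imposed. *)
definition heat_solution ::
  "real \<Rightarrow> real \<Rightarrow> real \<Rightarrow> real \<Rightarrow> (real \<Rightarrow> real) \<Rightarrow> (real \<Rightarrow> real) \<Rightarrow> (real \<Rightarrow> real) \<Rightarrow> real set \<Rightarrow>
   (real \<Rightarrow> real \<Rightarrow> real) \<Rightarrow> (real \<Rightarrow> real \<Rightarrow> real) \<Rightarrow> (real \<Rightarrow> real \<Rightarrow> real) \<Rightarrow> bool" where
  "heat_solution a \<sigma>\<^sub>L \<sigma>\<^sub>M \<sigma>\<^sub>R u\<^sub>0\<^sub>L u\<^sub>0\<^sub>M u\<^sub>0\<^sub>R J u\<^sub>L u\<^sub>M u\<^sub>R \<longleftrightarrow>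
     heat_equation \<sigma>\<^sub>L {..<- a} u\<^sub>L \<and>
     heat_equation \<sigma>\<^sub>M {- a<..<a} u\<^sub>M \<and>
     heat_equation \<sigma>\<^sub>R {a<..} u\<^sub>R \<and>
     regular_up_to_boundary {..- a} {- a} u\<^sub>L \<and>
     regular_up_to_boundary {- a..a} {- a, a} u\<^sub>M \<and>
     regular_up_to_boundary {a..} {a} u\<^sub>R \<and>
     (\<forall>x\<le>- a. u\<^sub>L x 0 = u\<^sub>0\<^sub>L x) \<and>
     (\<forall>x\<in>{- a..a}. u\<^sub>M x 0 = u\<^sub>0\<^sub>M x) \<and>
     (\<forall>x\<ge>a. u\<^sub>R x 0 = u\<^sub>0\<^sub>R x) \<and>
     (\<forall>t\<ge>0. ((\<lambda>x. u\<^sub>L x t) \<longlongrightarrow> 0) at_bot) \<and>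
     (\<forall>t\<ge>0. ((\<lambda>x. u\<^sub>R x t) \<longlongrightarrow> 0) at_top) \<and>
     (\<forall>t\<in>J. interface_conditions a \<sigma>\<^sub>L \<sigma>\<^sub>M \<sigma>\<^sub>R (\<lambda>x. u\<^sub>L x t) (\<lambda>x. u\<^sub>M x t) (\<lambda>x. u\<^sub>R x t))"

section \<open>Transforms and contours\<close>

definition fourier_on :: "real set \<Rightarrow> (real \<Rightarrow> real) \<Rightarrow> complex \<Rightarrow> complex" where
  "fourier_on I u k = (LBINT x:I. exp (- (\<i> * k * complex_of_real x)) * complex_of_real (u x))"

definition Delta_L :: "real \<Rightarrow> real \<Rightarrow> real \<Rightarrow> real \<Rightarrow> complex \<Rightarrow> complex" where
  "Delta_L a \<sigma>\<^sub>L \<sigma>\<^sub>M \<sigma>\<^sub>R k =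
     pi * ((\<sigma>\<^sub>L - \<sigma>\<^sub>M) * (\<sigma>\<^sub>M - \<sigma>\<^sub>R) + exp (4 * \<i> * a * k * \<sigma>\<^sub>L / \<sigma>\<^sub>M) * (\<sigma>\<^sub>L + \<sigma>\<^sub>M) * (\<sigma>\<^sub>M + \<sigma>\<^sub>R))"

definition Delta_R :: "real \<Rightarrow> real \<Rightarrow> real \<Rightarrow> real \<Rightarrow> complex \<Rightarrow> complex" where
  "Delta_R a \<sigma>\<^sub>L \<sigma>\<^sub>M \<sigma>\<^sub>R k =
     pi * ((\<sigma>\<^sub>L + \<sigma>\<^sub>M) * (\<sigma>\<^sub>M + \<sigma>\<^sub>R) + exp (4 * \<i> * a * k * \<sigma>\<^sub>R / \<sigma>\<^sub>M) * (\<sigma>\<^sub>L - \<sigma>\<^sub>M) * (\<sigma>\<^sub>M - \<sigma>\<^sub>R))"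

definition Delta_tilde :: "real \<Rightarrow> real \<Rightarrow> real \<Rightarrow> real \<Rightarrow> complex \<Rightarrow> complex" where
  "Delta_tilde a \<sigma>\<^sub>L \<sigma>\<^sub>M \<sigma>\<^sub>R = Delta_L (- a) \<sigma>\<^sub>R \<sigma>\<^sub>M \<sigma>\<^sub>L"

lemma Delta_tilde_eq:
  assumes "\<sigma>\<^sub>M \<noteq> 0"
  shows "Delta_tilde a \<sigma>\<^sub>L \<sigma>\<^sub>M \<sigma>\<^sub>R k =
           exp (- 4 * \<i> * a * k * \<sigma>\<^sub>R / \<sigma>\<^sub>M) * Delta_R a \<sigma>\<^sub>L \<sigma>\<^sub>M \<sigma>\<^sub>R k"
proof -
  have "exp (- 4 * \<i> * a * k * \<sigma>\<^sub>R / \<sigma>\<^sub>M) * exp (4 * \<i> * a * k * \<sigma>\<^sub>R / \<sigma>\<^sub>M) = 1"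
    by (simp flip: exp_add)
  then show ?thesis
    unfolding Delta_tilde_def Delta_L_def Delta_R_def by (simp add: exp_minus field_simps)
qed

(* D is the set of k with Re (k^2) < 0; the boundary of its upper (lower) part consists of the
   rays from 0 at angles pi/4 and 3 pi/4 (- pi/4 and - 3 pi/4). A deformed boundary keeps
   these rays outside the disc of radius r and joins their end points by a path g around 0.
   It stays in the open half-plane, because the transforms of the half-line data are in general
   not defined on the other side of the real axis. *)

definition upper_detour :: "real \<Rightarrow> (real \<Rightarrow> complex) \<Rightarrow> bool" where
  "upper_detour r g \<longleftrightarrow> 0 < r \<and> valid_path g \<and> path_image g \<subseteq> {k. 0 < Im k} \<and>
     pathstart g = r * cis (3 * pi / 4) \<and> pathfinish g = r * cis (pi / 4)"

definition lower_detour :: "real \<Rightarrow> (real \<Rightarrow> complex) \<Rightarrow> bool" where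
  "lower_detour r g \<longleftrightarrow> 0 < r \<and> valid_path g \<and> path_image g \<subseteq> {k. Im k < 0} \<and>
     pathstart g = r * cis (- pi / 4) \<and> pathfinish g = r * cis (- 3 * pi / 4)"

definition outward_ray_integral :: "real \<Rightarrow> real \<Rightarrow> (complex \<Rightarrow> complex) \<Rightarrow> complex" where
  "outward_ray_integral r \<theta> f = (LBINT s:{r..}. f (s * cis \<theta>) * cis \<theta>)"

definition integral_D0_plus :: "real \<Rightarrow> (real \<Rightarrow> complex) \<Rightarrow> (complex \<Rightarrow> complex) \<Rightarrow> complex" where
  "integral_D0_plus r g f =
     - outward_ray_integral r (3 * pi / 4) f + contour_integral g f + outward_ray_integral r (pi / 4) f"

definition integral_D0_minus :: "real \<Rightarrow> (real \<Rightarrow> complex) \<Rightarrow> (complex \<Rightarrow> complex) \<Rightarrow> complex" where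
  "integral_D0_minus r g f =
     - outward_ray_integral r (- pi / 4) f + contour_integral g f + outward_ray_integral r (- 3 * pi / 4) f"

section \<open>The solution formulae\<close>

(* P and N stand for integration over the deformed boundaries of the upper and lower part of D,
   and hL, hM, hR for the transforms of the initial data. *)

definition formula_L ::
  "real \<Rightarrow> real \<Rightarrow> real \<Rightarrow> real \<Rightarrow> (complex \<Rightarrow> complex) \<Rightarrow> (complex \<Rightarrow> complex) \<Rightarrow> (complex \<Rightarrow> complex) \<Rightarrow>
   ((complex \<Rightarrow> complex) \<Rightarrow> complex) \<Rightarrow> real \<Rightarrow> real \<Rightarrow> complex" where
  "formula_L a \<sigma>\<^sub>L \<sigma>\<^sub>M \<sigma>\<^sub>R hL hM hR N x t =
     1 / (2 * pi) * (LBINT k. exp (\<i> * k * x - (\<sigma>\<^sub>L * k)\<^sup>2 * t) * hL (complex_of_real k))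
   - \<sigma>\<^sub>L * (\<sigma>\<^sub>M + \<sigma>\<^sub>R) *
       N (\<lambda>k. exp (\<i> * k * (x + a + 3 * a * \<sigma>\<^sub>L / \<sigma>\<^sub>M) - (\<sigma>\<^sub>L * k)\<^sup>2 * t) / Delta_L a \<sigma>\<^sub>L \<sigma>\<^sub>M \<sigma>\<^sub>R k
              * hM (k * \<sigma>\<^sub>L / \<sigma>\<^sub>M))
   - 1 / 2 *
       N (\<lambda>k. exp (\<i> * k * (x + 2 * a) - (\<sigma>\<^sub>L * k)\<^sup>2 * t) / Delta_L a \<sigma>\<^sub>L \<sigma>\<^sub>M \<sigma>\<^sub>R k
              * ((\<sigma>\<^sub>L + \<sigma>\<^sub>M) * (\<sigma>\<^sub>M - \<sigma>\<^sub>R)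
                 + exp (4 * \<i> * k * a * \<sigma>\<^sub>L / \<sigma>\<^sub>M) * (\<sigma>\<^sub>L - \<sigma>\<^sub>M) * (\<sigma>\<^sub>M + \<sigma>\<^sub>R))
              * hL (- k))
   + \<sigma>\<^sub>L * (\<sigma>\<^sub>R - \<sigma>\<^sub>M) *
       N (\<lambda>k. exp (\<i> * k * (x + a + a * \<sigma>\<^sub>L / \<sigma>\<^sub>M) - (\<sigma>\<^sub>L * k)\<^sup>2 * t) / Delta_L a \<sigma>\<^sub>L \<sigma>\<^sub>M \<sigma>\<^sub>R k
              * hM (- k * \<sigma>\<^sub>L / \<sigma>\<^sub>M))
   - 2 * \<sigma>\<^sub>L * \<sigma>\<^sub>M *
       N (\<lambda>k. exp (\<i> * k * (x + a + a * \<sigma>\<^sub>L / \<sigma>\<^sub>R + 2 * a * \<sigma>\<^sub>L / \<sigma>\<^sub>M) - (\<sigma>\<^sub>L * k)\<^sup>2 * t)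
              / Delta_L a \<sigma>\<^sub>L \<sigma>\<^sub>M \<sigma>\<^sub>R k
              * hR (k * \<sigma>\<^sub>L / \<sigma>\<^sub>R))"

(* Pitfall: in the integrals P with factors (\<sigma>\<^sub>M - \<sigma>\<^sub>L) * (\<sigma>\<^sub>M \<plusminus> \<sigma>\<^sub>R) / 2, hM (- k) goes with
   exp (\<i> k (x + 2 a)) and hM k with exp (\<i> k (x + 4 a)), as the reflection
   x -> - x, L <-> R of the two integrals N of hM (- k) and hM k requires. With hM k and
   hM (- k) exchanged the temperature is discontinuous at - a. *)
definition formula_M ::
  "real \<Rightarrow> real \<Rightarrow> real \<Rightarrow> real \<Rightarrow> (complex \<Rightarrow> complex) \<Rightarrow> (complex \<Rightarrow> complex) \<Rightarrow> (complex \<Rightarrow> complex) \<Rightarrow>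
   ((complex \<Rightarrow> complex) \<Rightarrow> complex) \<Rightarrow> ((complex \<Rightarrow> complex) \<Rightarrow> complex) \<Rightarrow> real \<Rightarrow> real \<Rightarrow> complex" where
  "formula_M a \<sigma>\<^sub>L \<sigma>\<^sub>M \<sigma>\<^sub>R hL hM hR P N x t =
     1 / (2 * pi) * (LBINT k. exp (\<i> * k * x - (\<sigma>\<^sub>M * k)\<^sup>2 * t) * hM (complex_of_real k))
   - \<sigma>\<^sub>M * (\<sigma>\<^sub>M - \<sigma>\<^sub>R) *
       N (\<lambda>k. exp (\<i> * k * (x + a + a * \<sigma>\<^sub>M / \<sigma>\<^sub>L) - (\<sigma>\<^sub>M * k)\<^sup>2 * t)
              / Delta_L a \<sigma>\<^sub>L \<sigma>\<^sub>M \<sigma>\<^sub>R (k * \<sigma>\<^sub>M / \<sigma>\<^sub>L) * hL (- k * \<sigma>\<^sub>M / \<sigma>\<^sub>L))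
   + (\<sigma>\<^sub>L - \<sigma>\<^sub>M) * (\<sigma>\<^sub>M - \<sigma>\<^sub>R) / 2 *
       N (\<lambda>k. exp (\<i> * k * x - (\<sigma>\<^sub>M * k)\<^sup>2 * t)
              / Delta_L a \<sigma>\<^sub>L \<sigma>\<^sub>M \<sigma>\<^sub>R (k * \<sigma>\<^sub>M / \<sigma>\<^sub>L) * hM k)
   + \<sigma>\<^sub>M * (\<sigma>\<^sub>M + \<sigma>\<^sub>R) *
       P (\<lambda>k. exp (\<i> * k * (x + a - a * \<sigma>\<^sub>M / \<sigma>\<^sub>L) - (\<sigma>\<^sub>M * k)\<^sup>2 * t)
              / Delta_R a \<sigma>\<^sub>L \<sigma>\<^sub>M \<sigma>\<^sub>R (k * \<sigma>\<^sub>M / \<sigma>\<^sub>R) * hL (k * \<sigma>\<^sub>M / \<sigma>\<^sub>L))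
   - \<sigma>\<^sub>M * (\<sigma>\<^sub>L + \<sigma>\<^sub>M) *
       N (\<lambda>k. exp (\<i> * k * (x + 3 * a + a * \<sigma>\<^sub>M / \<sigma>\<^sub>R) - (\<sigma>\<^sub>M * k)\<^sup>2 * t)
              / Delta_L a \<sigma>\<^sub>L \<sigma>\<^sub>M \<sigma>\<^sub>R (k * \<sigma>\<^sub>M / \<sigma>\<^sub>L) * hR (k * \<sigma>\<^sub>M / \<sigma>\<^sub>R))
   - (\<sigma>\<^sub>L + \<sigma>\<^sub>M) * (\<sigma>\<^sub>M - \<sigma>\<^sub>R) / 2 *
       N (\<lambda>k. exp (\<i> * k * (x + 2 * a) - (\<sigma>\<^sub>M * k)\<^sup>2 * t)
              / Delta_L a \<sigma>\<^sub>L \<sigma>\<^sub>M \<sigma>\<^sub>R (k * \<sigma>\<^sub>M / \<sigma>\<^sub>L) * hM (- k))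
   + (\<sigma>\<^sub>M - \<sigma>\<^sub>L) * (\<sigma>\<^sub>M + \<sigma>\<^sub>R) / 2 *
       P (\<lambda>k. exp (\<i> * k * (x + 2 * a) - (\<sigma>\<^sub>M * k)\<^sup>2 * t)
              / Delta_R a \<sigma>\<^sub>L \<sigma>\<^sub>M \<sigma>\<^sub>R (k * \<sigma>\<^sub>M / \<sigma>\<^sub>R) * hM (- k))
   + (\<sigma>\<^sub>M - \<sigma>\<^sub>L) * (\<sigma>\<^sub>M - \<sigma>\<^sub>R) / 2 *
       P (\<lambda>k. exp (\<i> * k * (x + 4 * a) - (\<sigma>\<^sub>M * k)\<^sup>2 * t)
              / Delta_R a \<sigma>\<^sub>L \<sigma>\<^sub>M \<sigma>\<^sub>R (k * \<sigma>\<^sub>M / \<sigma>\<^sub>R) * hM k)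
   + \<sigma>\<^sub>M * (\<sigma>\<^sub>M - \<sigma>\<^sub>L) *
       P (\<lambda>k. exp (\<i> * k * (x + 3 * a - a * \<sigma>\<^sub>M / \<sigma>\<^sub>R) - (\<sigma>\<^sub>M * k)\<^sup>2 * t)
              / Delta_R a \<sigma>\<^sub>L \<sigma>\<^sub>M \<sigma>\<^sub>R (k * \<sigma>\<^sub>M / \<sigma>\<^sub>R) * hR (- k * \<sigma>\<^sub>M / \<sigma>\<^sub>R))"

definition formula_R ::
  "real \<Rightarrow> real \<Rightarrow> real \<Rightarrow> real \<Rightarrow> (complex \<Rightarrow> complex) \<Rightarrow> (complex \<Rightarrow> complex) \<Rightarrow> (complex \<Rightarrow> complex) \<Rightarrow>
   ((complex \<Rightarrow> complex) \<Rightarrow> complex) \<Rightarrow> real \<Rightarrow> real \<Rightarrow> complex" where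
  "formula_R a \<sigma>\<^sub>L \<sigma>\<^sub>M \<sigma>\<^sub>R hL hM hR P x t =
     1 / (2 * pi) * (LBINT k. exp (\<i> * k * x - (\<sigma>\<^sub>R * k)\<^sup>2 * t) * hR (complex_of_real k))
   + \<sigma>\<^sub>R * (\<sigma>\<^sub>M + \<sigma>\<^sub>L) *
       P (\<lambda>k. exp (\<i> * k * (x - a - 3 * a * \<sigma>\<^sub>R / \<sigma>\<^sub>M) - (\<sigma>\<^sub>R * k)\<^sup>2 * t) / Delta_tilde a \<sigma>\<^sub>L \<sigma>\<^sub>M \<sigma>\<^sub>R k
              * hM (k * \<sigma>\<^sub>R / \<sigma>\<^sub>M))
   + 1 / 2 *
       P (\<lambda>k. exp (\<i> * k * (x - 2 * a) - (\<sigma>\<^sub>R * k)\<^sup>2 * t) / Delta_tilde a \<sigma>\<^sub>L \<sigma>\<^sub>M \<sigma>\<^sub>R k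
              * ((\<sigma>\<^sub>R + \<sigma>\<^sub>M) * (\<sigma>\<^sub>M - \<sigma>\<^sub>L)
                 + exp (- 4 * \<i> * k * a * \<sigma>\<^sub>R / \<sigma>\<^sub>M) * (\<sigma>\<^sub>R - \<sigma>\<^sub>M) * (\<sigma>\<^sub>M + \<sigma>\<^sub>L))
              * hR (- k))
   - \<sigma>\<^sub>R * (\<sigma>\<^sub>L - \<sigma>\<^sub>M) *
       P (\<lambda>k. exp (\<i> * k * (x - a - a * \<sigma>\<^sub>R / \<sigma>\<^sub>M) - (\<sigma>\<^sub>R * k)\<^sup>2 * t) / Delta_tilde a \<sigma>\<^sub>L \<sigma>\<^sub>M \<sigma>\<^sub>R k
              * hM (- k * \<sigma>\<^sub>R / \<sigma>\<^sub>M))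
   + 2 * \<sigma>\<^sub>R * \<sigma>\<^sub>M *
       P (\<lambda>k. exp (\<i> * k * (x - a - a * \<sigma>\<^sub>R / \<sigma>\<^sub>L - 2 * a * \<sigma>\<^sub>R / \<sigma>\<^sub>M) - (\<sigma>\<^sub>R * k)\<^sup>2 * t)
              / Delta_tilde a \<sigma>\<^sub>L \<sigma>\<^sub>M \<sigma>\<^sub>R k
              * hL (k * \<sigma>\<^sub>R / \<sigma>\<^sub>L))"

end

(* Measured by travel time x / sigma the three layers all have diffusivity 1, and the heat flow is
   a Gaussian average of the wave flow. So each of the three temperatures is the heat flow on the
   whole line of an extension of its initial data past the interfaces, obtained by scattering the
   travelling waves of d'Alembert's formula at the interfaces; even and odd parts of the extensions
   then match, which gives the interface conditions exactly. Uniqueness is a maximum principle with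
   a barrier that has concave kinks at the interfaces and controls the corners, where the data may
   jump. For the formulae, the Fourier-Laplace transforms of the extensions solve the 2 x 2 linear
   system of the reflections, whose determinant is Delta, and the contours may be moved to a
   horizontal line, where Gaussian integrals and Fubini's theorem give back the heat flow. *)

theory Submission
  imports Defs "HOL-Probability.Probability"
begin

section \<open>Integrals depending on a parameter\<close>

text \<open>A contour integral of this kind displays neither its initial values nor its one-sided
  fluxes, so the solution is built as a heat flow and the formulae are identified with it
  afterwards. The extensions are dictated by parity: the heat flow at a point depends only on the
  even part of its data about that point, the gradient only on the odd part. In travel time the flux
  \<open>\<sigma>^2 * u_x\<close> is \<open>\<sigma>\<close> times a slope, so at an interface the
  even parts have to agree, and the odd parts after weighting by the speeds. These two equations
  determine the continuation of both data beyond the interface; solving them produces the reflection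
  coefficients. Their moduli are below 1, so repeated reflections stay bounded. Boundedness is all
  that is used of the extensions, and so their transforms are taken strictly below the real axis.
  The map \<open>k \<mapsto> - k\<close> brings the upper contours there as well, and the common
  factor \<open>1 - q * E^2\<close> of the determinants has no zero there, so moving the contours
  meets no pole.\<close>

lemma tendsto_integral_dominated:
  fixes s :: "'c::first_countable_topology \<Rightarrow> 'b \<Rightarrow> 'a::{banach, second_countable_topology}"
  assumes meas: "\<And>z. s z \<in> borel_measurable M" "f \<in> borel_measurable M"
    and w: "integrable M w"
    and bound: "\<forall>\<^sub>F z in at z0 within S. \<forall>x\<in>space M. norm (s z x) \<le> w x"
    and lim: "AE x in M. ((\<lambda>z. s z x) \<longlongrightarrow> f x) (at z0 within S)"
  shows "((\<lambda>z. integral\<^sup>L M (s z)) \<longlongrightarrow> integral\<^sup>L M f) (at z0 within S)"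
  unfolding tendsto_at_iff_sequentially
proof (intro allI impI)
  fix X :: "nat \<Rightarrow> 'c" assume X: "\<forall>i. X i \<in> S - {z0}" "X \<longlonglongrightarrow> z0"
  have fl: "filterlim X (at z0 within S) sequentially"
    using X by (auto simp: filterlim_at)
  from eventually_compose_filterlim[OF bound fl]
  obtain N where N: "\<And>n x. N \<le> n \<Longrightarrow> x \<in> space M \<Longrightarrow> norm (s (X n) x) \<le> w x"
    by (auto simp: eventually_sequentially)
  \<comment> \<open>The majorant is valid only near \<open>z0\<close>, that is from index
    \<open>N\<close> on, so dominated convergence is applied to the shifted sequence.\<close>
  have "(\<lambda>n. integral\<^sup>L M (s (X (n + N)))) \<longlonglongrightarrow> integral\<^sup>L M f"
  proof (rule integral_dominated_convergence[where w = w])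
    show "AE x in M. (\<lambda>n. s (X (n + N)) x) \<longlonglongrightarrow> f x"
      using lim
      by eventually_elim (intro LIMSEQ_ignore_initial_segment filterlim_compose[OF _ fl])
  qed (use meas w N in auto)
  then show "((\<lambda>z. integral\<^sup>L M (s z)) \<circ> X) \<longlonglongrightarrow> integral\<^sup>L M f"
    unfolding o_def by (rule LIMSEQ_offset)
qed

text \<open>The mean value inequality on the ball bounds the difference quotients by the majorant of
  the derivative, so dominated convergence applies. The scalar field is left open: the real case
  serves the heat flow, the complex case the holomorphy of transforms.\<close>

lemma has_field_derivative_lebesgue_integral:
  fixes f :: "'a::{real_normed_field, banach, second_countable_topology} \<Rightarrow> 'b \<Rightarrow> 'a"
  assumes d: "0 < d"
    and int: "\<And>z. dist z z0 < d \<Longrightarrow> integrable M (f z)"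
    and der: "\<And>z x. dist z z0 < d \<Longrightarrow> x \<in> space M \<Longrightarrow> ((\<lambda>z. f z x) has_field_derivative f' z x) (at z)"
    and bound: "\<And>z x. dist z z0 < d \<Longrightarrow> x \<in> space M \<Longrightarrow> norm (f' z x) \<le> w x"
    and w: "integrable M w"
    and meas: "f' z0 \<in> borel_measurable M"
  shows "((\<lambda>z. integral\<^sup>L M (f z)) has_field_derivative integral\<^sup>L M (f' z0)) (at z0)"
proof -
  \<comment> \<open>The value 0 outside the ball makes \<open>q h\<close> measurable for every
    \<open>h\<close>, although \<open>f (z0 + h)\<close> is known to be integrable only
    inside.\<close>
  define q where "q h x = (if dist (z0 + h) z0 < d then (f (z0 + h) x - f z0 x) / h else 0)" for h x
  have near: "\<forall>\<^sub>F h in at 0. dist (z0 + h) z0 < d"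
    using d by (auto simp: eventually_at dist_norm)
  have int0: "integrable M (f z0)" using int[of z0] d by simp
  have "((\<lambda>h. integral\<^sup>L M (q h)) \<longlongrightarrow> integral\<^sup>L M (f' z0)) (at 0)"
  proof (rule tendsto_integral_dominated[where w = w])
    show "q h \<in> borel_measurable M" for h
      using int[of "z0 + h"] int0 unfolding q_def
      by (cases "dist (z0 + h) z0 < d") (auto dest!: borel_measurable_integrable)
    show "\<forall>\<^sub>F h in at 0. \<forall>x\<in>space M. norm (q h x) \<le> w x"
      using near eventually_neq_at_within[of 0 0 UNIV]
    proof eventually_elim
      case (elim h)
      show ?case
      proof
        fix x assume x: "x \<in> space M"
        have "norm (f (z0 + h) x - f z0 x) \<le> w x * norm ((z0 + h) - z0)"
        proof (rule field_differentiable_bound[where S = "ball z0 d" and f' = "\<lambda>z. f' z x"])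
          show "((\<lambda>z. f z x) has_field_derivative f' z x) (at z within ball z0 d)"
            if "z \<in> ball z0 d" for z
            using der[of z x] x that by (auto simp: dist_commute intro: DERIV_subset)
          show "norm (f' z x) \<le> w x" if "z \<in> ball z0 d" for z
            using bound[of z x] x that by (auto simp: dist_commute)
        qed (use elim d in \<open>auto simp: dist_commute\<close>)
        then show "norm (q h x) \<le> w x"
          using elim by (simp add: q_def norm_divide divide_simps)
      qed
    qed
    show "AE x in M. ((\<lambda>h. q h x) \<longlongrightarrow> f' z0 x) (at 0)"
    proof (rule AE_I2)
      fix x assume x: "x \<in> space M"
      have "((\<lambda>h. (f (z0 + h) x - f z0 x) / h) \<longlongrightarrow> f' z0 x) (at 0)"
        using der[of z0 x] d x by (simp add: DERIV_def)
      moreover have "\<forall>\<^sub>F h in at 0. (f (z0 + h) x - f z0 x) / h = q h x"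
        using near by eventually_elim (simp add: q_def)
      ultimately show "((\<lambda>h. q h x) \<longlongrightarrow> f' z0 x) (at 0)"
        by (rule Lim_transform_eventually)
    qed
  qed (use w meas in auto)
  moreover have "\<forall>\<^sub>F h in at 0. integral\<^sup>L M (q h) = (integral\<^sup>L M (f (z0 + h)) - integral\<^sup>L M (f z0)) / h"
    using near
  proof eventually_elim
    case (elim h)
    then have "q h = (\<lambda>x. (f (z0 + h) x - f z0 x) / h)" by (auto simp: q_def)
    then show ?case using int[of "z0 + h"] int0 elim by simp
  qed
  ultimately have "((\<lambda>h. (integral\<^sup>L M (f (z0 + h)) - integral\<^sup>L M (f z0)) / h) \<longlongrightarrow> integral\<^sup>L M (f' z0)) (at 0)"
    by (rule Lim_transform_eventually)
  then show ?thesis by (simp add: DERIV_def)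
qed

section \<open>The heat flow on the line\<close>

text \<open>The temperature at unit diffusivity, written so that time zero needs no separate clause.\<close>

definition heat_flow :: "(real \<Rightarrow> real) \<Rightarrow> real \<Rightarrow> real \<Rightarrow> real" where
  "heat_flow f t z = (LBINT y. std_normal_density y * f (z + sqrt (2 * t) * y))"

definition heat_kernel :: "real \<Rightarrow> real \<Rightarrow> real" where
  "heat_kernel t z = exp (- (z\<^sup>2) / (4 * t)) / sqrt (4 * pi * t)"

definition heat_kernel_x :: "real \<Rightarrow> real \<Rightarrow> real" where
  "heat_kernel_x t z = - (z / (2 * t)) * heat_kernel t z"

definition heat_kernel_xx :: "real \<Rightarrow> real \<Rightarrow> real" where
  "heat_kernel_xx t z = (z\<^sup>2 / (4 * t\<^sup>2) - 1 / (2 * t)) * heat_kernel t z"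

lemma heat_kernel_measurable [measurable]:
  "heat_kernel t \<in> borel_measurable borel" "heat_kernel_x t \<in> borel_measurable borel"
  "heat_kernel_xx t \<in> borel_measurable borel"
  unfolding heat_kernel_def[abs_def] heat_kernel_x_def[abs_def] heat_kernel_xx_def[abs_def]
  by measurable

lemma heat_kernel_minus [simp]:
  "heat_kernel t (- z) = heat_kernel t z" "heat_kernel_x t (- z) = - heat_kernel_x t z"
  by (simp_all add: heat_kernel_def heat_kernel_x_def)

lemma heat_kernel_nonneg: "0 < t \<Longrightarrow> 0 \<le> heat_kernel t z"
  by (simp add: heat_kernel_def)

lemma DERIV_heat_kernel:
  assumes "0 < t"
  shows "(heat_kernel t has_real_derivative heat_kernel_x t z) (at z)"
  unfolding heat_kernel_def[abs_def] heat_kernel_x_def using assms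
  by (auto intro!: derivative_eq_intros simp: field_simps)

lemma DERIV_heat_kernel_x:
  assumes "0 < t"
  shows "(heat_kernel_x t has_real_derivative heat_kernel_xx t z) (at z)"
  unfolding heat_kernel_x_def[abs_def] heat_kernel_xx_def using assms
  by (auto intro!: derivative_eq_intros DERIV_heat_kernel simp: heat_kernel_x_def field_simps power2_eq_square)

text \<open>The time derivative is the second space derivative again: the kernel solves the heat
  equation. Moving the square root into the exponent as a logarithm leaves a single exponential to
  differentiate.\<close>

lemma DERIV_heat_kernel_time:
  assumes "0 < t"
  shows "((\<lambda>t. heat_kernel t z) has_real_derivative heat_kernel_xx t z) (at t)"
proof -
  have e: "heat_kernel t z = exp (- (z\<^sup>2) / (4 * t) - ln (4 * pi * t) / 2)" if "0 < t" for t
    using that by (simp add: heat_kernel_def exp_diff ln_sqrt[symmetric])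
  have "((\<lambda>t. exp (- (z\<^sup>2) / (4 * t) - ln (4 * pi * t) / 2)) has_real_derivative
      exp (- (z\<^sup>2) / (4 * t) - ln (4 * pi * t) / 2) * (z\<^sup>2 / (4 * t\<^sup>2) - 1 / (2 * t))) (at t)"
    by (rule derivative_eq_intros refl | use assms in \<open>simp add: power2_eq_square\<close>)+
  then show ?thesis
  proof (rule has_field_derivative_transform_within_open[where S = "{0<..}", THEN DERIV_cong])
  qed (use assms in \<open>auto simp: e heat_kernel_xx_def\<close>)
qed

lemma integrable_gaussian:
  assumes "0 < c"
  shows "integrable lborel (\<lambda>y::real. exp (- (c * (y - m)\<^sup>2)))"
proof -
  \<comment> \<open>The function is a multiple of the normal density with mean \<open>m\<close> and
    variance \<open>1 / (2 * c)\<close>.\<close>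
  define s where "s = sqrt (1 / (2 * c))"
  have s2: "s\<^sup>2 = 1 / (2 * c)" using assms by (simp add: s_def)
  have "0 < s" using assms by (simp add: s_def)
  then have "integrable lborel (\<lambda>y. sqrt (2 * pi * s\<^sup>2) * normal_density m s y)" by simp
  also have "(\<lambda>y. sqrt (2 * pi * s\<^sup>2) * normal_density m s y) = (\<lambda>y. exp (- (c * (y - m)\<^sup>2)))"
    unfolding normal_density_def s2 using assms by (auto simp: field_simps)
  finally show ?thesis .
qed

lemma exp_diff_eq: "exp (x - y) = exp x * exp (- y)" for x y :: real
  by (simp add: exp_add[symmetric])

text \<open>The factor \<open>1 + (z - y)^2\<close> is what a time derivative or two space
  derivatives of the kernel cost, so one integrable majorant serves the kernel and all its
  derivatives locally uniformly in space and time.\<close>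

lemma heat_kernel_dominated:
  assumes "0 < t0"
  obtains w where "integrable lborel w"
    "\<And>z t y. \<bar>z - z0\<bar> \<le> 1 \<Longrightarrow> \<bar>t - t0\<bar> \<le> t0 / 2 \<Longrightarrow> (1 + (z - y)\<^sup>2) * heat_kernel t (z - y) \<le> w y"
proof -
  \<comment> \<open>With \<open>q = (z - y)^2\<close> and \<open>t \<le> 3 * t0 / 2\<close> the
    kernel decays at least like \<open>exp (- q / (6 * t0))\<close>. Half of this exponent absorbs
    the factor \<open>1 + q\<close>. The other half becomes a Gaussian about \<open>z0\<close>
    because \<open>q \<ge> (y - z0)^2 / 2 - 1\<close>.\<close>
  define w where "w y = (1 + 12 * t0) / sqrt (2 * pi * t0) * exp (1 / (12 * t0)) * exp (- (1 / (24 * t0) * (y - z0)\<^sup>2))" for y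
  have "integrable lborel w"
    unfolding w_def using assms by (intro integrable_mult_right integrable_gaussian) auto
  moreover have "(1 + (z - y)\<^sup>2) * heat_kernel t (z - y) \<le> w y"
    if z: "\<bar>z - z0\<bar> \<le> 1" and t: "\<bar>t - t0\<bar> \<le> t0 / 2" for z t y
  proof -
    define q where "q = (z - y)\<^sup>2"
    have q0: "0 \<le> q" by (simp add: q_def)
    have t1: "t0 / 2 \<le> t" "t \<le> 3 * t0 / 2" "0 < t" using t assms by linarith+
    have "(z - z0)\<^sup>2 \<le> 1" using z by (simp add: abs_square_le_1)
    moreover have "(y - z0)\<^sup>2 \<le> 2 * q + 2 * (z - z0)\<^sup>2"
      unfolding q_def using sum_squares_bound[of "z - y" "z0 - z"] zero_le_power2[of "(z - y) + (z - z0)"]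
      by (simp add: power2_eq_square algebra_simps)
    ultimately have q1: "(y - z0)\<^sup>2 / 2 - 1 \<le> q" by simp
    have a: "exp (- q / (4 * t)) \<le> exp (- (q / (6 * t0)))"
      using t1 q0 assms by (auto simp: field_simps intro: mult_left_mono)
    have "1 + q \<le> (1 + 12 * t0) * (1 + q / (12 * t0))"
      using q0 assms by (simp add: field_simps)
    also have "\<dots> \<le> (1 + 12 * t0) * exp (q / (12 * t0))"
      using assms by (intro mult_left_mono exp_ge_add_one_self) auto
    finally have b: "1 + q \<le> (1 + 12 * t0) * exp (q / (12 * t0))" .
    have c: "1 / sqrt (4 * pi * t) \<le> 1 / sqrt (2 * pi * t0)"
      using t1 assms by (intro divide_left_mono real_sqrt_le_mono mult_pos_pos) (auto simp: field_simps)
    have "(1 + q) * (exp (- q / (4 * t)) * (1 / sqrt (4 * pi * t)))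
        \<le> ((1 + 12 * t0) * exp (q / (12 * t0))) * (exp (- (q / (6 * t0))) * (1 / sqrt (2 * pi * t0)))"
      using a b c t1 assms by (intro mult_mono) (auto simp: q0)
    also have "\<dots> = (1 + 12 * t0) / sqrt (2 * pi * t0) * exp (q / (12 * t0) - q / (6 * t0))"
      unfolding exp_diff_eq by (simp only: divide_inverse mult_ac mult_1_left)
    also have "q / (12 * t0) - q / (6 * t0) = - (q / (12 * t0))" using assms by (simp add: field_simps)
    also have "(1 + 12 * t0) / sqrt (2 * pi * t0) * exp (- (q / (12 * t0)))
       \<le> (1 + 12 * t0) / sqrt (2 * pi * t0) * exp (1 / (12 * t0) + - (1 / (24 * t0) * (y - z0)\<^sup>2))"
      using q1 assms by (intro mult_left_mono) (auto simp: field_simps)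
    also have "\<dots> = w y" by (simp only: w_def exp_add mult.assoc)
    finally show ?thesis by (simp add: heat_kernel_def q_def)
  qed
  ultimately show thesis by (rule that)
qed

lemma heat_kernel_x_le:
  assumes "0 < t0" "\<bar>t - t0\<bar> \<le> t0 / 2"
  shows "\<bar>heat_kernel_x t z\<bar> \<le> 1 / t0 * ((1 + z\<^sup>2) * heat_kernel t z)"
proof -
  have t: "t0 / 2 \<le> t" "0 < t" using assms by linarith+
  have "\<bar>z\<bar> \<le> 1 + z\<^sup>2" using sum_squares_bound[of "\<bar>z\<bar>" 1] unfolding power2_abs by simp
  then have "\<bar>z / (2 * t)\<bar> \<le> (1 + z\<^sup>2) * (1 / t0)"
    using t assms frac_le[of "1 + z\<^sup>2" "\<bar>z\<bar>" t0 "2 * t"] by simp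
  from mult_right_mono[OF this heat_kernel_nonneg[of t z]] t show ?thesis
    using heat_kernel_nonneg[of t z] by (simp add: heat_kernel_x_def abs_mult algebra_simps)
qed

lemma heat_kernel_xx_le:
  assumes "0 < t0" "\<bar>t - t0\<bar> \<le> t0 / 2"
  shows "\<bar>heat_kernel_xx t z\<bar> \<le> (1 / t0\<^sup>2 + 1 / t0) * ((1 + z\<^sup>2) * heat_kernel t z)"
proof -
  have t: "t0 / 2 \<le> t" "0 < t" using assms by linarith+
  have "(t0 / 2)\<^sup>2 \<le> t\<^sup>2" using t assms by (intro power_mono) auto
  then have "t0\<^sup>2 \<le> 4 * t\<^sup>2" by (simp add: power_divide)
  then have 1: "z\<^sup>2 / (4 * t\<^sup>2) \<le> z\<^sup>2 / t0\<^sup>2" using t assms by (intro divide_left_mono) auto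
  have 2: "1 / (2 * t) \<le> 1 / t0" using t assms by (intro divide_left_mono) auto
  have "\<bar>z\<^sup>2 / (4 * t\<^sup>2) - 1 / (2 * t)\<bar> \<le> z\<^sup>2 / (4 * t\<^sup>2) + 1 / (2 * t)" using t by (simp add: abs_le_iff)
  also have "\<dots> \<le> z\<^sup>2 / t0\<^sup>2 + 1 / t0" using 1 2 by simp
  also have "\<dots> \<le> (1 / t0\<^sup>2 + 1 / t0) * (1 + z\<^sup>2)" using assms by (simp add: field_simps)
  finally have "\<bar>z\<^sup>2 / (4 * t\<^sup>2) - 1 / (2 * t)\<bar> \<le> (1 / t0\<^sup>2 + 1 / t0) * (1 + z\<^sup>2)" .
  from mult_right_mono[OF this heat_kernel_nonneg[of t z]] t show ?thesis
    using heat_kernel_nonneg[of t z] by (simp add: heat_kernel_xx_def abs_mult mult.assoc)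
qed

section \<open>Heat flow of bounded measurable data\<close>

locale bounded_measurable =
  fixes f :: "real \<Rightarrow> real" and C :: real
  assumes measurable_f [measurable]: "f \<in> borel_measurable borel"
    and bound: "\<And>z. \<bar>f z\<bar> \<le> C"
begin

lemma bound_nonneg: "0 \<le> C"
  using bound[of 0] by linarith

lemma integrable_kernel:
  assumes t: "0 < t"
  shows "integrable lborel (\<lambda>y. heat_kernel t (z - y) * f y)"
    "integrable lborel (\<lambda>y. heat_kernel_x t (z - y) * f y)"
    "integrable lborel (\<lambda>y. heat_kernel_xx t (z - y) * f y)"
proof -
  obtain w where w: "integrable lborel w"
    "\<And>z' s y. \<bar>z' - z\<bar> \<le> 1 \<Longrightarrow> \<bar>s - t\<bar> \<le> t / 2 \<Longrightarrow> (1 + (z' - y)\<^sup>2) * heat_kernel s (z' - y) \<le> w y"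
    using heat_kernel_dominated[OF t] by metis
  have wb: "(1 + (z - y)\<^sup>2) * heat_kernel t (z - y) \<le> w y" for y
    using w(2)[of z t y] t by simp
  have D: "integrable lborel (\<lambda>y. g (z - y) * f y)"
    if [measurable]: "g \<in> borel_measurable borel"
     and g: "\<And>x. \<bar>g x\<bar> \<le> K * ((1 + x\<^sup>2) * heat_kernel t x)" and "0 \<le> K" for g K
  proof (rule Bochner_Integration.integrable_bound)
    show "integrable lborel (\<lambda>y. K * w y * C)" using w by simp
    show "AE y in lborel. norm (g (z - y) * f y) \<le> norm (K * w y * C)"
    proof (rule AE_I2)
      fix y
      have "\<bar>g (z - y)\<bar> \<le> K * w y"
        using g[of "z - y"] mult_left_mono[OF wb[of y] \<open>0 \<le> K\<close>] by linarith
      then have "\<bar>g (z - y)\<bar> * \<bar>f y\<bar> \<le> K * w y * C"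
        using bound[of y] by (intro mult_mono) auto
      then have "\<bar>g (z - y) * f y\<bar> \<le> K * w y * C" by (simp only: abs_mult)
      then show "norm (g (z - y) * f y) \<le> norm (K * w y * C)"
        unfolding real_norm_def by linarith
    qed
  qed measurable
  have "\<bar>heat_kernel t x\<bar> \<le> 1 * ((1 + x\<^sup>2) * heat_kernel t x)" for x
    using heat_kernel_nonneg[OF t, of x] by (simp add: algebra_simps)
  then show "integrable lborel (\<lambda>y. heat_kernel t (z - y) * f y)" by (intro D[where K = 1]) auto
  show "integrable lborel (\<lambda>y. heat_kernel_x t (z - y) * f y)"
    using heat_kernel_x_le[OF t, of t] t by (intro D[where K = "1 / t"]) auto
  show "integrable lborel (\<lambda>y. heat_kernel_xx t (z - y) * f y)"
    using heat_kernel_xx_le[OF t, of t] t by (intro D[where K = "1 / t\<^sup>2 + 1 / t"]) auto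
qed

lemma heat_flow_kernel:
  assumes t: "0 < t"
  shows "heat_flow f t z = (LBINT y. heat_kernel t (z - y) * f y)"
proof -
  have c: "sqrt (2 * t) \<noteq> 0" "0 < sqrt (2 * t)" using t by auto
  have "(LBINT y. heat_kernel t (z - y) * f y)
     = \<bar>sqrt (2 * t)\<bar> *\<^sub>R (LBINT y. heat_kernel t (z - (z + sqrt (2 * t) * y)) * f (z + sqrt (2 * t) * y))"
    by (rule lborel_integral_real_affine[OF c(1)])
  also have "\<dots> = (LBINT y. sqrt (2 * t) * (heat_kernel t (z - (z + sqrt (2 * t) * y)) * f (z + sqrt (2 * t) * y)))"
    using c by simp
  also have "(\<lambda>y. sqrt (2 * t) * (heat_kernel t (z - (z + sqrt (2 * t) * y)) * f (z + sqrt (2 * t) * y)))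
    = (\<lambda>y. std_normal_density y * f (z + sqrt (2 * t) * y))"
  proof
    fix y
    have "sqrt (4 * pi * t) = sqrt (2 * t) * sqrt (2 * pi)" by (simp add: real_sqrt_mult[symmetric])
    moreover have "(sqrt (2 * t) * y)\<^sup>2 / (4 * t) = y\<^sup>2 / 2" using t by (simp add: power_mult_distrib field_simps)
    ultimately have "sqrt (2 * t) * heat_kernel t (z - (z + sqrt (2 * t) * y)) = std_normal_density y"
      using c unfolding heat_kernel_def std_normal_density_def by (simp add: field_simps)
    then show "sqrt (2 * t) * (heat_kernel t (z - (z + sqrt (2 * t) * y)) * f (z + sqrt (2 * t) * y)) =
      std_normal_density y * f (z + sqrt (2 * t) * y)" by (simp add: mult.assoc[symmetric])
  qed
  finally show ?thesis by (simp add: heat_flow_def)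
qed

lemma heat_flow_0: "heat_flow f 0 z = f z"
  by (simp add: heat_flow_def)

lemma heat_flow_le: "\<bar>heat_flow f t z\<bar> \<le> C"
proof -
  have "\<bar>heat_flow f t z\<bar> \<le> (LBINT y. \<bar>std_normal_density y * f (z + sqrt (2 * t) * y)\<bar>)"
    unfolding heat_flow_def by (rule integral_abs_bound)
  also have "\<dots> \<le> (LBINT y. std_normal_density y * C)"
    by (rule integral_mono') (auto simp: abs_mult bound_nonneg intro!: mult_left_mono bound)
  finally show ?thesis by simp
qed

definition heat_flow_x :: "real \<Rightarrow> real \<Rightarrow> real" where
  "heat_flow_x t z = (LBINT y. heat_kernel_x t (z - y) * f y)"

definition heat_flow_xx :: "real \<Rightarrow> real \<Rightarrow> real" where
  "heat_flow_xx t z = (LBINT y. heat_kernel_xx t (z - y) * f y)"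

text \<open>Differentiation under the integral sign, with multiples of one majorant in all three
  cases. The last two derivatives agree because the kernel itself solves the heat equation.\<close>

lemma
  assumes t: "0 < t"
  shows DERIV_heat_flow: "(heat_flow f t has_real_derivative heat_flow_x t z) (at z)"
    and DERIV_heat_flow_x: "(heat_flow_x t has_real_derivative heat_flow_xx t z) (at z)"
    and DERIV_heat_flow_time: "((\<lambda>t. heat_flow f t z) has_real_derivative heat_flow_xx t z) (at t)"
proof -
  obtain w where w: "integrable lborel w"
    "\<And>z' s y. \<bar>z' - z\<bar> \<le> 1 \<Longrightarrow> \<bar>s - t\<bar> \<le> t / 2 \<Longrightarrow> (1 + (z' - y)\<^sup>2) * heat_kernel s (z' - y) \<le> w y"
    using heat_kernel_dominated[OF t] by metis
  have B: "\<bar>g * f y\<bar> \<le> K * w y * C"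
    if "\<bar>g\<bar> \<le> K * ((1 + (z' - y)\<^sup>2) * heat_kernel s (z' - y))" "0 \<le> K"
      "\<bar>z' - z\<bar> \<le> 1" "\<bar>s - t\<bar> \<le> t / 2" for g K z' s y
  proof -
    have "\<bar>g\<bar> \<le> K * w y"
      using that(1) mult_left_mono[OF w(2)[OF that(3,4), of y] \<open>0 \<le> K\<close>] by linarith
    then show ?thesis unfolding abs_mult using bound[of y] by (intro mult_mono) auto
  qed
  have i: "integrable lborel (\<lambda>y. K * w y * C)" for K using w by simp
  have "((\<lambda>z. LBINT y. heat_kernel t (z - y) * f y) has_real_derivative heat_flow_x t z) (at z)"
    unfolding heat_flow_x_def
  proof (rule has_field_derivative_lebesgue_integral[where d = 1, OF _ _ _ _ i[of "1 / t"]])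
    show "norm (heat_kernel_x t (z' - y) * f y) \<le> 1 / t * w y * C" if "dist z' z < 1" for z' y
      unfolding real_norm_def using that t by (intro B[OF heat_kernel_x_le]) (auto simp: dist_real_def)
  qed (auto intro!: derivative_eq_intros DERIV_chain'[OF _ DERIV_heat_kernel] integrable_kernel t)
  then show "(heat_flow f t has_real_derivative heat_flow_x t z) (at z)"
    by (simp add: heat_flow_kernel[OF t, abs_def])
  show "(heat_flow_x t has_real_derivative heat_flow_xx t z) (at z)"
    unfolding heat_flow_xx_def heat_flow_x_def[abs_def]
  proof (rule has_field_derivative_lebesgue_integral[where d = 1, OF _ _ _ _ i[of "1 / t\<^sup>2 + 1 / t"]])
    show "norm (heat_kernel_xx t (z' - y) * f y) \<le> (1 / t\<^sup>2 + 1 / t) * w y * C" if "dist z' z < 1" for z' y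
      unfolding real_norm_def using that t by (intro B[OF heat_kernel_xx_le]) (auto simp: dist_real_def)
  qed (auto intro!: derivative_eq_intros DERIV_chain'[OF _ DERIV_heat_kernel_x] integrable_kernel t)
  have "((\<lambda>t. LBINT y. heat_kernel t (z - y) * f y) has_real_derivative heat_flow_xx t z) (at t)"
    unfolding heat_flow_xx_def
  proof (rule has_field_derivative_lebesgue_integral[where d = "t / 2", OF _ _ _ _ i[of "1 / t\<^sup>2 + 1 / t"]])
    show "norm (heat_kernel_xx s (z - y) * f y) \<le> (1 / t\<^sup>2 + 1 / t) * w y * C" if "dist s t < t / 2" for s y
      unfolding real_norm_def using that t by (intro B[OF heat_kernel_xx_le]) (auto simp: dist_real_def)
  next
    fix s y assume "dist s t < t / 2"
    then have "0 < s" using t unfolding dist_real_def by linarith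
    then show "((\<lambda>s. heat_kernel s (z - y) * f y) has_real_derivative heat_kernel_xx s (z - y) * f y) (at s)"
      by (auto intro!: derivative_eq_intros DERIV_heat_kernel_time)
  next
    fix s assume "dist s t < t / 2"
    then have "0 < s" using t unfolding dist_real_def by linarith
    then show "integrable lborel (\<lambda>y. heat_kernel s (z - y) * f y)" by (rule integrable_kernel)
  qed (use t in auto)
  then show "((\<lambda>t. heat_flow f t z) has_real_derivative heat_flow_xx t z) (at t)"
  proof (rule has_field_derivative_transform_within_open)
    show "open {0::real<..}" "t \<in> {0<..}" using t by auto
  qed (simp add: heat_flow_kernel)
qed

text \<open>The density in \<open>heat_flow\<close> does not vary with time, so pointwise limits of
  \<open>f\<close> suffice for dominated convergence even where the heat kernel becomes
  singular.\<close>

lemma heat_flow_tendsto: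
  assumes "filterlim zz F (at z0 within S)" "((\<lambda>p. tt p) \<longlongrightarrow> 0) (at z0 within S)"
    and lim: "\<And>y. ((\<lambda>p. f (zz p + sqrt (2 * tt p) * y)) \<longlongrightarrow> l) (at z0 within S)"
  shows "((\<lambda>p. heat_flow f (tt p) (zz p)) \<longlongrightarrow> l) (at (z0::'c::first_countable_topology) within S)"
proof -
  have "((\<lambda>p. heat_flow f (tt p) (zz p)) \<longlongrightarrow> (LBINT y. std_normal_density y * l)) (at z0 within S)"
    unfolding heat_flow_def
  proof (rule tendsto_integral_dominated[where w = "\<lambda>y. std_normal_density y * C"])
    show "\<forall>\<^sub>F p in at z0 within S. \<forall>y\<in>space lborel.
        norm (std_normal_density y * f (zz p + sqrt (2 * tt p) * y)) \<le> std_normal_density y * C"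
      by (auto simp: abs_mult intro!: always_eventually mult_left_mono bound)
    show "AE y in lborel. ((\<lambda>p. std_normal_density y * f (zz p + sqrt (2 * tt p) * y)) \<longlongrightarrow>
        std_normal_density y * l) (at z0 within S)"
      by (intro AE_I2 tendsto_mult_left lim)
  qed auto
  then show ?thesis by simp
qed

end

section \<open>Integrals over the deformed contours\<close>

text \<open>This is the characteristic function of the standard normal distribution after the
  substitution \<open>y = sqrt (2 * c) * s\<close>.\<close>

lemma gaussian_fourier:
  fixes X c :: real
  assumes c: "0 < c"
  shows "integrable lborel (\<lambda>s. exp (\<i> * X * s - c * (complex_of_real s)\<^sup>2))"
    and "(LBINT s. exp (\<i> * X * s - c * (complex_of_real s)\<^sup>2)) = sqrt (pi / c) * exp (- (X\<^sup>2) / (4 * c))"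
proof -
  have e: "exp (\<i> * X * s - c * (complex_of_real s)\<^sup>2) = exp (- (c * (s - 0)\<^sup>2)) *\<^sub>R iexp (X * s)" for s
    unfolding scaleR_conv_of_real exp_of_real[symmetric] exp_add[symmetric]
    by (rule arg_cong[where f = exp]) (simp add: mult_ac)
  show int: "integrable lborel (\<lambda>s. exp (\<i> * X * s - c * (complex_of_real s)\<^sup>2))"
    unfolding e by (rule Bochner_Integration.integrable_bound[OF integrable_gaussian[OF c, of 0]]) auto
  define d where "d = sqrt (2 * c)"
  have d: "0 < d" "d\<^sup>2 = 2 * c" using c by (auto simp: d_def)
  have "complex_of_real (exp (- ((X / d)\<^sup>2) / 2)) = (LBINT y. std_normal_density y *\<^sub>R iexp (X / d * y))"
    using fun_cong[OF char_std_normal_distribution, of "X / d"]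
    by (simp add: char_def integral_density)
  also have "\<dots> = \<bar>d\<bar> *\<^sub>R (LBINT s. std_normal_density (0 + d * s) *\<^sub>R iexp (X / d * (0 + d * s)))"
    using d by (intro lborel_integral_real_affine) auto
  also have "(\<lambda>s. std_normal_density (0 + d * s) *\<^sub>R iexp (X / d * (0 + d * s)))
     = (\<lambda>s. complex_of_real (1 / sqrt (2 * pi)) * exp (\<i> * X * s - c * (complex_of_real s)\<^sup>2))"
    unfolding e std_normal_density_def using d
    by (auto simp: power_mult_distrib scaleR_conv_of_real)
  finally have "complex_of_real (exp (- ((X / d)\<^sup>2) / 2)) =
     complex_of_real (d / sqrt (2 * pi)) * (LBINT s. exp (\<i> * X * s - c * (complex_of_real s)\<^sup>2))"
    using d by (simp add: scaleR_conv_of_real)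
  moreover have "(X / d)\<^sup>2 / 2 = X\<^sup>2 / (4 * c)" using d by (simp add: power_divide)
  moreover have "d / sqrt (2 * pi) = 1 / sqrt (pi / c)"
    using c unfolding d_def by (simp add: real_sqrt_mult real_sqrt_divide field_simps)
  ultimately have "complex_of_real (exp (- (X\<^sup>2) / (4 * c))) =
     complex_of_real (1 / sqrt (pi / c)) * (LBINT s. exp (\<i> * X * s - c * (complex_of_real s)\<^sup>2))"
    by simp
  moreover have "sqrt (pi / c) \<noteq> 0" using c by simp
  ultimately show "(LBINT s. exp (\<i> * X * s - c * (complex_of_real s)\<^sup>2)) = sqrt (pi / c) * exp (- (X\<^sup>2) / (4 * c))"
    by (simp add: field_simps)
qed

text \<open>The factor common to all integrands of the formulae, with
  \<open>c = \<sigma>^2 * t\<close> and \<open>X\<close> the signed distance to an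
  interface.\<close>

definition gaussian_wave :: "real \<Rightarrow> real \<Rightarrow> complex \<Rightarrow> complex" where
  "gaussian_wave X c k = exp (\<i> * k * X - c * k\<^sup>2)"

lemma gaussian_wave_minus: "gaussian_wave X c (- k) = gaussian_wave (- X) c k"
  by (simp add: gaussian_wave_def)

lemma norm_gaussian_wave:
  "norm (gaussian_wave X c k) = exp (- (X * Im k) - c * ((Re k)\<^sup>2 - (Im k)\<^sup>2))"
  by (simp add: gaussian_wave_def norm_exp_eq_Re power2_eq_square mult.commute)

lemma holomorphic_gaussian_wave [holomorphic_intros]: "gaussian_wave X c holomorphic_on S"
  unfolding gaussian_wave_def[abs_def] by (intro holomorphic_intros)

lemma cis_diagonals:
  "complex_of_real s * cis (pi / 4) = Complex (s / sqrt 2) (s / sqrt 2)"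
  "complex_of_real s * cis (3 * pi / 4) = Complex (- (s / sqrt 2)) (s / sqrt 2)"
  "complex_of_real s * cis (- pi / 4) = Complex (s / sqrt 2) (- (s / sqrt 2))"
  "complex_of_real s * cis (- 3 * pi / 4) = Complex (- (s / sqrt 2)) (- (s / sqrt 2))"
proof -
  have *: "cos (3 * pi / 4) = - (sqrt 2 / 2)" "sin (3 * pi / 4) = sqrt 2 / 2"
    using sin_add[of "pi / 2" "pi / 4"] cos_add[of "pi / 2" "pi / 4"] by (simp_all add: sin_45 cos_45)
  have "s * (sqrt 2 / 2) = s / sqrt 2" by (simp add: field_simps)
  then show
    "complex_of_real s * cis (pi / 4) = Complex (s / sqrt 2) (s / sqrt 2)"
    "complex_of_real s * cis (3 * pi / 4) = Complex (- (s / sqrt 2)) (s / sqrt 2)"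
    "complex_of_real s * cis (- pi / 4) = Complex (s / sqrt 2) (- (s / sqrt 2))"
    "complex_of_real s * cis (- 3 * pi / 4) = Complex (- (s / sqrt 2)) (- (s / sqrt 2))"
    unfolding complex_eq_iff by (simp_all add: sin_45 cos_45 *)
qed

lemma convex_half_planes: "convex {k. Im k < 0}" "open {k. Im k < 0}" "convex {k. 0 < Im k}" "open {k. 0 < Im k}"
  using convex_halfspace_Im_lt[of 0] convex_halfspace_Im_gt[of 0] open_halfspace_Im_lt[of 0] open_halfspace_Im_gt[of 0]
  by simp_all

lemma tendsto_integral_symmetric:
  fixes f :: "real \<Rightarrow> 'a::{banach, second_countable_topology}"
  assumes f: "integrable lborel f"
  shows "((\<lambda>R. LBINT s. indicator {-R..R} s *\<^sub>R f s) \<longlongrightarrow> integral\<^sup>L lborel f) at_top"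
proof (rule integral_dominated_convergence_at_top[where w = "\<lambda>s. norm (f s)"])
  have [measurable]: "f \<in> borel_measurable lborel" using f by auto
  show "(\<lambda>s. indicator {-R..R} s *\<^sub>R f s) \<in> borel_measurable lborel" for R by measurable
  show "AE s in lborel. ((\<lambda>R. indicator {-R..R} s *\<^sub>R f s) \<longlongrightarrow> f s) at_top"
  proof (rule AE_I2)
    fix s :: real
    have "\<forall>\<^sub>F R in at_top. indicator {-R..R} s *\<^sub>R f s = f s"
      using eventually_ge_at_top[of "\<bar>s\<bar>"] by eventually_elim (auto simp: indicator_def abs_le_iff)
    then show "((\<lambda>R. indicator {-R..R} s *\<^sub>R f s) \<longlongrightarrow> f s) at_top"
      by (rule tendsto_eventually)
  qed
  show "\<forall>\<^sub>F R in at_top. AE s in lborel. norm (indicator {-R..R} s *\<^sub>R f s) \<le> norm (f s)"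
    by (auto simp: indicator_def)
qed (use f in auto)

text \<open>By the fundamental theorem the truncated ray integral is an increment of the primitive.
  The exponential bound makes the whole ray integral converge, so the primitive has a limit along
  the ray.\<close>

lemma outward_ray_integral_primitive:
  fixes r \<alpha> \<theta> M :: real and f \<Phi> :: "complex \<Rightarrow> complex"
  assumes r: "0 < r" and dec: "0 < \<alpha>"
    and prim: "\<And>s::real. r \<le> s \<Longrightarrow> (\<Phi> has_field_derivative f (s * cis \<theta>)) (at (s * cis \<theta>))"
    and cont: "continuous_on {r..} (\<lambda>s. f (complex_of_real s * cis \<theta>))"
    and bound: "\<And>s::real. r \<le> s \<Longrightarrow> norm (f (s * cis \<theta>)) \<le> M * exp (- (\<alpha> * s))"
  shows "((\<lambda>R. \<Phi> (complex_of_real R * cis \<theta>)) \<longlongrightarrow> \<Phi> (r * cis \<theta>) + outward_ray_integral r \<theta> f) at_top"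
proof -
  define h where "h s = indicator {r..} s *\<^sub>R (f (s * cis \<theta>) * cis \<theta>)" for s
  have hm: "h \<in> borel_measurable borel"
    unfolding h_def using cont by (intro borel_measurable_continuous_on_indicator continuous_intros) auto
  have "set_integrable lborel {0<..} (\<lambda>s. exp (- (s * \<alpha>)))" by (rule integrable_I0i_exp_mscale[OF dec])
  then have "integrable lborel (\<lambda>s. M * (indicator {0<..} s *\<^sub>R exp (- (s * \<alpha>))))"
    unfolding set_integrable_def by (rule integrable_mult_right)
  then have hi: "integrable lborel h"
  proof (rule Bochner_Integration.integrable_bound)
    show "AE s in lborel. norm (h s) \<le> norm (M * (indicator {0<..} s *\<^sub>R exp (- (s * \<alpha>))))"
    proof (rule AE_I2)
      fix s show "norm (h s) \<le> norm (M * (indicator {0<..} s *\<^sub>R exp (- (s * \<alpha>))))"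
      proof (cases "r \<le> s")
        case True
        then have "norm (h s) \<le> M * exp (- (\<alpha> * s))" using bound[of s] by (simp add: h_def norm_mult)
        also have "\<dots> \<le> norm (M * (indicator {0<..} s *\<^sub>R exp (- (s * \<alpha>))))"
          using True r by (simp add: abs_mult mult.commute)
        finally show ?thesis .
      qed (simp add: h_def)
    qed
  qed (use hm in auto)
  have FTC: "(LBINT s. indicator {..R} s *\<^sub>R h s) = \<Phi> (complex_of_real R * cis \<theta>) - \<Phi> (r * cis \<theta>)" if R: "r \<le> R" for R
  proof -
    have "(LBINT s. indicator {..R} s *\<^sub>R h s) = (LBINT s. indicator {r..R} s *\<^sub>R (f (s * cis \<theta>) * cis \<theta>))"
      by (intro Bochner_Integration.integral_cong) (auto simp: h_def indicator_def)
    also have "\<dots> = \<Phi> (complex_of_real R * cis \<theta>) - \<Phi> (r * cis \<theta>)"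
    proof (rule integral_FTC_atLeastAtMost[OF R])
      fix s assume s: "r \<le> s" "s \<le> R"
      have "((\<lambda>z. \<Phi> (z * cis \<theta>)) has_field_derivative f (s * cis \<theta>) * cis \<theta>) (at (complex_of_real s))"
        by (rule DERIV_chain2[where f = \<Phi> and g = "\<lambda>z. z * cis \<theta>", OF prim[OF s(1)]]) (auto intro!: derivative_eq_intros)
      then show "((\<lambda>s. \<Phi> (complex_of_real s * cis \<theta>)) has_vector_derivative f (s * cis \<theta>) * cis \<theta>) (at s within {r..R})"
        by (rule has_vector_derivative_real_field)
    qed (intro continuous_intros continuous_on_subset[OF cont], auto)
    finally show ?thesis .
  qed
  have "((\<lambda>R. LBINT s. indicator {..R} s *\<^sub>R h s) \<longlongrightarrow> integral\<^sup>L lborel h) at_top"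
    by (rule tendsto_integral_at_top) (use hi in auto)
  moreover have "\<forall>\<^sub>F R in at_top. (LBINT s. indicator {..R} s *\<^sub>R h s) = \<Phi> (complex_of_real R * cis \<theta>) - \<Phi> (r * cis \<theta>)"
    using eventually_ge_at_top[of r] by eventually_elim (rule FTC)
  ultimately have "((\<lambda>R. \<Phi> (complex_of_real R * cis \<theta>) - \<Phi> (r * cis \<theta>)) \<longlongrightarrow> integral\<^sup>L lborel h) at_top"
    by (rule Lim_transform_eventually)
  moreover have "integral\<^sup>L lborel h = outward_ray_integral r \<theta> f"
    by (simp only: outward_ray_integral_def set_lebesgue_integral_def h_def[abs_def])
  ultimately have "((\<lambda>R. \<Phi> (complex_of_real R * cis \<theta>) - \<Phi> (r * cis \<theta>)) \<longlongrightarrow> outward_ray_integral r \<theta> f) at_top" by simp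
  from tendsto_add[OF tendsto_const this, of "\<Phi> (r * cis \<theta>)"] show ?thesis by simp
qed

text \<open>For \<open>X < 0\<close> the wave decays as \<open>Im k\<close> tends to minus infinity
  along the diagonals. The integrand \<open>f\<close> is tied to the wave only in the open
  half-plane, since the transforms occurring in it may be meaningless elsewhere.\<close>

locale wave_on_lower_half_plane =
  fixes X c M :: real and B f :: "complex \<Rightarrow> complex"
  assumes X: "X < 0" and c: "0 < c"
    and holo_B: "B holomorphic_on {k. Im k < 0}"
    and bound_B: "\<And>k. Im k < 0 \<Longrightarrow> norm (B k) \<le> M"
    and f_eq: "\<And>k. Im k < 0 \<Longrightarrow> f k = gaussian_wave X c k * B k"
begin

lemma holo_f: "f holomorphic_on {k. Im k < 0}"
proof -
  have "(\<lambda>k. gaussian_wave X c k * B k) holomorphic_on {k. Im k < 0}"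
    by (intro holomorphic_intros holo_B)
  then show ?thesis by (rule holomorphic_transform) (simp add: f_eq)
qed

lemma M_nonneg: "0 \<le> M"
  using order_trans[OF norm_ge_zero bound_B[of "- \<i>"]] by simp

lemma norm_f: "Im k < 0 \<Longrightarrow> norm (f k) \<le> M * exp (- (X * Im k) - c * ((Re k)\<^sup>2 - (Im k)\<^sup>2))"
  using mult_left_mono[OF bound_B[of k], of "norm (gaussian_wave X c k)"]
  by (simp add: f_eq norm_mult norm_gaussian_wave mult.commute)

lemma integrable_line: "integrable lborel (\<lambda>s. f (of_real s - \<i>))"
\<comment> \<open>At \<open>k = s - \<i>\<close> the modulus of the wave is
  \<open>exp (X + c) * exp (- c * s^2)\<close>.\<close>
proof (rule Bochner_Integration.integrable_bound[where f = "\<lambda>s::real. M * exp (X + c) * exp (- (c * (s - 0)\<^sup>2))"])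
  have "continuous_on UNIV (\<lambda>s. f (complex_of_real s - \<i>))"
    by (rule continuous_on_compose2[OF holomorphic_on_imp_continuous_on[OF holo_f]])
       (auto intro!: continuous_intros)
  then show "(\<lambda>s. f (complex_of_real s - \<i>)) \<in> borel_measurable lborel"
    by (simp add: borel_measurable_continuous_onI)
  show "AE s in lborel. norm (f (complex_of_real s - \<i>)) \<le> norm (M * exp (X + c) * exp (- (c * (s - 0)\<^sup>2)))"
  proof (rule AE_I2)
    fix s :: real
    show "norm (f (complex_of_real s - \<i>)) \<le> norm (M * exp (X + c) * exp (- (c * (s - 0)\<^sup>2)))"
      using norm_f[of "s - \<i>"] M_nonneg by (simp add: abs_mult exp_add[symmetric] mult.assoc algebra_simps)
  qed
qed (intro integrable_mult_right integrable_gaussian c)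

text \<open>A primitive on the convex half-plane replaces Cauchy's theorem: every piece of either
  path is an increment of \<open>\<Phi>\<close>, so only the far ends have to be compared, along
  vertical segments that contribute at most a multiple of \<open>R * exp (X * R)\<close>. The sign
  arises because the boundary of the lower region runs from right to left.\<close>

lemma integral_D0_minus_eq_line:
  assumes g: "lower_detour r g"
  shows "integral_D0_minus r g f = - (LBINT s. f (of_real s - \<i>))"
proof -
  let ?H = "{k. Im k < 0}"
  have r: "0 < r" using g by (simp add: lower_detour_def)
  obtain \<Phi> where \<Phi>'': "\<And>k. Im k < 0 \<Longrightarrow> (\<Phi> has_field_derivative f k) (at k within ?H)"
    using holomorphic_convex_primitive'[OF convex_half_planes(1,2) holo_f] by (metis mem_Collect_eq)
  then have \<Phi>': "\<And>k. k \<in> ?H \<Longrightarrow> (\<Phi> has_field_derivative f k) (at k within ?H)" by simp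
  have \<Phi>: "(\<Phi> has_field_derivative f k) (at k)" if "Im k < 0" for k
    using \<Phi>'[of k] that at_within_open[OF _ convex_half_planes(2), of k] by simp
  have contg: "contour_integral g f = \<Phi> (r * cis (- 3 * pi / 4)) - \<Phi> (r * cis (- pi / 4))"
    using contour_integral_unique[OF contour_integral_primitive[OF \<Phi>', of g]] g
    by (simp add: lower_detour_def)
  have contf: "continuous_on ?H f" by (rule holomorphic_on_imp_continuous_on[OF holo_f])
  \<comment> \<open>On the diagonals \<open>(Re k)^2 = (Im k)^2\<close>, so the quadratic exponent
    has modulus 1 and the decay comes from \<open>X\<close> alone.\<close>
  have ray: "((\<lambda>R. \<Phi> (complex_of_real R * cis \<theta>)) \<longlongrightarrow> \<Phi> (r * cis \<theta>) + outward_ray_integral r \<theta> f) at_top"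
    if \<theta>: "\<theta> = - pi / 4 \<or> \<theta> = - 3 * pi / 4" for \<theta>
  proof (rule outward_ray_integral_primitive[OF r, of "- X / sqrt 2"])
    have diag: "s * cis \<theta> = Complex (s / sqrt 2) (- (s / sqrt 2)) \<or> s * cis \<theta> = Complex (- (s / sqrt 2)) (- (s / sqrt 2))"
      for s :: real using \<theta> cis_diagonals(3,4)[of s] by metis
    have im: "Im (s * cis \<theta>) = - (s / sqrt 2)" for s :: real
      using diag[of s] by (metis complex.sel(2))
    have re: "(Re (s * cis \<theta>))\<^sup>2 = (s / sqrt 2)\<^sup>2" for s :: real
      using diag[of s] by (metis complex.sel(1) power2_minus)
    show "0 < - X / sqrt 2" using X by (intro divide_pos_pos) auto
    show "(\<Phi> has_field_derivative f (s * cis \<theta>)) (at (s * cis \<theta>))" if "r \<le> s" for s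
      using r that by (intro \<Phi>, subst im) auto
    show "continuous_on {r..} (\<lambda>s. f (complex_of_real s * cis \<theta>))"
    proof (rule continuous_on_compose2[OF contf])
      show "(\<lambda>s. complex_of_real s * cis \<theta>) ` {r..} \<subseteq> ?H" using im r by (auto simp del: times_complex.sel)
    qed (intro continuous_intros)
    show "norm (f (s * cis \<theta>)) \<le> M * exp (- (- X / sqrt 2 * s))" if "r \<le> s" for s
    proof -
      have "Im (s * cis \<theta>) < 0" using im[of s] r that by (simp del: times_complex.sel)
      from norm_f[OF this] show ?thesis unfolding re unfolding im by simp
    qed
  qed
  \<comment> \<open>The integral between the two corners at height \<open>- R\<close>, one on each
    ray, independently of the path.\<close>
  define \<Psi> where "\<Psi> R = \<Phi> (Complex (- R) (- R)) - \<Phi> (Complex R (- R))" for R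
  have "((\<lambda>R. \<Phi> (complex_of_real R * cis (- 3 * pi / 4)) - \<Phi> (complex_of_real R * cis (- pi / 4))) \<longlongrightarrow>
      (\<Phi> (r * cis (- 3 * pi / 4)) + outward_ray_integral r (- 3 * pi / 4) f)
      - (\<Phi> (r * cis (- pi / 4)) + outward_ray_integral r (- pi / 4) f)) at_top"
    by (intro tendsto_diff ray) auto
  also have "(\<Phi> (r * cis (- 3 * pi / 4)) + outward_ray_integral r (- 3 * pi / 4) f)
      - (\<Phi> (r * cis (- pi / 4)) + outward_ray_integral r (- pi / 4) f) = integral_D0_minus r g f"
    by (simp add: integral_D0_minus_def contg)
  also have "(\<lambda>R. \<Phi> (complex_of_real R * cis (- 3 * pi / 4)) - \<Phi> (complex_of_real R * cis (- pi / 4))) = (\<lambda>R. \<Psi> (R / sqrt 2))"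
    unfolding cis_diagonals \<Psi>_def by auto
  finally have "((\<lambda>R. \<Psi> (R / sqrt 2)) \<longlongrightarrow> integral_D0_minus r g f) at_top" .
  moreover have "filterlim (\<lambda>R::real. sqrt 2 * R) at_top at_top"
    by (rule filterlim_tendsto_pos_mult_at_top[OF tendsto_const]) (auto intro: filterlim_ident)
  ultimately have "((\<lambda>R. \<Psi> (sqrt 2 * R / sqrt 2)) \<longlongrightarrow> integral_D0_minus r g f) at_top"
    by (rule filterlim_compose)
  then have 1: "(\<Psi> \<longlongrightarrow> integral_D0_minus r g f) at_top" by simp
  have seg: "norm (\<Phi> (Complex x (- R)) - \<Phi> (Complex x (- 1))) \<le> M * (R * exp (X * R))"
    if R: "1 \<le> R" "- X \<le> c * R" and x: "\<bar>x\<bar> = R" for x R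
  proof -
    have "norm (\<Phi> (Complex x (- R)) - \<Phi> (Complex x (- 1))) \<le> M * exp (X * R) * norm (Complex x (- R) - Complex x (- 1))"
    proof (rule field_differentiable_bound[where S = "closed_segment (Complex x (- R)) (Complex x (- 1))" and f' = f])
      have S: "\<exists>u. k = Complex x (- u) \<and> 1 \<le> u \<and> u \<le> R"
        if k: "k \<in> closed_segment (Complex x (- R)) (Complex x (- 1))" for k
      proof -
        obtain v where v: "0 \<le> v" "v \<le> 1" "k = (1 - v) *\<^sub>R Complex x (- R) + v *\<^sub>R Complex x (- 1)"
          using k by (auto simp: closed_segment_def)
        have "k = Complex x (- ((1 - v) * R + v))" unfolding v(3) by (simp add: complex_eq_iff algebra_simps)
        moreover have "1 \<le> (1 - v) * R + v" "(1 - v) * R + v \<le> R"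
          using v(1,2) R mult_left_mono[of 1 R "1 - v"] mult_left_mono[of 1 R v] by (auto simp: algebra_simps)
        ultimately show ?thesis by blast
      qed
      show "(\<Phi> has_field_derivative f k) (at k within closed_segment (Complex x (- R)) (Complex x (- 1)))"
        if "k \<in> closed_segment (Complex x (- R)) (Complex x (- 1))" for k
        using S[OF that] by (auto intro!: DERIV_subset[OF \<Phi>])
      show "norm (f k) \<le> M * exp (X * R)" if k: "k \<in> closed_segment (Complex x (- R)) (Complex x (- 1))" for k
      proof -
        obtain u where u: "k = Complex x (- u)" "1 \<le> u" "u \<le> R" using S[OF k] by auto
        \<comment> \<open>Once \<open>R \<ge> - X / c\<close> the bound on the vertical segment is
          largest at its lower end \<open>u = R\<close>, where the Gaussian factor disappears and
          \<open>exp (X * R)\<close> remains.\<close>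
        have "(- X) * (R - u) \<le> (c * R) * (R - u)" using R u by (intro mult_right_mono) auto
        also have "\<dots> \<le> c * (R + u) * (R - u)" using c u by (intro mult_right_mono mult_left_mono) auto
        also have "c * (R + u) * (R - u) = c * (x\<^sup>2 - u\<^sup>2)"
          unfolding x[symmetric] using power2_abs[of x] by (simp add: power2_eq_square algebra_simps)
        finally have "- (X * (- u)) - c * (x\<^sup>2 - u\<^sup>2) \<le> X * R" by (simp add: algebra_simps)
        then have "M * exp (- (X * (- u)) - c * (x\<^sup>2 - u\<^sup>2)) \<le> M * exp (X * R)"
          using M_nonneg by (intro mult_left_mono) auto
        then show ?thesis using norm_f[of k] u by simp
      qed
    qed auto
    also have "norm (Complex x (- R) - Complex x (- 1)) = R - 1"
      using R by (simp add: cmod_def)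
    also have "M * exp (X * R) * (R - 1) \<le> M * exp (X * R) * R" using M_nonneg by (intro mult_left_mono) auto
    finally show ?thesis by (simp add: mult_ac)
  qed
  have exp0: "((\<lambda>R. M * (R * exp (X * R))) \<longlongrightarrow> 0) at_top"
  proof -
    have "filterlim (\<lambda>R. (- X) * R) at_top at_top"
      using X by (intro filterlim_tendsto_pos_mult_at_top[OF tendsto_const]) (auto intro: filterlim_ident)
    from filterlim_compose[OF tendsto_power_div_exp_0[of 1] this]
    have "((\<lambda>R. M / (- X) * (((- X) * R) ^ 1 / exp ((- X) * R))) \<longlongrightarrow> M / (- X) * 0) at_top"
      by (rule tendsto_mult_left)
    also have "(\<lambda>R. M / (- X) * (((- X) * R) ^ 1 / exp ((- X) * R))) = (\<lambda>R. M * (R * exp (X * R)))"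
    proof
      fix R
      have "exp (X * R) = 1 / exp ((- X) * R)" using exp_minus[of "(- X) * R"] by (simp add: inverse_eq_divide)
      then show "M / (- X) * (((- X) * R) ^ 1 / exp ((- X) * R)) = M * (R * exp (X * R))" using X by simp
    qed
    finally show ?thesis by simp
  qed
  have line: "(LBINT s. indicator {-R..R} s *\<^sub>R f (of_real s - \<i>)) = \<Phi> (Complex R (- 1)) - \<Phi> (Complex (- R) (- 1))"
    if R: "0 \<le> R" for R
  proof -
    have e: "Complex s (- 1) = complex_of_real s - \<i>" for s by (simp add: complex_eq_iff)
    have "(LBINT s. indicator {-R..R} s *\<^sub>R f (of_real s - \<i>)) = \<Phi> (complex_of_real R - \<i>) - \<Phi> (complex_of_real (- R) - \<i>)"
    proof (rule integral_FTC_atLeastAtMost)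
      fix s assume s: "- R \<le> s" "s \<le> R"
      show "((\<lambda>s. \<Phi> (complex_of_real s - \<i>)) has_vector_derivative f (s - \<i>)) (at s within {-R..R})"
      proof (rule has_vector_derivative_real_field)
        have "((\<lambda>z. z - \<i>) has_field_derivative 1) (at (complex_of_real s))"
          by (auto intro!: derivative_eq_intros)
        from DERIV_chain2[where f = \<Phi>, OF \<Phi> this]
        show "((\<lambda>z. \<Phi> (z - \<i>)) has_field_derivative f (complex_of_real s - \<i>)) (at (complex_of_real s))"
          by simp
      qed
    next
      show "continuous_on {-R..R} (\<lambda>s. f (complex_of_real s - \<i>))"
        by (rule continuous_on_compose2[OF contf]) (auto intro!: continuous_intros)
    qed (use R in auto)
    then show ?thesis by (simp add: e)
  qed
  have "((\<lambda>R. \<Psi> R + (LBINT s. indicator {-R..R} s *\<^sub>R f (of_real s - \<i>))) \<longlongrightarrow> 0) at_top"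
  proof (rule Lim_null_comparison)
    have "((\<lambda>R. M * (R * exp (X * R)) + M * (R * exp (X * R))) \<longlongrightarrow> 0 + 0) at_top"
      by (intro tendsto_add exp0)
    then show "((\<lambda>R. M * (R * exp (X * R)) + M * (R * exp (X * R))) \<longlongrightarrow> 0) at_top" by simp
    show "\<forall>\<^sub>F R in at_top. norm (\<Psi> R + (LBINT s. indicator {-R..R} s *\<^sub>R f (of_real s - \<i>)))
        \<le> M * (R * exp (X * R)) + M * (R * exp (X * R))"
      using eventually_ge_at_top[of 1] eventually_ge_at_top[of "- X / c"]
    proof eventually_elim
      case (elim R)
      have R: "1 \<le> R" "- X \<le> c * R" using elim c by (auto simp: field_simps)
      have "\<Psi> R + (LBINT s. indicator {-R..R} s *\<^sub>R f (of_real s - \<i>)) =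
        (\<Phi> (Complex (- R) (- R)) - \<Phi> (Complex (- R) (- 1))) - (\<Phi> (Complex R (- R)) - \<Phi> (Complex R (- 1)))"
        using R by (simp add: \<Psi>_def line)
      also have "norm \<dots> \<le> M * (R * exp (X * R)) + M * (R * exp (X * R))"
        using R by (intro order_trans[OF norm_triangle_ineq4] add_mono seg) auto
      finally show ?case .
    qed
  qed
  moreover have "((\<lambda>R. \<Psi> R + (LBINT s. indicator {-R..R} s *\<^sub>R f (of_real s - \<i>)))
      \<longlongrightarrow> integral_D0_minus r g f + (LBINT s. f (of_real s - \<i>))) at_top"
    by (intro tendsto_add 1 tendsto_integral_symmetric integrable_line)
  ultimately have "integral_D0_minus r g f + (LBINT s. f (of_real s - \<i>)) = 0"
    by (intro tendsto_unique[OF trivial_limit_at_top_linorder])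
  then show ?thesis by (simp add: eq_neg_iff_add_eq_0)
qed

end

text \<open>Reflection through 0 reduces this to the lower contour. The detour is not reflected
  itself: a primitive sees only its end points, so a straight segment may represent it below the
  axis. The orientation is now from left to right, hence no sign.\<close>

lemma integral_D0_plus_eq_line:
  assumes X: "0 < X" and c: "0 < c"
    and holo: "B holomorphic_on {k. Im k < 0}"
    and bound: "\<And>k. Im k < 0 \<Longrightarrow> norm (B k) \<le> M"
    and f: "\<And>k. 0 < Im k \<Longrightarrow> f k = gaussian_wave X c k * B (- k)"
    and g: "upper_detour r g"
  shows "integral_D0_plus r g f = (LBINT s. f (of_real s + \<i>))"
proof -
  interpret N: wave_on_lower_half_plane "- X" c M B "\<lambda>k. f (- k)"
    using X c holo bound f by unfold_locales (auto simp: gaussian_wave_minus)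
  have refl: "(\<lambda>s. f (- (complex_of_real (0 + - 1 * s) - \<i>))) = (\<lambda>s. f (complex_of_real s + \<i>))" by (simp add: add.commute)
  let ?a = "r * cis (- pi / 4)" and ?b = "r * cis (- 3 * pi / 4)"
  have r: "0 < r" using g by (simp add: upper_detour_def)
  have l: "lower_detour r (linepath ?a ?b)"
  proof -
    have "closed_segment ?a ?b \<subseteq> {k. Im k < 0}"
      using r by (intro closed_segment_subset convex_half_planes) (auto simp only: cis_diagonals, auto)
    then show ?thesis using r by (simp add: lower_detour_def)
  qed
  have ends: "r * cis (3 * pi / 4) = - ?a" "r * cis (pi / 4) = - ?b"
    unfolding cis_diagonals by (auto simp: complex_eq_iff)
  have rays: "cis (3 * pi / 4) = - cis (- pi / 4)" "cis (pi / 4) = - cis (- 3 * pi / 4)"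
    using cis_diagonals[of 1] by (auto simp: complex_eq_iff)
  obtain \<Phi> where \<Phi>': "\<And>k. Im k < 0 \<Longrightarrow> (\<Phi> has_field_derivative f (- k)) (at k within {k. Im k < 0})"
    using holomorphic_convex_primitive'[OF convex_half_planes(1,2) N.holo_f] by (metis mem_Collect_eq)
  have "contour_integral (linepath ?a ?b) (\<lambda>k. f (- k)) = \<Phi> ?b - \<Phi> ?a"
    using contour_integral_unique[OF contour_integral_primitive[of "{k. Im k < 0}" \<Phi> "\<lambda>k. f (- k)" "linepath ?a ?b"]] \<Phi>' l
    by (simp add: lower_detour_def)
  moreover have "contour_integral g f = - \<Phi> (- (- ?b)) - - \<Phi> (- (- ?a))"
  proof -
    have "((\<lambda>k. - \<Phi> (- k)) has_field_derivative f k) (at k within {k. 0 < Im k})" if k: "0 < Im k" for k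
    proof -
      have "(\<Phi> has_field_derivative f (- (- k))) (at (- k))"
        using \<Phi>'[of "- k"] k at_within_open[OF _ convex_half_planes(2), of "- k"] by simp
      then have "((\<lambda>k. - \<Phi> (- k)) has_field_derivative - (f k * (- 1))) (at k)"
        by (intro DERIV_minus DERIV_chain2[where f = \<Phi>]) (auto intro!: derivative_eq_intros)
      then show ?thesis by (auto intro: DERIV_subset)
    qed
    then show ?thesis
      using contour_integral_unique[OF contour_integral_primitive[of "{k. 0 < Im k}" "\<lambda>k. - \<Phi> (- k)" f g]] g ends
      by (simp add: upper_detour_def)
  qed
  ultimately have "contour_integral g f = - contour_integral (linepath ?a ?b) (\<lambda>k. f (- k))" by simp
  moreover have "outward_ray_integral r (3 * pi / 4) f = - outward_ray_integral r (- pi / 4) (\<lambda>k. f (- k))"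
    "outward_ray_integral r (pi / 4) f = - outward_ray_integral r (- 3 * pi / 4) (\<lambda>k. f (- k))"
    unfolding outward_ray_integral_def rays set_lebesgue_integral_def Bochner_Integration.integral_minus[symmetric]
    by (simp_all only: mult_minus_right scaleR_minus_right)
  ultimately have "integral_D0_plus r g f = - integral_D0_minus r (linepath ?a ?b) (\<lambda>k. f (- k))"
    by (simp add: integral_D0_plus_def integral_D0_minus_def)
  also have "\<dots> = (LBINT s. f (- (of_real s - \<i>)))" by (simp only: N.integral_D0_minus_eq_line[OF l] minus_minus)
  also have "\<dots> = (LBINT s. f (of_real s + \<i>))"
    using lborel_integral_real_affine[of "- 1" "\<lambda>s. f (- (complex_of_real s - \<i>))" 0] unfolding refl by simp
  finally show "integral_D0_plus r g f = (LBINT s. f (of_real s + \<i>))" .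
qed

section \<open>Bounded holomorphic functions on the lower half-plane\<close>

definition bounded_holomorphic :: "(complex \<Rightarrow> complex) \<Rightarrow> bool" where
  "bounded_holomorphic B \<longleftrightarrow>
     B holomorphic_on {k. Im k < 0} \<and> (\<exists>M. \<forall>k. Im k < 0 \<longrightarrow> norm (B k) \<le> M)"

lemma bounded_holomorphicI:
  assumes "B holomorphic_on {k. Im k < 0}" "\<And>k. Im k < 0 \<Longrightarrow> norm (B k) \<le> M"
  shows "bounded_holomorphic B"
  using assms unfolding bounded_holomorphic_def by blast

lemma bounded_holomorphicE:
  assumes "bounded_holomorphic B"
  obtains M where "0 \<le> M" "B holomorphic_on {k. Im k < 0}" "\<And>k. Im k < 0 \<Longrightarrow> norm (B k) \<le> M"
proof -
  obtain M where M: "\<And>k. Im k < 0 \<Longrightarrow> norm (B k) \<le> M" using assms by (auto simp: bounded_holomorphic_def)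
  show thesis
    using M assms order_trans[OF norm_ge_zero M[of "- \<i>"]]
    by (intro that[of M]) (auto simp: bounded_holomorphic_def)
qed

named_theorems bounded_holomorphic_intros

lemma bounded_holomorphic_const [bounded_holomorphic_intros]: "bounded_holomorphic (\<lambda>_. c)"
  by (rule bounded_holomorphicI[of _ "norm c"]) auto

lemma bounded_holomorphic_mult [bounded_holomorphic_intros]:
  assumes "bounded_holomorphic A" "bounded_holomorphic B"
  shows "bounded_holomorphic (\<lambda>k. A k * B k)"
proof -
  obtain M where M: "0 \<le> M" "A holomorphic_on {k. Im k < 0}" "\<And>k. Im k < 0 \<Longrightarrow> norm (A k) \<le> M"
    using assms(1) by (rule bounded_holomorphicE) (rule that)
  obtain N where N: "0 \<le> N" "B holomorphic_on {k. Im k < 0}" "\<And>k. Im k < 0 \<Longrightarrow> norm (B k) \<le> N"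
    using assms(2) by (rule bounded_holomorphicE) (rule that)
  show ?thesis
    by (rule bounded_holomorphicI[of _ "M * N"])
       (use M N in \<open>auto intro!: holomorphic_intros mult_mono simp: norm_mult\<close>)
qed

lemma bounded_holomorphic_add [bounded_holomorphic_intros]:
  assumes "bounded_holomorphic A" "bounded_holomorphic B"
  shows "bounded_holomorphic (\<lambda>k. A k + B k)"
proof -
  obtain M where M: "0 \<le> M" "A holomorphic_on {k. Im k < 0}" "\<And>k. Im k < 0 \<Longrightarrow> norm (A k) \<le> M"
    using assms(1) by (rule bounded_holomorphicE) (rule that)
  obtain N where N: "0 \<le> N" "B holomorphic_on {k. Im k < 0}" "\<And>k. Im k < 0 \<Longrightarrow> norm (B k) \<le> N"
    using assms(2) by (rule bounded_holomorphicE) (rule that)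
  show ?thesis
  proof (rule bounded_holomorphicI[of _ "M + N"])
    show "norm (A k + B k) \<le> M + N" if "Im k < 0" for k
      using norm_triangle_ineq[of "A k" "B k"] M(3)[OF that] N(3)[OF that] by linarith
  qed (use M N in \<open>auto intro!: holomorphic_intros\<close>)
qed

lemma bounded_holomorphic_diff [bounded_holomorphic_intros]:
  assumes "bounded_holomorphic A" "bounded_holomorphic B"
  shows "bounded_holomorphic (\<lambda>k. A k - B k)"
  using bounded_holomorphic_add[OF assms(1) bounded_holomorphic_mult[OF bounded_holomorphic_const[of "- 1"] assms(2)]]
  by simp

lemma bounded_holomorphic_scale:
  assumes "bounded_holomorphic B" "0 < \<sigma>"
  shows "bounded_holomorphic (\<lambda>k. B (complex_of_real \<sigma> * k))"
proof -
  obtain M where M: "0 \<le> M" "B holomorphic_on {k. Im k < 0}" "\<And>k. Im k < 0 \<Longrightarrow> norm (B k) \<le> M"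
    using assms(1) by (rule bounded_holomorphicE) (rule that)
  have "(B \<circ> (*) (complex_of_real \<sigma>)) holomorphic_on {k. Im k < 0}"
    using assms by (intro holomorphic_on_compose_gen[OF _ M(2)] holomorphic_intros) (auto simp: mult_pos_neg)
  then show ?thesis
    using M(3) assms by (intro bounded_holomorphicI[of _ M]) (auto simp: o_def mult_pos_neg)
qed

lemma norm_exp_minus_i: "norm (exp (- (\<i> * k * complex_of_real z))) = exp (z * Im k)"
  by (simp add: norm_exp_eq_Re mult.commute)

lemma norm_exp_minus_i_le: "Im k \<le> 0 \<Longrightarrow> 0 \<le> z \<Longrightarrow> norm (exp (- (\<i> * k * complex_of_real z))) \<le> 1"
  unfolding norm_exp_minus_i by (simp add: mult_nonneg_nonpos)

lemma bounded_holomorphic_exp [bounded_holomorphic_intros]: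
  assumes "0 \<le> \<beta>"
  shows "bounded_holomorphic (\<lambda>k. exp (- (\<i> * k * complex_of_real \<beta>)))"
  using assms by (intro bounded_holomorphicI[of _ 1]) (auto intro!: holomorphic_intros norm_exp_minus_i_le simp del: norm_exp_eq_Re)

text \<open>Below the real axis the exponential has modulus at most 1, so this is the reverse
  triangle inequality. With \<open>\<bar>q\<bar> < 1\<close> it keeps the determinants of the
  interface problem away from zero.\<close>

lemma resonance_norm_ge:
  assumes "Im k \<le> 0" "0 \<le> \<beta>"
  shows "1 - \<bar>q\<bar> \<le> norm (1 - complex_of_real q * exp (- (\<i> * k * complex_of_real \<beta>)))"
proof -
  have "norm (complex_of_real q * exp (- (\<i> * k * complex_of_real \<beta>))) \<le> \<bar>q\<bar> * 1"
    unfolding norm_mult norm_of_real using assms by (intro mult_left_mono norm_exp_minus_i_le) auto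
  then show ?thesis
    using norm_triangle_ineq2[of 1 "complex_of_real q * exp (- (\<i> * k * complex_of_real \<beta>))"] by simp
qed

lemma resonance_nonzero:
  assumes "Im k \<le> 0" "0 \<le> \<beta>" "\<bar>q\<bar> < 1"
  shows "1 - complex_of_real q * exp (- (\<i> * k * complex_of_real \<beta>)) \<noteq> 0"
  using resonance_norm_ge[OF assms(1,2), of q] assms(3) by auto

lemma bounded_holomorphic_resonance [bounded_holomorphic_intros]:
  assumes "0 \<le> \<beta>" "\<bar>q\<bar> < 1"
  shows "bounded_holomorphic (\<lambda>k. 1 / (1 - complex_of_real q * exp (- (\<i> * k * complex_of_real \<beta>))))"
proof (rule bounded_holomorphicI[of _ "1 / (1 - \<bar>q\<bar>)"])
  show "(\<lambda>k. 1 / (1 - complex_of_real q * exp (- (\<i> * k * complex_of_real \<beta>)))) holomorphic_on {k. Im k < 0}"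
    using assms resonance_nonzero[OF _ assms] by (intro holomorphic_intros) auto
  show "norm (1 / (1 - complex_of_real q * exp (- (\<i> * k * complex_of_real \<beta>)))) \<le> 1 / (1 - \<bar>q\<bar>)"
    if "Im k < 0" for k
    using resonance_norm_ge[of k \<beta> q] that assms by (simp add: norm_divide) (intro divide_left_mono mult_pos_pos, auto)
qed

text \<open>Both kinds of contour are brought to the same line \<open>Im k = - 1\<close>; for the
  upper one the line integral at height 1 is reflected by \<open>s \<mapsto> - s\<close>. From here
  on upper and lower integrals are treated alike.\<close>

lemma
  assumes X: "X < 0" and c: "0 < c" and B: "bounded_holomorphic B"
  shows integrable_wave: "integrable lborel (\<lambda>s. gaussian_wave X c (of_real s - \<i>) * B (of_real s - \<i>))"
    and integral_D0_minus_wave: "lower_detour r g \<Longrightarrow>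
      (\<And>k. Im k < 0 \<Longrightarrow> f k = gaussian_wave X c k * B k) \<Longrightarrow>
      integral_D0_minus r g f = - (LBINT s. gaussian_wave X c (of_real s - \<i>) * B (of_real s - \<i>))"
    and integral_D0_plus_wave: "upper_detour r g \<Longrightarrow>
      (\<And>k. 0 < Im k \<Longrightarrow> f k = gaussian_wave (- X) c k * B (- k)) \<Longrightarrow>
      integral_D0_plus r g f = (LBINT s. gaussian_wave X c (of_real s - \<i>) * B (of_real s - \<i>))"
proof -
  obtain M where M: "0 \<le> M" "B holomorphic_on {k. Im k < 0}" "\<And>k. Im k < 0 \<Longrightarrow> norm (B k) \<le> M"
    using B by (rule bounded_holomorphicE) (rule that)
  interpret W: wave_on_lower_half_plane X c M B "\<lambda>k. gaussian_wave X c k * B k"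
    using assms M by unfold_locales auto
  show "integrable lborel (\<lambda>s. gaussian_wave X c (of_real s - \<i>) * B (of_real s - \<i>))"
    by (rule W.integrable_line)
  show "integral_D0_minus r g f = - (LBINT s. gaussian_wave X c (of_real s - \<i>) * B (of_real s - \<i>))"
    if g: "lower_detour r g" and f: "\<And>k. Im k < 0 \<Longrightarrow> f k = gaussian_wave X c k * B k"
  proof -
    interpret F: wave_on_lower_half_plane X c M B f
      using assms M f by unfold_locales auto
    show ?thesis using F.integral_D0_minus_eq_line[OF g] by (simp add: f)
  qed
  show "integral_D0_plus r g f = (LBINT s. gaussian_wave X c (of_real s - \<i>) * B (of_real s - \<i>))"
    if g: "upper_detour r g" and f: "\<And>k. 0 < Im k \<Longrightarrow> f k = gaussian_wave (- X) c k * B (- k)"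
  proof -
    have "integral_D0_plus r g f = (LBINT s. f (of_real s + \<i>))"
      using X by (intro integral_D0_plus_eq_line[OF _ c M(2,3) f g]) auto
    also have "\<dots> = (LBINT s. f (of_real (0 + - 1 * s) + \<i>))"
      using lborel_integral_real_affine[of "- 1" "\<lambda>s. f (complex_of_real s + \<i>)" 0] by simp
    also have "(\<lambda>s. f (of_real (0 + - 1 * s) + \<i>)) = (\<lambda>s. gaussian_wave X c (of_real s - \<i>) * B (of_real s - \<i>))"
    proof
      fix s :: real
      have "f (of_real (0 + - 1 * s) + \<i>) = gaussian_wave (- X) c (- (of_real s - \<i>)) * B (- (- (of_real s - \<i>)))"
        by (subst f) auto
      then show "f (of_real (0 + - 1 * s) + \<i>) = gaussian_wave X c (of_real s - \<i>) * B (of_real s - \<i>)"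
        by (simp only: gaussian_wave_minus minus_minus)
    qed
    finally show ?thesis .
  qed
qed

section \<open>Fourier-Laplace transforms\<close>

text \<open>The Laplace transform at \<open>\<i> * k\<close>, that is the Fourier transform of the
  half-line part. For bounded \<open>F\<close> it converges when \<open>Im k < 0\<close>.\<close>

definition laplace :: "(real \<Rightarrow> real) \<Rightarrow> complex \<Rightarrow> complex" where
  "laplace F k = (LBINT z:{0<..}. exp (- (\<i> * k * complex_of_real z)) * complex_of_real (F z))"

lemma laplace_cong: "(\<And>z. 0 < z \<Longrightarrow> F z = G z) \<Longrightarrow> laplace F k = laplace G k"
  unfolding laplace_def by (intro set_lebesgue_integral_cong) auto

lemma integrable_times_product:
  fixes f g :: "real \<Rightarrow> real"
  assumes "integrable lborel f" "integrable lborel g"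
  shows "integrable (lborel \<Otimes>\<^sub>M lborel) (\<lambda>(x, y). f x * g y)"
proof (rule lborel_pair.Fubini_integrable)
  have [measurable]: "f \<in> borel_measurable borel" "g \<in> borel_measurable borel" using assms by auto
  show "(\<lambda>(x, y). f x * g y) \<in> borel_measurable (lborel \<Otimes>\<^sub>M lborel)" by measurable
qed (use assms in \<open>auto simp: abs_mult\<close>)

text \<open>Lowering the line by \<open>\<eta>\<close> multiplies the wave by
  \<open>exp (\<eta> * Y + c * \<eta>^2)\<close> and shifts its frequency to
  \<open>Y + 2 * c * \<eta>\<close>; in the Gaussian integral the two effects cancel. The values
  used are \<open>\<eta> = 0\<close> for data and \<open>\<eta> = 1\<close> for extensions.\<close>

lemma gaussian_wave_kernel:
  assumes c: "0 < c"
  shows "(LBINT s. gaussian_wave Y c (of_real s - \<i> * of_real \<eta>)) = complex_of_real (2 * pi * heat_kernel c Y)"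
proof -
  have "gaussian_wave Y c (of_real s - \<i> * of_real \<eta>)
      = exp (\<eta> * Y + c * \<eta>\<^sup>2) * exp (\<i> * complex_of_real (Y + 2 * c * \<eta>) * s - c * (complex_of_real s)\<^sup>2)" for s :: real
    unfolding gaussian_wave_def exp_of_real[symmetric] exp_add[symmetric]
    by (rule arg_cong[where f = exp]) (simp add: power2_eq_square algebra_simps)
  then have "(LBINT s. gaussian_wave Y c (of_real s - \<i> * of_real \<eta>)) =
     complex_of_real (exp (\<eta> * Y + c * \<eta>\<^sup>2)) * (sqrt (pi / c) * exp (- ((Y + 2 * c * \<eta>)\<^sup>2) / (4 * c)))"
    using gaussian_fourier(2)[OF c, of "Y + 2 * c * \<eta>"] by simp
  also have "\<dots> = complex_of_real (sqrt (pi / c) * (exp (\<eta> * Y + c * \<eta>\<^sup>2) * exp (- ((Y + 2 * c * \<eta>)\<^sup>2) / (4 * c))))"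
    by simp
  also have "exp (\<eta> * Y + c * \<eta>\<^sup>2) * exp (- ((Y + 2 * c * \<eta>)\<^sup>2) / (4 * c)) = exp (- (Y\<^sup>2) / (4 * c))"
    unfolding exp_add[symmetric] using c by (intro arg_cong[where f = exp]) (simp add: power2_eq_square field_simps)
  also have "sqrt (pi / c) * exp (- (Y\<^sup>2) / (4 * c)) = 2 * pi * heat_kernel c Y"
  proof -
    have "sqrt (4 * pi * c) * sqrt (pi / c) = sqrt ((2 * pi)\<^sup>2)"
      unfolding real_sqrt_mult[symmetric] using c by (simp add: power2_eq_square)
    then have "sqrt (4 * pi * c) * sqrt (pi / c) = 2 * pi" unfolding real_sqrt_abs by simp
    moreover have "sqrt (4 * pi * c) \<noteq> 0" using c by simp
    ultimately have "sqrt (pi / c) = 2 * pi / sqrt (4 * pi * c)" by (metis nonzero_eq_divide_eq mult.commute)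
    then show ?thesis unfolding heat_kernel_def by simp
  qed
  finally show ?thesis .
qed

text \<open>The weight \<open>exp (\<eta> * Y y)\<close> is exactly the part of the modulus of the
  wave that depends on \<open>y\<close>; what remains is a Gaussian in \<open>s\<close>, so the
  product is integrable in both variables.\<close>

lemma fubini_wave:
  fixes G Y :: "real \<Rightarrow> real"
  assumes c: "0 < c" and G [measurable]: "G \<in> borel_measurable borel"
    and Y [measurable]: "Y \<in> borel_measurable borel"
    and int: "integrable lborel (\<lambda>y. exp (\<eta> * Y y) * \<bar>G y\<bar>)"
  shows "(LBINT s. (LBINT y. gaussian_wave (Y y) c (of_real s - \<i> * of_real \<eta>) * complex_of_real (G y)))
      = complex_of_real (2 * pi * (LBINT y. heat_kernel c (Y y) * G y))"
proof -
  let ?g = "\<lambda>s y. gaussian_wave (Y y) c (of_real s - \<i> * of_real \<eta>) * complex_of_real (G y)"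
  have "integrable (lborel \<Otimes>\<^sub>M lborel) (\<lambda>(s, y). (exp (c * \<eta>\<^sup>2) * exp (- (c * (s - 0)\<^sup>2))) * (exp (\<eta> * Y y) * \<bar>G y\<bar>))"
    by (intro integrable_times_product integrable_mult_right integrable_gaussian c int)
  then have "integrable (lborel \<Otimes>\<^sub>M lborel) (\<lambda>(s, y). ?g s y)"
  proof (rule Bochner_Integration.integrable_bound)
    show "(\<lambda>(s, y). ?g s y) \<in> borel_measurable (lborel \<Otimes>\<^sub>M lborel)"
      unfolding gaussian_wave_def by measurable
    show "AE p in lborel \<Otimes>\<^sub>M lborel. norm (case p of (s, y) \<Rightarrow> ?g s y) \<le>
        norm (case p of (s, y) \<Rightarrow> (exp (c * \<eta>\<^sup>2) * exp (- (c * (s - 0)\<^sup>2))) * (exp (\<eta> * Y y) * \<bar>G y\<bar>))"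
      by (rule AE_I2) (auto simp: norm_mult norm_gaussian_wave abs_mult algebra_simps simp flip: exp_add)
  qed
  from lborel_pair.Fubini_integral[OF this]
  have "(LBINT s. (LBINT y. ?g s y)) = (LBINT y. (LBINT s. ?g s y))" by simp
  also have "\<dots> = (LBINT y. complex_of_real (2 * pi * (heat_kernel c (Y y) * G y)))"
    by (intro Bochner_Integration.integral_cong) (simp_all add: gaussian_wave_kernel[OF c])
  finally show ?thesis by (simp only: integral_complex_of_real Bochner_Integration.integral_mult_right_zero)
qed

lemma line_integral_fourier_on:
  fixes x :: real
  assumes c: "0 < c" and u: "set_integrable lborel I u"
  shows "(LBINT k. gaussian_wave x c (of_real k) * fourier_on I u (of_real k))
     = complex_of_real (2 * pi * (LBINT y:I. heat_kernel c (x - y) * u y))"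
proof -
  define G where "G y = indicator I y * u y" for y
  have G: "integrable lborel G" using u by (simp add: set_integrable_def G_def[abs_def])
  then have [measurable]: "G \<in> borel_measurable borel" by auto
  have "(LBINT k. gaussian_wave x c (of_real k) * fourier_on I u (of_real k))
     = (LBINT s. (LBINT y. gaussian_wave (x - y) c (of_real s - \<i> * of_real 0) * complex_of_real (G y)))"
  proof (rule Bochner_Integration.integral_cong[OF refl])
    fix s :: real
    have "gaussian_wave x c s * fourier_on I u s
      = (LBINT y. gaussian_wave x c s * (indicator I y *\<^sub>R (exp (- (\<i> * complex_of_real s * complex_of_real y)) * complex_of_real (u y))))"
      by (simp only: fourier_on_def set_lebesgue_integral_def integral_mult_right_zero)
    also have "\<dots> = (LBINT y. gaussian_wave (x - y) c (of_real s - \<i> * of_real 0) * complex_of_real (G y))"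
    proof (rule Bochner_Integration.integral_cong[OF refl])
      fix y
      have "gaussian_wave (x - y) c s = gaussian_wave x c s * exp (- (\<i> * complex_of_real s * complex_of_real y))"
        unfolding gaussian_wave_def exp_add[symmetric] by (rule arg_cong[where f = exp]) (simp add: algebra_simps)
      then show "gaussian_wave x c s * (indicator I y *\<^sub>R (exp (- (\<i> * complex_of_real s * complex_of_real y)) * complex_of_real (u y)))
        = gaussian_wave (x - y) c (of_real s - \<i> * of_real 0) * complex_of_real (G y)"
        by (simp add: G_def indicator_def)
    qed
    finally show "gaussian_wave x c s * fourier_on I u s = (LBINT y. gaussian_wave (x - y) c (of_real s - \<i> * of_real 0) * complex_of_real (G y))" .
  qed
  also have "\<dots> = complex_of_real (2 * pi * (LBINT y. heat_kernel c (x - y) * G y))"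
    using G by (intro fubini_wave c) auto
  also have "(LBINT y. heat_kernel c (x - y) * G y) = (LBINT y:I. heat_kernel c (x - y) * u y)"
    unfolding set_lebesgue_integral_def G_def by (simp add: mult.left_commute)
  finally show ?thesis .
qed

lemma integrable_exp_half_line:
  fixes C :: real
  assumes "0 < \<alpha>"
  shows "integrable lborel (\<lambda>z. indicator {0<..} z * (C * exp (- (z * \<alpha>))))"
  using integrable_mult_right[OF integrable_I0i_exp_mscale[OF assms, unfolded set_integrable_def], of C]
  by (simp add: mult.left_commute)

context bounded_measurable
begin

lemma integrable_laplace:
  assumes k: "Im k < 0"
  shows "set_integrable lborel {0<..} (\<lambda>z. exp (- (\<i> * k * complex_of_real z)) * complex_of_real (f z))"
  unfolding set_integrable_def
proof (rule Bochner_Integration.integrable_bound[OF integrable_exp_half_line[of "- Im k" C]])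
  show "AE z in lborel. norm (indicator {0<..} z *\<^sub>R (exp (- (\<i> * k * complex_of_real z)) * complex_of_real (f z)))
     \<le> norm (indicator {0<..} z * (C * exp (- (z * - Im k))))"
  proof (rule AE_I2)
    fix z
    show "norm (indicator {0<..} z *\<^sub>R (exp (- (\<i> * k * complex_of_real z)) * complex_of_real (f z)))
       \<le> norm (indicator {0<..} z * (C * exp (- (z * - Im k))))"
    proof (cases "0 < z")
      case True
      have "norm (exp (- (\<i> * k * complex_of_real z))) * \<bar>f z\<bar> \<le> exp (z * Im k) * C"
        unfolding norm_exp_minus_i by (intro mult_left_mono bound) auto
      then show ?thesis
        using True bound_nonneg by (simp add: norm_mult abs_mult mult.commute[of C] del: norm_exp_eq_Re)
    qed simp
  qed
qed (use k in auto)

text \<open>With \<open>\<beta>\<close> the width of the middle layer this separates the data inside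
  the layer from what lies beyond the opposite interface, and so turns the scattering rule into
  equations between transforms.\<close>

lemma laplace_shift:
  assumes k: "Im k < 0" and \<beta>: "0 \<le> \<beta>"
  shows "laplace f k = laplace (\<lambda>z. if z < \<beta> then f z else 0) k
       + exp (- (\<i> * k * complex_of_real \<beta>)) * laplace (\<lambda>z. f (\<beta> + z)) k"
proof -
  let ?h = "\<lambda>z. exp (- (\<i> * k * complex_of_real z)) * complex_of_real (f z)"
  define g where "g z = indicator {\<beta><..} z *\<^sub>R ?h z" for z
  have i: "set_integrable lborel {0<..} ?h" by (rule integrable_laplace[OF k])
  have "{\<beta><..} \<subseteq> {0<..}" "{0<..<\<beta>} \<subseteq> {0<..}" using \<beta> by auto
  then have i2: "set_integrable lborel {\<beta><..} ?h" "set_integrable lborel {0<..<\<beta>} ?h"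
    by (auto intro: set_integrable_subset[OF i])
  have "laplace f k = (LBINT z:{0<..<\<beta>} \<union> {\<beta><..}. ?h z)"
    unfolding laplace_def set_lebesgue_integral_def
  proof (rule integral_cong_AE)
    show "AE z in lborel. indicator {0<..} z *\<^sub>R ?h z = indicator ({0<..<\<beta>} \<union> {\<beta><..}) z *\<^sub>R ?h z"
      using AE_lborel_singleton[of \<beta>] by eventually_elim (use \<beta> in \<open>auto simp: indicator_def\<close>)
  qed measurable
  also have "\<dots> = (LBINT z:{0<..<\<beta>}. ?h z) + (LBINT z:{\<beta><..}. ?h z)"
    by (rule set_integral_Un) (use i2 in auto)
  also have "(LBINT z:{0<..<\<beta>}. ?h z) = laplace (\<lambda>z. if z < \<beta> then f z else 0) k"
    unfolding laplace_def set_lebesgue_integral_def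
    by (intro Bochner_Integration.integral_cong) (auto simp: indicator_def)
  also have "(LBINT z:{\<beta><..}. ?h z) = (LBINT z. g z)"
    unfolding set_lebesgue_integral_def g_def ..
  also have "\<dots> = (LBINT z. g (\<beta> + 1 * z))"
    using lborel_integral_real_affine[of 1 g \<beta>] by simp
  also have "\<dots> = (LBINT z. exp (- (\<i> * k * complex_of_real \<beta>)) * (indicator {0<..} z *\<^sub>R
      (exp (- (\<i> * k * complex_of_real z)) * complex_of_real (f (\<beta> + z)))))"
    by (intro Bochner_Integration.integral_cong)
       (auto simp: g_def indicator_def algebra_simps simp flip: exp_add)
  also have "\<dots> = exp (- (\<i> * k * complex_of_real \<beta>)) * laplace (\<lambda>z. f (\<beta> + z)) k"
    by (simp only: laplace_def set_lebesgue_integral_def integral_mult_right_zero)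
  finally show ?thesis .
qed

text \<open>One unit below the axis the wave carries the weight \<open>exp (- \<sigma> * z)\<close>,
  which makes a merely bounded \<open>f\<close> admissible for Fubini's theorem.\<close>

lemma line_integral_laplace:
  assumes X: "X < 0" and c: "0 < c" and \<sigma>: "0 < \<sigma>"
  shows "(LBINT s. gaussian_wave X c (of_real s - \<i>) * laplace f (of_real \<sigma> * (of_real s - \<i>)))
     = complex_of_real (2 * pi * (LBINT z:{0<..}. heat_kernel c (X - \<sigma> * z) * f z))"
proof -
  define G where "G z = indicator {0<..} z * f z" for z :: real
  have [measurable]: "G \<in> borel_measurable borel" unfolding G_def by measurable
  have "(LBINT s. gaussian_wave X c (of_real s - \<i>) * laplace f (of_real \<sigma> * (of_real s - \<i>)))
     = (LBINT s. (LBINT z. gaussian_wave (X - \<sigma> * z) c (of_real s - \<i> * of_real 1) * complex_of_real (G z)))"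
  proof (rule Bochner_Integration.integral_cong[OF refl])
    fix s :: real
    let ?k = "of_real s - \<i>"
    have "gaussian_wave X c ?k * laplace f (of_real \<sigma> * ?k)
      = (LBINT z. gaussian_wave X c ?k * (indicator {0<..} z *\<^sub>R (exp (- (\<i> * (of_real \<sigma> * ?k) * complex_of_real z)) * complex_of_real (f z))))"
      by (simp only: laplace_def set_lebesgue_integral_def integral_mult_right_zero)
    also have "\<dots> = (LBINT z. gaussian_wave (X - \<sigma> * z) c (of_real s - \<i> * of_real 1) * complex_of_real (G z))"
    proof (rule Bochner_Integration.integral_cong[OF refl])
      fix z
      have "gaussian_wave (X - \<sigma> * z) c ?k = gaussian_wave X c ?k * exp (- (\<i> * (of_real \<sigma> * ?k) * complex_of_real z))"
        unfolding gaussian_wave_def exp_add[symmetric] by (rule arg_cong[where f = exp]) (simp add: algebra_simps)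
      then show "gaussian_wave X c ?k * (indicator {0<..} z *\<^sub>R (exp (- (\<i> * (of_real \<sigma> * ?k) * complex_of_real z)) * complex_of_real (f z)))
        = gaussian_wave (X - \<sigma> * z) c (of_real s - \<i> * of_real 1) * complex_of_real (G z)"
        by (simp add: G_def indicator_def)
    qed
    finally show "gaussian_wave X c ?k * laplace f (of_real \<sigma> * ?k) =
      (LBINT z. gaussian_wave (X - \<sigma> * z) c (of_real s - \<i> * of_real 1) * complex_of_real (G z))" .
  qed
  also have "\<dots> = complex_of_real (2 * pi * (LBINT z. heat_kernel c (X - \<sigma> * z) * G z))"
  proof (rule fubini_wave[OF c])
    show "integrable lborel (\<lambda>z. exp (1 * (X - \<sigma> * z)) * \<bar>G z\<bar>)"
    proof (rule Bochner_Integration.integrable_bound[OF integrable_exp_half_line[OF \<sigma>, of "C * exp X"]])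
      show "AE z in lborel. norm (exp (1 * (X - \<sigma> * z)) * \<bar>G z\<bar>) \<le> norm (indicator {0<..} z * (C * exp X * exp (- (z * \<sigma>))))"
        using bound bound_nonneg
        by (intro AE_I2) (auto simp: G_def indicator_def abs_mult mult_ac simp flip: exp_add intro!: mult_right_mono)
    qed measurable
  qed measurable
  also have "(LBINT z. heat_kernel c (X - \<sigma> * z) * G z) = (LBINT z:{0<..}. heat_kernel c (X - \<sigma> * z) * f z)"
    unfolding set_lebesgue_integral_def G_def by (simp add: mult.left_commute)
  finally show ?thesis .
qed

end

lemma laplace_linear:
  assumes "bounded_measurable F C" "bounded_measurable G D" and k: "Im k < 0"
  shows "laplace (\<lambda>z. p * F z + q * G z) k = p * laplace F k + q * laplace G k"
proof -
  interpret F: bounded_measurable F C by fact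
  interpret G: bounded_measurable G D by fact
  note i = F.integrable_laplace[OF k] G.integrable_laplace[OF k]
  have "laplace (\<lambda>z. p * F z + q * G z) k =
     (LBINT z:{0<..}. complex_of_real p * (exp (- (\<i> * k * complex_of_real z)) * complex_of_real (F z))
        + complex_of_real q * (exp (- (\<i> * k * complex_of_real z)) * complex_of_real (G z)))"
    unfolding laplace_def by (rule arg_cong[where f = "set_lebesgue_integral lborel {0<..}"]) (auto simp: algebra_simps)
  also have "\<dots> = p * laplace F k + q * laplace G k"
    unfolding laplace_def using i by (simp add: set_integral_add set_integral_mult_right)
  finally show ?thesis .
qed

text \<open>The integral of \<open>\<bar>F\<bar>\<close> bounds the transform up to the real axis.
  It is applied to the given data, whose integrability enters here; the transforms of the extensions
  are expressed through these.\<close>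

lemma bounded_holomorphic_laplace [bounded_holomorphic_intros]:
  assumes F: "set_integrable lborel {0<..} F"
  shows "bounded_holomorphic (laplace F)"
proof -
  define G where "G z = indicator {0<..} z * F z" for z :: real
  have G: "integrable lborel G" using F by (simp add: set_integrable_def G_def[abs_def])
  then have [measurable]: "G \<in> borel_measurable borel" by auto
  have G0: "G z = 0" if "z \<le> 0" for z using that by (simp add: G_def)
  have L: "laplace F k = (LBINT z. exp (- (\<i> * k * complex_of_real z)) * complex_of_real (G z))" for k
    unfolding laplace_def set_lebesgue_integral_def
    by (intro Bochner_Integration.integral_cong) (auto simp: G_def indicator_def)
  have nle: "norm (exp (- (\<i> * k * complex_of_real z)) * complex_of_real (G z)) \<le> \<bar>G z\<bar>" if "Im k < 0" for k z
  proof (cases "0 < z")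
    case True
    then show ?thesis
      using mult_right_mono[OF norm_exp_minus_i_le[of k z], of "\<bar>G z\<bar>"] that by (simp add: norm_mult)
  qed (simp add: G0)
  have int: "integrable lborel (\<lambda>z. exp (- (\<i> * k * complex_of_real z)) * complex_of_real (G z))" if "Im k < 0" for k
    by (rule Bochner_Integration.integrable_bound[OF integrable_abs[OF G]]) (use nle[OF that] in auto)
  show ?thesis
  proof (rule bounded_holomorphicI[of _ "LBINT z. \<bar>G z\<bar>"])
    show "norm (laplace F k) \<le> (LBINT z. \<bar>G z\<bar>)" if "Im k < 0" for k
      unfolding L by (rule Bochner_Integration.integral_norm_bound_integral[OF int[OF that] integrable_abs[OF G] nle[OF that]])
    have "laplace F field_differentiable at k0" if k0: "Im k0 < 0" for k0
    proof -
      \<comment> \<open>Half the distance to the axis: within \<open>\<eta>\<close> of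
        \<open>k0\<close> one stays below \<open>- \<eta>\<close>, so the factor \<open>z\<close>
        from differentiation is absorbed by
        \<open>z * exp (- (z * \<eta>)) \<le> 1 / \<eta>\<close>.\<close>
      define \<eta> where "\<eta> = - Im k0 / 2"
      have \<eta>: "0 < \<eta>" using k0 by (simp add: \<eta>_def)
      have near: "Im k \<le> - \<eta>" if "dist k k0 < \<eta>" for k
        using abs_Im_le_cmod[of "k - k0"] that unfolding dist_norm \<eta>_def by simp
      have "((\<lambda>k. LBINT z. exp (- (\<i> * k * complex_of_real z)) * complex_of_real (G z)) has_field_derivative
          (LBINT z. - (\<i> * complex_of_real z) * exp (- (\<i> * k0 * complex_of_real z)) * complex_of_real (G z))) (at k0)"
      proof (rule has_field_derivative_lebesgue_integral[OF \<eta>, where w = "\<lambda>z. 1 / \<eta> * \<bar>G z\<bar>"])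
        show "norm (- (\<i> * complex_of_real z) * exp (- (\<i> * k * complex_of_real z)) * complex_of_real (G z)) \<le> 1 / \<eta> * \<bar>G z\<bar>"
          if k: "dist k k0 < \<eta>" for k z
        proof (cases "0 < z")
          case True
          have "z * Im k \<le> - (z * \<eta>)" using mult_left_mono[OF near[OF k], of z] True by simp
          then have "z * exp (z * Im k) \<le> z * exp (- (z * \<eta>))" using True by simp
          also have "\<dots> \<le> 1 / \<eta>"
          proof -
            have "z * \<eta> \<le> exp (z * \<eta>)" using exp_ge_add_one_self[of "z * \<eta>"] by linarith
            then show ?thesis using \<eta> by (simp add: exp_minus field_simps)
          qed
          finally have "z * exp (z * Im k) * \<bar>G z\<bar> \<le> 1 / \<eta> * \<bar>G z\<bar>" by (intro mult_right_mono) auto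
          then show ?thesis using True by (simp add: norm_mult norm_exp_minus_i del: norm_exp_eq_Re)
        qed (simp add: G0)
        show "((\<lambda>k. exp (- (\<i> * k * complex_of_real z)) * complex_of_real (G z)) has_field_derivative
           - (\<i> * complex_of_real z) * exp (- (\<i> * k * complex_of_real z)) * complex_of_real (G z)) (at k)" for k z
          by (auto intro!: derivative_eq_intros)
        show "integrable lborel (\<lambda>z. exp (- (\<i> * k * complex_of_real z)) * complex_of_real (G z))" if "dist k k0 < \<eta>" for k
          using near[OF that] \<eta> by (intro int) simp
      qed (use G in auto)
      then show ?thesis unfolding L[abs_def] field_differentiable_def by blast
    qed
    then show "laplace F holomorphic_on {k. Im k < 0}"
      by (simp add: holomorphic_on_open convex_half_planes(2) field_differentiable_def)
  qed
qed

section \<open>Continuity, decay and symmetrization of the heat flow\<close>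

context bounded_measurable
begin

lemma isCont_heat_flow:
  assumes t: "0 < t"
  shows "isCont (\<lambda>(z, t). heat_flow f t z) (z, t)"
proof -
  obtain w where w: "integrable lborel w"
    "\<And>z' s y. \<bar>z' - z\<bar> \<le> 1 \<Longrightarrow> \<bar>s - t\<bar> \<le> t / 2 \<Longrightarrow> (1 + (z' - y)\<^sup>2) * heat_kernel s (z' - y) \<le> w y"
    using heat_kernel_dominated[OF t] by metis
  define U where "U = ball z 1 \<times> ball t (t / 2)"
  have U: "open U" "(z, t) \<in> U" using t by (auto simp: U_def open_Times)
  then have near: "\<forall>\<^sub>F p in at (z, t). p \<in> U" by (rule eventually_at_in_open')
  have "((\<lambda>p. LBINT y. heat_kernel (snd p) (fst p - y) * f y) \<longlongrightarrow> (LBINT y. heat_kernel t (z - y) * f y)) (at (z, t))"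
  proof (rule tendsto_integral_dominated[where w = "\<lambda>y. w y * C"])
    show "\<forall>\<^sub>F p in at (z, t). \<forall>y\<in>space lborel. norm (heat_kernel (snd p) (fst p - y) * f y) \<le> w y * C"
      using near
    proof eventually_elim
      case (elim p)
      then have "\<bar>z - fst p\<bar> < 1" "\<bar>t - snd p\<bar> < t / 2" by (auto simp: U_def dist_real_def mem_Times_iff)
      then have p: "\<bar>fst p - z\<bar> \<le> 1" "\<bar>snd p - t\<bar> \<le> t / 2" "0 < snd p" by linarith+
      show ?case
      proof
        fix y
        have "\<bar>heat_kernel (snd p) (fst p - y)\<bar> \<le> (1 + (fst p - y)\<^sup>2) * heat_kernel (snd p) (fst p - y)"
          using heat_kernel_nonneg[OF p(3), of "fst p - y"] by (simp add: algebra_simps)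
        also have "\<dots> \<le> w y" by (rule w(2)[OF p(1,2)])
        finally show "norm (heat_kernel (snd p) (fst p - y) * f y) \<le> w y * C"
          unfolding real_norm_def abs_mult using bound[of y] by (intro mult_mono) auto
      qed
    qed
    show "AE y in lborel. ((\<lambda>p. heat_kernel (snd p) (fst p - y) * f y) \<longlongrightarrow> heat_kernel t (z - y) * f y) (at (z, t))"
      unfolding heat_kernel_def using t by (intro AE_I2) (auto intro!: tendsto_eq_intros)
  qed (use w in auto)
  moreover have "\<forall>\<^sub>F p in at (z, t). (LBINT y. heat_kernel (snd p) (fst p - y) * f y) = (case p of (z, t) \<Rightarrow> heat_flow f t z)"
    using near
  proof eventually_elim
    case (elim p)
    then have "\<bar>t - snd p\<bar> < t / 2" by (auto simp: U_def dist_real_def mem_Times_iff)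
    then have "0 < snd p" by linarith
    then show ?case by (simp add: case_prod_beta heat_flow_kernel)
  qed
  ultimately show ?thesis
    unfolding isCont_def by (simp add: Lim_transform_eventually heat_flow_kernel[OF t])
qed

text \<open>The neighbourhood contains negative times. They do no harm: \<open>sqrt\<close> is odd
  and continuous on the whole line, so the arguments of \<open>f\<close> still converge to
  \<open>z\<close>.\<close>

lemma isCont_heat_flow_0:
  assumes "isCont f z"
  shows "isCont (\<lambda>(z, t). heat_flow f t z) (z, 0)"
proof -
  have "((\<lambda>p. heat_flow f (snd p) (fst p)) \<longlongrightarrow> f z) (at (z, 0))"
  proof (rule heat_flow_tendsto)
    show "((\<lambda>p. f (fst p + sqrt (2 * snd p) * y)) \<longlongrightarrow> f z) (at (z, 0))" for y
      by (rule isCont_tendsto_compose[OF assms]) (auto intro!: tendsto_eq_intros)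
  qed (auto intro!: tendsto_eq_intros)
  then show ?thesis by (simp add: isCont_def case_prod_unfold heat_flow_0)
qed

lemma heat_flow_tendsto_at_top:
  fixes zz :: "real \<Rightarrow> real"
  assumes "\<And>c. ((\<lambda>x. f (zz x + c)) \<longlongrightarrow> 0) at_top"
  shows "((\<lambda>x. heat_flow f t (zz x)) \<longlongrightarrow> 0) at_top"
proof -
  have "((\<lambda>x. LBINT y. std_normal_density y * f (zz x + sqrt (2 * t) * y)) \<longlongrightarrow> (LBINT y::real. 0)) at_top"
  proof (rule integral_dominated_convergence_at_top[where w = "\<lambda>y. std_normal_density y * C"])
    show "\<forall>\<^sub>F x in at_top. AE y in lborel. norm (std_normal_density y * f (zz x + sqrt (2 * t) * y)) \<le> std_normal_density y * C"
      by (auto simp: abs_mult intro!: always_eventually mult_left_mono bound)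
    show "AE y in lborel. ((\<lambda>x. std_normal_density y * f (zz x + sqrt (2 * t) * y)) \<longlongrightarrow> 0) at_top"
      by (intro AE_I2 tendsto_mult_right_zero assms)
  qed auto
  then show ?thesis by (simp add: heat_flow_def)
qed

text \<open>The normal density is even, so the flow at \<open>z\<close> feels only the even part of
  \<open>f\<close> about \<open>z\<close>; likewise the derivative of the kernel is odd and the
  gradient feels only the odd part. Interface conditions thereby become parity conditions on the
  extended data.\<close>

lemma heat_flow_symmetrized:
  "2 * heat_flow f t z = (LBINT y. std_normal_density y * (f (z + sqrt (2 * t) * y) + f (z - sqrt (2 * t) * y)))"
proof -
  let ?g = "\<lambda>y. std_normal_density y * f (z + sqrt (2 * t) * y)"
  have i: "integrable lborel ?g"
    by (rule Bochner_Integration.integrable_bound[where f = "\<lambda>y. std_normal_density y * C"])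
       (auto simp: abs_mult intro!: mult_left_mono order_trans[OF bound])
  have r: "?g (0 + - 1 * y) = std_normal_density y * f (z - sqrt (2 * t) * y)" for y
    by (simp add: std_normal_density_def)
  have "integrable lborel (\<lambda>y. ?g (0 + - 1 * y))" "(LBINT y. ?g y) = (LBINT y. ?g (0 + - 1 * y))"
    using lborel_integrable_real_affine[OF i, of "- 1" 0] lborel_integral_real_affine[of "- 1" ?g 0] by simp_all
  then show ?thesis using i unfolding heat_flow_def r by (simp add: algebra_simps)
qed

lemma heat_flow_x_symmetrized:
  assumes t: "0 < t"
  shows "2 * heat_flow_x t z = (LBINT y. heat_kernel_x t y * (f (z - y) - f (z + y)))"
proof -
  let ?g = "\<lambda>y. heat_kernel_x t (z - y) * f y"
  have i: "integrable lborel ?g" by (rule integrable_kernel[OF t])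
  have r1: "?g (z + - 1 * y) = heat_kernel_x t y * f (z - y)" for y by simp
  have r2: "?g (z + 1 * y) = - (heat_kernel_x t y * f (z + y))" for y by simp
  have 1: "integrable lborel (\<lambda>y. ?g (z + - 1 * y))" "(LBINT y. ?g y) = (LBINT y. ?g (z + - 1 * y))"
    using lborel_integrable_real_affine[OF i, of "- 1" z] lborel_integral_real_affine[of "- 1" ?g z] by simp_all
  have 2: "integrable lborel (\<lambda>y. ?g (z + 1 * y))" "(LBINT y. ?g y) = (LBINT y. ?g (z + 1 * y))"
    using lborel_integrable_real_affine[OF i, of "1" z] lborel_integral_real_affine[of "1" ?g z] by simp_all
  have "2 * heat_flow_x t z = (LBINT y. ?g (z + - 1 * y)) + (LBINT y. ?g (z + 1 * y))"
    using 1(2) 2(2) unfolding heat_flow_x_def by linarith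
  also have "\<dots> = (LBINT y. ?g (z + - 1 * y) + ?g (z + 1 * y))"
    by (rule Bochner_Integration.integral_add[symmetric, OF 1(1) 2(1)])
  finally show ?thesis unfolding r1 r2 by (simp add: algebra_simps)
qed

lemma heat_equation_heat_flow:
  assumes \<sigma>: "0 < \<sigma>"
  shows "heat_equation \<sigma> I (\<lambda>x t. heat_flow f t ((x - x0) / \<sigma>))"
  unfolding heat_equation_def
proof (intro exI[of _ "\<lambda>x t. heat_flow_x t ((x - x0) / \<sigma>) / \<sigma>"] ballI allI impI conjI)
  fix x t :: real assume t: "0 < t"
  have d: "((\<lambda>y. (y - x0) / \<sigma>) has_real_derivative 1 / \<sigma>) (at x)"
    using \<sigma> by (auto intro!: derivative_eq_intros)
  show "((\<lambda>y. heat_flow f t ((y - x0) / \<sigma>)) has_real_derivative heat_flow_x t ((x - x0) / \<sigma>) / \<sigma>) (at x)"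
    using DERIV_chain2[OF DERIV_heat_flow[OF t] d] by simp
  show "\<exists>uxx. ((\<lambda>y. heat_flow_x t ((y - x0) / \<sigma>) / \<sigma>) has_real_derivative uxx) (at x) \<and>
      ((\<lambda>\<tau>. heat_flow f \<tau> ((x - x0) / \<sigma>)) has_real_derivative \<sigma>\<^sup>2 * uxx) (at t)"
  proof (intro exI conjI)
    show "((\<lambda>y. heat_flow_x t ((y - x0) / \<sigma>) / \<sigma>) has_real_derivative heat_flow_xx t ((x - x0) / \<sigma>) / \<sigma>\<^sup>2) (at x)"
      using DERIV_cdivide[OF DERIV_chain2[OF DERIV_heat_flow_x[OF t] d], of \<sigma>] by (simp add: power2_eq_square)
    show "((\<lambda>\<tau>. heat_flow f \<tau> ((x - x0) / \<sigma>)) has_real_derivative \<sigma>\<^sup>2 * (heat_flow_xx t ((x - x0) / \<sigma>) / \<sigma>\<^sup>2)) (at t)"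
      using DERIV_heat_flow_time[OF t] \<sigma> by simp
  qed
qed

lemma regular_heat_flow:
  assumes \<sigma>: "0 < \<sigma>" and cont: "\<And>x. x \<in> I - E \<Longrightarrow> isCont f ((x - x0) / \<sigma>)"
  shows "regular_up_to_boundary I E (\<lambda>x t. heat_flow f t ((x - x0) / \<sigma>))"
  unfolding regular_up_to_boundary_def
proof (intro conjI allI impI)
  show "continuous_on (I \<times> {0..} - E \<times> {0}) (\<lambda>(x, t). heat_flow f t ((x - x0) / \<sigma>))"
  proof (rule continuous_at_imp_continuous_on, rule ballI)
    fix p :: "real \<times> real" assume "p \<in> I \<times> {0..} - E \<times> {0}"
    then obtain x t where p: "p = (x, t)" "x \<in> I" "0 \<le> t" "x \<in> E \<Longrightarrow> t \<noteq> 0" by auto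
    have "isCont (\<lambda>(z, t). heat_flow f t z) ((x - x0) / \<sigma>, t)"
      using isCont_heat_flow[of t "(x - x0) / \<sigma>"] isCont_heat_flow_0[OF cont, of x] p by (cases "t = 0") auto
    moreover have "isCont (\<lambda>p. ((fst p - x0) / \<sigma>, snd p)) p"
      using \<sigma> by (intro continuous_intros) auto
    ultimately have "isCont (\<lambda>p. (\<lambda>(z, t). heat_flow f t z) ((fst p - x0) / \<sigma>, snd p)) p"
      using isCont_o2[where g = "\<lambda>(z, t). heat_flow f t z" and f = "\<lambda>p. ((fst p - x0) / \<sigma>, snd p)" and a = p] p(1)
      by simp
    then show "isCont (\<lambda>(x, t). heat_flow f t ((x - x0) / \<sigma>)) p" by (simp add: case_prod_unfold)
  qed
  show "\<exists>K. \<forall>x\<in>I. \<forall>t\<in>{0..T}. \<bar>heat_flow f t ((x - x0) / \<sigma>)\<bar> \<le> K" for T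
    using heat_flow_le by blast
qed

end

text \<open>Only \<open>y > 0\<close> is asked for, since the data may jump at the interface:
  negative \<open>y\<close> follow by symmetry, and for \<open>t > 0\<close> the point
  \<open>y = 0\<close> is a null set.\<close>

lemma heat_flow_eq_if_even_parts_eq:
  assumes "bounded_measurable f C" "bounded_measurable g D"
    and eq: "\<And>y. 0 < y \<Longrightarrow> f (z + y) + f (z - y) = g (z' + y) + g (z' - y)" and t: "0 < t"
  shows "heat_flow f t z = heat_flow g t z'"
proof -
  have "(LBINT y. std_normal_density y * (f (z + sqrt (2 * t) * y) + f (z - sqrt (2 * t) * y)))
     = (LBINT y. std_normal_density y * (g (z' + sqrt (2 * t) * y) + g (z' - sqrt (2 * t) * y)))"
  proof (rule integral_cong_AE)
    interpret F: bounded_measurable f C by fact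
    interpret G: bounded_measurable g D by fact
    show "AE y in lborel. std_normal_density y * (f (z + sqrt (2 * t) * y) + f (z - sqrt (2 * t) * y))
        = std_normal_density y * (g (z' + sqrt (2 * t) * y) + g (z' - sqrt (2 * t) * y))"
      using AE_lborel_singleton[of 0]
    proof eventually_elim
      case (elim y)
      then show ?case
        using eq[of "sqrt (2 * t) * y"] eq[of "- (sqrt (2 * t) * y)"] t
        by (cases "0 < y") (auto simp: zero_less_mult_iff mult_less_0_iff add.commute)
    qed
  qed (use assms in \<open>auto simp: bounded_measurable_def\<close>)
  then show ?thesis
    using bounded_measurable.heat_flow_symmetrized[OF assms(1), of t z]
      bounded_measurable.heat_flow_symmetrized[OF assms(2), of t z'] by simp
qed

lemma heat_flow_x_eq_if_odd_parts_eq: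
  assumes "bounded_measurable f C" "bounded_measurable g D"
    and eq: "\<And>y. 0 < y \<Longrightarrow> p * (f (z - y) - f (z + y)) = q * (g (z' - y) - g (z' + y))" and t: "0 < t"
  shows "p * bounded_measurable.heat_flow_x f t z = q * bounded_measurable.heat_flow_x g t z'"
proof -
  interpret F: bounded_measurable f C by fact
  interpret G: bounded_measurable g D by fact
  have "p * (f (z - y) - f (z + y)) = q * (g (z' - y) - g (z' + y))" for y
    using eq[of y] eq[of "- y"] by (cases y "0 :: real" rule: linorder_cases) (auto simp: algebra_simps)
  then have "p * (heat_kernel_x t y * (f (z - y) - f (z + y))) = q * (heat_kernel_x t y * (g (z' - y) - g (z' + y)))" for y
    unfolding mult.left_commute[of p "heat_kernel_x t y"] mult.left_commute[of q "heat_kernel_x t y"] by (rule arg_cong)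
  then have "(LBINT y. p * (heat_kernel_x t y * (f (z - y) - f (z + y)))) =
      (LBINT y. q * (heat_kernel_x t y * (g (z' - y) - g (z' + y))))" by (rule Bochner_Integration.integral_cong[OF refl])
  then have "p * (2 * F.heat_flow_x t z) = q * (2 * G.heat_flow_x t z')"
    unfolding F.heat_flow_x_symmetrized[OF t] G.heat_flow_x_symmetrized[OF t] by simp
  then show ?thesis by simp
qed

section \<open>The three-layer problem\<close>

lemma bounded_if_continuous_tendsto_at_top:
  fixes u :: "real \<Rightarrow> real"
  assumes c: "continuous_on {a..} u" and l: "(u \<longlongrightarrow> 0) at_top"
  obtains C where "\<And>x. a \<le> x \<Longrightarrow> \<bar>u x\<bar> \<le> C"
proof -
  have "\<forall>\<^sub>F x in at_top. dist (u x) 0 < 1" using l by (rule tendstoD) simp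
  then obtain N where N: "\<And>x. N \<le> x \<Longrightarrow> \<bar>u x\<bar> < 1" by (auto simp: eventually_at_top_linorder)
  have "bounded (u ` {a..max a N})"
    by (intro compact_imp_bounded compact_continuous_image continuous_on_subset[OF c]) auto
  then obtain K where K: "\<forall>x\<in>{a..max a N}. \<bar>u x\<bar> \<le> K" by (auto simp: bounded_iff)
  show thesis
  proof (rule that[of "max K 1"])
    fix x assume "a \<le> x"
    then show "\<bar>u x\<bar> \<le> max K 1" using N[of x] K by (cases "N \<le> x") (auto simp: le_max_iff_disj)
  qed
qed

lemma filterlim_affine_at_top: "0 < c \<Longrightarrow> filterlim (\<lambda>x::real. d + c * x) at_top at_top"
  by (intro filterlim_tendsto_add_at_top[OF tendsto_const] filterlim_tendsto_pos_mult_at_top[OF tendsto_const] filterlim_ident)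

lemma filterlim_affine_at_bot: "0 < c \<Longrightarrow> filterlim (\<lambda>x::real. d - c * x) at_bot at_top"
  using filterlim_affine_at_top[of c "- d"] by (simp add: filterlim_uminus_at_bot algebra_simps)

locale three_layers =
  fixes a \<sigma>\<^sub>L \<sigma>\<^sub>M \<sigma>\<^sub>R :: real and u\<^sub>L u\<^sub>M u\<^sub>R :: "real \<Rightarrow> real"
  assumes pos: "0 < a" "0 < \<sigma>\<^sub>L" "0 < \<sigma>\<^sub>M" "0 < \<sigma>\<^sub>R"
    and data_L: "continuous_on {..- a} u\<^sub>L" "set_integrable lborel {..- a} u\<^sub>L" "(u\<^sub>L \<longlongrightarrow> 0) at_bot"
    and data_M: "continuous_on {- a..a} u\<^sub>M"
    and data_R: "continuous_on {a..} u\<^sub>R" "set_integrable lborel {a..} u\<^sub>R" "(u\<^sub>R \<longlongrightarrow> 0) at_top"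
begin

text \<open>Lengths are measured by travel time at speed \<open>\<sigma>\<^sub>L\<close>, \<open>\<sigma>\<^sub>M\<close>, \<open>\<sigma>\<^sub>R\<close>, which makes all three
  diffusivities 1. The interfaces sit at 0 in the outer layers and at \<open>\<plusminus>b\<close> in the middle;
  \<open>\<rho>\<^sub>L\<close> and \<open>\<rho>\<^sub>R\<close> are the reflection coefficients seen from the middle.\<close>

definition b :: real where "b = a / \<sigma>\<^sub>M"
definition \<rho>\<^sub>L :: real where "\<rho>\<^sub>L = (\<sigma>\<^sub>M - \<sigma>\<^sub>L) / (\<sigma>\<^sub>M + \<sigma>\<^sub>L)"
definition \<rho>\<^sub>R :: real where "\<rho>\<^sub>R = (\<sigma>\<^sub>M - \<sigma>\<^sub>R) / (\<sigma>\<^sub>M + \<sigma>\<^sub>R)"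

definition d\<^sub>L :: "real \<Rightarrow> real" where "d\<^sub>L z = (if z \<le> 0 then u\<^sub>L (- a + \<sigma>\<^sub>L * z) else 0)"
definition d\<^sub>M :: "real \<Rightarrow> real" where "d\<^sub>M z = (if \<bar>z\<bar> \<le> b then u\<^sub>M (\<sigma>\<^sub>M * z) else 0)"
definition d\<^sub>R :: "real \<Rightarrow> real" where "d\<^sub>R z = (if 0 \<le> z then u\<^sub>R (a + \<sigma>\<^sub>R * z) else 0)"

lemma b_pos: "0 < b" using pos by (simp add: b_def)

lemma \<rho>_less_1: "\<bar>\<rho>\<^sub>L\<bar> < 1" "\<bar>\<rho>\<^sub>R\<bar> < 1"
  using pos by (auto simp: \<rho>\<^sub>L_def \<rho>\<^sub>R_def abs_if divide_simps)

text \<open>Extensions of the data past the interfaces: the left and right moving halves of the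
  extended data are scattered at each interface, as d'Alembert's formula would have it for the
  wave equation with the same interface conditions.\<close>

primrec reflections :: "nat \<Rightarrow> real \<Rightarrow> real" where
  "reflections 0 z = d\<^sub>M z"
| "reflections (Suc n) z =
     (if \<bar>z\<bar> \<le> b then d\<^sub>M z
      else if b < z then \<rho>\<^sub>R * reflections n (2 * b - z) + (1 - \<rho>\<^sub>R) * d\<^sub>R (z - b)
      else \<rho>\<^sub>L * reflections n (- 2 * b - z) + (1 - \<rho>\<^sub>L) * d\<^sub>L (z + b))"

definition f\<^sub>M :: "real \<Rightarrow> real" where "f\<^sub>M z = lim (\<lambda>n. reflections n z)"

text \<open>Seen from the middle a wave reaching the left interface is transmitted with amplitude
  \<open>1 + \<rho>\<^sub>L\<close>; seen from the left it is reflected with amplitude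
  \<open>- \<rho>\<^sub>L\<close>. The same holds on the right.\<close>

definition f\<^sub>L :: "real \<Rightarrow> real" where
  "f\<^sub>L z = (if z \<le> 0 then d\<^sub>L z else (1 + \<rho>\<^sub>L) * f\<^sub>M (z - b) - \<rho>\<^sub>L * d\<^sub>L (- z))"

definition f\<^sub>R :: "real \<Rightarrow> real" where
  "f\<^sub>R z = (if 0 \<le> z then d\<^sub>R z else (1 + \<rho>\<^sub>R) * f\<^sub>M (b + z) - \<rho>\<^sub>R * d\<^sub>R (- z))"

text \<open>The mirror images \<open>2 * b - z\<close> and \<open>- 2 * b - z\<close> of an outer
  point lie closer to the middle by at least one layer width or fall into the range already settled,
  so each round of the recursion extends the final values by \<open>2 * b\<close> on either side.
  Hence \<open>f\<^sub>M\<close> is the limit of an eventually constant sequence.\<close>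

lemma reflections_stable:
  "\<bar>z\<bar> \<le> (2 * real n + 1) * b \<Longrightarrow> n \<le> m \<Longrightarrow> reflections m z = reflections n z"
proof (induction n arbitrary: z m)
  case 0
  then show ?case by (cases m) auto
next
  case (Suc n)
  then obtain m' where m: "m = Suc m'" "n \<le> m'" by (cases m) auto
  have z: "\<bar>z\<bar> \<le> (2 * real n + 1) * b + 2 * b" using Suc.prems(1) by (simp add: algebra_simps)
  have nb: "0 \<le> real n * b" "(2 * real n + 1) * b = 2 * (real n * b) + b" using b_pos by (auto simp: algebra_simps)
  have "reflections m' (2 * b - z) = reflections n (2 * b - z)" if "b < z"
    using z that b_pos nb by (intro Suc.IH m(2)) linarith
  moreover have "reflections m' (- 2 * b - z) = reflections n (- 2 * b - z)" if "z < - b"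
    using z that b_pos nb by (intro Suc.IH m(2)) linarith
  ultimately show ?case by (auto simp: m(1))
qed

lemma reflections_tendsto: "(\<lambda>n. reflections n z) \<longlonglongrightarrow> f\<^sub>M z"
proof -
  obtain n where "\<bar>z\<bar> / b \<le> real n" using real_arch_simple by blast
  then have "\<bar>z\<bar> \<le> real n * b" using b_pos by (simp add: field_simps)
  also have "\<dots> \<le> (2 * real n + 1) * b" using b_pos by (intro mult_right_mono) auto
  finally have "\<forall>m\<ge>n. reflections m z = reflections n z" using reflections_stable by blast
  then have "(\<lambda>m. reflections m z) \<longlonglongrightarrow> reflections n z"
    by (intro tendsto_eventually eventually_sequentiallyI[of n]) blast
  then have "convergent (\<lambda>n. reflections n z)" by (rule convergentI)
  then show ?thesis by (simp add: f\<^sub>M_def convergent_LIMSEQ_iff)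
qed

lemma f\<^sub>M_middle: "\<bar>z\<bar> \<le> b \<Longrightarrow> f\<^sub>M z = d\<^sub>M z"
  using LIMSEQ_unique[OF LIMSEQ_Suc[OF reflections_tendsto[of z]], of "d\<^sub>M z"] by simp

lemma f\<^sub>M_right: "b < z \<Longrightarrow> f\<^sub>M z = \<rho>\<^sub>R * f\<^sub>M (2 * b - z) + (1 - \<rho>\<^sub>R) * d\<^sub>R (z - b)"
proof (rule LIMSEQ_unique[OF LIMSEQ_Suc[OF reflections_tendsto[of z]]])
  assume z: "b < z"
  have "(\<lambda>n. \<rho>\<^sub>R * reflections n (2 * b - z) + (1 - \<rho>\<^sub>R) * d\<^sub>R (z - b))
     \<longlonglongrightarrow> \<rho>\<^sub>R * f\<^sub>M (2 * b - z) + (1 - \<rho>\<^sub>R) * d\<^sub>R (z - b)"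
    by (intro tendsto_intros reflections_tendsto)
  then show "(\<lambda>n. reflections (Suc n) z) \<longlonglongrightarrow> \<rho>\<^sub>R * f\<^sub>M (2 * b - z) + (1 - \<rho>\<^sub>R) * d\<^sub>R (z - b)"
    using z b_pos by simp
qed

lemma f\<^sub>M_left: "z < - b \<Longrightarrow> f\<^sub>M z = \<rho>\<^sub>L * f\<^sub>M (- 2 * b - z) + (1 - \<rho>\<^sub>L) * d\<^sub>L (z + b)"
proof (rule LIMSEQ_unique[OF LIMSEQ_Suc[OF reflections_tendsto[of z]]])
  assume z: "z < - b"
  have "(\<lambda>n. \<rho>\<^sub>L * reflections n (- 2 * b - z) + (1 - \<rho>\<^sub>L) * d\<^sub>L (z + b))
     \<longlonglongrightarrow> \<rho>\<^sub>L * f\<^sub>M (- 2 * b - z) + (1 - \<rho>\<^sub>L) * d\<^sub>L (z + b)"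
    by (intro tendsto_intros reflections_tendsto)
  then show "(\<lambda>n. reflections (Suc n) z) \<longlonglongrightarrow> \<rho>\<^sub>L * f\<^sub>M (- 2 * b - z) + (1 - \<rho>\<^sub>L) * d\<^sub>L (z + b)"
    using z b_pos by simp
qed

lemma data_measurable [measurable]:
  "d\<^sub>L \<in> borel_measurable borel" "d\<^sub>M \<in> borel_measurable borel" "d\<^sub>R \<in> borel_measurable borel"
proof -
  have mid: "\<bar>z\<bar> \<le> b \<Longrightarrow> \<bar>\<sigma>\<^sub>M * z\<bar> \<le> a" for z
    using pos mult_left_mono[of "\<bar>z\<bar>" b \<sigma>\<^sub>M] by (simp add: b_def abs_mult)
  have "(\<lambda>z. indicator {..0} z *\<^sub>R u\<^sub>L (- a + \<sigma>\<^sub>L * z)) \<in> borel_measurable borel"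
    using pos by (intro borel_measurable_continuous_on_indicator continuous_on_compose2[OF data_L(1)] continuous_intros)
      (auto simp: mult_nonneg_nonpos)
  moreover have "(\<lambda>z. indicator {-b..b} z *\<^sub>R u\<^sub>M (\<sigma>\<^sub>M * z)) \<in> borel_measurable borel"
    using mid by (intro borel_measurable_continuous_on_indicator continuous_on_compose2[OF data_M] continuous_intros)
      (force simp: abs_le_iff)+
  moreover have "(\<lambda>z. indicator {0..} z *\<^sub>R u\<^sub>R (a + \<sigma>\<^sub>R * z)) \<in> borel_measurable borel"
    using pos by (intro borel_measurable_continuous_on_indicator continuous_on_compose2[OF data_R(1)] continuous_intros) auto
  moreover have "d\<^sub>L = (\<lambda>z. indicator {..0} z *\<^sub>R u\<^sub>L (- a + \<sigma>\<^sub>L * z))"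
    "d\<^sub>M = (\<lambda>z. indicator {-b..b} z *\<^sub>R u\<^sub>M (\<sigma>\<^sub>M * z))"
    "d\<^sub>R = (\<lambda>z. indicator {0..} z *\<^sub>R u\<^sub>R (a + \<sigma>\<^sub>R * z))"
    by (auto simp: d\<^sub>L_def d\<^sub>M_def d\<^sub>R_def indicator_def fun_eq_iff abs_le_iff)
  ultimately show "d\<^sub>L \<in> borel_measurable borel" "d\<^sub>M \<in> borel_measurable borel" "d\<^sub>R \<in> borel_measurable borel"
    by simp_all
qed

lemma data_bounded: "\<exists>D. 0 \<le> D \<and> (\<forall>z. \<bar>d\<^sub>L z\<bar> \<le> D) \<and> (\<forall>z. \<bar>d\<^sub>M z\<bar> \<le> D) \<and> (\<forall>z. \<bar>d\<^sub>R z\<bar> \<le> D)"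
proof -
  obtain R where R: "\<And>x. a \<le> x \<Longrightarrow> \<bar>u\<^sub>R x\<bar> \<le> R"
    by (rule bounded_if_continuous_tendsto_at_top[OF data_R(1,3)]) (rule that)
  have "continuous_on {a..} (\<lambda>x. u\<^sub>L (- x))"
    by (intro continuous_on_compose2[OF data_L(1)] continuous_intros) auto
  moreover have "((\<lambda>x. u\<^sub>L (- x)) \<longlongrightarrow> 0) at_top" using data_L(3) by (simp add: filterlim_at_bot_mirror)
  ultimately obtain L where L: "\<And>x. a \<le> x \<Longrightarrow> \<bar>u\<^sub>L (- x)\<bar> \<le> L"
    by (rule bounded_if_continuous_tendsto_at_top) (rule that)
  have "bounded (u\<^sub>M ` {-a..a})" by (intro compact_imp_bounded compact_continuous_image data_M) auto
  then obtain M where M: "\<forall>x\<in>{-a..a}. \<bar>u\<^sub>M x\<bar> \<le> M" by (auto simp: bounded_iff)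
  have "\<bar>d\<^sub>L z\<bar> \<le> max 0 L" for z
    using L[of "a - \<sigma>\<^sub>L * z"] pos by (auto simp: d\<^sub>L_def mult_nonneg_nonpos le_max_iff_disj)
  moreover have "\<bar>d\<^sub>R z\<bar> \<le> max 0 R" for z
    using R[of "a + \<sigma>\<^sub>R * z"] pos by (auto simp: d\<^sub>R_def le_max_iff_disj)
  moreover have "\<bar>d\<^sub>M z\<bar> \<le> max 0 M" for z
  proof (cases "\<bar>z\<bar> \<le> b")
    case True
    then have "\<bar>\<sigma>\<^sub>M * z\<bar> \<le> a" using pos mult_left_mono[of "\<bar>z\<bar>" b \<sigma>\<^sub>M] by (simp add: b_def abs_mult)
    then show ?thesis using M True by (auto simp: d\<^sub>M_def abs_le_iff le_max_iff_disj)
  qed (simp add: d\<^sub>M_def)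
  moreover have "max 0 L \<le> max (max 0 L) (max (max 0 M) (max 0 R))" "max 0 M \<le> max (max 0 L) (max (max 0 M) (max 0 R))"
    "max 0 R \<le> max (max 0 L) (max (max 0 M) (max 0 R))" "0 \<le> max (max 0 L) (max (max 0 M) (max 0 R))" by auto
  ultimately show ?thesis
    by (intro exI[of _ "max (max 0 L) (max (max 0 M) (max 0 R))"]) (blast intro: order_trans)
qed

lemma reflections_measurable: "reflections n \<in> borel_measurable borel"
proof (induction n)
  case 0
  have "reflections 0 = d\<^sub>M" by (simp add: fun_eq_iff)
  then show ?case by simp
next
  case (Suc n)
  note [measurable] = Suc
  have "reflections (Suc n) = (\<lambda>z. if \<bar>z\<bar> \<le> b then d\<^sub>M z
      else if b < z then \<rho>\<^sub>R * reflections n (2 * b - z) + (1 - \<rho>\<^sub>R) * d\<^sub>R (z - b)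
      else \<rho>\<^sub>L * reflections n (- 2 * b - z) + (1 - \<rho>\<^sub>L) * d\<^sub>L (z + b))"
    by (simp add: fun_eq_iff)
  also have "\<dots> \<in> borel_measurable borel" by measurable
  finally show ?case .
qed

lemma extension_bounded: "\<exists>C. bounded_measurable f\<^sub>L C \<and> bounded_measurable f\<^sub>M C \<and> bounded_measurable f\<^sub>R C"
proof -
  obtain D where D: "0 \<le> D" "\<And>z. \<bar>d\<^sub>L z\<bar> \<le> D" "\<And>z. \<bar>d\<^sub>M z\<bar> \<le> D" "\<And>z. \<bar>d\<^sub>R z\<bar> \<le> D"
    using data_bounded by auto
  define \<rho> where "\<rho> = max \<bar>\<rho>\<^sub>L\<bar> \<bar>\<rho>\<^sub>R\<bar>"
  have \<rho>: "\<bar>\<rho>\<^sub>L\<bar> \<le> \<rho>" "\<bar>\<rho>\<^sub>R\<bar> \<le> \<rho>" "\<rho> < 1" "0 \<le> \<rho>" using \<rho>_less_1 by (auto simp: \<rho>_def)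
  \<comment> \<open>The fixed point of \<open>K \<mapsto> \<rho> * K + 2 * D\<close>, the effect on
    the bound of one scattering; \<open>2 * D\<close> stands for transmitted outer data, whose
    amplitude \<open>1 - r\<close> is at most 2.\<close>
  define K where "K = 2 * D / (1 - \<rho>)"
  have K: "\<rho> * K + 2 * D = K" using \<rho> by (simp add: K_def field_simps)
  have K0: "0 \<le> K" using \<rho> D(1) by (simp add: K_def)
  have DK: "D \<le> K"
    using K mult_nonneg_nonneg[OF \<rho>(4) K0] D(1) by linarith
  have scatter: "\<bar>r * x + (1 - r) * y\<bar> \<le> K" if "\<bar>r\<bar> \<le> \<rho>" "\<bar>x\<bar> \<le> K" "\<bar>y\<bar> \<le> D" for r x y
  proof -
    have "\<bar>r * x\<bar> \<le> \<rho> * K" unfolding abs_mult using that K0 \<rho> by (intro mult_mono) auto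
    moreover have "\<bar>(1 - r) * y\<bar> \<le> 2 * D"
      unfolding abs_mult using that \<rho> by (intro mult_mono) auto
    ultimately show ?thesis using K by linarith
  qed
  have scatter': "\<bar>(1 + r) * x - r * y\<bar> \<le> 3 * K" if "\<bar>r\<bar> \<le> \<rho>" "\<bar>x\<bar> \<le> K" "\<bar>y\<bar> \<le> D" for r x y
  proof -
    have "\<bar>(1 + r) * x\<bar> \<le> 2 * K" unfolding abs_mult using that \<rho> by (intro mult_mono) auto
    moreover have "\<bar>r * y\<bar> \<le> 1 * K"
      unfolding abs_mult using that \<rho> DK by (intro mult_mono) auto
    ultimately show ?thesis by linarith
  qed
  have "\<bar>reflections n z\<bar> \<le> K" for n z
  proof (induction n arbitrary: z)
    case 0
    then show ?case using D(3)[of z] DK by simp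
  next
    case (Suc n)
    have "\<bar>d\<^sub>M z\<bar> \<le> K" using D(3)[of z] DK by simp
    then show ?case using scatter[OF \<rho>(2) Suc D(4)] scatter[OF \<rho>(1) Suc D(2)] by simp
  qed
  then have fM: "\<bar>f\<^sub>M z\<bar> \<le> K" for z
    using LIMSEQ_le_const2[OF tendsto_rabs[OF reflections_tendsto[of z]], of K] by blast
  have [measurable]: "f\<^sub>M \<in> borel_measurable borel"
    by (rule borel_measurable_LIMSEQ_real[OF reflections_tendsto reflections_measurable])
  have "f\<^sub>L \<in> borel_measurable borel" "f\<^sub>R \<in> borel_measurable borel"
    unfolding f\<^sub>L_def[abs_def] f\<^sub>R_def[abs_def] by measurable
  moreover have "\<bar>f\<^sub>L z\<bar> \<le> 3 * K" for z
    using scatter'[OF \<rho>(1) fM D(2), of "z - b" "- z"] D(2)[of z] DK K0 by (auto simp: f\<^sub>L_def)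
  moreover have "\<bar>f\<^sub>R z\<bar> \<le> 3 * K" for z
    using scatter'[OF \<rho>(2) fM D(4), of "b + z" "- z"] D(4)[of z] DK K0 by (auto simp: f\<^sub>R_def)
  moreover have "\<bar>f\<^sub>M z\<bar> \<le> 3 * K" for z using fM[of z] K0 by simp
  ultimately show ?thesis
    by (intro exI[of _ "3 * K"]) (auto simp: bounded_measurable_def)
qed

text \<open>A bound given by a term of the locale, so that it can be the parameter of the three
  instances of \<open>bounded_measurable\<close> below.\<close>

definition C :: real where
  "C = (SOME C. bounded_measurable f\<^sub>L C \<and> bounded_measurable f\<^sub>M C \<and> bounded_measurable f\<^sub>R C)"

lemma bounded_measurable_extensions: "bounded_measurable f\<^sub>L C" "bounded_measurable f\<^sub>M C" "bounded_measurable f\<^sub>R C"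
  using someI_ex[OF extension_bounded] by (auto simp: C_def)

sublocale L: bounded_measurable f\<^sub>L C by (rule bounded_measurable_extensions)
sublocale M: bounded_measurable f\<^sub>M C by (rule bounded_measurable_extensions)
sublocale R: bounded_measurable f\<^sub>R C by (rule bounded_measurable_extensions)

end

section \<open>The heat flows of the extensions solve the interface problem\<close>

context three_layers
begin

definition v\<^sub>L :: "real \<Rightarrow> real \<Rightarrow> real" where "v\<^sub>L x t = heat_flow f\<^sub>L t ((x - (- a)) / \<sigma>\<^sub>L)"
definition v\<^sub>M :: "real \<Rightarrow> real \<Rightarrow> real" where "v\<^sub>M x t = heat_flow f\<^sub>M t ((x - 0) / \<sigma>\<^sub>M)"
definition v\<^sub>R :: "real \<Rightarrow> real \<Rightarrow> real" where "v\<^sub>R x t = heat_flow f\<^sub>R t ((x - a) / \<sigma>\<^sub>R)"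

lemma f\<^sub>L_data: "x \<le> - a \<Longrightarrow> f\<^sub>L ((x - (- a)) / \<sigma>\<^sub>L) = u\<^sub>L x"
  using pos by (simp add: f\<^sub>L_def d\<^sub>L_def divide_le_0_iff)

lemma f\<^sub>M_data: "x \<in> {- a..a} \<Longrightarrow> f\<^sub>M ((x - 0) / \<sigma>\<^sub>M) = u\<^sub>M x"
  using pos by (subst f\<^sub>M_middle) (auto simp: d\<^sub>M_def b_def abs_le_iff divide_right_mono minus_divide_left simp del: divide_minus_left)

lemma f\<^sub>R_data: "a \<le> x \<Longrightarrow> f\<^sub>R ((x - a) / \<sigma>\<^sub>R) = u\<^sub>R x"
  using pos by (simp add: f\<^sub>R_def d\<^sub>R_def)

lemma isCont_transfer:
  fixes u f :: "real \<Rightarrow> real"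
  assumes cont: "continuous_on S u" and S: "open T" "T \<subseteq> S" "x \<in> T" and \<sigma>: "0 < \<sigma>"
    and eq: "\<And>x. x \<in> T \<Longrightarrow> f ((x - x0) / \<sigma>) = u x"
  shows "isCont f ((x - x0) / \<sigma>)"
proof -
  have 0: "x0 + \<sigma> * ((x - x0) / \<sigma>) = x" using \<sigma> by simp
  have "isCont u (x0 + \<sigma> * ((x - x0) / \<sigma>))"
    unfolding 0 using continuous_on_subset[OF cont S(2)] S(1,3) by (simp add: continuous_on_eq_continuous_at)
  then have "isCont (\<lambda>z. u (x0 + \<sigma> * z)) ((x - x0) / \<sigma>)"
    by (rule isCont_o2[where f = "\<lambda>z. x0 + \<sigma> * z" and g = u, rotated]) (intro continuous_intros)
  moreover have "\<forall>\<^sub>F z in nhds ((x - x0) / \<sigma>). u (x0 + \<sigma> * z) = f z"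
  proof -
    have "open ((\<lambda>z. x0 + \<sigma> * z) -` T)" by (intro open_vimage S continuous_intros)
    then have "\<forall>\<^sub>F z in nhds ((x - x0) / \<sigma>). z \<in> (\<lambda>z. x0 + \<sigma> * z) -` T"
      by (rule eventually_nhds_in_open) (use 0 S(3) in simp)
    then show ?thesis
    proof eventually_elim
      case (elim z)
      from eq[of "x0 + \<sigma> * z"] elim show ?case using \<sigma> by simp
    qed
  qed
  ultimately show ?thesis by (simp cong: isCont_cong)
qed

lemma isCont_extensions:
  "x \<in> {..- a} - {- a} \<Longrightarrow> isCont f\<^sub>L ((x - (- a)) / \<sigma>\<^sub>L)"
  "x \<in> {- a..a} - {- a, a} \<Longrightarrow> isCont f\<^sub>M ((x - 0) / \<sigma>\<^sub>M)"
  "x \<in> {a..} - {a} \<Longrightarrow> isCont f\<^sub>R ((x - a) / \<sigma>\<^sub>R)"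
proof -
  show "isCont f\<^sub>L ((x - (- a)) / \<sigma>\<^sub>L)" if "x \<in> {..- a} - {- a}"
    by (rule isCont_transfer[OF data_L(1), of "{..<- a}"]) (use pos that f\<^sub>L_data in auto)
  show "isCont f\<^sub>M ((x - 0) / \<sigma>\<^sub>M)" if "x \<in> {- a..a} - {- a, a}"
  proof (rule isCont_transfer[OF data_M, of "{- a<..<a}"])
    show "f\<^sub>M ((x - 0) / \<sigma>\<^sub>M) = u\<^sub>M x" if "x \<in> {- a<..<a}" for x using that by (intro f\<^sub>M_data) auto
  qed (use pos that in auto)
  show "isCont f\<^sub>R ((x - a) / \<sigma>\<^sub>R)" if "x \<in> {a..} - {a}"
    by (rule isCont_transfer[OF data_R(1), of "{a<..}"]) (use pos that f\<^sub>R_data in auto)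
qed

text \<open>Conservation of flux in travel-time coordinates, where \<open>\<sigma>^2 * u_x\<close>
  becomes \<open>\<sigma>\<close> times a slope. This equation is what fixes the reflection
  coefficients.\<close>

lemma speed_reflection: "\<sigma>\<^sub>L * (1 + \<rho>\<^sub>L) = \<sigma>\<^sub>M * (1 - \<rho>\<^sub>L)" "\<sigma>\<^sub>R * (1 + \<rho>\<^sub>R) = \<sigma>\<^sub>M * (1 - \<rho>\<^sub>R)"
proof -
  have "\<sigma>\<^sub>M + \<sigma>\<^sub>L \<noteq> 0" "\<sigma>\<^sub>M + \<sigma>\<^sub>R \<noteq> 0" using pos by auto
  then show "\<sigma>\<^sub>L * (1 + \<rho>\<^sub>L) = \<sigma>\<^sub>M * (1 - \<rho>\<^sub>L)" "\<sigma>\<^sub>R * (1 + \<rho>\<^sub>R) = \<sigma>\<^sub>M * (1 - \<rho>\<^sub>R)"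
    unfolding \<rho>\<^sub>L_def \<rho>\<^sub>R_def by (simp_all add: field_simps)
qed

text \<open>The first equation says that temperature is continuous, the second that flux is. Read as
  a linear system for the unknown values \<open>f\<^sub>L (0 + y)\<close> and
  \<open>f\<^sub>M (- b - y)\<close> they yield the scattering rule, so here they only have to be
  checked.\<close>

lemma scattering_left:
  assumes "0 < y"
  shows "f\<^sub>L (0 + y) + f\<^sub>L (0 - y) = f\<^sub>M (- b + y) + f\<^sub>M (- b - y)"
    and "\<sigma>\<^sub>L * (f\<^sub>L (0 - y) - f\<^sub>L (0 + y)) = \<sigma>\<^sub>M * (f\<^sub>M (- b - y) - f\<^sub>M (- b + y))"
proof -
  have m: "f\<^sub>M (- b - y) = \<rho>\<^sub>L * f\<^sub>M (- b + y) + (1 - \<rho>\<^sub>L) * d\<^sub>L (- y)"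
    using f\<^sub>M_left[of "- b - y"] assms by (simp add: algebra_simps)
  have l: "f\<^sub>L (0 + y) = (1 + \<rho>\<^sub>L) * f\<^sub>M (- b + y) - \<rho>\<^sub>L * d\<^sub>L (- y)" "f\<^sub>L (0 - y) = d\<^sub>L (- y)"
    using assms by (simp_all add: f\<^sub>L_def)
  show "f\<^sub>L (0 + y) + f\<^sub>L (0 - y) = f\<^sub>M (- b + y) + f\<^sub>M (- b - y)"
    unfolding l m by (simp add: algebra_simps)
  have "\<sigma>\<^sub>L * (f\<^sub>L (0 - y) - f\<^sub>L (0 + y)) = (\<sigma>\<^sub>L * (1 + \<rho>\<^sub>L)) * (d\<^sub>L (- y) - f\<^sub>M (- b + y))"
    unfolding l by (simp add: algebra_simps)
  also have "\<dots> = \<sigma>\<^sub>M * (f\<^sub>M (- b - y) - f\<^sub>M (- b + y))"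
    unfolding speed_reflection m by (simp add: algebra_simps)
  finally show "\<sigma>\<^sub>L * (f\<^sub>L (0 - y) - f\<^sub>L (0 + y)) = \<sigma>\<^sub>M * (f\<^sub>M (- b - y) - f\<^sub>M (- b + y))" .
qed

lemma scattering_right:
  assumes "0 < y"
  shows "f\<^sub>M (b + y) + f\<^sub>M (b - y) = f\<^sub>R (0 + y) + f\<^sub>R (0 - y)"
    and "\<sigma>\<^sub>M * (f\<^sub>M (b - y) - f\<^sub>M (b + y)) = \<sigma>\<^sub>R * (f\<^sub>R (0 - y) - f\<^sub>R (0 + y))"
proof -
  have m: "f\<^sub>M (b + y) = \<rho>\<^sub>R * f\<^sub>M (b - y) + (1 - \<rho>\<^sub>R) * d\<^sub>R y"
    using f\<^sub>M_right[of "b + y"] assms by (simp add: algebra_simps)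
  have r: "f\<^sub>R (0 - y) = (1 + \<rho>\<^sub>R) * f\<^sub>M (b - y) - \<rho>\<^sub>R * d\<^sub>R y" "f\<^sub>R (0 + y) = d\<^sub>R y"
    using assms by (simp_all add: f\<^sub>R_def)
  show "f\<^sub>M (b + y) + f\<^sub>M (b - y) = f\<^sub>R (0 + y) + f\<^sub>R (0 - y)"
    unfolding r m by (simp add: algebra_simps)
  have "\<sigma>\<^sub>R * (f\<^sub>R (0 - y) - f\<^sub>R (0 + y)) = (\<sigma>\<^sub>R * (1 + \<rho>\<^sub>R)) * (f\<^sub>M (b - y) - d\<^sub>R y)"
    unfolding r by (simp add: algebra_simps)
  also have "\<dots> = \<sigma>\<^sub>M * (f\<^sub>M (b - y) - f\<^sub>M (b + y))"
    unfolding speed_reflection m by (simp add: algebra_simps)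
  finally show "\<sigma>\<^sub>M * (f\<^sub>M (b - y) - f\<^sub>M (b + y)) = \<sigma>\<^sub>R * (f\<^sub>R (0 - y) - f\<^sub>R (0 + y))" by simp
qed

lemma DERIV_v:
  assumes t: "0 < t"
  shows "((\<lambda>x. v\<^sub>L x t) has_real_derivative L.heat_flow_x t ((x - (- a)) / \<sigma>\<^sub>L) / \<sigma>\<^sub>L) (at x within S)"
    and "((\<lambda>x. v\<^sub>M x t) has_real_derivative M.heat_flow_x t ((x - 0) / \<sigma>\<^sub>M) / \<sigma>\<^sub>M) (at x within S)"
    and "((\<lambda>x. v\<^sub>R x t) has_real_derivative R.heat_flow_x t ((x - a) / \<sigma>\<^sub>R) / \<sigma>\<^sub>R) (at x within S)"
proof -
  have d: "((\<lambda>y. (y - x0) / \<sigma>) has_real_derivative 1 / \<sigma>) (at x within S)" if "0 < \<sigma>" for x0 \<sigma>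
    using that by (auto intro!: derivative_eq_intros)
  show "((\<lambda>x. v\<^sub>L x t) has_real_derivative L.heat_flow_x t ((x - (- a)) / \<sigma>\<^sub>L) / \<sigma>\<^sub>L) (at x within S)"
    using DERIV_chain2[OF L.DERIV_heat_flow[OF t] d[OF pos(2), of "- a"]] by (simp add: v\<^sub>L_def[abs_def])
  show "((\<lambda>x. v\<^sub>M x t) has_real_derivative M.heat_flow_x t ((x - 0) / \<sigma>\<^sub>M) / \<sigma>\<^sub>M) (at x within S)"
    using DERIV_chain2[OF M.DERIV_heat_flow[OF t] d[OF pos(3), of 0]] by (simp add: v\<^sub>M_def[abs_def])
  show "((\<lambda>x. v\<^sub>R x t) has_real_derivative R.heat_flow_x t ((x - a) / \<sigma>\<^sub>R) / \<sigma>\<^sub>R) (at x within S)"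
    using DERIV_chain2[OF R.DERIV_heat_flow[OF t] d[OF pos(4), of a]] by (simp add: v\<^sub>R_def[abs_def])
qed

lemma interface_conditions_v:
  assumes t: "0 < t"
  shows "interface_conditions a \<sigma>\<^sub>L \<sigma>\<^sub>M \<sigma>\<^sub>R (\<lambda>x. v\<^sub>L x t) (\<lambda>x. v\<^sub>M x t) (\<lambda>x. v\<^sub>R x t)"
  unfolding interface_conditions_def
proof (intro conjI exI)
  show "v\<^sub>L (- a) t = v\<^sub>M (- a) t"
    using heat_flow_eq_if_even_parts_eq[OF bounded_measurable_extensions(1,2) scattering_left(1) t]
    by (simp add: v\<^sub>L_def v\<^sub>M_def b_def)
  show "v\<^sub>M a t = v\<^sub>R a t"
    using heat_flow_eq_if_even_parts_eq[OF bounded_measurable_extensions(2,3) scattering_right(1) t]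
    by (simp add: v\<^sub>R_def v\<^sub>M_def b_def)
  have 1: "\<sigma>\<^sub>L * L.heat_flow_x t 0 = \<sigma>\<^sub>M * M.heat_flow_x t (- b)"
    by (rule heat_flow_x_eq_if_odd_parts_eq[OF bounded_measurable_extensions(1,2) scattering_left(2) t])
  show "\<sigma>\<^sub>L\<^sup>2 * (L.heat_flow_x t ((- a - (- a)) / \<sigma>\<^sub>L) / \<sigma>\<^sub>L) = \<sigma>\<^sub>M\<^sup>2 * (M.heat_flow_x t ((- a - 0) / \<sigma>\<^sub>M) / \<sigma>\<^sub>M)"
    using 1 pos by (simp add: power2_eq_square b_def)
  have 2: "\<sigma>\<^sub>M * M.heat_flow_x t b = \<sigma>\<^sub>R * R.heat_flow_x t 0"
    by (rule heat_flow_x_eq_if_odd_parts_eq[OF bounded_measurable_extensions(2,3) scattering_right(2) t])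
  show "\<sigma>\<^sub>M\<^sup>2 * (M.heat_flow_x t ((a - 0) / \<sigma>\<^sub>M) / \<sigma>\<^sub>M) = \<sigma>\<^sub>R\<^sup>2 * (R.heat_flow_x t ((a - a) / \<sigma>\<^sub>R) / \<sigma>\<^sub>R)"
    using 2 pos by (simp add: power2_eq_square b_def)
qed (intro DERIV_v t)+

lemma v_0: "x \<le> - a \<Longrightarrow> v\<^sub>L x 0 = u\<^sub>L x" "x \<in> {- a..a} \<Longrightarrow> v\<^sub>M x 0 = u\<^sub>M x" "a \<le> x \<Longrightarrow> v\<^sub>R x 0 = u\<^sub>R x"
  unfolding v\<^sub>L_def v\<^sub>M_def v\<^sub>R_def L.heat_flow_0 M.heat_flow_0 R.heat_flow_0
  using f\<^sub>L_data f\<^sub>M_data f\<^sub>R_data by auto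

text \<open>One-sided derivatives see the closed layers only. This carries compatible data over to
  the flows at time 0, which agree with the data just on those layers.\<close>

lemma interface_conditions_cong:
  assumes "\<And>x. x \<le> - a \<Longrightarrow> w\<^sub>L x = w\<^sub>L' x" "\<And>x. x \<in> {- a..a} \<Longrightarrow> w\<^sub>M x = w\<^sub>M' x" "\<And>x. a \<le> x \<Longrightarrow> w\<^sub>R x = w\<^sub>R' x"
    and "interface_conditions a \<sigma>\<^sub>L \<sigma>\<^sub>M \<sigma>\<^sub>R w\<^sub>L w\<^sub>M w\<^sub>R"
  shows "interface_conditions a \<sigma>\<^sub>L \<sigma>\<^sub>M \<sigma>\<^sub>R w\<^sub>L' w\<^sub>M' w\<^sub>R'"
proof -
  have tr: "(g has_real_derivative p) (at x within S)"
    if "(f has_real_derivative p) (at x within S)" "x \<in> S" "\<And>y. y \<in> S \<Longrightarrow> f y = g y" for f g p x S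
    by (rule has_field_derivative_transform_within[OF that(1), of 1]) (use that in auto)
  from assms(4) obtain p q p' q' where
    pq: "w\<^sub>L (- a) = w\<^sub>M (- a)" "w\<^sub>M a = w\<^sub>R a"
      "(w\<^sub>L has_real_derivative p) (at (- a) within {..- a})" "(w\<^sub>M has_real_derivative q) (at (- a) within {- a..a})"
      "\<sigma>\<^sub>L\<^sup>2 * p = \<sigma>\<^sub>M\<^sup>2 * q"
      "(w\<^sub>M has_real_derivative p') (at a within {- a..a})" "(w\<^sub>R has_real_derivative q') (at a within {a..})"
      "\<sigma>\<^sub>M\<^sup>2 * p' = \<sigma>\<^sub>R\<^sup>2 * q'"
    unfolding interface_conditions_def by blast
  have "(w\<^sub>L' has_real_derivative p) (at (- a) within {..- a})" by (rule tr[OF pq(3)]) (use assms(1) in auto)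
  moreover have "(w\<^sub>M' has_real_derivative q) (at (- a) within {- a..a})" by (rule tr[OF pq(4)]) (use assms(2) pos in auto)
  moreover have "(w\<^sub>M' has_real_derivative p') (at a within {- a..a})" by (rule tr[OF pq(6)]) (use assms(2) pos in auto)
  moreover have "(w\<^sub>R' has_real_derivative q') (at a within {a..})" by (rule tr[OF pq(7)]) (use assms(3) in auto)
  moreover have "w\<^sub>L' (- a) = w\<^sub>M' (- a)" "w\<^sub>M' a = w\<^sub>R' a"
    using pq(1,2) assms(1)[of "- a"] assms(2)[of "- a"] assms(2)[of a] assms(3)[of a] pos by auto
  ultimately show ?thesis using pq(5,8) unfolding interface_conditions_def by blast
qed

lemma v_tendsto:
  "((\<lambda>x. v\<^sub>L x t) \<longlongrightarrow> 0) at_bot" "((\<lambda>x. v\<^sub>R x t) \<longlongrightarrow> 0) at_top"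
proof -
  \<comment> \<open>For each fixed shift \<open>c\<close> the argument finally stays in the left
    layer, where the extension is the given data.\<close>
  have "((\<lambda>x. f\<^sub>L ((- x - (- a)) / \<sigma>\<^sub>L + c)) \<longlongrightarrow> 0) at_top" for c
  proof -
    have "filterlim (\<lambda>x. \<sigma>\<^sub>L * c - x) at_bot at_top"
      using filterlim_affine_at_bot[of 1 "\<sigma>\<^sub>L * c"] by simp
    from filterlim_compose[OF data_L(3) this] have "((\<lambda>x. u\<^sub>L (\<sigma>\<^sub>L * c - x)) \<longlongrightarrow> 0) at_top" .
    moreover have "\<forall>\<^sub>F x in at_top. u\<^sub>L (\<sigma>\<^sub>L * c - x) = f\<^sub>L ((- x - (- a)) / \<sigma>\<^sub>L + c)"
      using eventually_ge_at_top[of "\<sigma>\<^sub>L * c + a"]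
    proof eventually_elim
      case (elim x)
      have "(- x - (- a)) / \<sigma>\<^sub>L + c = ((\<sigma>\<^sub>L * c - x) - (- a)) / \<sigma>\<^sub>L" using pos by (simp add: field_simps)
      then show ?case using f\<^sub>L_data[of "\<sigma>\<^sub>L * c - x"] elim by simp
    qed
    ultimately show ?thesis by (rule Lim_transform_eventually)
  qed
  from L.heat_flow_tendsto_at_top[of "\<lambda>x. (- x - (- a)) / \<sigma>\<^sub>L", OF this]
  show "((\<lambda>x. v\<^sub>L x t) \<longlongrightarrow> 0) at_bot"
    unfolding filterlim_at_bot_mirror v\<^sub>L_def .
  have "((\<lambda>x. f\<^sub>R ((x - a) / \<sigma>\<^sub>R + c)) \<longlongrightarrow> 0) at_top" for c
  proof -
    have "filterlim (\<lambda>x. \<sigma>\<^sub>R * c + x) at_top at_top"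
      using filterlim_affine_at_top[of 1 "\<sigma>\<^sub>R * c"] by simp
    from filterlim_compose[OF data_R(3) this] have "((\<lambda>x. u\<^sub>R (\<sigma>\<^sub>R * c + x)) \<longlongrightarrow> 0) at_top" .
    moreover have "\<forall>\<^sub>F x in at_top. u\<^sub>R (\<sigma>\<^sub>R * c + x) = f\<^sub>R ((x - a) / \<sigma>\<^sub>R + c)"
      using eventually_ge_at_top[of "a - \<sigma>\<^sub>R * c"]
    proof eventually_elim
      case (elim x)
      have "(x - a) / \<sigma>\<^sub>R + c = ((\<sigma>\<^sub>R * c + x) - a) / \<sigma>\<^sub>R" using pos by (simp add: field_simps)
      then show ?case using f\<^sub>R_data[of "\<sigma>\<^sub>R * c + x"] elim by simp
    qed
    ultimately show ?thesis by (rule Lim_transform_eventually)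
  qed
  from R.heat_flow_tendsto_at_top[of "\<lambda>x. (x - a) / \<sigma>\<^sub>R", OF this]
  show "((\<lambda>x. v\<^sub>R x t) \<longlongrightarrow> 0) at_top" unfolding v\<^sub>R_def .
qed

lemma heat_solution_v:
  assumes "J = {0<..} \<or> J = {0..} \<and> interface_conditions a \<sigma>\<^sub>L \<sigma>\<^sub>M \<sigma>\<^sub>R u\<^sub>L u\<^sub>M u\<^sub>R"
  shows "heat_solution a \<sigma>\<^sub>L \<sigma>\<^sub>M \<sigma>\<^sub>R u\<^sub>L u\<^sub>M u\<^sub>R J v\<^sub>L v\<^sub>M v\<^sub>R"
  unfolding heat_solution_def
proof (intro conjI)
  show "heat_equation \<sigma>\<^sub>L {..<- a} v\<^sub>L" "heat_equation \<sigma>\<^sub>M {- a<..<a} v\<^sub>M" "heat_equation \<sigma>\<^sub>R {a<..} v\<^sub>R"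
    unfolding v\<^sub>L_def v\<^sub>M_def v\<^sub>R_def
    by (intro L.heat_equation_heat_flow M.heat_equation_heat_flow R.heat_equation_heat_flow pos)+
  show "regular_up_to_boundary {..- a} {- a} v\<^sub>L"
    unfolding v\<^sub>L_def by (rule L.regular_heat_flow[OF pos(2)]) (rule isCont_extensions)
  show "regular_up_to_boundary {- a..a} {- a, a} v\<^sub>M"
    unfolding v\<^sub>M_def by (rule M.regular_heat_flow[OF pos(3)]) (rule isCont_extensions)
  show "regular_up_to_boundary {a..} {a} v\<^sub>R"
    unfolding v\<^sub>R_def by (rule R.regular_heat_flow[OF pos(4)]) (rule isCont_extensions)
  show "\<forall>t\<in>J. interface_conditions a \<sigma>\<^sub>L \<sigma>\<^sub>M \<sigma>\<^sub>R (\<lambda>x. v\<^sub>L x t) (\<lambda>x. v\<^sub>M x t) (\<lambda>x. v\<^sub>R x t)"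
  proof
    fix t assume t: "t \<in> J"
    show "interface_conditions a \<sigma>\<^sub>L \<sigma>\<^sub>M \<sigma>\<^sub>R (\<lambda>x. v\<^sub>L x t) (\<lambda>x. v\<^sub>M x t) (\<lambda>x. v\<^sub>R x t)"
    proof (cases "t = 0")
      case True
      then have "interface_conditions a \<sigma>\<^sub>L \<sigma>\<^sub>M \<sigma>\<^sub>R u\<^sub>L u\<^sub>M u\<^sub>R" using t assms by auto
      then show ?thesis
        unfolding True by (rule interface_conditions_cong[rotated 3]) (simp_all only: v_0)
    qed (use t assms in \<open>auto intro!: interface_conditions_v\<close>)
  qed
qed (use v_0 v_tendsto in auto)

end

section \<open>Uniqueness\<close>

text \<open>The derivative \<open>g\<close> is assumed differentiable at \<open>x\<close> only, as
  \<open>heat_equation\<close> provides. If \<open>l\<close> were positive, \<open>g\<close> would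
  be positive just to the right of its zero \<open>x\<close>, and by the mean value theorem
  \<open>f\<close> would exceed its maximum there.\<close>

lemma second_derivative_nonpos_at_max:
  fixes f g :: "real \<Rightarrow> real"
  assumes d: "\<forall>\<^sub>F y in nhds x. (f has_real_derivative g y) (at y)"
    and d2: "(g has_real_derivative l) (at x)"
    and max: "\<forall>\<^sub>F y in nhds x. f y \<le> f x"
  shows "l \<le> 0"
proof (rule ccontr)
  assume "\<not> l \<le> 0"
  then have l: "0 < l" by simp
  obtain e where e: "0 < e" "\<And>y. dist y x < e \<Longrightarrow> (f has_real_derivative g y) (at y) \<and> f y \<le> f x"
    using eventually_conj[OF d max] unfolding eventually_nhds_metric by blast
  have "(f has_real_derivative g x) (at x)" using e by simp
  then have g0: "g x = 0"
    by (rule DERIV_local_max[OF _ e(1)]) (use e(2) in \<open>auto simp: dist_real_def abs_minus_commute\<close>)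
  obtain h where h: "0 < h" "\<And>k. 0 < k \<Longrightarrow> k < h \<Longrightarrow> g x < g (x + k)"
    using DERIV_pos_inc_right[OF d2 l] by blast
  define k where "k = min e h / 2"
  have k: "0 < k" "k < e" "k < h" using e(1) h(1) by (auto simp: k_def)
  obtain z where z: "x < z" "z < x + k" "f (x + k) - f x = (x + k - x) * g z"
    using MVT2[of x "x + k" f g] e(2) k by (auto simp: dist_real_def)
  have "0 < g z" using h(2)[of "z - x"] z k g0 by simp
  then have "0 < k * g z" using k by simp
  then have "f x < f (x + k)" using z(3) by simp
  moreover have "f (x + k) \<le> f x" using e(2)[of "x + k"] k by (simp add: dist_real_def)
  ultimately show False by simp
qed

lemma left_derivative_at_max:
  fixes f :: "real \<Rightarrow> real"
  assumes max: "\<forall>\<^sub>F y in nhds x. y \<le> x \<longrightarrow> f y \<le> f x"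
    and p: "(f has_real_derivative p) (at x within {..x})"
  shows "0 \<le> p"
proof (rule ccontr)
  obtain e where e: "0 < e" "\<And>y. dist y x < e \<Longrightarrow> y \<le> x \<Longrightarrow> f y \<le> f x"
    using max unfolding eventually_nhds_metric by blast
  assume "\<not> 0 \<le> p"
  then obtain d where d: "0 < d" "\<And>h. 0 < h \<Longrightarrow> x - h \<in> {..x} \<Longrightarrow> h < d \<Longrightarrow> f x < f (x - h)"
    using has_real_derivative_neg_dec_left[OF p] by auto
  obtain h where "0 < h" "h < d" "h < e" using d(1) e(1) dense[of 0 "min d e"] by auto
  then show False using d(2)[of h] e(2)[of "x - h"] by (auto simp: dist_real_def)
qed

lemma right_derivative_at_max:
  fixes f :: "real \<Rightarrow> real"
  assumes max: "\<forall>\<^sub>F y in nhds x. x \<le> y \<longrightarrow> f y \<le> f x"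
    and q: "(f has_real_derivative q) (at x within {x..})"
  shows "q \<le> 0"
proof (rule ccontr)
  obtain e where e: "0 < e" "\<And>y. dist y x < e \<Longrightarrow> x \<le> y \<Longrightarrow> f y \<le> f x"
    using max unfolding eventually_nhds_metric by blast
  assume "\<not> q \<le> 0"
  then obtain d where d: "0 < d" "\<And>h. 0 < h \<Longrightarrow> x + h \<in> {x..} \<Longrightarrow> h < d \<Longrightarrow> f x < f (x + h)"
    using has_real_derivative_pos_inc_right[OF q] by auto
  obtain h where "0 < h" "h < d" "h < e" using d(1) e(1) dense[of 0 "min d e"] by auto
  then show False using d(2)[of h] e(2)[of "x + h"] by (auto simp: dist_real_def)
qed

text \<open>A maximum over the compact rectangle is attained. On the parabolic boundary it is
  negative; elsewhere \<open>crit\<close> excludes it. The maximum may occur at the final time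
  \<open>T\<close>, which is why \<open>crit\<close> compares with earlier times only.\<close>

lemma negative_if_no_interior_maximum:
  fixes V :: "real \<Rightarrow> real \<Rightarrow> real"
  assumes cont: "continuous_on ({-X..X} \<times> {\<tau>..T}) (\<lambda>(x, t). V x t)"
    and init: "\<And>x. \<bar>x\<bar> \<le> X \<Longrightarrow> V x \<tau> < 0"
    and side: "\<And>x t. \<bar>x\<bar> = X \<Longrightarrow> \<tau> \<le> t \<Longrightarrow> t \<le> T \<Longrightarrow> V x t < 0"
    and crit: "\<And>x t. \<bar>x\<bar> < X \<Longrightarrow> \<tau> < t \<Longrightarrow> t \<le> T \<Longrightarrow> \<forall>\<^sub>F y in nhds x. V y t \<le> V x t \<Longrightarrow>
        \<forall>s\<in>{\<tau>..t}. V x s \<le> V x t \<Longrightarrow> False"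
    and x: "\<bar>x\<bar> \<le> X" and t: "\<tau> \<le> t" "t \<le> T"
  shows "V x t < 0"
proof -
  let ?R = "{-X..X} \<times> {\<tau>..T}"
  have xt: "(x, t) \<in> ?R" using x t by (auto simp: abs_le_iff)
  obtain p where p: "p \<in> ?R" "\<And>q. q \<in> ?R \<Longrightarrow> (case q of (x, t) \<Rightarrow> V x t) \<le> (case p of (x, t) \<Rightarrow> V x t)"
    using continuous_attains_sup[OF compact_Times[OF compact_Icc compact_Icc] _ cont] xt by blast
  obtain y s where ys: "p = (y, s)" by (cases p)
  have max: "V y' s' \<le> V y s" if "\<bar>y'\<bar> \<le> X" "\<tau> \<le> s'" "s' \<le> T" for y' s'
    using p(2)[of "(y', s')"] that ys by (auto simp: abs_le_iff)
  have y: "\<bar>y\<bar> \<le> X" "\<tau> \<le> s" "s \<le> T" using p(1) ys by (auto simp: abs_le_iff)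
  have "V y s < 0"
  proof (cases "\<bar>y\<bar> = X \<or> s = \<tau>")
    case True
    then show ?thesis using init side y by auto
  next
    case False
    then have ys': "\<bar>y\<bar> < X" "\<tau> < s" using y by auto
    have "\<forall>\<^sub>F z in nhds y. z \<in> {-X<..<X}" by (rule eventually_nhds_in_open) (use ys' in \<open>auto simp: abs_less_iff\<close>)
    then have "\<forall>\<^sub>F z in nhds y. V z s \<le> V y s"
      by eventually_elim (use max y in \<open>auto simp: abs_le_iff\<close>)
    moreover have "\<forall>r\<in>{\<tau>..s}. V y r \<le> V y s" using max y by auto
    ultimately show ?thesis using crit[OF ys' y(3)] by blast
  qed
  then show ?thesis using max[OF x t] by simp
qed

text \<open>Away from the corners the function is continuous down to time 0, and on a compact set
  this continuity is uniform.\<close>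

lemma small_near_time_0:
  fixes w :: "real \<Rightarrow> real \<Rightarrow> real"
  assumes reg: "regular_up_to_boundary I E w" and zero: "\<And>x. x \<in> I \<Longrightarrow> w x 0 = 0"
    and K: "compact K" "K \<subseteq> I" "K \<inter> E = {}" and e: "0 < e"
  obtains d where "0 < d" "\<And>x t. x \<in> K \<Longrightarrow> 0 \<le> t \<Longrightarrow> t \<le> d \<Longrightarrow> \<bar>w x t\<bar> < e"
proof -
  have "continuous_on (K \<times> {0..1}) (\<lambda>(x, t). w x t)"
    by (rule continuous_on_subset[OF reg[unfolded regular_up_to_boundary_def, THEN conjunct1]]) (use K in auto)
  then have "uniformly_continuous_on (K \<times> {0..1}) (\<lambda>(x, t). w x t)"
    by (rule compact_uniformly_continuous) (intro compact_Times K compact_Icc)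
  then obtain d where d: "0 < d" "\<And>p q. p \<in> K \<times> {0..1} \<Longrightarrow> q \<in> K \<times> {0..1} \<Longrightarrow> dist q p < d \<Longrightarrow>
      dist (case q of (x, t) \<Rightarrow> w x t) (case p of (x, t) \<Rightarrow> w x t) < e"
    unfolding uniformly_continuous_on_def using e by blast
  show thesis
  proof (rule that[of "min 1 (d / 2)"])
    fix x t assume x: "x \<in> K" and t: "0 \<le> t" "t \<le> min 1 (d / 2)"
    have "dist (x, t) (x, 0) < d" using t d(1) by (simp add: dist_Pair_Pair dist_real_def)
    from d(2)[OF _ _ this] x t zero[of x] K(2) show "\<bar>w x t\<bar> < e" by (auto simp: dist_real_def)
  qed (use d in auto)
qed

text \<open>These properties hold for the difference of two solutions with the same data. Control at
  infinity comes from the boundedness contained in \<open>regular_up_to_boundary\<close>.\<close>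

locale zero_data_solution =
  fixes a \<sigma>\<^sub>L \<sigma>\<^sub>M \<sigma>\<^sub>R :: real and w\<^sub>L w\<^sub>M w\<^sub>R :: "real \<Rightarrow> real \<Rightarrow> real"
  assumes pos: "0 < a" "0 < \<sigma>\<^sub>L" "0 < \<sigma>\<^sub>M" "0 < \<sigma>\<^sub>R"
    and heat: "heat_equation \<sigma>\<^sub>L {..<- a} w\<^sub>L" "heat_equation \<sigma>\<^sub>M {- a<..<a} w\<^sub>M" "heat_equation \<sigma>\<^sub>R {a<..} w\<^sub>R"
    and reg: "regular_up_to_boundary {..- a} {- a} w\<^sub>L" "regular_up_to_boundary {- a..a} {- a, a} w\<^sub>M"
      "regular_up_to_boundary {a..} {a} w\<^sub>R"
    and zero: "\<And>x. x \<le> - a \<Longrightarrow> w\<^sub>L x 0 = 0" "\<And>x. x \<in> {- a..a} \<Longrightarrow> w\<^sub>M x 0 = 0" "\<And>x. a \<le> x \<Longrightarrow> w\<^sub>R x 0 = 0"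
    and interface: "\<And>t. 0 < t \<Longrightarrow> interface_conditions a \<sigma>\<^sub>L \<sigma>\<^sub>M \<sigma>\<^sub>R (\<lambda>x. w\<^sub>L x t) (\<lambda>x. w\<^sub>M x t) (\<lambda>x. w\<^sub>R x t)"
begin

definition W :: "real \<Rightarrow> real \<Rightarrow> real" where
  "W x t = (if x \<le> - a then w\<^sub>L x t else if x \<le> a then w\<^sub>M x t else w\<^sub>R x t)"

lemma matching:
  assumes "0 \<le> t" shows "w\<^sub>L (- a) t = w\<^sub>M (- a) t" "w\<^sub>M a t = w\<^sub>R a t"
  using interface[of t] zero[of "- a"] zero[of a] assms pos
  by (cases "t = 0"; auto simp: interface_conditions_def)+

lemma W_eq:
  assumes "0 \<le> t"
  shows "x \<le> - a \<Longrightarrow> W x t = w\<^sub>L x t" "x \<in> {- a..a} \<Longrightarrow> W x t = w\<^sub>M x t" "a \<le> x \<Longrightarrow> W x t = w\<^sub>R x t"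
  using matching[OF assms] pos by (auto simp: W_def)

lemma W_bounded: "\<exists>C. \<forall>x. \<forall>t\<in>{0..T}. \<bar>W x t\<bar> \<le> C" if T: "0 \<le> T"
proof -
  note b = reg[unfolded regular_up_to_boundary_def, THEN conjunct2, THEN spec, THEN mp, OF T]
  obtain A where A: "\<forall>x\<in>{..- a}. \<forall>t\<in>{0..T}. \<bar>w\<^sub>L x t\<bar> \<le> A" using b(1) by (rule exE)
  obtain B where B: "\<forall>x\<in>{- a..a}. \<forall>t\<in>{0..T}. \<bar>w\<^sub>M x t\<bar> \<le> B" using b(2) by (rule exE)
  obtain C where C: "\<forall>x\<in>{a..}. \<forall>t\<in>{0..T}. \<bar>w\<^sub>R x t\<bar> \<le> C" using b(3) by (rule exE)
  have "\<bar>W x t\<bar> \<le> max A (max B C)" if "t \<in> {0..T}" for x t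
    using that A B C by (simp add: W_def le_max_iff_disj)
  then show ?thesis by blast
qed

lemma continuous_W:
  assumes "0 < \<tau>"
  shows "continuous_on (UNIV \<times> {\<tau>..T}) (\<lambda>(x, t). W x t)"
proof -
  have piece: "continuous_on (I \<times> {\<tau>..T}) (\<lambda>(x, t). W x t)"
    if "regular_up_to_boundary I E w" "\<And>x t. x \<in> I \<Longrightarrow> 0 \<le> t \<Longrightarrow> W x t = w x t" for I E w
  proof -
    have "continuous_on (I \<times> {\<tau>..T}) (\<lambda>(x, t). w x t)"
      by (rule continuous_on_subset[OF that(1)[unfolded regular_up_to_boundary_def, THEN conjunct1]]) (use assms in auto)
    then show ?thesis by (rule continuous_on_eq) (use that(2) assms in auto)
  qed
  have "continuous_on ({..- a} \<times> {\<tau>..T} \<union> ({- a..a} \<times> {\<tau>..T} \<union> {a..} \<times> {\<tau>..T})) (\<lambda>(x, t). W x t)"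
  proof (intro continuous_on_closed_Un closed_Un closed_Times closed_atMost closed_atLeast closed_atLeastAtMost)
    show "continuous_on ({..- a} \<times> {\<tau>..T}) (\<lambda>(x, t). W x t)" by (rule piece[OF reg(1)]) (simp add: W_eq)
    show "continuous_on ({- a..a} \<times> {\<tau>..T}) (\<lambda>(x, t). W x t)" by (rule piece[OF reg(2)]) (simp add: W_eq)
    show "continuous_on ({a..} \<times> {\<tau>..T}) (\<lambda>(x, t). W x t)" by (rule piece[OF reg(3)]) (simp add: W_eq)
  qed
  also have "{..- a} \<times> {\<tau>..T} \<union> ({- a..a} \<times> {\<tau>..T} \<union> {a..} \<times> {\<tau>..T}) = UNIV \<times> {\<tau>..T}" by auto
  finally show ?thesis .
qed

lemma W_small:
  assumes \<delta>: "0 < \<delta>" and e: "0 < e"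
  obtains d where "0 < d"
    "\<And>x t. \<bar>x\<bar> \<le> X \<Longrightarrow> \<delta> \<le> \<bar>x + a\<bar> \<Longrightarrow> \<delta> \<le> \<bar>x - a\<bar> \<Longrightarrow> 0 \<le> t \<Longrightarrow> t \<le> d \<Longrightarrow> \<bar>W x t\<bar> < e"
proof -
  obtain d1 where d1: "0 < d1" "\<And>x t. x \<in> {-X..- a - \<delta>} \<Longrightarrow> 0 \<le> t \<Longrightarrow> t \<le> d1 \<Longrightarrow> \<bar>w\<^sub>L x t\<bar> < e"
    by (rule small_near_time_0[OF reg(1) zero(1), of "{-X..- a - \<delta>}" e]) (use \<delta> e in auto)
  obtain d2 where d2: "0 < d2" "\<And>x t. x \<in> {-a + \<delta>..a - \<delta>} \<Longrightarrow> 0 \<le> t \<Longrightarrow> t \<le> d2 \<Longrightarrow> \<bar>w\<^sub>M x t\<bar> < e"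
    by (rule small_near_time_0[OF reg(2) zero(2), of "{-a + \<delta>..a - \<delta>}" e]) (use \<delta> e in auto)
  obtain d3 where d3: "0 < d3" "\<And>x t. x \<in> {a + \<delta>..X} \<Longrightarrow> 0 \<le> t \<Longrightarrow> t \<le> d3 \<Longrightarrow> \<bar>w\<^sub>R x t\<bar> < e"
    by (rule small_near_time_0[OF reg(3) zero(3), of "{a + \<delta>..X}" e]) (use \<delta> e in auto)
  show thesis
  proof (rule that[of "min d1 (min d2 d3)"])
    fix x t assume x: "\<bar>x\<bar> \<le> X" "\<delta> \<le> \<bar>x + a\<bar>" "\<delta> \<le> \<bar>x - a\<bar>" and t: "0 \<le> t" "t \<le> min d1 (min d2 d3)"
    consider "x \<le> - a" | "- a < x" "x \<le> a" | "a < x" by linarith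
    then show "\<bar>W x t\<bar> < e"
    proof cases
      case 1
      then have "x \<in> {-X..- a - \<delta>}" using x by auto
      then show ?thesis using 1 d1(2) t by (simp add: W_def)
    next
      case 2
      then have "x \<in> {-a + \<delta>..a - \<delta>}" using x by auto
      then show ?thesis using 2 d2(2) t by (simp add: W_def)
    next
      case 3
      then have "x \<in> {a + \<delta>..X}" using x pos by auto
      then show ?thesis using 3 d3(2) t pos by (simp add: W_def)
    qed
  qed (use d1 d2 d3 in auto)
qed

lemma W_heat:
  assumes x: "x \<noteq> - a" "x \<noteq> a" and t: "0 < t"
  obtains \<sigma> g l where "\<sigma> \<in> {\<sigma>\<^sub>L, \<sigma>\<^sub>M, \<sigma>\<^sub>R}" "\<forall>\<^sub>F y in nhds x. ((\<lambda>x. W x t) has_real_derivative g y) (at y)"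
    "(g has_real_derivative l) (at x)" "((\<lambda>s. W x s) has_real_derivative \<sigma>\<^sup>2 * l) (at t)"
proof -
  have piece: "\<exists>g l. (\<forall>\<^sub>F y in nhds x. ((\<lambda>x. W x t) has_real_derivative g y) (at y)) \<and>
      (g has_real_derivative l) (at x) \<and> ((\<lambda>s. W x s) has_real_derivative \<sigma>\<^sup>2 * l) (at t)"
    if h: "heat_equation \<sigma> I w" and I: "open I" "x \<in> I" and eq: "\<And>x t. x \<in> I \<Longrightarrow> 0 \<le> t \<Longrightarrow> W x t = w x t" for \<sigma> I w
  proof -
    obtain u where u: "\<And>x. x \<in> I \<Longrightarrow> ((\<lambda>y. w y t) has_real_derivative u x t) (at x)"
        "\<exists>l. ((\<lambda>y. u y t) has_real_derivative l) (at x) \<and> ((\<lambda>s. w x s) has_real_derivative \<sigma>\<^sup>2 * l) (at t)"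
      using h I(2) t unfolding heat_equation_def by meson
    obtain l where l: "((\<lambda>y. u y t) has_real_derivative l) (at x)" "((\<lambda>s. w x s) has_real_derivative \<sigma>\<^sup>2 * l) (at t)"
      using u(2) by blast
    have "((\<lambda>x. W x t) has_real_derivative u y t) (at y)" if "y \<in> I" for y
      by (rule has_field_derivative_transform_within_open[OF u(1)[OF that] I(1) that]) (use eq t in auto)
    then have "\<forall>\<^sub>F y in nhds x. ((\<lambda>x. W x t) has_real_derivative u y t) (at y)"
      using eventually_nhds_in_open[OF I] by (auto elim: eventually_mono)
    moreover have "((\<lambda>s. W x s) has_real_derivative \<sigma>\<^sup>2 * l) (at t)"
      by (rule has_field_derivative_transform_within_open[OF l(2), of "{0<..}"]) (use eq t I in auto)
    ultimately show ?thesis using l(1) by (intro exI[of _ "\<lambda>y. u y t"] exI[of _ l] conjI)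
  qed
  consider "x < - a" | "- a < x" "x < a" | "a < x" using x by linarith
  then show thesis
  proof cases
    case 1
    then show ?thesis using piece[OF heat(1)] W_eq that[of \<sigma>\<^sub>L] by auto
  next
    case 2
    then show ?thesis using piece[OF heat(2)] W_eq that[of \<sigma>\<^sub>M] by auto
  next
    case 3
    then show ?thesis using piece[OF heat(3)] W_eq that[of \<sigma>\<^sub>R] by auto
  qed
qed

text \<open>Near an interface the middle layer and the corresponding half-line coincide, so its
  one-sided derivative may be taken within the half-line, the form in which the tests at a maximum
  are stated.\<close>

lemma W_interface:
  assumes t: "0 < t"
  obtains p q p' q' where
    "((\<lambda>x. W x t) has_real_derivative p) (at (- a) within {..- a})"
    "((\<lambda>x. W x t) has_real_derivative q) (at (- a) within {- a..})" "\<sigma>\<^sub>L\<^sup>2 * p = \<sigma>\<^sub>M\<^sup>2 * q"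
    "((\<lambda>x. W x t) has_real_derivative p') (at a within {..a})"
    "((\<lambda>x. W x t) has_real_derivative q') (at a within {a..})" "\<sigma>\<^sub>M\<^sup>2 * p' = \<sigma>\<^sub>R\<^sup>2 * q'"
proof -
  obtain p q p' q' where d:
    "((\<lambda>x. w\<^sub>L x t) has_real_derivative p) (at (- a) within {..- a})"
    "((\<lambda>x. w\<^sub>M x t) has_real_derivative q) (at (- a) within {- a..a})" "\<sigma>\<^sub>L\<^sup>2 * p = \<sigma>\<^sub>M\<^sup>2 * q"
    "((\<lambda>x. w\<^sub>M x t) has_real_derivative p') (at a within {- a..a})"
    "((\<lambda>x. w\<^sub>R x t) has_real_derivative q') (at a within {a..})" "\<sigma>\<^sub>M\<^sup>2 * p' = \<sigma>\<^sub>R\<^sup>2 * q'"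
    using interface[OF t] unfolding interface_conditions_def by blast
  have tr: "((\<lambda>x. W x t) has_real_derivative l) (at y within S)"
    if "((\<lambda>x. w x t) has_real_derivative l) (at y within S)" "y \<in> S" "\<And>x. x \<in> S \<Longrightarrow> W x t = w x t" for w l y S
    by (rule has_field_derivative_transform_within[OF that(1), of 1]) (use that in auto)
  have 1: "((\<lambda>x. W x t) has_real_derivative p) (at (- a) within {..- a})"
    by (rule tr[where w = w\<^sub>L, OF d(1)]) (use t W_eq in auto)
  have "((\<lambda>x. W x t) has_real_derivative q) (at (- a) within {- a..a})"
    by (rule tr[where w = w\<^sub>M, OF d(2)]) (use t W_eq pos in auto)
  moreover have "at (- a) within {- a..} = at (- a) within {- a..a}"
    by (rule at_within_nhd[of _ "{..<a}"]) (use pos in auto)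
  ultimately have 2: "((\<lambda>x. W x t) has_real_derivative q) (at (- a) within {- a..})" by simp
  have "((\<lambda>x. W x t) has_real_derivative p') (at a within {- a..a})"
    by (rule tr[where w = w\<^sub>M, OF d(4)]) (use t W_eq pos in auto)
  moreover have "at a within {..a} = at a within {- a..a}"
    by (rule at_within_nhd[of _ "{- a<..}"]) (use pos in auto)
  ultimately have 3: "((\<lambda>x. W x t) has_real_derivative p') (at a within {..a})" by simp
  have 4: "((\<lambda>x. W x t) has_real_derivative q') (at a within {a..})"
    by (rule tr[where w = w\<^sub>R, OF d(5)]) (use t W_eq pos in auto)
  show thesis by (rule that[OF 1 2 d(3) 3 4 d(6)])
qed

text \<open>The barrier. A Gaussian of the largest diffusivity \<open>D\<close> with the slow time decay \<open>s\<close> to the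
  power \<open>- \<beta>\<close> is a supersolution for all three diffusivities at once; started a little before
  time 0 above an interface it dominates any bound near the corner where the data may jump.
  The growing term \<open>hill\<close> has concave kinks at the interfaces, which makes the flux condition
  strict and so rules out maxima there, and it takes care of infinity.\<close>

definition D :: real where "D = max (\<sigma>\<^sub>L\<^sup>2) (max (\<sigma>\<^sub>M\<^sup>2) (\<sigma>\<^sub>R\<^sup>2))"
definition \<beta> :: real where "\<beta> = min (\<sigma>\<^sub>L\<^sup>2) (min (\<sigma>\<^sub>M\<^sup>2) (\<sigma>\<^sub>R\<^sup>2)) / (2 * D)"

definition gauss :: "real \<Rightarrow> real \<Rightarrow> real" where
  "gauss s y = exp (- (\<beta> * ln s) - y\<^sup>2 / (4 * D * s))"

definition hill :: "real \<Rightarrow> real" where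
  "hill x = (if x \<le> - a then a\<^sup>2 + (x + a)\<^sup>2 else if x \<le> a then x\<^sup>2 else a\<^sup>2 + (x - a)\<^sup>2)"

lemma D_pos: "0 < D" using pos by (simp add: D_def less_max_iff_disj)

lemma \<beta>_bounds: "0 < \<beta>" "\<beta> \<le> 1"
proof -
  have "min (\<sigma>\<^sub>L\<^sup>2) (min (\<sigma>\<^sub>M\<^sup>2) (\<sigma>\<^sub>R\<^sup>2)) \<le> D" by (auto simp: D_def)
  then show "\<beta> \<le> 1" using D_pos by (simp add: \<beta>_def)
  show "0 < \<beta>" using pos D_pos by (simp add: \<beta>_def)
qed

lemma diffusivity:
  assumes "\<sigma> \<in> {\<sigma>\<^sub>L, \<sigma>\<^sub>M, \<sigma>\<^sub>R}"
  shows "\<sigma>\<^sup>2 \<le> D" "2 * D * \<beta> \<le> \<sigma>\<^sup>2"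
  using assms D_pos by (auto simp: D_def \<beta>_def)

lemma gauss_pos: "0 < gauss s y" by (simp add: gauss_def)

lemma gauss_derivatives:
  assumes s: "0 < s"
  shows "((\<lambda>x. gauss s (x + c)) has_real_derivative - ((x + c) / (2 * D * s)) * gauss s (x + c)) (at x within S)"
    and "((\<lambda>x. - ((x + c) / (2 * D * s)) * gauss s (x + c)) has_real_derivative
        ((x + c)\<^sup>2 / (4 * D\<^sup>2 * s\<^sup>2) - 1 / (2 * D * s)) * gauss s (x + c)) (at x within S)"
proof -
  show 1: "((\<lambda>x. gauss s (x + c)) has_real_derivative - ((x + c) / (2 * D * s)) * gauss s (x + c)) (at x within S)" for x S
    unfolding gauss_def using s D_pos by (auto intro!: derivative_eq_intros simp: field_simps)
  show "((\<lambda>x. - ((x + c) / (2 * D * s)) * gauss s (x + c)) has_real_derivative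
        ((x + c)\<^sup>2 / (4 * D\<^sup>2 * s\<^sup>2) - 1 / (2 * D * s)) * gauss s (x + c)) (at x within S)"
    using s D_pos by (auto intro!: derivative_eq_intros 1 simp: field_simps power2_eq_square)
qed

lemma gauss_derivative_time:
  assumes s: "0 < t + r"
  shows "((\<lambda>t. gauss (t + r) y) has_real_derivative
      (y\<^sup>2 / (4 * D * (t + r)\<^sup>2) - \<beta> / (t + r)) * gauss (t + r) y) (at t)"
proof -
  have "((\<lambda>s. gauss s y) has_real_derivative (y\<^sup>2 / (4 * D * s\<^sup>2) - \<beta> / s) * gauss s y) (at s)"
    if "0 < s" for s
    unfolding gauss_def using that D_pos
    by (auto intro!: derivative_eq_intros simp: field_simps power2_eq_square)
  from this[OF s] show ?thesis by (simp only: DERIV_shift)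
qed

text \<open>The two terms of the second derivative are compared separately:
  \<open>\<sigma>^2 \<le> D\<close> for the quadratic one,
  \<open>2 * D * \<beta> \<le> \<sigma>^2\<close> for the negative one. A heat kernel proper, with
  decay of power 1/2, would fail the second as soon as the speeds differ.\<close>

lemma gauss_supersolution:
  assumes s: "0 < s" and \<sigma>: "\<sigma> \<in> {\<sigma>\<^sub>L, \<sigma>\<^sub>M, \<sigma>\<^sub>R}"
  shows "\<sigma>\<^sup>2 * ((y\<^sup>2 / (4 * D\<^sup>2 * s\<^sup>2) - 1 / (2 * D * s)) * gauss s y) \<le> (y\<^sup>2 / (4 * D * s\<^sup>2) - \<beta> / s) * gauss s y"
proof -
  have "\<sigma>\<^sup>2 * (y\<^sup>2 / (4 * D\<^sup>2 * s\<^sup>2)) \<le> D * (y\<^sup>2 / (4 * D\<^sup>2 * s\<^sup>2))"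
    using diffusivity[OF \<sigma>] by (intro mult_right_mono) auto
  also have "\<dots> = y\<^sup>2 / (4 * D * s\<^sup>2)" using D_pos by (simp add: power2_eq_square)
  finally have 1: "\<sigma>\<^sup>2 * (y\<^sup>2 / (4 * D\<^sup>2 * s\<^sup>2)) \<le> y\<^sup>2 / (4 * D * s\<^sup>2)" .
  have "\<beta> / s = 2 * D * \<beta> / (2 * D * s)" using D_pos by simp
  also have "\<dots> \<le> \<sigma>\<^sup>2 / (2 * D * s)" using diffusivity[OF \<sigma>] D_pos s by (intro divide_right_mono) auto
  finally have "\<sigma>\<^sup>2 * (y\<^sup>2 / (4 * D\<^sup>2 * s\<^sup>2) - 1 / (2 * D * s)) \<le> y\<^sup>2 / (4 * D * s\<^sup>2) - \<beta> / s"
    using 1 by (simp add: algebra_simps)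
  from mult_right_mono[OF this less_imp_le[OF gauss_pos[of s y]]] show ?thesis by (simp add: mult.assoc)
qed

text \<open>The Gaussian centred at one interface has a slope at the other, at distance
  \<open>2 * a\<close>; up to the factor \<open>a / D\<close> this number bounds that slope,
  whatever the age of the Gaussian.\<close>

definition flux_bound :: real where "flux_bound = 1 + 2 / (a\<^sup>2 / D)\<^sup>2"

text \<open>With \<open>u = 1 / s\<close> and \<open>c = a^2 / D\<close> the quantity is
  \<open>u * u^\<beta> * exp (- c * u)\<close>. For \<open>u \<le> 1\<close> it is at most 1;
  otherwise \<open>\<beta> \<le> 1\<close> and \<open>exp v \<ge> v^2 / 2\<close> give
  \<open>2 / c^2\<close>. The constant is the sum of both bounds.\<close>

lemma gauss_flux_le:
  assumes s: "0 < s"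
  shows "1 / s * gauss s (2 * a) \<le> flux_bound" "1 / s * gauss s (- 2 * a) \<le> flux_bound"
proof -
  define u c where "u = 1 / s" and "c = a\<^sup>2 / D"
  have u: "0 < u" and c: "0 < c" using s pos D_pos by (auto simp: u_def c_def)
  have g: "gauss s (2 * a) = exp (\<beta> * ln u) * exp (- (c * u))"
    using s D_pos unfolding gauss_def exp_add[symmetric] u_def c_def
    by (intro arg_cong[where f = exp]) (simp add: ln_div power2_eq_square)
  have cu: "0 \<le> c * u" using u c by simp
  have fb: "flux_bound = 1 + 2 / c\<^sup>2" by (simp add: flux_bound_def c_def)
  have "u * gauss s (2 * a) \<le> flux_bound"
  proof (cases "u \<le> 1")
    case True
    then have "exp (\<beta> * ln u) \<le> 1" using u \<beta>_bounds by (simp add: mult_nonneg_nonpos)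
    then have "gauss s (2 * a) \<le> 1 * 1" unfolding g using cu by (intro mult_mono) auto
    then have "u * gauss s (2 * a) \<le> 1 * 1" using True u gauss_pos[of s "2 * a"] by (intro mult_mono) auto
    then show ?thesis unfolding fb using c by (auto intro: order_trans)
  next
    case False
    then have "\<beta> * ln u \<le> 1 * ln u" using \<beta>_bounds by (intro mult_right_mono) auto
    then have "exp (\<beta> * ln u) \<le> exp (ln u)" by simp
    then have "exp (\<beta> * ln u) \<le> u" using u by simp
    then have "u * gauss s (2 * a) \<le> u * (u * exp (- (c * u)))" unfolding g using u by simp
    also have "\<dots> \<le> 2 / c\<^sup>2"
    proof -
      have "(c * u)\<^sup>2 / 2 \<le> exp (c * u)" using exp_lower_Taylor_quadratic[OF cu] cu by linarith
      then show ?thesis using c by (simp add: exp_minus field_simps power2_eq_square)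
    qed
    finally show ?thesis unfolding fb by simp
  qed
  then show "1 / s * gauss s (2 * a) \<le> flux_bound" "1 / s * gauss s (- 2 * a) \<le> flux_bound"
    by (simp_all add: u_def gauss_def)
qed

end

section \<open>Comparison with the barrier\<close>

context zero_data_solution
begin

lemma hill_nonneg: "0 \<le> hill x" by (simp add: hill_def)

definition hill_x :: "real \<Rightarrow> real" where
  "hill_x x = (if x < - a then 2 * (x + a) else if x < a then 2 * x else 2 * (x - a))"

lemma hill_derivatives:
  assumes x: "x \<noteq> - a" "x \<noteq> a"
  shows "\<forall>\<^sub>F y in nhds x. (hill has_real_derivative hill_x y) (at y)"
    and "(hill_x has_real_derivative 2) (at x)"
proof -
  have *: "(\<forall>\<^sub>F y in nhds x. (hill has_real_derivative hill_x y) (at y)) \<and> (hill_x has_real_derivative 2) (at x)"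
    if I: "open I" "x \<in> I" and eq: "\<And>y. y \<in> I \<Longrightarrow> hill y = f y" "\<And>y. y \<in> I \<Longrightarrow> hill_x y = g y"
      and d: "\<And>y. (f has_real_derivative g y) (at y)" "(g has_real_derivative 2) (at x)" for I f g
  proof
    have "(hill has_real_derivative hill_x y) (at y)" if "y \<in> I" for y
      unfolding eq(2)[OF that]
      by (rule has_field_derivative_transform_within_open[OF d(1) I(1) that]) (use eq in auto)
    then show "\<forall>\<^sub>F y in nhds x. (hill has_real_derivative hill_x y) (at y)"
      using eventually_nhds_in_open[OF I] by (auto elim: eventually_mono)
    show "(hill_x has_real_derivative 2) (at x)"
      by (rule has_field_derivative_transform_within_open[OF d(2) I]) (use eq in auto)
  qed
  consider "x \<in> {..<- a}" | "x \<in> {- a<..<a}" | "x \<in> {a<..}" using x by force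
  then have "(\<forall>\<^sub>F y in nhds x. (hill has_real_derivative hill_x y) (at y)) \<and> (hill_x has_real_derivative 2) (at x)"
  proof cases
    case 1
    show ?thesis
      by (rule *[OF _ 1, of "\<lambda>x. a\<^sup>2 + (x + a)\<^sup>2" "\<lambda>x. 2 * (x + a)"])
         (auto simp: hill_def hill_x_def intro!: derivative_eq_intros)
  next
    case 2
    show ?thesis
      by (rule *[OF _ 2, of "\<lambda>x. x\<^sup>2" "\<lambda>x. 2 * x"])
         (auto simp: hill_def hill_x_def intro!: derivative_eq_intros)
  next
    case 3
    show ?thesis
      by (rule *[OF _ 3, of "\<lambda>x. a\<^sup>2 + (x - a)\<^sup>2" "\<lambda>x. 2 * (x - a)"])
         (use pos in \<open>auto simp: hill_def hill_x_def intro!: derivative_eq_intros\<close>)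
  qed
  then show "\<forall>\<^sub>F y in nhds x. (hill has_real_derivative hill_x y) (at y)" "(hill_x has_real_derivative 2) (at x)"
    by auto
qed

text \<open>At each interface the slope drops by \<open>2 * a\<close> from left to right. The outer
  slopes are zero, so the kink enters the flux balance through the middle speed alone.\<close>

lemma hill_one_sided:
  "(hill has_real_derivative 0) (at (- a) within {..- a})"
  "(hill has_real_derivative - 2 * a) (at (- a) within {- a..})"
  "(hill has_real_derivative 2 * a) (at a within {..a})"
  "(hill has_real_derivative 0) (at a within {a..})"
proof -
  have tr: "(hill has_real_derivative l) (at y within S)"
    if "(f has_real_derivative l) (at y within S)" "y \<in> S" "\<And>x. x \<in> S \<Longrightarrow> dist x y < a \<Longrightarrow> f x = hill x" for f l y S
    by (rule has_field_derivative_transform_within[OF that(1) pos(1) that(2)]) (rule that(3))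
  show "(hill has_real_derivative 0) (at (- a) within {..- a})"
    by (rule tr[of "\<lambda>x. a\<^sup>2 + (x + a)\<^sup>2"]) (auto simp: hill_def intro!: derivative_eq_intros)
  show "(hill has_real_derivative - 2 * a) (at (- a) within {- a..})"
    by (rule tr[of "\<lambda>x. x\<^sup>2"]) (auto simp: hill_def dist_real_def intro!: derivative_eq_intros)
  show "(hill has_real_derivative 2 * a) (at a within {..a})"
    by (rule tr[of "\<lambda>x. x\<^sup>2"]) (use pos in \<open>auto simp: hill_def dist_real_def intro!: derivative_eq_intros\<close>)
  show "(hill has_real_derivative 0) (at a within {a..})"
    by (rule tr[of "\<lambda>x. a\<^sup>2 + (x - a)\<^sup>2"]) (use pos in \<open>auto simp: hill_def intro!: derivative_eq_intros\<close>)
qed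

lemma continuous_hill: "continuous_on UNIV hill"
proof -
  have "continuous_on ({..- a} \<union> ({- a..a} \<union> {a..})) hill"
  proof (intro continuous_on_closed_Un closed_Un closed_atMost closed_atLeast closed_atLeastAtMost)
    show "continuous_on {..- a} hill"
      by (rule continuous_on_eq[of _ "\<lambda>x. a\<^sup>2 + (x + a)\<^sup>2"]) (auto simp: hill_def intro!: continuous_intros)
    show "continuous_on {- a..a} hill"
      by (rule continuous_on_eq[of _ "\<lambda>x. x\<^sup>2"]) (auto simp: hill_def intro!: continuous_intros)
    show "continuous_on {a..} hill"
      by (rule continuous_on_eq[of _ "\<lambda>x. a\<^sup>2 + (x - a)\<^sup>2"])
         (use pos in \<open>auto simp: hill_def intro!: continuous_intros\<close>)
  qed
  also have "{..- a} \<union> ({- a..a} \<union> {a..}) = (UNIV :: real set)" by auto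
  finally show ?thesis .
qed

text \<open>The second derivative of \<open>hill\<close> is 2 away from the interfaces and every
  diffusivity is at most \<open>D\<close>, so the rate \<open>2 * D + 1\<close> leaves a margin
  \<open>\<epsilon>\<close> in the heat inequality. The shift \<open>r\<close> sets the age of the
  Gaussians independently of the time.\<close>

definition barrier :: "real \<Rightarrow> real \<Rightarrow> real \<Rightarrow> real \<Rightarrow> real \<Rightarrow> real" where
  "barrier \<epsilon> A r x t = \<epsilon> * (1 + hill x + (2 * D + 1) * t) + A * (gauss (t + r) (x + a) + gauss (t + r) (x + - a))"

lemma flux_bound_pos: "0 < flux_bound"
  by (simp add: flux_bound_def add_pos_nonneg)

text \<open>A maximum of the difference away from the interfaces contradicts the margin in the heat
  inequality, and one at an interface contradicts the concave kink. The condition on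
  \<open>A * flux_bound\<close> says that the kink outweighs the slope which each Gaussian has at
  the opposite interface.\<close>

lemma W_less_barrier:
  assumes \<tau>: "0 < \<tau>" "0 < \<tau> + r" and \<epsilon>: "0 < \<epsilon>" and A: "0 \<le> A" "A * flux_bound < 2 * \<epsilon> * \<sigma>\<^sub>M\<^sup>2"
    and init: "\<And>x. \<bar>x\<bar> \<le> X \<Longrightarrow> W x \<tau> < barrier \<epsilon> A r x \<tau>"
    and side: "\<And>x t. \<bar>x\<bar> = X \<Longrightarrow> \<tau> \<le> t \<Longrightarrow> t \<le> T \<Longrightarrow> W x t < barrier \<epsilon> A r x t"
    and x: "\<bar>x\<bar> \<le> X" and t: "\<tau> \<le> t" "t \<le> T"
  shows "W x t < barrier \<epsilon> A r x t"
proof -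
  define V where "V x t = W x t - barrier \<epsilon> A r x t" for x t
  have "V x t < 0"
  proof (rule negative_if_no_interior_maximum[where V = V and X = X and T = T and \<tau> = \<tau>])
    have "continuous_on ({-X..X} \<times> {\<tau>..T}) (\<lambda>p. W (fst p) (snd p))"
      using continuous_on_subset[OF continuous_W[OF \<tau>(1), of T]] by (simp add: case_prod_unfold Times_subset_cancel2 subset_iff)
    moreover have "continuous_on ({-X..X} \<times> {\<tau>..T}) (\<lambda>p. hill (fst p))"
      by (rule continuous_on_compose2[OF continuous_hill]) (auto intro!: continuous_intros)
    moreover have "snd p + r \<noteq> 0" "0 < snd p + r" if "p \<in> {-X..X} \<times> {\<tau>..T}" for p
      using that \<tau> by (auto simp: mem_Times_iff)
    ultimately show "continuous_on ({-X..X} \<times> {\<tau>..T}) (\<lambda>(x, t). V x t)"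
      unfolding V_def barrier_def gauss_def case_prod_unfold using D_pos
      by (intro continuous_intros) auto
    show "V x \<tau> < 0" if "\<bar>x\<bar> \<le> X" for x using init[OF that] by (simp add: V_def)
    show "V x t < 0" if "\<bar>x\<bar> = X" "\<tau> \<le> t" "t \<le> T" for x t using side[OF that] by (simp add: V_def)
  next
    fix x t
    assume xt: "\<bar>x\<bar> < X" "\<tau> < t" "t \<le> T" and max: "\<forall>\<^sub>F y in nhds x. V y t \<le> V x t"
      and max_t: "\<forall>s\<in>{\<tau>..t}. V x s \<le> V x t"
    define s where "s = t + r"
    have s: "0 < s" using xt \<tau> by (simp add: s_def)
    have t0: "0 < t" using xt \<tau> by simp
    define G where "G y = - ((y + a) / (2 * D * s)) * gauss s (y + a) + - ((y + - a) / (2 * D * s)) * gauss s (y + - a)" for y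
    have DG: "((\<lambda>y. gauss s (y + a) + gauss s (y + - a)) has_real_derivative G y) (at y within S)" for y S
      unfolding G_def by (intro DERIV_add gauss_derivatives s)
    have DV: "((\<lambda>y. V y t) has_real_derivative w - (\<epsilon> * h + A * G y)) (at y within S)"
      if "((\<lambda>y. W y t) has_real_derivative w) (at y within S)" "(hill has_real_derivative h) (at y within S)" for w h y S
    proof -
      have "((\<lambda>y. \<epsilon> * (1 + hill y + (2 * D + 1) * t)) has_real_derivative \<epsilon> * h) (at y within S)"
        using that(2) by (auto intro!: derivative_eq_intros)
      from DERIV_diff[OF that(1) DERIV_add[OF this DERIV_cmult[OF DG, of A]]]
      show ?thesis unfolding V_def barrier_def s_def[symmetric] .
    qed
    define \<kappa> where "\<kappa> = 1 / s * gauss s (2 * a)"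
    have \<kappa>: "0 < \<kappa>" "\<kappa> \<le> flux_bound" using gauss_flux_le(1)[OF s] gauss_pos[of s "2 * a"] s by (auto simp: \<kappa>_def)
    have g2: "gauss s (- (2 * a)) = gauss s (2 * a)" by (simp add: gauss_def)
    \<comment> \<open>A Gaussian has zero slope at its own centre, so each value comes from the
      Gaussian at the other interface.\<close>
    have Ga: "G (- a) = a / D * \<kappa>" "G a = - (a / D * \<kappa>)"
      unfolding G_def \<kappa>_def using D_pos s g2 by (auto simp: field_simps)
    \<comment> \<open>The slopes of the Gaussians do not jump, but the flux weights do; the
      resulting defect is at most \<open>D\<close> times the slope and stays below the contribution
      \<open>2 * a * \<epsilon> * \<sigma>\<^sub>M^2\<close> of the kink.\<close>
    have flux: "(\<sigma>\<^sub>M\<^sup>2 - \<sigma>\<^sup>2) * (A * (a / D * \<kappa>)) < 2 * a * \<epsilon> * \<sigma>\<^sub>M\<^sup>2" for \<sigma>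
    proof -
      have "\<sigma>\<^sub>M\<^sup>2 \<le> D" using diffusivity(1)[of \<sigma>\<^sub>M] by simp
      then have "\<sigma>\<^sub>M\<^sup>2 - \<sigma>\<^sup>2 \<le> D" using zero_le_power2[of \<sigma>] by linarith
      then have "(\<sigma>\<^sub>M\<^sup>2 - \<sigma>\<^sup>2) * (A * (a / D * \<kappa>)) \<le> D * (A * (a / D * \<kappa>))"
        using A pos D_pos \<kappa> by (intro mult_right_mono) auto
      also have "\<dots> = a * (A * \<kappa>)" using D_pos by simp
      also have "\<dots> \<le> a * (A * flux_bound)" using A pos \<kappa> by (intro mult_left_mono) auto
      also have "\<dots> < a * (2 * \<epsilon> * \<sigma>\<^sub>M\<^sup>2)" using A pos by (intro mult_strict_left_mono) auto
      finally show ?thesis by (simp add: mult_ac)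
    qed
    have max_left: "\<forall>\<^sub>F y in nhds x. y \<le> x \<longrightarrow> V y t \<le> V x t" using max by (rule eventually_mono) simp
    have max_right: "\<forall>\<^sub>F y in nhds x. x \<le> y \<longrightarrow> V y t \<le> V x t" using max by (rule eventually_mono) simp
    consider "x = - a" | "x = a" | "x \<noteq> - a" "x \<noteq> a" by blast
    then show False
    proof cases
      \<comment> \<open>At a maximum the left slope is nonnegative and the right slope nonpositive.
        Weighting them and inserting the flux condition for \<open>W\<close> contradicts
        \<open>flux\<close>.\<close>
      case 1
      obtain p q where W: "((\<lambda>x. W x t) has_real_derivative p) (at (- a) within {..- a})"
        "((\<lambda>x. W x t) has_real_derivative q) (at (- a) within {- a..})" "\<sigma>\<^sub>L\<^sup>2 * p = \<sigma>\<^sub>M\<^sup>2 * q"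
        by (rule W_interface[OF t0]) (rule that)
      have "0 \<le> p - (\<epsilon> * 0 + A * G (- a))"
        by (rule left_derivative_at_max[OF max_left[unfolded 1] DV[OF W(1) hill_one_sided(1)]])
      then have "\<sigma>\<^sub>L\<^sup>2 * (A * (a / D * \<kappa>)) \<le> \<sigma>\<^sub>L\<^sup>2 * p" by (intro mult_left_mono) (auto simp: Ga)
      moreover have "q - (\<epsilon> * (- 2 * a) + A * G (- a)) \<le> 0"
        by (rule right_derivative_at_max[OF max_right[unfolded 1] DV[OF W(2) hill_one_sided(2)]])
      then have "\<sigma>\<^sub>M\<^sup>2 * q \<le> \<sigma>\<^sub>M\<^sup>2 * (A * (a / D * \<kappa>) - 2 * a * \<epsilon>)" by (intro mult_left_mono) (auto simp: Ga algebra_simps)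
      ultimately have "\<sigma>\<^sub>L\<^sup>2 * (A * (a / D * \<kappa>)) \<le> \<sigma>\<^sub>M\<^sup>2 * (A * (a / D * \<kappa>)) - 2 * a * \<epsilon> * \<sigma>\<^sub>M\<^sup>2"
        using W(3) by (simp add: right_diff_distrib mult_ac)
      then show False using flux[of \<sigma>\<^sub>L] unfolding left_diff_distrib by linarith
    next
      case 2
      obtain p q where W: "((\<lambda>x. W x t) has_real_derivative p) (at a within {..a})"
        "((\<lambda>x. W x t) has_real_derivative q) (at a within {a..})" "\<sigma>\<^sub>M\<^sup>2 * p = \<sigma>\<^sub>R\<^sup>2 * q"
        by (rule W_interface[OF t0]) (rule that)
      have "0 \<le> p - (\<epsilon> * (2 * a) + A * G a)"
        by (rule left_derivative_at_max[OF max_left[unfolded 2] DV[OF W(1) hill_one_sided(3)]])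
      then have "\<sigma>\<^sub>M\<^sup>2 * (2 * a * \<epsilon> - A * (a / D * \<kappa>)) \<le> \<sigma>\<^sub>M\<^sup>2 * p" by (intro mult_left_mono) (auto simp: Ga algebra_simps)
      moreover have "q - (\<epsilon> * 0 + A * G a) \<le> 0"
        by (rule right_derivative_at_max[OF max_right[unfolded 2] DV[OF W(2) hill_one_sided(4)]])
      then have "\<sigma>\<^sub>R\<^sup>2 * q \<le> \<sigma>\<^sub>R\<^sup>2 * (- (A * (a / D * \<kappa>)))" by (intro mult_left_mono) (auto simp: Ga)
      ultimately have "2 * a * \<epsilon> * \<sigma>\<^sub>M\<^sup>2 - \<sigma>\<^sub>M\<^sup>2 * (A * (a / D * \<kappa>)) \<le> - (\<sigma>\<^sub>R\<^sup>2 * (A * (a / D * \<kappa>)))"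
        using W(3) by (simp add: right_diff_distrib mult_ac)
      then show False using flux[of \<sigma>\<^sub>R] unfolding left_diff_distrib by linarith
    next
      case 3
      obtain \<sigma> g l where W: "\<sigma> \<in> {\<sigma>\<^sub>L, \<sigma>\<^sub>M, \<sigma>\<^sub>R}" "\<forall>\<^sub>F y in nhds x. ((\<lambda>x. W x t) has_real_derivative g y) (at y)"
        "(g has_real_derivative l) (at x)" "((\<lambda>s. W x s) has_real_derivative \<sigma>\<^sup>2 * l) (at t)"
        by (rule W_heat[OF 3 t0]) (rule that)
      define G2 where "G2 y = (y\<^sup>2 / (4 * D\<^sup>2 * s\<^sup>2) - 1 / (2 * D * s)) * gauss s y" for y
      define Gt where "Gt y = (y\<^sup>2 / (4 * D * s\<^sup>2) - \<beta> / s) * gauss s y" for y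
      have "\<forall>\<^sub>F y in nhds x. ((\<lambda>y. V y t) has_real_derivative g y - (\<epsilon> * hill_x y + A * G y)) (at y)"
        using W(2) hill_derivatives(1)[OF 3] by eventually_elim (rule DV)
      moreover have "((\<lambda>y. g y - (\<epsilon> * hill_x y + A * G y)) has_real_derivative l - (\<epsilon> * 2 + A * (G2 (x + a) + G2 (x + - a)))) (at x)"
        unfolding G_def G2_def
        by (intro DERIV_diff DERIV_add DERIV_cmult W(3) hill_derivatives(2)[OF 3] gauss_derivatives(2) s)
      ultimately have "l - (\<epsilon> * 2 + A * (G2 (x + a) + G2 (x + - a))) \<le> 0"
        by (rule second_derivative_nonpos_at_max) (rule max)
      then have "\<sigma>\<^sup>2 * l \<le> \<sigma>\<^sup>2 * (\<epsilon> * 2 + A * (G2 (x + a) + G2 (x + - a)))" by (intro mult_left_mono) auto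
      also have "\<dots> = \<sigma>\<^sup>2 * (2 * \<epsilon>) + A * (\<sigma>\<^sup>2 * G2 (x + a) + \<sigma>\<^sup>2 * G2 (x + - a))" by (simp add: algebra_simps)
      also have "\<dots> \<le> D * (2 * \<epsilon>) + A * (Gt (x + a) + Gt (x + - a))"
        unfolding G2_def Gt_def using diffusivity(1)[OF W(1)] \<epsilon> A
        by (intro add_mono mult_right_mono mult_left_mono gauss_supersolution s W(1)) auto
      finally have 1: "\<sigma>\<^sup>2 * l \<le> D * (2 * \<epsilon>) + A * (Gt (x + a) + Gt (x + - a))" .
      have "((\<lambda>t. V x t) has_real_derivative \<sigma>\<^sup>2 * l - (\<epsilon> * (2 * D + 1) + A * (Gt (x + a) + Gt (x + - a)))) (at t)"
        unfolding V_def barrier_def Gt_def s_def using s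
        by (auto intro!: derivative_eq_intros W(4) gauss_derivative_time simp: s_def)
      \<comment> \<open>The derivative is taken from the left because only earlier times are known
        to give smaller values.\<close>
      then have "((\<lambda>t. V x t) has_real_derivative \<sigma>\<^sup>2 * l - (\<epsilon> * (2 * D + 1) + A * (Gt (x + a) + Gt (x + - a)))) (at t within {..t})"
        by (rule has_field_derivative_at_within)
      moreover have "\<forall>\<^sub>F s in nhds t. s \<le> t \<longrightarrow> V x s \<le> V x t"
        using eventually_nhds_in_open[of "{\<tau><..}" t] max_t xt by (auto elim!: eventually_mono)
      ultimately have "0 \<le> \<sigma>\<^sup>2 * l - (\<epsilon> * (2 * D + 1) + A * (Gt (x + a) + Gt (x + - a)))"
        by (rule left_derivative_at_max[rotated])
      then show False using 1 \<epsilon> by (simp add: algebra_simps)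
    qed
  qed (use x t in auto)
  then show ?thesis by (simp add: V_def)
qed

lemma gauss_le:
  assumes "0 < s0" "s0 \<le> s"
  shows "gauss s y \<le> exp (- (\<beta> * ln s0))"
proof -
  have "\<beta> * ln s0 \<le> \<beta> * ln s" using assms \<beta>_bounds by (intro mult_left_mono) auto
  moreover have "0 \<le> y\<^sup>2 / (4 * D * s)" using assms D_pos by simp
  ultimately show ?thesis unfolding gauss_def by simp
qed

text \<open>The constants depend on each other in this order: \<open>\<epsilon>\<close>; an
  amplitude \<open>A\<close> so small that the Gaussians are harmless for the fluxes and at the
  target point; an initial age \<open>\<theta>\<close> so small that nevertheless \<open>A\<close>
  times the Gaussian exceeds the bound of \<open>W\<close> near a corner; and a starting time
  \<open>\<tau>\<close> so early that \<open>W\<close> is below \<open>\<epsilon>\<close> away from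
  the corners. Finally \<open>\<epsilon>\<close> tends to 0.\<close>

lemma W_nonpos:
  assumes t0: "0 < t0"
  shows "W x0 t0 \<le> 0"
proof -
  \<comment> \<open>The value 2 consists of the constant 1 in the barrier and another 1 for the two
    Gaussians, which together amount to at most \<open>\<epsilon>\<close> at time
    \<open>t0\<close>.\<close>
  define N where "N = 2 + hill x0 + (2 * D + 1) * t0"
  have N: "0 < N" using hill_nonneg[of x0] D_pos t0 by (simp add: N_def add_pos_nonneg)
  have main: "W x0 t0 \<le> \<epsilon> * N" if \<epsilon>: "0 < \<epsilon>" for \<epsilon>
  proof -
    obtain C where "\<forall>x. \<forall>t\<in>{0..t0}. \<bar>W x t\<bar> \<le> C" using W_bounded[of t0] t0 by auto
    then have C: "W x t \<le> C" "0 \<le> C" if "0 \<le> t" "t \<le> t0" for x t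
      using that by (force simp: abs_le_iff)+
    have C0: "0 \<le> C" using C(2)[of t0] t0 by simp
    \<comment> \<open>Bounds a Gaussian at time \<open>t0\<close>: its age
      \<open>t0 + (\<theta> - \<tau>)\<close> is then at least \<open>t0 / 2\<close>.\<close>
    define g where "g = exp (- (\<beta> * ln (t0 / 2)))"
    define A where "A = min (\<epsilon> * \<sigma>\<^sub>M\<^sup>2 / flux_bound) (\<epsilon> / (2 * g))"
    have A0: "0 < A" using \<epsilon> pos flux_bound_pos by (simp add: A_def g_def)
    have "A * flux_bound \<le> (\<epsilon> * \<sigma>\<^sub>M\<^sup>2 / flux_bound) * flux_bound"
      using flux_bound_pos by (intro mult_right_mono) (auto simp: A_def)
    also have "\<dots> < 2 * \<epsilon> * \<sigma>\<^sub>M\<^sup>2" using flux_bound_pos \<epsilon> pos by simp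
    finally have A1: "A * flux_bound < 2 * \<epsilon> * \<sigma>\<^sub>M\<^sup>2" .
    have A2: "A * (2 * g) \<le> \<epsilon>"
    proof -
      have "A * (2 * g) \<le> \<epsilon> / (2 * g) * (2 * g)" by (intro mult_right_mono) (auto simp: A_def g_def)
      then show ?thesis by (simp add: g_def)
    qed
    \<comment> \<open>Chosen so that \<open>\<theta>^(- \<beta>) = exp \<Lambda>\<close>. For
      \<open>\<bar>y\<bar> \<le> sqrt \<theta>\<close> the spatial factor of the Gaussian is at
      least \<open>exp (- 1 / (4 * D))\<close>, which the second summand compensates.\<close>
    define \<Lambda> where "\<Lambda> = ln ((C + 1) / A) + 1 / (4 * D)"
    define \<theta> where "\<theta> = exp (- (\<Lambda> / \<beta>))"
    have \<theta>: "0 < \<theta>" "- (\<beta> * ln \<theta>) = \<Lambda>" using \<beta>_bounds by (auto simp: \<theta>_def)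
    define \<delta> where "\<delta> = sqrt \<theta>"
    have \<delta>: "0 < \<delta>" "\<delta>\<^sup>2 = \<theta>" using \<theta> by (auto simp: \<delta>_def)
    have corner: "C + 1 \<le> A * gauss \<theta> y" if "\<bar>y\<bar> \<le> \<delta>" for y
    proof -
      have "y\<^sup>2 \<le> \<theta>" using power_mono[OF that, of 2] \<delta> by simp
      then have "y\<^sup>2 / (4 * D * \<theta>) \<le> \<theta> / (4 * D * \<theta>)" using D_pos \<theta> by (intro divide_right_mono) auto
      then have "y\<^sup>2 / (4 * D * \<theta>) \<le> 1 / (4 * D)" using \<theta> by simp
      then have "exp (ln ((C + 1) / A)) \<le> gauss \<theta> y"
        unfolding gauss_def \<theta>(2) \<Lambda>_def by simp
      then have "(C + 1) / A \<le> gauss \<theta> y" using C0 A0 by simp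
      then show ?thesis using A0 by (simp add: field_simps)
    qed
    \<comment> \<open>At \<open>\<bar>x\<bar> = X\<close> one has
      \<open>hill x \<ge> (C / \<epsilon> + 1)^2 \<ge> C / \<epsilon>\<close>, so
      \<open>\<epsilon> * hill x\<close> alone dominates the bound \<open>C\<close>.\<close>
    define X where "X = max \<bar>x0\<bar> (a + C / \<epsilon> + 1)"
    have X: "\<bar>x0\<bar> \<le> X" "a + C / \<epsilon> + 1 \<le> X" by (auto simp: X_def)
    obtain d where d: "0 < d"
      "\<And>x t. \<bar>x\<bar> \<le> X \<Longrightarrow> \<delta> \<le> \<bar>x + a\<bar> \<Longrightarrow> \<delta> \<le> \<bar>x - a\<bar> \<Longrightarrow> 0 \<le> t \<Longrightarrow> t \<le> d \<Longrightarrow> \<bar>W x t\<bar> < \<epsilon>"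
      by (rule W_small[OF \<delta>(1) \<epsilon>]) (rule that)
    \<comment> \<open>The comparison starts at a positive time, where \<open>W\<close> is continuous
      across the interfaces. With \<open>r = \<theta> - \<tau>\<close>, possibly negative, the
      Gaussians have age \<open>\<theta>\<close> at that moment.\<close>
    define \<tau> where "\<tau> = min d (t0 / 2)"
    have \<tau>: "0 < \<tau>" "\<tau> \<le> d" "\<tau> \<le> t0 / 2" using d t0 by (auto simp: \<tau>_def)
    have ge: "\<epsilon> \<le> barrier \<epsilon> A (\<theta> - \<tau>) x t" "\<epsilon> * hill x < barrier \<epsilon> A (\<theta> - \<tau>) x t"
      "A * gauss (t + (\<theta> - \<tau>)) (x + a) \<le> barrier \<epsilon> A (\<theta> - \<tau>) x t"
      "A * gauss (t + (\<theta> - \<tau>)) (x - a) \<le> barrier \<epsilon> A (\<theta> - \<tau>) x t" if "0 \<le> t" for x t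
    proof -
      have p: "0 \<le> \<epsilon> * hill x" "0 \<le> \<epsilon> * ((2 * D + 1) * t)" "0 \<le> A * gauss (t + (\<theta> - \<tau>)) (x + a)"
        "0 \<le> A * gauss (t + (\<theta> - \<tau>)) (x - a)"
        using \<epsilon> A0 D_pos that hill_nonneg[of x] gauss_pos[THEN less_imp_le] by auto
      have b: "barrier \<epsilon> A (\<theta> - \<tau>) x t = \<epsilon> + \<epsilon> * hill x + \<epsilon> * ((2 * D + 1) * t)
          + A * gauss (t + (\<theta> - \<tau>)) (x + a) + A * gauss (t + (\<theta> - \<tau>)) (x - a)"
        unfolding barrier_def by (simp add: distrib_left)
      show "\<epsilon> \<le> barrier \<epsilon> A (\<theta> - \<tau>) x t" "\<epsilon> * hill x < barrier \<epsilon> A (\<theta> - \<tau>) x t"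
        "A * gauss (t + (\<theta> - \<tau>)) (x + a) \<le> barrier \<epsilon> A (\<theta> - \<tau>) x t"
        "A * gauss (t + (\<theta> - \<tau>)) (x - a) \<le> barrier \<epsilon> A (\<theta> - \<tau>) x t"
        unfolding b using p \<epsilon> by linarith+
    qed
    have "W x0 t0 < barrier \<epsilon> A (\<theta> - \<tau>) x0 t0"
    proof (rule W_less_barrier[where \<tau> = \<tau> and X = X and T = t0])
      show "W x \<tau> < barrier \<epsilon> A (\<theta> - \<tau>) x \<tau>" if x: "\<bar>x\<bar> \<le> X" for x
      proof (cases "\<delta> \<le> \<bar>x + a\<bar> \<and> \<delta> \<le> \<bar>x - a\<bar>")
        case True
        then have "\<bar>W x \<tau>\<bar> < \<epsilon>" using d(2)[OF x] \<tau> by auto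
        then show ?thesis using ge(1)[of \<tau> x] \<tau> by linarith
      next
        case False
        have "W x \<tau> \<le> C" using C(1)[of \<tau> x] \<tau> t0 by simp
        moreover have "\<tau> + (\<theta> - \<tau>) = \<theta>" by simp
        then have "C + 1 \<le> barrier \<epsilon> A (\<theta> - \<tau>) x \<tau>"
          using False corner[of "x + a"] corner[of "x - a"] ge(3,4)[of \<tau> x] \<tau> by fastforce
        ultimately show ?thesis by simp
      qed
      show "W x t < barrier \<epsilon> A (\<theta> - \<tau>) x t" if x: "\<bar>x\<bar> = X" and t: "\<tau> \<le> t" "t \<le> t0" for x t
      proof -
        have "C / \<epsilon> + 1 \<le> \<bar>x\<bar> - a" using X x by simp
        moreover have ce: "0 \<le> C / \<epsilon>" using C0 \<epsilon> by simp
        ultimately have "(C / \<epsilon> + 1)\<^sup>2 \<le> (\<bar>x\<bar> - a)\<^sup>2" by (intro power_mono) auto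
        moreover have "v \<le> (v + 1)\<^sup>2" if "0 \<le> v" for v :: real
          using that zero_le_power2[of v] by (simp add: power2_eq_square algebra_simps)
        from this[OF ce] have "C / \<epsilon> \<le> (C / \<epsilon> + 1)\<^sup>2" .
        moreover have "(\<bar>x\<bar> - a)\<^sup>2 \<le> hill x"
        proof -
          have ax: "a < \<bar>x\<bar>" using X x ce by simp
          show ?thesis
          proof (cases "0 \<le> x")
            case True
            then show ?thesis using ax pos by (simp add: hill_def)
          next
            case False
            moreover have "(- x - a)\<^sup>2 = (x + a)\<^sup>2" by (simp add: power2_eq_square algebra_simps)
            ultimately show ?thesis using ax by (simp add: hill_def)
          qed
        qed
        ultimately have "C / \<epsilon> \<le> hill x" by linarith
        then have "C \<le> \<epsilon> * hill x" using \<epsilon> by (simp add: field_simps)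
        then show ?thesis using C(1)[of t x] ge(2)[of t x] t \<tau> by simp
      qed
    qed (use \<tau> \<theta> \<epsilon> A0 A1 X t0 in auto)
    also have "barrier \<epsilon> A (\<theta> - \<tau>) x0 t0 \<le> \<epsilon> * (1 + hill x0 + (2 * D + 1) * t0) + A * (g + g)"
      unfolding barrier_def g_def using A0 \<tau> \<theta> t0
      by (intro add_left_mono mult_left_mono add_mono gauss_le) auto
    also have "\<dots> \<le> \<epsilon> * N" using A2 by (simp add: N_def algebra_simps)
    finally show ?thesis by simp
  qed
  show ?thesis
  proof (rule ccontr)
    assume "\<not> W x0 t0 \<le> 0"
    then have w: "0 < W x0 t0" by simp
    have "W x0 t0 \<le> W x0 t0 / (2 * N) * N" by (rule main) (use w N in simp)
    also have "\<dots> = W x0 t0 / 2" using N by simp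
    finally show False using w by simp
  qed
qed

end

section \<open>Differences of solutions and uniqueness\<close>

lemma heat_equation_diff:
  assumes "heat_equation \<sigma> I u" "heat_equation \<sigma> I v"
  shows "heat_equation \<sigma> I (\<lambda>x t. u x t - v x t)"
proof -
  obtain ux where u: "\<forall>x\<in>I. \<forall>t>0. ((\<lambda>y. u y t) has_real_derivative ux x t) (at x) \<and>
      (\<exists>l. ((\<lambda>y. ux y t) has_real_derivative l) (at x) \<and> ((\<lambda>s. u x s) has_real_derivative \<sigma>\<^sup>2 * l) (at t))"
    using assms(1) unfolding heat_equation_def by blast
  obtain vx where v: "\<forall>x\<in>I. \<forall>t>0. ((\<lambda>y. v y t) has_real_derivative vx x t) (at x) \<and>
      (\<exists>l. ((\<lambda>y. vx y t) has_real_derivative l) (at x) \<and> ((\<lambda>s. v x s) has_real_derivative \<sigma>\<^sup>2 * l) (at t))"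
    using assms(2) unfolding heat_equation_def by blast
  show ?thesis
    unfolding heat_equation_def
  proof (intro exI[of _ "\<lambda>x t. ux x t - vx x t"] ballI allI impI conjI)
    fix x t assume x: "x \<in> I" and t: "(0::real) < t"
    show "((\<lambda>y. u y t - v y t) has_real_derivative ux x t - vx x t) (at x)"
      using u v x t by (intro DERIV_diff) auto
    obtain l where l: "((\<lambda>y. ux y t) has_real_derivative l) (at x)" "((\<lambda>s. u x s) has_real_derivative \<sigma>\<^sup>2 * l) (at t)"
      using u x t by blast
    obtain m where m: "((\<lambda>y. vx y t) has_real_derivative m) (at x)" "((\<lambda>s. v x s) has_real_derivative \<sigma>\<^sup>2 * m) (at t)"
      using v x t by blast
    show "\<exists>uxx. ((\<lambda>y. ux y t - vx y t) has_real_derivative uxx) (at x) \<and>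
        ((\<lambda>\<tau>. u x \<tau> - v x \<tau>) has_real_derivative \<sigma>\<^sup>2 * uxx) (at t)"
      using DERIV_diff[OF l(1) m(1)] DERIV_diff[OF l(2) m(2)]
      by (intro exI[of _ "l - m"]) (simp add: right_diff_distrib)
  qed
qed

lemma regular_diff:
  assumes "regular_up_to_boundary I E u" "regular_up_to_boundary I E v"
  shows "regular_up_to_boundary I E (\<lambda>x t. u x t - v x t)"
  unfolding regular_up_to_boundary_def
proof (intro conjI allI impI)
  show "continuous_on (I \<times> {0..} - E \<times> {0}) (\<lambda>(x, t). u x t - v x t)"
    using assms unfolding regular_up_to_boundary_def case_prod_unfold by (intro continuous_on_diff) auto
  fix T :: real assume T: "0 \<le> T"
  obtain B where B: "\<forall>x\<in>I. \<forall>t\<in>{0..T}. \<bar>u x t\<bar> \<le> B" using assms(1) T unfolding regular_up_to_boundary_def by blast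
  obtain C where C: "\<forall>x\<in>I. \<forall>t\<in>{0..T}. \<bar>v x t\<bar> \<le> C" using assms(2) T unfolding regular_up_to_boundary_def by blast
  have "\<bar>u x t - v x t\<bar> \<le> B + C" if "x \<in> I" "t \<in> {0..T}" for x t
    using B C that by (intro order_trans[OF abs_triangle_ineq4] add_mono) auto
  then show "\<exists>C. \<forall>x\<in>I. \<forall>t\<in>{0..T}. \<bar>u x t - v x t\<bar> \<le> C" by blast
qed

lemma interface_conditions_diff:
  assumes "interface_conditions a \<sigma>1 \<sigma>2 \<sigma>3 u1 u2 u3" "interface_conditions a \<sigma>1 \<sigma>2 \<sigma>3 v1 v2 v3"
  shows "interface_conditions a \<sigma>1 \<sigma>2 \<sigma>3 (\<lambda>x. u1 x - v1 x) (\<lambda>x. u2 x - v2 x) (\<lambda>x. u3 x - v3 x)"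
proof -
  obtain p q p' q' where u: "u1 (- a) = u2 (- a)" "u2 a = u3 a"
    "(u1 has_real_derivative p) (at (- a) within {..- a})" "(u2 has_real_derivative q) (at (- a) within {- a..a})" "\<sigma>1\<^sup>2 * p = \<sigma>2\<^sup>2 * q"
    "(u2 has_real_derivative p') (at a within {- a..a})" "(u3 has_real_derivative q') (at a within {a..})" "\<sigma>2\<^sup>2 * p' = \<sigma>3\<^sup>2 * q'"
    using assms(1) unfolding interface_conditions_def by blast
  obtain r s r' s' where v: "v1 (- a) = v2 (- a)" "v2 a = v3 a"
    "(v1 has_real_derivative r) (at (- a) within {..- a})" "(v2 has_real_derivative s) (at (- a) within {- a..a})" "\<sigma>1\<^sup>2 * r = \<sigma>2\<^sup>2 * s"
    "(v2 has_real_derivative r') (at a within {- a..a})" "(v3 has_real_derivative s') (at a within {a..})" "\<sigma>2\<^sup>2 * r' = \<sigma>3\<^sup>2 * s'"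
    using assms(2) unfolding interface_conditions_def by blast
  have "\<sigma>1\<^sup>2 * (p - r) = \<sigma>2\<^sup>2 * (q - s)" "\<sigma>2\<^sup>2 * (p' - r') = \<sigma>3\<^sup>2 * (q' - s')"
    using u(5,8) v(5,8) by (simp_all add: right_diff_distrib)
  then show ?thesis
    unfolding interface_conditions_def using u(1,2) v(1,2)
      DERIV_diff[OF u(3) v(3)] DERIV_diff[OF u(4) v(4)] DERIV_diff[OF u(6) v(6)] DERIV_diff[OF u(7) v(7)]
    by (intro conjI exI) auto
qed

text \<open>The sign argument is applied to the difference \<open>u - v\<close>; exchanging the two
  solutions turns the inequalities into equality.\<close>

lemma heat_solution_le:
  assumes pos: "0 < a" "0 < \<sigma>1" "0 < \<sigma>2" "0 < \<sigma>3" and J: "{0<..} \<subseteq> J"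
    and u: "heat_solution a \<sigma>1 \<sigma>2 \<sigma>3 d1 d2 d3 J u1 u2 u3"
    and v: "heat_solution a \<sigma>1 \<sigma>2 \<sigma>3 d1 d2 d3 J v1 v2 v3" and t: "0 < t"
  shows "x \<le> - a \<Longrightarrow> u1 x t \<le> v1 x t" "x \<in> {- a..a} \<Longrightarrow> u2 x t \<le> v2 x t" "a \<le> x \<Longrightarrow> u3 x t \<le> v3 x t"
proof -
  interpret Z: zero_data_solution a \<sigma>1 \<sigma>2 \<sigma>3 "\<lambda>x t. u1 x t - v1 x t" "\<lambda>x t. u2 x t - v2 x t" "\<lambda>x t. u3 x t - v3 x t"
    by unfold_locales
      (use pos J u v in \<open>auto simp: heat_solution_def subset_iff intro!: heat_equation_diff regular_diff interface_conditions_diff\<close>)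
  show "x \<le> - a \<Longrightarrow> u1 x t \<le> v1 x t" "x \<in> {- a..a} \<Longrightarrow> u2 x t \<le> v2 x t" "a \<le> x \<Longrightarrow> u3 x t \<le> v3 x t"
    using Z.W_nonpos[OF t, of x] Z.W_eq[of t x] t by auto
qed

section \<open>The transforms of the extended data\<close>

text \<open>Factors of this kind express travel-time shifts in transforms, in the variable
  \<open>\<kappa>\<close>, which is \<open>\<sigma> * k\<close> up to sign and common to all layers.
  Since phases multiply by adding their arguments, matching exponents becomes a balance of travel
  times.\<close>

definition phase :: "real \<Rightarrow> complex \<Rightarrow> complex" where
  "phase \<beta> k = exp (\<i> * k * complex_of_real \<beta>)"

lemma phase_add: "phase \<beta> k * phase \<gamma> k = phase (\<beta> + \<gamma>) k"
  by (simp add: phase_def exp_add[symmetric] algebra_simps)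

lemma phase_nonzero: "phase \<beta> k \<noteq> 0" by (simp add: phase_def)

lemma phase_0 [simp]: "phase 0 k = 1" by (simp add: phase_def)

text \<open>An affine substitution onto the half-line that starts at the interface \<open>c\<close>.
  A negative \<open>d\<close> reads the data from right to left, which is the direction away from
  the interface for the left layer.\<close>

lemma fourier_on_laplace:
  assumes d: "d \<noteq> 0" and F: "\<And>z. indicator I (c + d * z) * u (c + d * z) = indicator {0<..} z * F z"
  shows "fourier_on I u k = of_real \<bar>d\<bar> * (phase (- c) k * laplace F (of_real d * k))"
proof -
  let ?g = "\<lambda>y. indicator I y *\<^sub>R (exp (- (\<i> * k * complex_of_real y)) * complex_of_real (u y))"
  have "fourier_on I u k = \<bar>d\<bar> *\<^sub>R (LBINT z. ?g (c + d * z))"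
    unfolding fourier_on_def set_lebesgue_integral_def by (rule lborel_integral_real_affine[OF d])
  also have "(\<lambda>z. ?g (c + d * z)) = (\<lambda>z. phase (- c) k * (indicator {0<..} z *\<^sub>R (exp (- (\<i> * (of_real d * k) * complex_of_real z)) * complex_of_real (F z))))"
  proof
    fix z
    have e: "exp (- (\<i> * k * complex_of_real (c + d * z))) = phase (- c) k * exp (- (\<i> * (of_real d * k) * complex_of_real z))"
      unfolding phase_def exp_add[symmetric] by (rule arg_cong[where f = exp]) (simp add: algebra_simps)
    have 1: "?g (c + d * z) = exp (- (\<i> * k * complex_of_real (c + d * z))) * complex_of_real (indicator I (c + d * z) * u (c + d * z))"
      by (simp add: indicator_def)
    have 2: "exp (- (\<i> * k * complex_of_real (c + d * z))) * complex_of_real (indicator I (c + d * z) * u (c + d * z))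
      = phase (- c) k * (indicator {0<..} z *\<^sub>R (exp (- (\<i> * (of_real d * k) * complex_of_real z)) * complex_of_real (F z)))"
      unfolding F e by (cases "0 < z") auto
    show "?g (c + d * z) = phase (- c) k * (indicator {0<..} z *\<^sub>R (exp (- (\<i> * (of_real d * k) * complex_of_real z)) * complex_of_real (F z)))"
      by (rule trans[OF 1 2])
  qed
  also have "(LBINT z. phase (- c) k * (indicator {0<..} z *\<^sub>R (exp (- (\<i> * (of_real d * k) * complex_of_real z)) * complex_of_real (F z))))
     = phase (- c) k * laplace F (of_real d * k)"
    by (simp only: laplace_def set_lebesgue_integral_def integral_mult_right_zero)
  finally show ?thesis by (simp add: scaleR_conv_of_real)
qed

lemma heat_kernel_scale:
  assumes "0 < \<sigma>" "0 < t"
  shows "\<sigma> * heat_kernel (\<sigma>\<^sup>2 * t) (\<sigma> * y) = heat_kernel t y"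
proof -
  have "sqrt (4 * pi * (\<sigma>\<^sup>2 * t)) = \<sigma> * sqrt (4 * pi * t)"
    using assms real_sqrt_mult[of "\<sigma>\<^sup>2" "4 * pi * t"] by (simp add: mult_ac)
  moreover have "(\<sigma> * y)\<^sup>2 / (4 * (\<sigma>\<^sup>2 * t)) = y\<^sup>2 / (4 * t)" using assms by (simp add: power_mult_distrib)
  ultimately show ?thesis using assms unfolding heat_kernel_def by simp
qed

lemma data_integral_scale:
  assumes \<sigma>: "0 < \<sigma>" and t: "0 < t"
    and F: "\<And>y. indicator I (x0 + \<sigma> * y) * u (x0 + \<sigma> * y) = indicator I' y * f y"
  shows "(LBINT Y:I. heat_kernel (\<sigma>\<^sup>2 * t) (x - Y) * u Y) = (LBINT y:I'. heat_kernel t ((x - x0) / \<sigma> - y) * f y)"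
proof -
  let ?g = "\<lambda>Y. indicator I Y *\<^sub>R (heat_kernel (\<sigma>\<^sup>2 * t) (x - Y) * u Y)"
  have "(LBINT Y. ?g Y) = \<bar>\<sigma>\<bar> *\<^sub>R (LBINT y. ?g (x0 + \<sigma> * y))"
    using \<sigma> by (intro lborel_integral_real_affine) auto
  also have "\<dots> = (LBINT y. \<sigma> * ?g (x0 + \<sigma> * y))" using \<sigma> by simp
  also have "(\<lambda>y. \<sigma> * ?g (x0 + \<sigma> * y)) = (\<lambda>y. indicator I' y *\<^sub>R (heat_kernel t ((x - x0) / \<sigma> - y) * f y))"
  proof
    fix y
    have x: "x - (x0 + \<sigma> * y) = \<sigma> * ((x - x0) / \<sigma> - y)" using \<sigma> by (simp add: field_simps)
    have 1: "\<sigma> * ?g (x0 + \<sigma> * y) = \<sigma> * heat_kernel (\<sigma>\<^sup>2 * t) (x - (x0 + \<sigma> * y)) * (indicator I (x0 + \<sigma> * y) * u (x0 + \<sigma> * y))"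
      by simp
    have 2: "\<sigma> * heat_kernel (\<sigma>\<^sup>2 * t) (x - (x0 + \<sigma> * y)) * (indicator I (x0 + \<sigma> * y) * u (x0 + \<sigma> * y))
        = indicator I' y *\<^sub>R (heat_kernel t ((x - x0) / \<sigma> - y) * f y)"
      unfolding x heat_kernel_scale[OF \<sigma> t] F by simp
    show "\<sigma> * ?g (x0 + \<sigma> * y) = indicator I' y *\<^sub>R (heat_kernel t ((x - x0) / \<sigma> - y) * f y)"
      by (rule trans[OF 1 2])
  qed
  finally show ?thesis unfolding set_lebesgue_integral_def .
qed

text \<open>The sign \<open>e\<close> records the side on which the extension lies:
  \<open>c + e * z\<close> runs away from the interface at \<open>c\<close>. The evenness of the
  heat kernel lets both sides share one formula.\<close>

lemma image_integral_scale:
  assumes \<sigma>: "0 < \<sigma>" and t: "0 < t" and e: "e = 1 \<or> e = - 1" and X: "X / \<sigma> = e * (z0 - c)"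
    and F: "\<And>z. indicator I (c + e * z) * f (c + e * z) = indicator {0<..} z * F z"
  shows "\<sigma> * (LBINT z:{0<..}. heat_kernel (\<sigma>\<^sup>2 * t) (X - \<sigma> * z) * F z) = (LBINT y:I. heat_kernel t (z0 - y) * f y)"
proof -
  let ?g = "\<lambda>y. indicator I y *\<^sub>R (heat_kernel t (z0 - y) * f y)"
  have "(LBINT y. ?g y) = \<bar>e\<bar> *\<^sub>R (LBINT z. ?g (c + e * z))"
    using e by (intro lborel_integral_real_affine) auto
  also have "\<dots> = (LBINT z. ?g (c + e * z))" using e by auto
  also have "(\<lambda>z. ?g (c + e * z)) = (\<lambda>z. \<sigma> * (indicator {0<..} z *\<^sub>R (heat_kernel (\<sigma>\<^sup>2 * t) (X - \<sigma> * z) * F z)))"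
  proof
    fix z
    have "z0 - (c + e * z) = e * (X / \<sigma> - z)" unfolding X using e by (auto simp: algebra_simps)
    then have k: "heat_kernel t (z0 - (c + e * z)) = heat_kernel t (X / \<sigma> - z)"
      using e heat_kernel_minus(1)[of t "X / \<sigma> - z"] by auto
    have s: "X - \<sigma> * z = \<sigma> * (X / \<sigma> - z)" using \<sigma> by (simp add: field_simps)
    have "?g (c + e * z) = heat_kernel t (z0 - (c + e * z)) * (indicator I (c + e * z) * f (c + e * z))" by simp
    also have "\<dots> = (\<sigma> * heat_kernel (\<sigma>\<^sup>2 * t) (X - \<sigma> * z)) * (indicator {0<..} z * F z)"
      unfolding F k unfolding s heat_kernel_scale[OF \<sigma> t] ..
    finally show "?g (c + e * z) = \<sigma> * (indicator {0<..} z *\<^sub>R (heat_kernel (\<sigma>\<^sup>2 * t) (X - \<sigma> * z) * F z))" by simp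
  qed
  finally show ?thesis unfolding set_lebesgue_integral_def by simp
qed

text \<open>The pieces are the given data and the extension on either side. The outer layers have
  one interface only and use \<open>c1 = c2\<close>, which empties the middle piece.\<close>

lemma (in bounded_measurable) heat_flow_split:
  assumes t: "0 < t" and c: "c1 \<le> c2"
  shows "heat_flow f t z = (LBINT y:{..<c1}. heat_kernel t (z - y) * f y)
    + (LBINT y:{c1<..<c2}. heat_kernel t (z - y) * f y) + (LBINT y:{c2<..}. heat_kernel t (z - y) * f y)"
proof -
  let ?h = "\<lambda>y. heat_kernel t (z - y) * f y"
  have i: "integrable lborel ?h" by (rule integrable_kernel[OF t])
  have si: "integrable lborel (\<lambda>y. indicator S y *\<^sub>R ?h y)" if "S \<in> sets borel" for S
    by (rule integrable_mult_indicator) (use that i in auto)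
  have "heat_flow f t z = (LBINT y. indicator {..<c1} y *\<^sub>R ?h y + indicator {c1<..<c2} y *\<^sub>R ?h y + indicator {c2<..} y *\<^sub>R ?h y)"
    unfolding heat_flow_kernel[OF t]
  proof (rule integral_cong_AE)
    show "AE y in lborel. ?h y = indicator {..<c1} y *\<^sub>R ?h y + indicator {c1<..<c2} y *\<^sub>R ?h y + indicator {c2<..} y *\<^sub>R ?h y"
      using AE_lborel_singleton[of c1] AE_lborel_singleton[of c2]
      by eventually_elim (use c in \<open>auto simp: indicator_def\<close>)
  qed measurable
  then show ?thesis unfolding set_lebesgue_integral_def using si by simp
qed

context three_layers
begin

text \<open>Transforms of the data, each read away from an interface: \<open>A\<^sub>1\<close> is
  the middle data read from the left interface, \<open>A\<^sub>2\<close> the same data read from the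
  right one.\<close>

abbreviation A\<^sub>1 :: "complex \<Rightarrow> complex" where "A\<^sub>1 \<equiv> laplace (\<lambda>z. if z < 2 * b then f\<^sub>M (- b + z) else 0)"
abbreviation A\<^sub>2 :: "complex \<Rightarrow> complex" where "A\<^sub>2 \<equiv> laplace (\<lambda>z. if z < 2 * b then f\<^sub>M (b - z) else 0)"
abbreviation L\<^sub>0 :: "complex \<Rightarrow> complex" where "L\<^sub>0 \<equiv> laplace (\<lambda>z. d\<^sub>L (- z))"
abbreviation R\<^sub>0 :: "complex \<Rightarrow> complex" where "R\<^sub>0 \<equiv> laplace d\<^sub>R"

text \<open>\<open>E\<close> is the delay of one crossing of the middle layer, \<open>q\<close> the
  amplitude of a round trip with one reflection at either interface, and \<open>Q\<close> the sum of
  the geometric series over all round trips.\<close>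

definition E :: "complex \<Rightarrow> complex" where "E \<kappa> = exp (- (\<i> * \<kappa> * complex_of_real (2 * b)))"
definition q :: real where "q = \<rho>\<^sub>L * \<rho>\<^sub>R"
definition Q :: "complex \<Rightarrow> complex" where "Q \<kappa> = 1 / (1 - complex_of_real q * exp (- (\<i> * \<kappa> * complex_of_real (4 * b))))"

lemma E_square: "E \<kappa> * E \<kappa> = exp (- (\<i> * \<kappa> * complex_of_real (4 * b)))"
  by (simp add: E_def exp_add[symmetric] algebra_simps)

lemma q_less_1: "\<bar>q\<bar> < 1"
  using \<rho>_less_1 mult_strict_mono[of "\<bar>\<rho>\<^sub>L\<bar>" 1 "\<bar>\<rho>\<^sub>R\<bar>" 1] by (simp add: q_def abs_mult)

lemma resonance_inverse:
  assumes "Im \<kappa> < 0"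
  shows "1 - complex_of_real q * (E \<kappa> * E \<kappa>) \<noteq> 0" "Q \<kappa> * (1 - complex_of_real q * (E \<kappa> * E \<kappa>)) = 1"
  using resonance_nonzero[of \<kappa> "4 * b" q] assms b_pos q_less_1 unfolding E_square Q_def by auto

lemma bounded_holomorphic_E [bounded_holomorphic_intros]: "bounded_holomorphic E"
  unfolding E_def[abs_def] using b_pos by (intro bounded_holomorphic_intros) auto

lemma bounded_holomorphic_Q [bounded_holomorphic_intros]: "bounded_holomorphic Q"
  unfolding Q_def[abs_def] using b_pos q_less_1 by (intro bounded_holomorphic_intros) auto

lemma data_transform_integrable:
  "set_integrable lborel {0<..} (\<lambda>z. if z < 2 * b then f\<^sub>M (- b + z) else 0)"
  "set_integrable lborel {0<..} (\<lambda>z. if z < 2 * b then f\<^sub>M (b - z) else 0)"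
  "set_integrable lborel {0<..} (\<lambda>z. d\<^sub>L (- z))"
  "set_integrable lborel {0<..} d\<^sub>R"
proof -
  have mid: "set_integrable lborel {0<..} (\<lambda>z. if z < 2 * b then g z else 0)"
    if [measurable]: "g \<in> borel_measurable borel" and g: "\<And>z. \<bar>g z\<bar> \<le> C" for g
    unfolding set_integrable_def
  proof (rule Bochner_Integration.integrable_bound[where f = "\<lambda>z. indicator {0<..<2 * b} z * C"])
    show "integrable lborel (\<lambda>z. indicator {0<..<2 * b} z * C)"
      using b_pos by (intro integrable_mult_left integrable_real_indicator) auto
    show "AE z in lborel. norm (indicator {0<..} z *\<^sub>R (if z < 2 * b then g z else 0)) \<le> norm (indicator {0<..<2 * b} z * C)"
      using g M.bound_nonneg by (intro AE_I2) (auto simp: indicator_def)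
  qed measurable
  show "set_integrable lborel {0<..} (\<lambda>z. if z < 2 * b then f\<^sub>M (- b + z) else 0)"
    by (rule mid) (auto intro: M.bound)
  show "set_integrable lborel {0<..} (\<lambda>z. if z < 2 * b then f\<^sub>M (b - z) else 0)"
    by (rule mid) (auto intro: M.bound)
  have "integrable lborel (\<lambda>z. indicator {..- a} (- a + - \<sigma>\<^sub>L * z) *\<^sub>R u\<^sub>L (- a + - \<sigma>\<^sub>L * z))"
    using data_L(2) pos unfolding set_integrable_def by (intro lborel_integrable_real_affine) auto
  moreover have "(\<lambda>z. indicator {0<..} z *\<^sub>R (indicator {..- a} (- a + - \<sigma>\<^sub>L * z) *\<^sub>R u\<^sub>L (- a + - \<sigma>\<^sub>L * z)))
      = (\<lambda>z. indicator {0<..} z *\<^sub>R d\<^sub>L (- z))"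
    using pos by (auto simp: indicator_def d\<^sub>L_def fun_eq_iff)
  ultimately show "set_integrable lborel {0<..} (\<lambda>z. d\<^sub>L (- z))"
    unfolding set_integrable_def using integrable_mult_indicator[of "{0<..}" lborel "\<lambda>z. indicator {..- a} (- a + - \<sigma>\<^sub>L * z) *\<^sub>R u\<^sub>L (- a + - \<sigma>\<^sub>L * z)"]
    by (simp del: scaleR_scaleR real_scaleR_def)
  have "integrable lborel (\<lambda>z. indicator {a..} (a + \<sigma>\<^sub>R * z) *\<^sub>R u\<^sub>R (a + \<sigma>\<^sub>R * z))"
    using data_R(2) pos unfolding set_integrable_def by (intro lborel_integrable_real_affine) auto
  moreover have "(\<lambda>z. indicator {0<..} z *\<^sub>R (indicator {a..} (a + \<sigma>\<^sub>R * z) *\<^sub>R u\<^sub>R (a + \<sigma>\<^sub>R * z)))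
      = (\<lambda>z. indicator {0<..} z *\<^sub>R d\<^sub>R z)"
    using pos by (auto simp: indicator_def d\<^sub>R_def fun_eq_iff)
  ultimately show "set_integrable lborel {0<..} d\<^sub>R"
    unfolding set_integrable_def using integrable_mult_indicator[of "{0<..}" lborel "\<lambda>z. indicator {a..} (a + \<sigma>\<^sub>R * z) *\<^sub>R u\<^sub>R (a + \<sigma>\<^sub>R * z)"]
    by (simp del: scaleR_scaleR real_scaleR_def)
qed

lemmas bounded_holomorphic_data [bounded_holomorphic_intros] =
  data_transform_integrable[THEN bounded_holomorphic_laplace]

lemma bounded_measurable_shifted:
  "bounded_measurable (\<lambda>z. f\<^sub>M (- b + z)) C" "bounded_measurable (\<lambda>z. f\<^sub>M (b - z)) C"
  "bounded_measurable (\<lambda>z. f\<^sub>M (b + z)) C" "bounded_measurable (\<lambda>z. f\<^sub>M (- b - z)) C"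
  "bounded_measurable (\<lambda>z. f\<^sub>R (- z)) C"
  "bounded_measurable (\<lambda>z. if z < 0 then 0 else d\<^sub>R z) C" "bounded_measurable (\<lambda>z. if z < 0 then 0 else d\<^sub>L (- z)) C"
proof -
  have "\<bar>d\<^sub>R z\<bar> \<le> C" if "0 \<le> z" for z using R.bound[of z] that by (simp add: f\<^sub>R_def)
  moreover have "\<bar>d\<^sub>L (- z)\<bar> \<le> C" if "0 \<le> z" for z using L.bound[of "- z"] that by (simp add: f\<^sub>L_def)
  ultimately show
    "bounded_measurable (\<lambda>z. f\<^sub>M (- b + z)) C" "bounded_measurable (\<lambda>z. f\<^sub>M (b - z)) C"
    "bounded_measurable (\<lambda>z. f\<^sub>M (b + z)) C" "bounded_measurable (\<lambda>z. f\<^sub>M (- b - z)) C"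
    "bounded_measurable (\<lambda>z. f\<^sub>R (- z)) C"
    "bounded_measurable (\<lambda>z. if z < 0 then 0 else d\<^sub>R z) C" "bounded_measurable (\<lambda>z. if z < 0 then 0 else d\<^sub>L (- z)) C"
    using M.bound R.bound M.bound_nonneg by (auto simp: bounded_measurable_def)
qed

text \<open>What lies beyond one interface is the reflected middle data followed, one crossing
  later, by the reflection of what lies beyond the other interface, plus transmitted outer data.
  Cutting the transforms at \<open>2 * b\<close> expresses this as two equations for
  \<open>mp\<close> and \<open>mm\<close>; the extensions of the outer data follow from
  them.\<close>

lemma laplace_system:
  assumes k: "Im \<kappa> < 0"
  defines "mp \<equiv> laplace (\<lambda>z. f\<^sub>M (b + z)) \<kappa>" and "mm \<equiv> laplace (\<lambda>z. f\<^sub>M (- b - z)) \<kappa>"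
  shows "mp = \<rho>\<^sub>R * (A\<^sub>2 \<kappa> + E \<kappa> * mm) + (1 - \<rho>\<^sub>R) * R\<^sub>0 \<kappa>"
    and "mm = \<rho>\<^sub>L * (A\<^sub>1 \<kappa> + E \<kappa> * mp) + (1 - \<rho>\<^sub>L) * L\<^sub>0 \<kappa>"
    and "laplace f\<^sub>L \<kappa> = (1 + \<rho>\<^sub>L) * (A\<^sub>1 \<kappa> + E \<kappa> * mp) - \<rho>\<^sub>L * L\<^sub>0 \<kappa>"
    and "laplace (\<lambda>z. f\<^sub>R (- z)) \<kappa> = (1 + \<rho>\<^sub>R) * (A\<^sub>2 \<kappa> + E \<kappa> * mm) - \<rho>\<^sub>R * R\<^sub>0 \<kappa>"
proof -
  note bm = bounded_measurable_shifted
  have s1: "laplace (\<lambda>z. f\<^sub>M (- b + z)) \<kappa> = A\<^sub>1 \<kappa> + E \<kappa> * mp"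
    using bounded_measurable.laplace_shift[OF bm(1) k, of "2 * b"] b_pos by (simp add: E_def mp_def)
  have s2: "laplace (\<lambda>z. f\<^sub>M (b - z)) \<kappa> = A\<^sub>2 \<kappa> + E \<kappa> * mm"
    using bounded_measurable.laplace_shift[OF bm(2) k, of "2 * b"] b_pos by (simp add: E_def mm_def)
  have r0: "laplace (\<lambda>z. if z < 0 then 0 else d\<^sub>R z) \<kappa> = R\<^sub>0 \<kappa>" by (rule laplace_cong) simp
  have l0: "laplace (\<lambda>z. if z < 0 then 0 else d\<^sub>L (- z)) \<kappa> = L\<^sub>0 \<kappa>" by (rule laplace_cong) simp
  have "mp = laplace (\<lambda>z. \<rho>\<^sub>R * f\<^sub>M (b - z) + (1 - \<rho>\<^sub>R) * (if z < 0 then 0 else d\<^sub>R z)) \<kappa>"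
    unfolding mp_def by (rule laplace_cong) (simp add: f\<^sub>M_right)
  also have "\<dots> = \<rho>\<^sub>R * (A\<^sub>2 \<kappa> + E \<kappa> * mm) + (1 - \<rho>\<^sub>R) * R\<^sub>0 \<kappa>"
    unfolding laplace_linear[OF bm(2,6) k] s2 r0 by simp
  finally show "mp = \<rho>\<^sub>R * (A\<^sub>2 \<kappa> + E \<kappa> * mm) + (1 - \<rho>\<^sub>R) * R\<^sub>0 \<kappa>" .
  have "mm = laplace (\<lambda>z. \<rho>\<^sub>L * f\<^sub>M (- b + z) + (1 - \<rho>\<^sub>L) * (if z < 0 then 0 else d\<^sub>L (- z))) \<kappa>"
    unfolding mm_def by (rule laplace_cong) (simp add: f\<^sub>M_left)
  also have "\<dots> = \<rho>\<^sub>L * (A\<^sub>1 \<kappa> + E \<kappa> * mp) + (1 - \<rho>\<^sub>L) * L\<^sub>0 \<kappa>"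
    unfolding laplace_linear[OF bm(1,7) k] s1 l0 by simp
  finally show "mm = \<rho>\<^sub>L * (A\<^sub>1 \<kappa> + E \<kappa> * mp) + (1 - \<rho>\<^sub>L) * L\<^sub>0 \<kappa>" .
  have "laplace f\<^sub>L \<kappa> = laplace (\<lambda>z. (1 + \<rho>\<^sub>L) * f\<^sub>M (- b + z) + (- \<rho>\<^sub>L) * (if z < 0 then 0 else d\<^sub>L (- z))) \<kappa>"
    by (rule laplace_cong) (simp add: f\<^sub>L_def)
  also have "\<dots> = (1 + \<rho>\<^sub>L) * (A\<^sub>1 \<kappa> + E \<kappa> * mp) - \<rho>\<^sub>L * L\<^sub>0 \<kappa>"
    unfolding laplace_linear[OF bm(1,7) k] s1 l0 by simp
  finally show "laplace f\<^sub>L \<kappa> = (1 + \<rho>\<^sub>L) * (A\<^sub>1 \<kappa> + E \<kappa> * mp) - \<rho>\<^sub>L * L\<^sub>0 \<kappa>" .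
  have "laplace (\<lambda>z. f\<^sub>R (- z)) \<kappa> = laplace (\<lambda>z. (1 + \<rho>\<^sub>R) * f\<^sub>M (b - z) + (- \<rho>\<^sub>R) * (if z < 0 then 0 else d\<^sub>R z)) \<kappa>"
    by (rule laplace_cong) (simp add: f\<^sub>R_def)
  also have "\<dots> = (1 + \<rho>\<^sub>R) * (A\<^sub>2 \<kappa> + E \<kappa> * mm) - \<rho>\<^sub>R * R\<^sub>0 \<kappa>"
    unfolding laplace_linear[OF bm(2,6) k] s2 r0 by simp
  finally show "laplace (\<lambda>z. f\<^sub>R (- z)) \<kappa> = (1 + \<rho>\<^sub>R) * (A\<^sub>2 \<kappa> + E \<kappa> * mm) - \<rho>\<^sub>R * R\<^sub>0 \<kappa>" .
qed

text \<open>Eliminating one unknown leaves the factor \<open>1 - q * E^2\<close>, whose inverse is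
  \<open>Q\<close>. Each of the four terms is the transform of one portion of data times an
  amplitude and a delay, in correspondence with the contour integrals of the formulae.\<close>

lemma laplace_solution:
  assumes k: "Im \<kappa> < 0"
  shows "laplace (\<lambda>z. f\<^sub>M (b + z)) \<kappa> = Q \<kappa> * (\<rho>\<^sub>R * A\<^sub>2 \<kappa> + \<rho>\<^sub>R * \<rho>\<^sub>L * (E \<kappa> * A\<^sub>1 \<kappa>)
       + \<rho>\<^sub>R * (1 - \<rho>\<^sub>L) * (E \<kappa> * L\<^sub>0 \<kappa>) + (1 - \<rho>\<^sub>R) * R\<^sub>0 \<kappa>)"
    and "laplace (\<lambda>z. f\<^sub>M (- b - z)) \<kappa> = Q \<kappa> * (\<rho>\<^sub>L * A\<^sub>1 \<kappa> + \<rho>\<^sub>L * \<rho>\<^sub>R * (E \<kappa> * A\<^sub>2 \<kappa>)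
       + \<rho>\<^sub>L * (1 - \<rho>\<^sub>R) * (E \<kappa> * R\<^sub>0 \<kappa>) + (1 - \<rho>\<^sub>L) * L\<^sub>0 \<kappa>)"
    and "laplace f\<^sub>L \<kappa> = Q \<kappa> * ((1 + \<rho>\<^sub>L) * A\<^sub>1 \<kappa> + (1 + \<rho>\<^sub>L) * \<rho>\<^sub>R * (E \<kappa> * A\<^sub>2 \<kappa>)
       + (\<rho>\<^sub>R * (E \<kappa> * E \<kappa>) - \<rho>\<^sub>L) * L\<^sub>0 \<kappa> + (1 + \<rho>\<^sub>L) * (1 - \<rho>\<^sub>R) * (E \<kappa> * R\<^sub>0 \<kappa>))"
    and "laplace (\<lambda>z. f\<^sub>R (- z)) \<kappa> = Q \<kappa> * ((1 + \<rho>\<^sub>R) * A\<^sub>2 \<kappa> + (1 + \<rho>\<^sub>R) * \<rho>\<^sub>L * (E \<kappa> * A\<^sub>1 \<kappa>)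
       + (\<rho>\<^sub>L * (E \<kappa> * E \<kappa>) - \<rho>\<^sub>R) * R\<^sub>0 \<kappa> + (1 + \<rho>\<^sub>R) * (1 - \<rho>\<^sub>L) * (E \<kappa> * L\<^sub>0 \<kappa>))"
proof -
  have elim: "x = Q \<kappa> * y" if "(1 - complex_of_real q * (E \<kappa> * E \<kappa>)) * x = y" for x y
    using resonance_inverse[OF k] that by (metis mult.assoc mult_1_left)
  have qq: "complex_of_real q = complex_of_real \<rho>\<^sub>L * complex_of_real \<rho>\<^sub>R" by (simp add: q_def)
  note sys = laplace_system[OF k]
  define mp mm where "mp = laplace (\<lambda>z. f\<^sub>M (b + z)) \<kappa>" and "mm = laplace (\<lambda>z. f\<^sub>M (- b - z)) \<kappa>"
  note sys = laplace_system[OF k, folded mp_def mm_def]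
  define l r where "l = laplace f\<^sub>L \<kappa>" and "r = laplace (\<lambda>z. f\<^sub>R (- z)) \<kappa>"
  note sys = sys[folded l_def r_def, unfolded of_real_diff of_real_add of_real_1]
  \<comment> \<open>The elimination is stated for arbitrary complex numbers, so that
    \<open>algebra\<close> faces polynomial identities without any transforms.\<close>
  have alg: "(1 - p * s * (e * e)) * x = s * a2 + s * p * (e * a1) + s * (1 - p) * (e * d1) + (1 - s) * d2"
    "(1 - p * s * (e * e)) * y = p * a1 + p * s * (e * a2) + p * (1 - s) * (e * d2) + (1 - p) * d1"
    "(1 - p * s * (e * e)) * ((1 + p) * (a1 + e * x) - p * d1) = (1 + p) * a1 + (1 + p) * s * (e * a2)
       + (s * (e * e) - p) * d1 + (1 + p) * (1 - s) * (e * d2)"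
    "(1 - p * s * (e * e)) * ((1 + s) * (a2 + e * y) - s * d2) = (1 + s) * a2 + (1 + s) * p * (e * a1)
       + (p * (e * e) - s) * d2 + (1 + s) * (1 - p) * (e * d1)"
    if xy: "x = s * (a2 + e * y) + (1 - s) * d2" "y = p * (a1 + e * x) + (1 - p) * d1"
    for p s e x y a1 a2 d1 d2 :: complex
    using xy by algebra+
  show "laplace (\<lambda>z. f\<^sub>M (b + z)) \<kappa> = Q \<kappa> * (\<rho>\<^sub>R * A\<^sub>2 \<kappa> + \<rho>\<^sub>R * \<rho>\<^sub>L * (E \<kappa> * A\<^sub>1 \<kappa>)
       + \<rho>\<^sub>R * (1 - \<rho>\<^sub>L) * (E \<kappa> * L\<^sub>0 \<kappa>) + (1 - \<rho>\<^sub>R) * R\<^sub>0 \<kappa>)"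
    unfolding mp_def[symmetric] of_real_mult of_real_diff of_real_add of_real_1
    by (rule elim, unfold qq) (rule alg(1)[OF sys(1,2)])
  show "laplace (\<lambda>z. f\<^sub>M (- b - z)) \<kappa> = Q \<kappa> * (\<rho>\<^sub>L * A\<^sub>1 \<kappa> + \<rho>\<^sub>L * \<rho>\<^sub>R * (E \<kappa> * A\<^sub>2 \<kappa>)
       + \<rho>\<^sub>L * (1 - \<rho>\<^sub>R) * (E \<kappa> * R\<^sub>0 \<kappa>) + (1 - \<rho>\<^sub>L) * L\<^sub>0 \<kappa>)"
    unfolding mm_def[symmetric] of_real_mult of_real_diff of_real_add of_real_1
    by (rule elim, unfold qq) (rule alg(2)[OF sys(1,2)])
  show "laplace f\<^sub>L \<kappa> = Q \<kappa> * ((1 + \<rho>\<^sub>L) * A\<^sub>1 \<kappa> + (1 + \<rho>\<^sub>L) * \<rho>\<^sub>R * (E \<kappa> * A\<^sub>2 \<kappa>)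
       + (\<rho>\<^sub>R * (E \<kappa> * E \<kappa>) - \<rho>\<^sub>L) * L\<^sub>0 \<kappa> + (1 + \<rho>\<^sub>L) * (1 - \<rho>\<^sub>R) * (E \<kappa> * R\<^sub>0 \<kappa>))"
    unfolding l_def[symmetric] of_real_mult of_real_diff of_real_add of_real_1
    by (rule elim, unfold qq sys(3)) (rule alg(3)[OF sys(1,2)])
  show "laplace (\<lambda>z. f\<^sub>R (- z)) \<kappa> = Q \<kappa> * ((1 + \<rho>\<^sub>R) * A\<^sub>2 \<kappa> + (1 + \<rho>\<^sub>R) * \<rho>\<^sub>L * (E \<kappa> * A\<^sub>1 \<kappa>)
       + (\<rho>\<^sub>L * (E \<kappa> * E \<kappa>) - \<rho>\<^sub>R) * R\<^sub>0 \<kappa> + (1 + \<rho>\<^sub>R) * (1 - \<rho>\<^sub>L) * (E \<kappa> * L\<^sub>0 \<kappa>))"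
    unfolding r_def[symmetric] of_real_mult of_real_diff of_real_add of_real_1
    by (rule elim, unfold qq sys(4)) (rule alg(4)[OF sys(1,2)])
qed

end

section \<open>The solution formulae\<close>

definition line_integral :: "real \<Rightarrow> real \<Rightarrow> (complex \<Rightarrow> complex) \<Rightarrow> complex" where
  "line_integral X c B = (LBINT s. gaussian_wave X c (of_real s - \<i>) * B (of_real s - \<i>))"

lemma line_integral_cong: "(\<And>k. Im k < 0 \<Longrightarrow> A k = B k) \<Longrightarrow> line_integral X c A = line_integral X c B"
  by (simp add: line_integral_def)

lemma line_integral_cmult: "line_integral X c (\<lambda>k. p * A k) = p * line_integral X c A"
  unfolding line_integral_def by (simp add: mult.left_commute[of _ p])

lemma line_integral_add:
  assumes "X < 0" "0 < c" "bounded_holomorphic A" "bounded_holomorphic B"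
  shows "line_integral X c (\<lambda>k. A k + B k) = line_integral X c A + line_integral X c B"
  unfolding line_integral_def using integrable_wave[OF assms(1,2,3)] integrable_wave[OF assms(1,2,4)]
  by (simp add: distrib_left)

context three_layers
begin

abbreviation h\<^sub>L :: "complex \<Rightarrow> complex" where "h\<^sub>L \<equiv> fourier_on {..<- a} u\<^sub>L"
abbreviation h\<^sub>M :: "complex \<Rightarrow> complex" where "h\<^sub>M \<equiv> fourier_on {- a<..<a} u\<^sub>M"
abbreviation h\<^sub>R :: "complex \<Rightarrow> complex" where "h\<^sub>R \<equiv> fourier_on {a<..} u\<^sub>R"

definition S :: real where "S = (\<sigma>\<^sub>L + \<sigma>\<^sub>M) * (\<sigma>\<^sub>M + \<sigma>\<^sub>R)"

lemma S_pos: "0 < S" using pos by (simp add: S_def)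

lemma phase_E: "phase (- (2 * b)) \<kappa> = E \<kappa>"
  by (simp add: phase_def E_def)

lemma phase_E2: "phase (- (4 * b)) \<kappa> = E \<kappa> * E \<kappa>"
  unfolding E_square by (simp add: phase_def)

lemma q_S: "complex_of_real q * S = (\<sigma>\<^sub>M - \<sigma>\<^sub>L) * (\<sigma>\<^sub>M - \<sigma>\<^sub>R)"
proof -
  have "\<sigma>\<^sub>M + \<sigma>\<^sub>L \<noteq> 0" "\<sigma>\<^sub>M + \<sigma>\<^sub>R \<noteq> 0" using pos by auto
  then have "q * S = (\<sigma>\<^sub>M - \<sigma>\<^sub>L) * (\<sigma>\<^sub>M - \<sigma>\<^sub>R)"
    unfolding q_def S_def \<rho>\<^sub>L_def \<rho>\<^sub>R_def add.commute[of \<sigma>\<^sub>L \<sigma>\<^sub>M] by simp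
  then have "complex_of_real (q * S) = complex_of_real ((\<sigma>\<^sub>M - \<sigma>\<^sub>L) * (\<sigma>\<^sub>M - \<sigma>\<^sub>R))" by simp
  then show ?thesis by simp
qed

text \<open>In the scaled variable all three determinants are \<open>pi * S\<close> times a phase
  times the resonance factor \<open>1 - q * E^2\<close>, which \<open>Q\<close> cancels. The trivial
  \<open>phase 0\<close> gives the three equations the common shape expected by
  \<open>collect_phases\<close>.\<close>

lemma Delta_eqs:
  assumes \<kappa>: "Im \<kappa> < 0"
  shows "k * of_real \<sigma>\<^sub>L = \<kappa> \<Longrightarrow> Delta_L a \<sigma>\<^sub>L \<sigma>\<^sub>M \<sigma>\<^sub>R k * Q \<kappa> = of_real (pi * S) * phase (4 * b) \<kappa>"
    and "k * of_real \<sigma>\<^sub>R = - \<kappa> \<Longrightarrow> Delta_R a \<sigma>\<^sub>L \<sigma>\<^sub>M \<sigma>\<^sub>R k * Q \<kappa> = of_real (pi * S) * phase 0 \<kappa>"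
    and "k * of_real \<sigma>\<^sub>R = - \<kappa> \<Longrightarrow> Delta_tilde a \<sigma>\<^sub>L \<sigma>\<^sub>M \<sigma>\<^sub>R k * Q \<kappa> = of_real (pi * S) * phase (4 * b) \<kappa>"
proof -
  have inv: "(1 - complex_of_real q * phase (- (4 * b)) \<kappa>) * Q \<kappa> = 1"
    using resonance_inverse(2)[OF \<kappa>] unfolding phase_E2 by (simp add: mult.commute)
  have ph: "phase (4 * b) \<kappa> * phase (- (4 * b)) \<kappa> = 1" by (simp add: phase_add)
  have Sc: "complex_of_real S = (\<sigma>\<^sub>L + \<sigma>\<^sub>M) * (\<sigma>\<^sub>M + \<sigma>\<^sub>R)" by (simp add: S_def)
  have qS: "(complex_of_real \<sigma>\<^sub>L - of_real \<sigma>\<^sub>M) * (of_real \<sigma>\<^sub>M - of_real \<sigma>\<^sub>R) = - (of_real q * of_real S)"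
    "(complex_of_real \<sigma>\<^sub>R - of_real \<sigma>\<^sub>M) * (of_real \<sigma>\<^sub>M - of_real \<sigma>\<^sub>L) = - (of_real q * of_real S)"
    unfolding q_S by (simp_all add: algebra_simps)
  show "Delta_L a \<sigma>\<^sub>L \<sigma>\<^sub>M \<sigma>\<^sub>R k * Q \<kappa> = of_real (pi * S) * phase (4 * b) \<kappa>" if k: "k * of_real \<sigma>\<^sub>L = \<kappa>"
  proof -
    have "exp (4 * \<i> * a * k * \<sigma>\<^sub>L / \<sigma>\<^sub>M) = phase (4 * b) \<kappa>"
      unfolding phase_def k[symmetric] by (rule arg_cong[where f = exp]) (simp add: b_def mult_ac)
    then have "Delta_L a \<sigma>\<^sub>L \<sigma>\<^sub>M \<sigma>\<^sub>R k = of_real pi * (phase (4 * b) \<kappa> * S - q * S)"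
      by (simp only: Delta_L_def qS) (simp add: Sc algebra_simps)
    also have "\<dots> = of_real (pi * S) * (phase (4 * b) \<kappa> - q * (phase (4 * b) \<kappa> * phase (- (4 * b)) \<kappa>))"
      unfolding ph by (simp add: algebra_simps)
    also have "\<dots> = of_real (pi * S) * phase (4 * b) \<kappa> * (1 - q * phase (- (4 * b)) \<kappa>)"
      by (simp add: algebra_simps)
    finally show ?thesis using inv by (simp add: mult.assoc)
  qed
  show "Delta_tilde a \<sigma>\<^sub>L \<sigma>\<^sub>M \<sigma>\<^sub>R k * Q \<kappa> = of_real (pi * S) * phase (4 * b) \<kappa>" if k: "k * of_real \<sigma>\<^sub>R = - \<kappa>"
  proof -
    have "\<kappa> = - (k * of_real \<sigma>\<^sub>R)" using k by simp
    then have "exp (4 * \<i> * complex_of_real (- a) * k * \<sigma>\<^sub>R / \<sigma>\<^sub>M) = phase (4 * b) \<kappa>"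
      unfolding phase_def by (intro arg_cong[where f = exp]) (simp add: b_def mult_ac)
    then have "Delta_tilde a \<sigma>\<^sub>L \<sigma>\<^sub>M \<sigma>\<^sub>R k = of_real pi * (phase (4 * b) \<kappa> * S - q * S)"
      by (simp only: Delta_tilde_def Delta_L_def qS) (simp add: Sc algebra_simps)
    also have "\<dots> = of_real (pi * S) * (phase (4 * b) \<kappa> - q * (phase (4 * b) \<kappa> * phase (- (4 * b)) \<kappa>))"
      unfolding ph by (simp add: algebra_simps)
    also have "\<dots> = of_real (pi * S) * phase (4 * b) \<kappa> * (1 - q * phase (- (4 * b)) \<kappa>)"
      by (simp add: algebra_simps)
    finally show ?thesis using inv by (simp add: mult.assoc)
  qed
  show "Delta_R a \<sigma>\<^sub>L \<sigma>\<^sub>M \<sigma>\<^sub>R k * Q \<kappa> = of_real (pi * S) * phase 0 \<kappa>" if k: "k * of_real \<sigma>\<^sub>R = - \<kappa>"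
  proof -
    have "\<kappa> = - (k * of_real \<sigma>\<^sub>R)" using k by simp
    then have "exp (4 * \<i> * a * k * \<sigma>\<^sub>R / \<sigma>\<^sub>M) = phase (- (4 * b)) \<kappa>"
      unfolding phase_def by (intro arg_cong[where f = exp]) (simp add: b_def mult_ac)
    then have "Delta_R a \<sigma>\<^sub>L \<sigma>\<^sub>M \<sigma>\<^sub>R k = of_real pi * ((\<sigma>\<^sub>L + \<sigma>\<^sub>M) * (\<sigma>\<^sub>M + \<sigma>\<^sub>R)
        + phase (- (4 * b)) \<kappa> * (complex_of_real \<sigma>\<^sub>L - of_real \<sigma>\<^sub>M) * (of_real \<sigma>\<^sub>M - of_real \<sigma>\<^sub>R))"
      by (simp only: Delta_R_def of_real_mult of_real_add)
    also have "\<dots> = of_real pi * (S - q * S * phase (- (4 * b)) \<kappa>)"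
      by (simp only: mult.assoc qS) (simp add: Sc algebra_simps)
    also have "\<dots> = of_real (pi * S) * (1 - q * phase (- (4 * b)) \<kappa>)" by (simp add: algebra_simps)
    finally show ?thesis using inv by (simp add: mult.assoc)
  qed
qed

text \<open>The sign in \<open>\<plusminus> \<kappa>\<close> decides in which direction the data are
  read. The bounded middle layer admits both signs; for a half-line only one of them keeps
  \<open>\<kappa>\<close> in the half-plane where the transform converges.\<close>

lemma transforms:
  shows "k * of_real \<sigma>\<^sub>M = \<kappa> \<Longrightarrow> h\<^sub>M k = of_real \<sigma>\<^sub>M * (phase b \<kappa> * A\<^sub>1 \<kappa>)"
    and "k * of_real \<sigma>\<^sub>M = - \<kappa> \<Longrightarrow> h\<^sub>M k = of_real \<sigma>\<^sub>M * (phase b \<kappa> * A\<^sub>2 \<kappa>)"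
    and "k * of_real \<sigma>\<^sub>L = - \<kappa> \<Longrightarrow> h\<^sub>L k = of_real \<sigma>\<^sub>L * (phase (- (a / \<sigma>\<^sub>L)) \<kappa> * L\<^sub>0 \<kappa>)"
    and "k * of_real \<sigma>\<^sub>R = \<kappa> \<Longrightarrow> h\<^sub>R k = of_real \<sigma>\<^sub>R * (phase (- (a / \<sigma>\<^sub>R)) \<kappa> * R\<^sub>0 \<kappa>)"
proof -
  have bM: "\<sigma>\<^sub>M * b = a" using pos by (simp add: b_def)
  have M: "- a + \<sigma>\<^sub>M * z \<in> {- a<..<a} \<longleftrightarrow> 0 < z \<and> z < 2 * b" "a + - \<sigma>\<^sub>M * z \<in> {- a<..<a} \<longleftrightarrow> 0 < z \<and> z < 2 * b" for z
  proof -
    have "0 < \<sigma>\<^sub>M * z \<longleftrightarrow> 0 < z" using pos by (simp add: zero_less_mult_iff)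
    moreover have "\<sigma>\<^sub>M * z < 2 * a \<longleftrightarrow> z < 2 * b"
      using mult_less_cancel_left_pos[OF pos(3), of z "2 * b"] unfolding mult.left_commute[of \<sigma>\<^sub>M 2 b] bM .
    ultimately show "- a + \<sigma>\<^sub>M * z \<in> {- a<..<a} \<longleftrightarrow> 0 < z \<and> z < 2 * b" "a + - \<sigma>\<^sub>M * z \<in> {- a<..<a} \<longleftrightarrow> 0 < z \<and> z < 2 * b"
      by auto
  qed
  have dM: "0 < z \<Longrightarrow> z < 2 * b \<Longrightarrow> f\<^sub>M (- b + z) = u\<^sub>M (- a + \<sigma>\<^sub>M * z)"
    "0 < z \<Longrightarrow> z < 2 * b \<Longrightarrow> f\<^sub>M (b - z) = u\<^sub>M (a - \<sigma>\<^sub>M * z)" for z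
    using f\<^sub>M_middle[of "- b + z"] f\<^sub>M_middle[of "b - z"] bM by (auto simp: d\<^sub>M_def abs_le_iff algebra_simps)
  show "h\<^sub>M k = of_real \<sigma>\<^sub>M * (phase b \<kappa> * A\<^sub>1 \<kappa>)" if k: "k * of_real \<sigma>\<^sub>M = \<kappa>"
  proof -
    have "h\<^sub>M k = of_real \<bar>\<sigma>\<^sub>M\<bar> * (phase (- (- a)) k * A\<^sub>1 (of_real \<sigma>\<^sub>M * k))"
      by (rule fourier_on_laplace) (use pos M(1) dM(1) in \<open>auto simp: indicator_def simp del: greaterThanLessThan_iff\<close>)
    moreover have "phase (- (- a)) k = phase b \<kappa>"
      unfolding phase_def k[symmetric] using pos by (simp add: b_def mult.assoc)
    moreover have "of_real \<sigma>\<^sub>M * k = \<kappa>" using k by (simp add: mult.commute)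
    ultimately show ?thesis using pos by simp
  qed
  show "h\<^sub>M k = of_real \<sigma>\<^sub>M * (phase b \<kappa> * A\<^sub>2 \<kappa>)" if k: "k * of_real \<sigma>\<^sub>M = - \<kappa>"
  proof -
    have k': "\<kappa> = - (k * of_real \<sigma>\<^sub>M)" using k by simp
    have "h\<^sub>M k = of_real \<bar>- \<sigma>\<^sub>M\<bar> * (phase (- a) k * A\<^sub>2 (of_real (- \<sigma>\<^sub>M) * k))"
      by (rule fourier_on_laplace) (use pos M(2) dM(2) in \<open>auto simp: indicator_def simp del: greaterThanLessThan_iff\<close>)
    moreover have "phase (- a) k = phase b \<kappa>"
      unfolding phase_def k' using pos by (simp add: b_def mult.assoc)
    moreover have "of_real (- \<sigma>\<^sub>M) * k = \<kappa>" unfolding k' by (simp add: mult.commute)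
    ultimately show ?thesis using pos by simp
  qed
  show "h\<^sub>L k = of_real \<sigma>\<^sub>L * (phase (- (a / \<sigma>\<^sub>L)) \<kappa> * L\<^sub>0 \<kappa>)" if k: "k * of_real \<sigma>\<^sub>L = - \<kappa>"
  proof -
    have k': "\<kappa> = - (k * of_real \<sigma>\<^sub>L)" using k by simp
    have "h\<^sub>L k = of_real \<bar>- \<sigma>\<^sub>L\<bar> * (phase (- (- a)) k * L\<^sub>0 (of_real (- \<sigma>\<^sub>L) * k))"
      by (rule fourier_on_laplace) (use pos in \<open>auto simp: indicator_def d\<^sub>L_def zero_less_mult_iff\<close>)
    moreover have "phase (- (- a)) k = phase (- (a / \<sigma>\<^sub>L)) \<kappa>"
      unfolding phase_def k' using pos by (simp add: mult.assoc)
    moreover have "of_real (- \<sigma>\<^sub>L) * k = \<kappa>" unfolding k' by (simp add: mult.commute)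
    ultimately show ?thesis using pos by simp
  qed
  show "h\<^sub>R k = of_real \<sigma>\<^sub>R * (phase (- (a / \<sigma>\<^sub>R)) \<kappa> * R\<^sub>0 \<kappa>)" if k: "k * of_real \<sigma>\<^sub>R = \<kappa>"
  proof -
    have "h\<^sub>R k = of_real \<bar>\<sigma>\<^sub>R\<bar> * (phase (- a) k * R\<^sub>0 (of_real \<sigma>\<^sub>R * k))"
      by (rule fourier_on_laplace) (use pos in \<open>auto simp: indicator_def d\<^sub>R_def zero_less_mult_iff\<close>)
    moreover have "phase (- a) k = phase (- (a / \<sigma>\<^sub>R)) \<kappa>"
      unfolding phase_def k[symmetric] using pos by (simp add: mult.assoc)
    moreover have "of_real \<sigma>\<^sub>R * k = \<kappa>" using k by (simp add: mult.commute)
    ultimately show ?thesis using pos by simp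
  qed
qed

text \<open>The hypothesis on the \<open>p\<close>s is the balance of travel times: exponent and
  data on one side, determinant and scattering term on the other. The quotient by the determinant
  turns into a product with \<open>Q\<close>.\<close>

lemma collect_phases:
  assumes \<kappa>: "Im \<kappa> < 0" and e: "e = w * phase p1 \<kappa>" and D: "D * Q \<kappa> = of_real (pi * S) * phase p0 \<kappa>"
    and h: "h = of_real s * (phase p2 \<kappa> * T)" and p: "p1 + p2 = p0 + p3"
  shows "e / D * h = w * (of_real (s / (pi * S)) * (Q \<kappa> * (phase p3 \<kappa> * T)))"
proof -
  have Q: "Q \<kappa> \<noteq> 0" using resonance_inverse(2)[OF \<kappa>] by auto
  have piS: "complex_of_real (pi * S) \<noteq> 0" using S_pos by simp
  have "D = of_real (pi * S) * phase p0 \<kappa> / Q \<kappa>" using D Q by (simp add: field_simps)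
  then have "e / D * h = w * (of_real s / of_real (pi * S)) * Q \<kappa> * T * (phase p1 \<kappa> * phase p2 \<kappa>) / phase p0 \<kappa>"
    unfolding e h by simp
  also have "phase p1 \<kappa> * phase p2 \<kappa> = phase p3 \<kappa> * phase p0 \<kappa>" unfolding phase_add p by (simp add: add.commute)
  also have "w * (of_real s / of_real (pi * S)) * Q \<kappa> * T * (phase p3 \<kappa> * phase p0 \<kappa>) / phase p0 \<kappa>
     = w * (of_real (s / (pi * S)) * (Q \<kappa> * (phase p3 \<kappa> * T)))"
    using phase_nonzero[of p0 \<kappa>] by simp
  finally show ?thesis .
qed

definition contour_value :: "real \<Rightarrow> real \<Rightarrow> real \<Rightarrow> (complex \<Rightarrow> complex) \<Rightarrow> complex" where
  "contour_value X \<sigma> t T = line_integral X (\<sigma>\<^sup>2 * t) (\<lambda>k. Q (of_real \<sigma> * k) * T (of_real \<sigma> * k))"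

lemma bounded_holomorphic_term:
  assumes "0 < \<sigma>" "bounded_holomorphic T"
  shows "bounded_holomorphic (\<lambda>k. p * (Q (of_real \<sigma> * k) * T (of_real \<sigma> * k)))"
  using assms by (intro bounded_holomorphic_intros bounded_holomorphic_scale)

text \<open>The pattern for all integrals over the lower contour. The parameters \<open>pe\<close>,
  \<open>ph\<close>, \<open>pD\<close>, \<open>pT\<close> are the travel times contained in the
  exponent, the data, the determinant and the scattering term.\<close>

lemma minus_term:
  fixes t :: real
  assumes g: "lower_detour r g" and X: "X < 0" "0 < t" "0 < \<sigma>"
    and T: "bounded_holomorphic T" "\<And>\<kappa>. T \<kappa> = phase pT \<kappa> * T' \<kappa>" and p: "pe + ph = pD + pT"
    and Y: "Y = of_real X + of_real \<sigma> * complex_of_real pe"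
    and D: "\<And>k. Im (of_real \<sigma> * k) < 0 \<Longrightarrow> D k * Q (of_real \<sigma> * k) = of_real (pi * S) * phase pD (of_real \<sigma> * k)"
    and h: "\<And>k. h k = of_real s * (phase ph (of_real \<sigma> * k) * T' (of_real \<sigma> * k))"
  shows "integral_D0_minus r g (\<lambda>k. exp (\<i> * k * Y - (complex_of_real \<sigma> * k)\<^sup>2 * of_real t) / D k * h k)
    = - (of_real (s / (pi * S)) * contour_value X \<sigma> t T)"
  unfolding contour_value_def line_integral_cmult[symmetric] unfolding line_integral_def
proof (rule integral_D0_minus_wave[OF X(1) _ bounded_holomorphic_term[OF X(3) T(1)] g])
  fix k assume "Im k < 0"
  then have \<kappa>: "Im (of_real \<sigma> * k) < 0" using X by (simp add: mult_pos_neg)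
  have e: "exp (\<i> * k * Y - (complex_of_real \<sigma> * k)\<^sup>2 * of_real t) = gaussian_wave X (\<sigma>\<^sup>2 * t) k * phase pe (of_real \<sigma> * k)"
    unfolding gaussian_wave_def phase_def exp_add[symmetric] Y
    by (rule arg_cong[where f = exp]) (simp add: algebra_simps power_mult_distrib)
  show "exp (\<i> * k * Y - (complex_of_real \<sigma> * k)\<^sup>2 * of_real t) / D k * h k
    = gaussian_wave X (\<sigma>\<^sup>2 * t) k * (of_real (s / (pi * S)) * (Q (of_real \<sigma> * k) * T (of_real \<sigma> * k)))"
    unfolding T(2) by (rule collect_phases[OF \<kappa> e D[OF \<kappa>] h p])
qed (use X in simp)

text \<open>The counterpart of \<open>minus_term\<close> with
  \<open>\<kappa> = - \<sigma> * k\<close>, so that \<open>k\<close> in the upper half-plane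
  corresponds to \<open>\<kappa>\<close> in the lower one.\<close>

lemma plus_term:
  fixes t :: real
  assumes g: "upper_detour r g" and X: "X < 0" "0 < t" "0 < \<sigma>"
    and T: "bounded_holomorphic T" "\<And>\<kappa>. T \<kappa> = phase pT \<kappa> * T' \<kappa>" and p: "pe + ph = pD + pT"
    and Y: "Y = - of_real X - of_real \<sigma> * complex_of_real pe"
    and D: "\<And>k. Im (- (of_real \<sigma> * k)) < 0 \<Longrightarrow> D k * Q (- (of_real \<sigma> * k)) = of_real (pi * S) * phase pD (- (of_real \<sigma> * k))"
    and h: "\<And>k. h k = of_real s * (phase ph (- (of_real \<sigma> * k)) * T' (- (of_real \<sigma> * k)))"
  shows "integral_D0_plus r g (\<lambda>k. exp (\<i> * k * Y - (complex_of_real \<sigma> * k)\<^sup>2 * of_real t) / D k * h k)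
    = of_real (s / (pi * S)) * contour_value X \<sigma> t T"
  unfolding contour_value_def line_integral_cmult[symmetric] unfolding line_integral_def
proof (rule integral_D0_plus_wave[OF X(1) _ bounded_holomorphic_term[OF X(3) T(1)] g])
  fix k assume "0 < Im k"
  then have \<kappa>: "Im (- (of_real \<sigma> * k)) < 0" using X by simp
  have e: "exp (\<i> * k * Y - (complex_of_real \<sigma> * k)\<^sup>2 * of_real t) = gaussian_wave (- X) (\<sigma>\<^sup>2 * t) k * phase pe (- (of_real \<sigma> * k))"
    unfolding gaussian_wave_def phase_def exp_add[symmetric] Y
    by (rule arg_cong[where f = exp]) (simp add: algebra_simps power_mult_distrib)
  show "exp (\<i> * k * Y - (complex_of_real \<sigma> * k)\<^sup>2 * of_real t) / D k * h k
    = gaussian_wave (- X) (\<sigma>\<^sup>2 * t) k * (of_real (s / (pi * S)) * (Q (of_real \<sigma> * - k) * T (of_real \<sigma> * - k)))"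
    unfolding T(2) mult_minus_right by (rule collect_phases[OF \<kappa> e D[OF \<kappa>] h p])
qed (use X in simp)

lemma line_integral_sum:
  assumes X: "X < 0" "0 < t" "0 < \<sigma>"
    and T: "bounded_holomorphic T1" "bounded_holomorphic T2" "bounded_holomorphic T3" "bounded_holomorphic T4"
    and eq: "\<And>\<kappa>. Im \<kappa> < 0 \<Longrightarrow> F \<kappa> = Q \<kappa> * (p1 * T1 \<kappa> + p2 * T2 \<kappa> + p3 * T3 \<kappa> + p4 * T4 \<kappa>)"
  shows "line_integral X (\<sigma>\<^sup>2 * t) (\<lambda>k. F (of_real \<sigma> * k)) = p1 * contour_value X \<sigma> t T1
    + p2 * contour_value X \<sigma> t T2 + p3 * contour_value X \<sigma> t T3 + p4 * contour_value X \<sigma> t T4"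
proof -
  let ?T = "\<lambda>p T k. p * (Q (of_real \<sigma> * k) * T (of_real \<sigma> * k))"
  have c: "0 < \<sigma>\<^sup>2 * t" using X by simp
  have "line_integral X (\<sigma>\<^sup>2 * t) (\<lambda>k. F (of_real \<sigma> * k))
    = line_integral X (\<sigma>\<^sup>2 * t) (\<lambda>k. ?T p1 T1 k + ?T p2 T2 k + ?T p3 T3 k + ?T p4 T4 k)"
  proof (rule line_integral_cong)
    fix k assume "Im k < 0"
    then have "Im (of_real \<sigma> * k) < 0" using X by (simp add: mult_pos_neg)
    from eq[OF this] show "F (of_real \<sigma> * k) = ?T p1 T1 k + ?T p2 T2 k + ?T p3 T3 k + ?T p4 T4 k"
      by (simp add: distrib_left mult_ac)
  qed
  also have "\<dots> = p1 * contour_value X \<sigma> t T1 + p2 * contour_value X \<sigma> t T2 + p3 * contour_value X \<sigma> t T3 + p4 * contour_value X \<sigma> t T4"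
    unfolding contour_value_def
    by (simp only: line_integral_add[OF X(1) c] bounded_holomorphic_add bounded_holomorphic_term[OF X(3)] T line_integral_cmult)
  finally show ?thesis .
qed

text \<open>The bracket in the formulae is, up to \<open>S\<close> and a phase, the reflection by
  the whole middle layer seen from outside: the direct reflection at the near interface plus the
  echo from the far one after two crossings.\<close>

lemma reflection_factors:
  "k * of_real \<sigma>\<^sub>L = \<kappa> \<Longrightarrow> (complex_of_real \<sigma>\<^sub>L + of_real \<sigma>\<^sub>M) * (of_real \<sigma>\<^sub>M - of_real \<sigma>\<^sub>R)
      + exp (4 * \<i> * k * of_real a * of_real \<sigma>\<^sub>L / of_real \<sigma>\<^sub>M) * (of_real \<sigma>\<^sub>L - of_real \<sigma>\<^sub>M) * (of_real \<sigma>\<^sub>M + of_real \<sigma>\<^sub>R)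
    = of_real S * (phase (4 * b) \<kappa> * (of_real \<rho>\<^sub>R * (E \<kappa> * E \<kappa>) - of_real \<rho>\<^sub>L))"
  "k * of_real \<sigma>\<^sub>R = - \<kappa> \<Longrightarrow> (complex_of_real \<sigma>\<^sub>R + of_real \<sigma>\<^sub>M) * (of_real \<sigma>\<^sub>M - of_real \<sigma>\<^sub>L)
      + exp (- 4 * \<i> * k * of_real a * of_real \<sigma>\<^sub>R / of_real \<sigma>\<^sub>M) * (of_real \<sigma>\<^sub>R - of_real \<sigma>\<^sub>M) * (of_real \<sigma>\<^sub>M + of_real \<sigma>\<^sub>L)
    = of_real S * (phase (4 * b) \<kappa> * (of_real \<rho>\<^sub>L * (E \<kappa> * E \<kappa>) - of_real \<rho>\<^sub>R))"
proof -
  have nz: "\<sigma>\<^sub>L + \<sigma>\<^sub>M \<noteq> 0" "\<sigma>\<^sub>M + \<sigma>\<^sub>R \<noteq> 0" using pos by auto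
  have \<rho>: "(\<sigma>\<^sub>L + \<sigma>\<^sub>M) * \<rho>\<^sub>L = \<sigma>\<^sub>M - \<sigma>\<^sub>L" "(\<sigma>\<^sub>M + \<sigma>\<^sub>R) * \<rho>\<^sub>R = \<sigma>\<^sub>M - \<sigma>\<^sub>R"
    using nz unfolding \<rho>\<^sub>L_def \<rho>\<^sub>R_def add.commute[of \<sigma>\<^sub>M \<sigma>\<^sub>L] by simp_all
  have S\<rho>: "S * \<rho>\<^sub>R = (\<sigma>\<^sub>L + \<sigma>\<^sub>M) * ((\<sigma>\<^sub>M + \<sigma>\<^sub>R) * \<rho>\<^sub>R)" "S * \<rho>\<^sub>L = ((\<sigma>\<^sub>L + \<sigma>\<^sub>M) * \<rho>\<^sub>L) * (\<sigma>\<^sub>M + \<sigma>\<^sub>R)"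
    by (simp_all add: S_def)
  have r: "(\<sigma>\<^sub>L + \<sigma>\<^sub>M) * (\<sigma>\<^sub>M - \<sigma>\<^sub>R) = S * \<rho>\<^sub>R" "(\<sigma>\<^sub>L - \<sigma>\<^sub>M) * (\<sigma>\<^sub>M + \<sigma>\<^sub>R) = - (S * \<rho>\<^sub>L)"
    "(\<sigma>\<^sub>R + \<sigma>\<^sub>M) * (\<sigma>\<^sub>M - \<sigma>\<^sub>L) = S * \<rho>\<^sub>L" "(\<sigma>\<^sub>R - \<sigma>\<^sub>M) * (\<sigma>\<^sub>M + \<sigma>\<^sub>L) = - (S * \<rho>\<^sub>R)"
    unfolding S\<rho> \<rho> by (simp_all add: algebra_simps)
  note c = r[THEN arg_cong[where f = complex_of_real], unfolded of_real_mult of_real_add of_real_diff of_real_minus]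
  have p: "phase (4 * b) \<kappa> * (x * (E \<kappa> * E \<kappa>)) = x" for x \<kappa>
    using phase_add[of "4 * b" \<kappa> "- (4 * b)"] by (simp add: phase_E2[symmetric] mult.left_commute[of _ x])
  show "(complex_of_real \<sigma>\<^sub>L + of_real \<sigma>\<^sub>M) * (of_real \<sigma>\<^sub>M - of_real \<sigma>\<^sub>R)
      + exp (4 * \<i> * k * of_real a * of_real \<sigma>\<^sub>L / of_real \<sigma>\<^sub>M) * (of_real \<sigma>\<^sub>L - of_real \<sigma>\<^sub>M) * (of_real \<sigma>\<^sub>M + of_real \<sigma>\<^sub>R)
    = of_real S * (phase (4 * b) \<kappa> * (of_real \<rho>\<^sub>R * (E \<kappa> * E \<kappa>) - of_real \<rho>\<^sub>L))" if k: "k * of_real \<sigma>\<^sub>L = \<kappa>"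
  proof -
    have e: "exp (4 * \<i> * k * of_real a * of_real \<sigma>\<^sub>L / of_real \<sigma>\<^sub>M) = phase (4 * b) \<kappa>"
      unfolding phase_def k[symmetric] by (rule arg_cong[where f = exp]) (simp add: b_def mult_ac)
    show ?thesis
      unfolding e mult.assoc[of "phase (4 * b) \<kappa>"] c unfolding right_diff_distrib p by (simp add: mult.left_commute)
  qed
  show "(complex_of_real \<sigma>\<^sub>R + of_real \<sigma>\<^sub>M) * (of_real \<sigma>\<^sub>M - of_real \<sigma>\<^sub>L)
      + exp (- 4 * \<i> * k * of_real a * of_real \<sigma>\<^sub>R / of_real \<sigma>\<^sub>M) * (of_real \<sigma>\<^sub>R - of_real \<sigma>\<^sub>M) * (of_real \<sigma>\<^sub>M + of_real \<sigma>\<^sub>L)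
    = of_real S * (phase (4 * b) \<kappa> * (of_real \<rho>\<^sub>L * (E \<kappa> * E \<kappa>) - of_real \<rho>\<^sub>R))" if k: "k * of_real \<sigma>\<^sub>R = - \<kappa>"
  proof -
    have "\<kappa> = - (k * of_real \<sigma>\<^sub>R)" using k by simp
    then have e: "exp (- 4 * \<i> * k * of_real a * of_real \<sigma>\<^sub>R / of_real \<sigma>\<^sub>M) = phase (4 * b) \<kappa>"
      unfolding phase_def by (intro arg_cong[where f = exp]) (simp add: b_def mult_ac)
    show ?thesis
      unfolding e mult.assoc[of "phase (4 * b) \<kappa>"] c unfolding right_diff_distrib p by (simp add: mult.left_commute)
  qed
qed

lemma reflected_data:
  "k * of_real \<sigma>\<^sub>L = \<kappa> \<Longrightarrow> ((complex_of_real \<sigma>\<^sub>L + of_real \<sigma>\<^sub>M) * (of_real \<sigma>\<^sub>M - of_real \<sigma>\<^sub>R)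
      + exp (4 * \<i> * k * of_real a * of_real \<sigma>\<^sub>L / of_real \<sigma>\<^sub>M) * (of_real \<sigma>\<^sub>L - of_real \<sigma>\<^sub>M) * (of_real \<sigma>\<^sub>M + of_real \<sigma>\<^sub>R)) * h\<^sub>L (- k)
    = of_real (S * \<sigma>\<^sub>L) * (phase (4 * b - a / \<sigma>\<^sub>L) \<kappa> * ((of_real \<rho>\<^sub>R * (E \<kappa> * E \<kappa>) - of_real \<rho>\<^sub>L) * L\<^sub>0 \<kappa>))"
  "k * of_real \<sigma>\<^sub>R = - \<kappa> \<Longrightarrow> ((complex_of_real \<sigma>\<^sub>R + of_real \<sigma>\<^sub>M) * (of_real \<sigma>\<^sub>M - of_real \<sigma>\<^sub>L)
      + exp (- 4 * \<i> * k * of_real a * of_real \<sigma>\<^sub>R / of_real \<sigma>\<^sub>M) * (of_real \<sigma>\<^sub>R - of_real \<sigma>\<^sub>M) * (of_real \<sigma>\<^sub>M + of_real \<sigma>\<^sub>L)) * h\<^sub>R (- k)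
    = of_real (S * \<sigma>\<^sub>R) * (phase (4 * b - a / \<sigma>\<^sub>R) \<kappa> * ((of_real \<rho>\<^sub>L * (E \<kappa> * E \<kappa>) - of_real \<rho>\<^sub>R) * R\<^sub>0 \<kappa>))"
proof -
  have p: "phase (4 * b - c) \<kappa> = phase (4 * b) \<kappa> * phase (- c) \<kappa>" for c by (simp add: phase_add)
  show "((complex_of_real \<sigma>\<^sub>L + of_real \<sigma>\<^sub>M) * (of_real \<sigma>\<^sub>M - of_real \<sigma>\<^sub>R)
      + exp (4 * \<i> * k * of_real a * of_real \<sigma>\<^sub>L / of_real \<sigma>\<^sub>M) * (of_real \<sigma>\<^sub>L - of_real \<sigma>\<^sub>M) * (of_real \<sigma>\<^sub>M + of_real \<sigma>\<^sub>R)) * h\<^sub>L (- k)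
    = of_real (S * \<sigma>\<^sub>L) * (phase (4 * b - a / \<sigma>\<^sub>L) \<kappa> * ((of_real \<rho>\<^sub>R * (E \<kappa> * E \<kappa>) - of_real \<rho>\<^sub>L) * L\<^sub>0 \<kappa>))"
    if "k * of_real \<sigma>\<^sub>L = \<kappa>"
    using transforms(3)[of "- k" \<kappa>] that unfolding p reflection_factors(1)[OF that] by (simp add: mult_ac)
  show "((complex_of_real \<sigma>\<^sub>R + of_real \<sigma>\<^sub>M) * (of_real \<sigma>\<^sub>M - of_real \<sigma>\<^sub>L)
      + exp (- 4 * \<i> * k * of_real a * of_real \<sigma>\<^sub>R / of_real \<sigma>\<^sub>M) * (of_real \<sigma>\<^sub>R - of_real \<sigma>\<^sub>M) * (of_real \<sigma>\<^sub>M + of_real \<sigma>\<^sub>L)) * h\<^sub>R (- k)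
    = of_real (S * \<sigma>\<^sub>R) * (phase (4 * b - a / \<sigma>\<^sub>R) \<kappa> * ((of_real \<rho>\<^sub>L * (E \<kappa> * E \<kappa>) - of_real \<rho>\<^sub>R) * R\<^sub>0 \<kappa>))"
    if "k * of_real \<sigma>\<^sub>R = - \<kappa>"
    using transforms(4)[of "- k" \<kappa>] that unfolding p reflection_factors(2)[OF that] by (simp add: mult_ac)
qed

text \<open>Used as rules that exhibit a term in the form required by \<open>minus_term\<close> and
  \<open>plus_term\<close>, with delay 0 or \<open>- (2 * b)\<close>.\<close>

lemma phase_mult: "x = phase 0 \<kappa> * x" "E \<kappa> * x = phase (- (2 * b)) \<kappa> * x"
  by (simp_all add: phase_E)

end

section \<open>Identification of the formulae with the heat flows\<close>

context three_layers
begin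

lemmas speed_pos = pos(2-4)

text \<open>Accounts for the integral over the real axis with which each formula begins: it is the
  heat flow generated by the data of the layer itself.\<close>

lemma data_line_integral:
  assumes "0 < \<sigma>" "0 < t" "set_integrable lborel I u"
    and "\<And>y. indicator I (x0 + \<sigma> * y) * u (x0 + \<sigma> * y) = indicator I' y * f y"
  shows "1 / (2 * pi) * (LBINT k. exp (\<i> * complex_of_real k * x - (complex_of_real \<sigma> * k)\<^sup>2 * complex_of_real t) * fourier_on I u (complex_of_real k))
    = complex_of_real (LBINT y:I'. heat_kernel t ((x - x0) / \<sigma> - y) * f y)"
proof -
  have "exp (\<i> * complex_of_real k * complex_of_real x - (complex_of_real \<sigma> * k)\<^sup>2 * complex_of_real t) = gaussian_wave x (\<sigma>\<^sup>2 * t) k" for k :: real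
    by (simp add: gaussian_wave_def algebra_simps power_mult_distrib)
  then have "(LBINT k. exp (\<i> * complex_of_real k * x - (complex_of_real \<sigma> * k)\<^sup>2 * complex_of_real t) * fourier_on I u (complex_of_real k))
    = complex_of_real (2 * pi * (LBINT y:I. heat_kernel (\<sigma>\<^sup>2 * t) (x - y) * u y))"
    using line_integral_fourier_on[of "\<sigma>\<^sup>2 * t" I u x] assms(1,2,3) by simp
  also have "(LBINT y:I. heat_kernel (\<sigma>\<^sup>2 * t) (x - y) * u y) = (LBINT y:I'. heat_kernel t ((x - x0) / \<sigma> - y) * f y)"
    by (rule data_integral_scale[OF assms(1,2,4)])
  finally show ?thesis by simp
qed

text \<open>Accounts for the contour integrals: summed up they are the heat flow generated by the
  extension on one side of the layer.\<close>

lemma image_line_integral: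
  assumes "0 < \<sigma>" "0 < t" "X < 0" "bounded_measurable F C"
    and "e = 1 \<or> e = - 1" "X / \<sigma> = e * (z0 - c)"
    and "\<And>z. indicator I (c + e * z) * f (c + e * z) = indicator {0<..} z * F z"
  shows "of_real (\<sigma> / (2 * pi)) * line_integral X (\<sigma>\<^sup>2 * t) (\<lambda>k. laplace F (of_real \<sigma> * k))
    = complex_of_real (LBINT y:I. heat_kernel t (z0 - y) * f y)"
proof -
  have "line_integral X (\<sigma>\<^sup>2 * t) (\<lambda>k. laplace F (of_real \<sigma> * k))
     = complex_of_real (2 * pi * (LBINT z:{0<..}. heat_kernel (\<sigma>\<^sup>2 * t) (X - \<sigma> * z) * F z))"
    unfolding line_integral_def
    using assms(1,2,3) by (intro bounded_measurable.line_integral_laplace[OF assms(4)]) auto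
  then have "of_real (\<sigma> / (2 * pi)) * line_integral X (\<sigma>\<^sup>2 * t) (\<lambda>k. laplace F (of_real \<sigma> * k))
     = complex_of_real (\<sigma> / (2 * pi) * (2 * pi * (LBINT z:{0<..}. heat_kernel (\<sigma>\<^sup>2 * t) (X - \<sigma> * z) * F z)))"
    by (simp only: of_real_mult)
  also have "\<sigma> / (2 * pi) * (2 * pi * (LBINT z:{0<..}. heat_kernel (\<sigma>\<^sup>2 * t) (X - \<sigma> * z) * F z))
     = (LBINT y:I. heat_kernel t (z0 - y) * f y)"
    using image_integral_scale[OF assms(1,2,5,6,7)] by simp
  finally show ?thesis .
qed

text \<open>Translates the prefactors of the formulae into the scattering amplitudes of
  \<open>laplace_solution\<close>; the last factor on the left comes from the scaling of the data
  and from the determinant.\<close>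

lemma coefficients:
  "\<sigma>\<^sub>L * (\<sigma>\<^sub>M + \<sigma>\<^sub>R) * (\<sigma>\<^sub>M / (pi * S)) = \<sigma>\<^sub>L / (2 * pi) * (1 + \<rho>\<^sub>L)"
  "\<sigma>\<^sub>L * (\<sigma>\<^sub>M - \<sigma>\<^sub>R) * (\<sigma>\<^sub>M / (pi * S)) = \<sigma>\<^sub>L / (2 * pi) * ((1 + \<rho>\<^sub>L) * \<rho>\<^sub>R)"
  "2 * \<sigma>\<^sub>L * \<sigma>\<^sub>M * (\<sigma>\<^sub>R / (pi * S)) = \<sigma>\<^sub>L / (2 * pi) * ((1 + \<rho>\<^sub>L) * (1 - \<rho>\<^sub>R))"
  "\<sigma>\<^sub>M * (\<sigma>\<^sub>M - \<sigma>\<^sub>R) * (\<sigma>\<^sub>L / (pi * S)) = \<sigma>\<^sub>M / (2 * pi) * (\<rho>\<^sub>R * (1 - \<rho>\<^sub>L))"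
  "(\<sigma>\<^sub>M - \<sigma>\<^sub>L) * (\<sigma>\<^sub>M - \<sigma>\<^sub>R) / 2 * (\<sigma>\<^sub>M / (pi * S)) = \<sigma>\<^sub>M / (2 * pi) * (\<rho>\<^sub>R * \<rho>\<^sub>L)"
  "\<sigma>\<^sub>M * (\<sigma>\<^sub>L + \<sigma>\<^sub>M) * (\<sigma>\<^sub>R / (pi * S)) = \<sigma>\<^sub>M / (2 * pi) * (1 - \<rho>\<^sub>R)"
  "(\<sigma>\<^sub>L + \<sigma>\<^sub>M) * (\<sigma>\<^sub>M - \<sigma>\<^sub>R) / 2 * (\<sigma>\<^sub>M / (pi * S)) = \<sigma>\<^sub>M / (2 * pi) * \<rho>\<^sub>R"
  "\<sigma>\<^sub>M * (\<sigma>\<^sub>M + \<sigma>\<^sub>R) * (\<sigma>\<^sub>L / (pi * S)) = \<sigma>\<^sub>M / (2 * pi) * (1 - \<rho>\<^sub>L)"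
  "(\<sigma>\<^sub>M - \<sigma>\<^sub>L) * (\<sigma>\<^sub>M + \<sigma>\<^sub>R) / 2 * (\<sigma>\<^sub>M / (pi * S)) = \<sigma>\<^sub>M / (2 * pi) * \<rho>\<^sub>L"
  "\<sigma>\<^sub>M * (\<sigma>\<^sub>M - \<sigma>\<^sub>L) * (\<sigma>\<^sub>R / (pi * S)) = \<sigma>\<^sub>M / (2 * pi) * (\<rho>\<^sub>L * (1 - \<rho>\<^sub>R))"
  "\<sigma>\<^sub>R * (\<sigma>\<^sub>M + \<sigma>\<^sub>L) * (\<sigma>\<^sub>M / (pi * S)) = \<sigma>\<^sub>R / (2 * pi) * (1 + \<rho>\<^sub>R)"
  "\<sigma>\<^sub>R * (\<sigma>\<^sub>M - \<sigma>\<^sub>L) * (\<sigma>\<^sub>M / (pi * S)) = \<sigma>\<^sub>R / (2 * pi) * ((1 + \<rho>\<^sub>R) * \<rho>\<^sub>L)"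
  "2 * \<sigma>\<^sub>R * \<sigma>\<^sub>M * (\<sigma>\<^sub>L / (pi * S)) = \<sigma>\<^sub>R / (2 * pi) * ((1 + \<rho>\<^sub>R) * (1 - \<rho>\<^sub>L))"
proof -
  have nz: "\<sigma>\<^sub>L + \<sigma>\<^sub>M \<noteq> 0" "\<sigma>\<^sub>M + \<sigma>\<^sub>R \<noteq> 0" using pos by auto
  define p r where "p = \<sigma>\<^sub>L + \<sigma>\<^sub>M" and "r = \<sigma>\<^sub>M + \<sigma>\<^sub>R"
  have \<rho>: "1 + \<rho>\<^sub>L = 2 * \<sigma>\<^sub>M / (\<sigma>\<^sub>L + \<sigma>\<^sub>M)" "1 - \<rho>\<^sub>L = 2 * \<sigma>\<^sub>L / (\<sigma>\<^sub>L + \<sigma>\<^sub>M)" "\<rho>\<^sub>L = (\<sigma>\<^sub>M - \<sigma>\<^sub>L) / (\<sigma>\<^sub>L + \<sigma>\<^sub>M)"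
    "1 + \<rho>\<^sub>R = 2 * \<sigma>\<^sub>M / (\<sigma>\<^sub>M + \<sigma>\<^sub>R)" "1 - \<rho>\<^sub>R = 2 * \<sigma>\<^sub>R / (\<sigma>\<^sub>M + \<sigma>\<^sub>R)" "\<rho>\<^sub>R = (\<sigma>\<^sub>M - \<sigma>\<^sub>R) / (\<sigma>\<^sub>M + \<sigma>\<^sub>R)"
    using nz unfolding \<rho>\<^sub>L_def \<rho>\<^sub>R_def add.commute[of \<sigma>\<^sub>M \<sigma>\<^sub>L] by (simp_all add: field_simps)
  show
    "\<sigma>\<^sub>L * (\<sigma>\<^sub>M + \<sigma>\<^sub>R) * (\<sigma>\<^sub>M / (pi * S)) = \<sigma>\<^sub>L / (2 * pi) * (1 + \<rho>\<^sub>L)"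
    "\<sigma>\<^sub>L * (\<sigma>\<^sub>M - \<sigma>\<^sub>R) * (\<sigma>\<^sub>M / (pi * S)) = \<sigma>\<^sub>L / (2 * pi) * ((1 + \<rho>\<^sub>L) * \<rho>\<^sub>R)"
    "2 * \<sigma>\<^sub>L * \<sigma>\<^sub>M * (\<sigma>\<^sub>R / (pi * S)) = \<sigma>\<^sub>L / (2 * pi) * ((1 + \<rho>\<^sub>L) * (1 - \<rho>\<^sub>R))"
    "\<sigma>\<^sub>M * (\<sigma>\<^sub>M - \<sigma>\<^sub>R) * (\<sigma>\<^sub>L / (pi * S)) = \<sigma>\<^sub>M / (2 * pi) * (\<rho>\<^sub>R * (1 - \<rho>\<^sub>L))"
    "(\<sigma>\<^sub>M - \<sigma>\<^sub>L) * (\<sigma>\<^sub>M - \<sigma>\<^sub>R) / 2 * (\<sigma>\<^sub>M / (pi * S)) = \<sigma>\<^sub>M / (2 * pi) * (\<rho>\<^sub>R * \<rho>\<^sub>L)"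
    "\<sigma>\<^sub>M * (\<sigma>\<^sub>L + \<sigma>\<^sub>M) * (\<sigma>\<^sub>R / (pi * S)) = \<sigma>\<^sub>M / (2 * pi) * (1 - \<rho>\<^sub>R)"
    "(\<sigma>\<^sub>L + \<sigma>\<^sub>M) * (\<sigma>\<^sub>M - \<sigma>\<^sub>R) / 2 * (\<sigma>\<^sub>M / (pi * S)) = \<sigma>\<^sub>M / (2 * pi) * \<rho>\<^sub>R"
    "\<sigma>\<^sub>M * (\<sigma>\<^sub>M + \<sigma>\<^sub>R) * (\<sigma>\<^sub>L / (pi * S)) = \<sigma>\<^sub>M / (2 * pi) * (1 - \<rho>\<^sub>L)"
    "(\<sigma>\<^sub>M - \<sigma>\<^sub>L) * (\<sigma>\<^sub>M + \<sigma>\<^sub>R) / 2 * (\<sigma>\<^sub>M / (pi * S)) = \<sigma>\<^sub>M / (2 * pi) * \<rho>\<^sub>L"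
    "\<sigma>\<^sub>M * (\<sigma>\<^sub>M - \<sigma>\<^sub>L) * (\<sigma>\<^sub>R / (pi * S)) = \<sigma>\<^sub>M / (2 * pi) * (\<rho>\<^sub>L * (1 - \<rho>\<^sub>R))"
    "\<sigma>\<^sub>R * (\<sigma>\<^sub>M + \<sigma>\<^sub>L) * (\<sigma>\<^sub>M / (pi * S)) = \<sigma>\<^sub>R / (2 * pi) * (1 + \<rho>\<^sub>R)"
    "\<sigma>\<^sub>R * (\<sigma>\<^sub>M - \<sigma>\<^sub>L) * (\<sigma>\<^sub>M / (pi * S)) = \<sigma>\<^sub>R / (2 * pi) * ((1 + \<rho>\<^sub>R) * \<rho>\<^sub>L)"
    "2 * \<sigma>\<^sub>R * \<sigma>\<^sub>M * (\<sigma>\<^sub>L / (pi * S)) = \<sigma>\<^sub>R / (2 * pi) * ((1 + \<rho>\<^sub>R) * (1 - \<rho>\<^sub>L))"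
    unfolding \<rho>(1,2,4,5) S_def unfolding \<rho>(3,6) add.commute[of \<sigma>\<^sub>M \<sigma>\<^sub>L] p_def[symmetric] r_def[symmetric]
    using nz[folded p_def r_def] by (simp_all add: field_simps)
qed

lemma integrable_data:
  "set_integrable lborel {..<- a} u\<^sub>L" "set_integrable lborel {- a<..<a} u\<^sub>M" "set_integrable lborel {a<..} u\<^sub>R"
proof -
  show "set_integrable lborel {..<- a} u\<^sub>L" by (rule set_integrable_subset[OF data_L(2)]) auto
  show "set_integrable lborel {- a<..<a} u\<^sub>M"
    by (rule set_integrable_subset[OF borel_integrable_atLeastAtMost'[OF data_M]]) auto
  show "set_integrable lborel {a<..} u\<^sub>R" by (rule set_integrable_subset[OF data_R(2)]) auto
qed

text \<open>Here \<open>X = x + a\<close> is the signed distance to the interface, and what remains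
  of each exponent is \<open>\<sigma>\<^sub>L\<close> times the travel time \<open>pe\<close>. The
  four contour integrals together form the flow of the extension to the right of the
  interface.\<close>

lemma formula_L_eq:
  assumes g: "lower_detour r g" and t: "0 < t" and x: "x < - a"
  shows "complex_of_real (v\<^sub>L x t) = formula_L a \<sigma>\<^sub>L \<sigma>\<^sub>M \<sigma>\<^sub>R h\<^sub>L h\<^sub>M h\<^sub>R (integral_D0_minus r g) x t"
proof -
  have N1: "integral_D0_minus r g (\<lambda>k. exp (\<i> * k * (complex_of_real x + complex_of_real a + 3 * complex_of_real a * complex_of_real \<sigma>\<^sub>L / complex_of_real \<sigma>\<^sub>M) - (\<sigma>\<^sub>L * k)\<^sup>2 * t)
      / Delta_L a \<sigma>\<^sub>L \<sigma>\<^sub>M \<sigma>\<^sub>R k * h\<^sub>M (k * \<sigma>\<^sub>L / \<sigma>\<^sub>M))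
    = - (of_real (\<sigma>\<^sub>M / (pi * S)) * contour_value (x + a) \<sigma>\<^sub>L t A\<^sub>1)"
    by (rule minus_term[OF g _ t speed_pos(1), where pD = "4 * b" and pe = "3 * b" and ph = b and pT = 0 and T' = "A\<^sub>1"];
          (rule Delta_eqs(1) transforms(1) phase_mult | intro bounded_holomorphic_intros)?)
       (use x pos in \<open>auto simp: b_def field_simps\<close>)
  have N2: "integral_D0_minus r g (\<lambda>k. exp (\<i> * k * (complex_of_real x + 2 * complex_of_real a) - (\<sigma>\<^sub>L * k)\<^sup>2 * t)
      / Delta_L a \<sigma>\<^sub>L \<sigma>\<^sub>M \<sigma>\<^sub>R k * ((complex_of_real \<sigma>\<^sub>L + complex_of_real \<sigma>\<^sub>M) * (complex_of_real \<sigma>\<^sub>M - complex_of_real \<sigma>\<^sub>R) + exp (4 * \<i> * k * a * \<sigma>\<^sub>L / \<sigma>\<^sub>M) * (complex_of_real \<sigma>\<^sub>L - complex_of_real \<sigma>\<^sub>M) * (complex_of_real \<sigma>\<^sub>M + complex_of_real \<sigma>\<^sub>R)) * h\<^sub>L (- k))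
    = - (of_real (S * \<sigma>\<^sub>L / (pi * S)) * contour_value (x + a) \<sigma>\<^sub>L t (\<lambda>\<kappa>. (of_real \<rho>\<^sub>R * (E \<kappa> * E \<kappa>) - of_real \<rho>\<^sub>L) * L\<^sub>0 \<kappa>))"
    \<comment> \<open>Groups the bracket with the transform, so that their product plays the part of
      the data in \<open>minus_term\<close>.\<close>
    unfolding mult.assoc[of "_ / _"]
    by (rule minus_term[OF g _ t speed_pos(1), where pD = "4 * b" and pe = "a / \<sigma>\<^sub>L" and ph = "4 * b - a / \<sigma>\<^sub>L" and pT = 0 and T' = "(\<lambda>\<kappa>. (of_real \<rho>\<^sub>R * (E \<kappa> * E \<kappa>) - of_real \<rho>\<^sub>L) * L\<^sub>0 \<kappa>)"];
          (rule Delta_eqs(1) reflected_data(1) phase_mult | intro bounded_holomorphic_intros)?)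
       (use x pos in \<open>auto simp: b_def field_simps\<close>)
  have N3: "integral_D0_minus r g (\<lambda>k. exp (\<i> * k * (complex_of_real x + complex_of_real a + complex_of_real a * complex_of_real \<sigma>\<^sub>L / complex_of_real \<sigma>\<^sub>M) - (\<sigma>\<^sub>L * k)\<^sup>2 * t)
      / Delta_L a \<sigma>\<^sub>L \<sigma>\<^sub>M \<sigma>\<^sub>R k * h\<^sub>M (- k * \<sigma>\<^sub>L / \<sigma>\<^sub>M))
    = - (of_real (\<sigma>\<^sub>M / (pi * S)) * contour_value (x + a) \<sigma>\<^sub>L t (\<lambda>\<kappa>. E \<kappa> * A\<^sub>2 \<kappa>))"
    by (rule minus_term[OF g _ t speed_pos(1), where pD = "4 * b" and pe = b and ph = b and pT = "- (2 * b)" and T' = "A\<^sub>2"];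
          (rule Delta_eqs(1) transforms(2) phase_mult | intro bounded_holomorphic_intros)?)
       (use x pos in \<open>auto simp: b_def field_simps\<close>)
  have N4: "integral_D0_minus r g (\<lambda>k. exp (\<i> * k * (complex_of_real x + complex_of_real a + complex_of_real a * complex_of_real \<sigma>\<^sub>L / complex_of_real \<sigma>\<^sub>R + 2 * complex_of_real a * complex_of_real \<sigma>\<^sub>L / complex_of_real \<sigma>\<^sub>M) - (\<sigma>\<^sub>L * k)\<^sup>2 * t)
      / Delta_L a \<sigma>\<^sub>L \<sigma>\<^sub>M \<sigma>\<^sub>R k * h\<^sub>R (k * \<sigma>\<^sub>L / \<sigma>\<^sub>R))
    = - (of_real (\<sigma>\<^sub>R / (pi * S)) * contour_value (x + a) \<sigma>\<^sub>L t (\<lambda>\<kappa>. E \<kappa> * R\<^sub>0 \<kappa>))"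
    by (rule minus_term[OF g _ t speed_pos(1), where pD = "4 * b" and pe = "a / \<sigma>\<^sub>R + 2 * b" and ph = "- (a / \<sigma>\<^sub>R)" and pT = "- (2 * b)" and T' = "R\<^sub>0"];
          (rule Delta_eqs(1) transforms(4) phase_mult | intro bounded_holomorphic_intros)?)
       (use x pos in \<open>auto simp: b_def field_simps\<close>)
  have sum: "line_integral (x + a) (\<sigma>\<^sub>L\<^sup>2 * t) (\<lambda>k. laplace f\<^sub>L (of_real \<sigma>\<^sub>L * k)) = of_real (1 + \<rho>\<^sub>L) * contour_value (x + a) \<sigma>\<^sub>L t A\<^sub>1 + 1 * contour_value (x + a) \<sigma>\<^sub>L t (\<lambda>\<kappa>. (of_real \<rho>\<^sub>R * (E \<kappa> * E \<kappa>) - of_real \<rho>\<^sub>L) * L\<^sub>0 \<kappa>) + of_real ((1 + \<rho>\<^sub>L) * \<rho>\<^sub>R) * contour_value (x + a) \<sigma>\<^sub>L t (\<lambda>\<kappa>. E \<kappa> * A\<^sub>2 \<kappa>) + of_real ((1 + \<rho>\<^sub>L) * (1 - \<rho>\<^sub>R)) * contour_value (x + a) \<sigma>\<^sub>L t (\<lambda>\<kappa>. E \<kappa> * R\<^sub>0 \<kappa>)"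
    by (rule line_integral_sum) (use x t pos laplace_solution(3) in \<open>auto intro!: bounded_holomorphic_intros simp: algebra_simps\<close>)
  have image: "of_real (\<sigma>\<^sub>L / (2 * pi)) * line_integral (x + a) (\<sigma>\<^sub>L\<^sup>2 * t) (\<lambda>k. laplace f\<^sub>L (of_real \<sigma>\<^sub>L * k))
    = complex_of_real (LBINT y:{0<..}. heat_kernel t ((x - - a) / \<sigma>\<^sub>L - y) * f\<^sub>L y)"
    by (rule image_line_integral[OF _ t _ bounded_measurable_extensions(1), where e = 1 and c = 0]) (use x pos in auto)
  have data: "1 / (2 * pi) * (LBINT k. exp (\<i> * complex_of_real k * x - (complex_of_real \<sigma>\<^sub>L * k)\<^sup>2 * complex_of_real t) * h\<^sub>L (complex_of_real k))
    = complex_of_real (LBINT y:{..<0}. heat_kernel t ((x - - a) / \<sigma>\<^sub>L - y) * f\<^sub>L y)"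
  proof (rule data_line_integral[OF _ t integrable_data(1)])
    show "indicator {..<- a} (- a + \<sigma>\<^sub>L * y) * u\<^sub>L (- a + \<sigma>\<^sub>L * y) = indicator {..<0} y * f\<^sub>L y" for y
      using pos by (auto simp: indicator_def f\<^sub>L_def d\<^sub>L_def mult_less_0_iff)
  qed (use pos in auto)
  have c: "complex_of_real \<sigma>\<^sub>L * (of_real \<sigma>\<^sub>M + of_real \<sigma>\<^sub>R) * of_real (\<sigma>\<^sub>M / (pi * S)) = of_real (\<sigma>\<^sub>L / (2 * pi)) * of_real (1 + \<rho>\<^sub>L)"
    "complex_of_real \<sigma>\<^sub>L * (of_real \<sigma>\<^sub>M - of_real \<sigma>\<^sub>R) * of_real (\<sigma>\<^sub>M / (pi * S)) = of_real (\<sigma>\<^sub>L / (2 * pi)) * of_real ((1 + \<rho>\<^sub>L) * \<rho>\<^sub>R)"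
    "2 * complex_of_real \<sigma>\<^sub>L * of_real \<sigma>\<^sub>M * of_real (\<sigma>\<^sub>R / (pi * S)) = of_real (\<sigma>\<^sub>L / (2 * pi)) * of_real ((1 + \<rho>\<^sub>L) * (1 - \<rho>\<^sub>R))"
    using coefficients(1,2,3)[THEN arg_cong[where f = complex_of_real]]
    by (simp_all only: of_real_mult of_real_add of_real_diff of_real_numeral of_real_1)
  have c2: "1 / 2 * complex_of_real (S * \<sigma>\<^sub>L / (pi * S)) = of_real (\<sigma>\<^sub>L / (2 * pi)) * 1" using S_pos by simp
  have alg: "d - cL * (cM + cR) * - (m1 * y1) - 1 / 2 * - (m2 * y2) + cL * (cR - cM) * - (m3 * y3) - 2 * cL * cM * - (m4 * y4)
    = d + (cL * (cM + cR) * m1 * y1 + 1 / 2 * m2 * y2 + cL * (cM - cR) * m3 * y3 + 2 * cL * cM * m4 * y4)"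
    for d cL cM cR m1 m2 m3 m4 y1 y2 y3 y4 :: complex by (simp add: algebra_simps)
  have "formula_L a \<sigma>\<^sub>L \<sigma>\<^sub>M \<sigma>\<^sub>R h\<^sub>L h\<^sub>M h\<^sub>R (integral_D0_minus r g) x t
    = complex_of_real (LBINT y:{..<0}. heat_kernel t ((x - - a) / \<sigma>\<^sub>L - y) * f\<^sub>L y)
     + of_real (\<sigma>\<^sub>L / (2 * pi)) * line_integral (x + a) (\<sigma>\<^sub>L\<^sup>2 * t) (\<lambda>k. laplace f\<^sub>L (of_real \<sigma>\<^sub>L * k))"
    unfolding formula_L_def N1 N2 N3 N4 data alg c c2 sum by (simp only: distrib_left mult.assoc)
  also have "\<dots> = complex_of_real (v\<^sub>L x t)"
    unfolding image v\<^sub>L_def using L.heat_flow_split[OF t, of 0 0 "(x - - a) / \<sigma>\<^sub>L"]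
    by (simp add: set_lebesgue_integral_def)
  finally show ?thesis by simp
qed

text \<open>The lower contours, with \<open>X = x - a\<close>, produce the extension beyond the
  right interface, and the upper ones, with \<open>X = - (x + a)\<close>, the extension beyond the
  left interface.\<close>

lemma formula_M_eq:
  assumes gP: "upper_detour r\<^sub>P g\<^sub>P" and gN: "lower_detour r\<^sub>N g\<^sub>N" and t: "0 < t" and x: "- a < x" "x < a"
  shows "complex_of_real (v\<^sub>M x t) =
    formula_M a \<sigma>\<^sub>L \<sigma>\<^sub>M \<sigma>\<^sub>R h\<^sub>L h\<^sub>M h\<^sub>R (integral_D0_plus r\<^sub>P g\<^sub>P) (integral_D0_minus r\<^sub>N g\<^sub>N) x t"
proof -
  have N1: "integral_D0_minus r\<^sub>N g\<^sub>N (\<lambda>k. exp (\<i> * k * (complex_of_real x + complex_of_real a + complex_of_real a * complex_of_real \<sigma>\<^sub>M / complex_of_real \<sigma>\<^sub>L) - (\<sigma>\<^sub>M * k)\<^sup>2 * t)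
      / Delta_L a \<sigma>\<^sub>L \<sigma>\<^sub>M \<sigma>\<^sub>R (k * \<sigma>\<^sub>M / \<sigma>\<^sub>L) * h\<^sub>L (- k * \<sigma>\<^sub>M / \<sigma>\<^sub>L))
    = - (of_real (\<sigma>\<^sub>L / (pi * S)) * contour_value (x - a) \<sigma>\<^sub>M t (\<lambda>\<kappa>. E \<kappa> * L\<^sub>0 \<kappa>))"
    by (rule minus_term[OF gN _ t speed_pos(2), where pD = "4 * b" and pe = "2 * b + a / \<sigma>\<^sub>L" and ph = "- (a / \<sigma>\<^sub>L)" and pT = "- (2 * b)" and T' = "L\<^sub>0"];
          (rule Delta_eqs(1) transforms(3) phase_mult | intro bounded_holomorphic_intros)?)
       (use x pos in \<open>auto simp: b_def field_simps\<close>)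
  have N2: "integral_D0_minus r\<^sub>N g\<^sub>N (\<lambda>k. exp (\<i> * k * complex_of_real x - (\<sigma>\<^sub>M * k)\<^sup>2 * t)
      / Delta_L a \<sigma>\<^sub>L \<sigma>\<^sub>M \<sigma>\<^sub>R (k * \<sigma>\<^sub>M / \<sigma>\<^sub>L) * h\<^sub>M k)
    = - (of_real (\<sigma>\<^sub>M / (pi * S)) * contour_value (x - a) \<sigma>\<^sub>M t (\<lambda>\<kappa>. E \<kappa> * A\<^sub>1 \<kappa>))"
    by (rule minus_term[OF gN _ t speed_pos(2), where pD = "4 * b" and pe = b and ph = b and pT = "- (2 * b)" and T' = "A\<^sub>1"];
          (rule Delta_eqs(1) transforms(1) phase_mult | intro bounded_holomorphic_intros)?)
       (use x pos in \<open>auto simp: b_def field_simps\<close>)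
  have N3: "integral_D0_minus r\<^sub>N g\<^sub>N (\<lambda>k. exp (\<i> * k * (complex_of_real x + 3 * complex_of_real a + complex_of_real a * complex_of_real \<sigma>\<^sub>M / complex_of_real \<sigma>\<^sub>R) - (\<sigma>\<^sub>M * k)\<^sup>2 * t)
      / Delta_L a \<sigma>\<^sub>L \<sigma>\<^sub>M \<sigma>\<^sub>R (k * \<sigma>\<^sub>M / \<sigma>\<^sub>L) * h\<^sub>R (k * \<sigma>\<^sub>M / \<sigma>\<^sub>R))
    = - (of_real (\<sigma>\<^sub>R / (pi * S)) * contour_value (x - a) \<sigma>\<^sub>M t R\<^sub>0)"
    by (rule minus_term[OF gN _ t speed_pos(2), where pD = "4 * b" and pe = "4 * b + a / \<sigma>\<^sub>R" and ph = "- (a / \<sigma>\<^sub>R)" and pT = 0 and T' = "R\<^sub>0"];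
          (rule Delta_eqs(1) transforms(4) phase_mult | intro bounded_holomorphic_intros)?)
       (use x pos in \<open>auto simp: b_def field_simps\<close>)
  have N4: "integral_D0_minus r\<^sub>N g\<^sub>N (\<lambda>k. exp (\<i> * k * (complex_of_real x + 2 * complex_of_real a) - (\<sigma>\<^sub>M * k)\<^sup>2 * t)
      / Delta_L a \<sigma>\<^sub>L \<sigma>\<^sub>M \<sigma>\<^sub>R (k * \<sigma>\<^sub>M / \<sigma>\<^sub>L) * h\<^sub>M (- k))
    = - (of_real (\<sigma>\<^sub>M / (pi * S)) * contour_value (x - a) \<sigma>\<^sub>M t A\<^sub>2)"
    by (rule minus_term[OF gN _ t speed_pos(2), where pD = "4 * b" and pe = "3 * b" and ph = b and pT = 0 and T' = "A\<^sub>2"];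
          (rule Delta_eqs(1) transforms(2) phase_mult | intro bounded_holomorphic_intros)?)
       (use x pos in \<open>auto simp: b_def field_simps\<close>)
  have P1: "integral_D0_plus r\<^sub>P g\<^sub>P (\<lambda>k. exp (\<i> * k * (complex_of_real x + complex_of_real a - complex_of_real a * complex_of_real \<sigma>\<^sub>M / complex_of_real \<sigma>\<^sub>L) - (\<sigma>\<^sub>M * k)\<^sup>2 * t)
      / Delta_R a \<sigma>\<^sub>L \<sigma>\<^sub>M \<sigma>\<^sub>R (k * \<sigma>\<^sub>M / \<sigma>\<^sub>R) * h\<^sub>L (k * \<sigma>\<^sub>M / \<sigma>\<^sub>L))
    = of_real (\<sigma>\<^sub>L / (pi * S)) * contour_value (- (x + a)) \<sigma>\<^sub>M t L\<^sub>0"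
    by (rule plus_term[OF gP _ t speed_pos(2), where pD = 0 and pe = "a / \<sigma>\<^sub>L" and ph = "- (a / \<sigma>\<^sub>L)" and pT = 0 and T' = "L\<^sub>0"];
          (rule Delta_eqs(2) transforms(3) phase_mult | intro bounded_holomorphic_intros)?)
       (use x pos in \<open>auto simp: b_def field_simps\<close>)
  have P2: "integral_D0_plus r\<^sub>P g\<^sub>P (\<lambda>k. exp (\<i> * k * (complex_of_real x + 2 * complex_of_real a) - (\<sigma>\<^sub>M * k)\<^sup>2 * t)
      / Delta_R a \<sigma>\<^sub>L \<sigma>\<^sub>M \<sigma>\<^sub>R (k * \<sigma>\<^sub>M / \<sigma>\<^sub>R) * h\<^sub>M (- k))
    = of_real (\<sigma>\<^sub>M / (pi * S)) * contour_value (- (x + a)) \<sigma>\<^sub>M t A\<^sub>1"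
    by (rule plus_term[OF gP _ t speed_pos(2), where pD = 0 and pe = "- b" and ph = b and pT = 0 and T' = "A\<^sub>1"];
          (rule Delta_eqs(2) transforms(1) phase_mult | intro bounded_holomorphic_intros)?)
       (use x pos in \<open>auto simp: b_def field_simps\<close>)
  have P3: "integral_D0_plus r\<^sub>P g\<^sub>P (\<lambda>k. exp (\<i> * k * (complex_of_real x + 4 * complex_of_real a) - (\<sigma>\<^sub>M * k)\<^sup>2 * t)
      / Delta_R a \<sigma>\<^sub>L \<sigma>\<^sub>M \<sigma>\<^sub>R (k * \<sigma>\<^sub>M / \<sigma>\<^sub>R) * h\<^sub>M k)
    = of_real (\<sigma>\<^sub>M / (pi * S)) * contour_value (- (x + a)) \<sigma>\<^sub>M t (\<lambda>\<kappa>. E \<kappa> * A\<^sub>2 \<kappa>)"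
    by (rule plus_term[OF gP _ t speed_pos(2), where pD = 0 and pe = "- (3 * b)" and ph = b and pT = "- (2 * b)" and T' = "A\<^sub>2"];
          (rule Delta_eqs(2) transforms(2) phase_mult | intro bounded_holomorphic_intros)?)
       (use x pos in \<open>auto simp: b_def field_simps\<close>)
  have P4: "integral_D0_plus r\<^sub>P g\<^sub>P (\<lambda>k. exp (\<i> * k * (complex_of_real x + 3 * complex_of_real a - complex_of_real a * complex_of_real \<sigma>\<^sub>M / complex_of_real \<sigma>\<^sub>R) - (\<sigma>\<^sub>M * k)\<^sup>2 * t)
      / Delta_R a \<sigma>\<^sub>L \<sigma>\<^sub>M \<sigma>\<^sub>R (k * \<sigma>\<^sub>M / \<sigma>\<^sub>R) * h\<^sub>R (- k * \<sigma>\<^sub>M / \<sigma>\<^sub>R))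
    = of_real (\<sigma>\<^sub>R / (pi * S)) * contour_value (- (x + a)) \<sigma>\<^sub>M t (\<lambda>\<kappa>. E \<kappa> * R\<^sub>0 \<kappa>)"
    by (rule plus_term[OF gP _ t speed_pos(2), where pD = 0 and pe = "- (2 * b) + a / \<sigma>\<^sub>R" and ph = "- (a / \<sigma>\<^sub>R)" and pT = "- (2 * b)" and T' = "R\<^sub>0"];
          (rule Delta_eqs(2) transforms(4) phase_mult | intro bounded_holomorphic_intros)?)
       (use x pos in \<open>auto simp: b_def field_simps\<close>)
  have sum_right: "line_integral (x - a) (\<sigma>\<^sub>M\<^sup>2 * t) (\<lambda>k. laplace (\<lambda>z. f\<^sub>M (b + z)) (of_real \<sigma>\<^sub>M * k)) = of_real (\<rho>\<^sub>R) * contour_value (x - a) \<sigma>\<^sub>M t A\<^sub>2 + of_real (\<rho>\<^sub>R * \<rho>\<^sub>L) * contour_value (x - a) \<sigma>\<^sub>M t (\<lambda>\<kappa>. E \<kappa> * A\<^sub>1 \<kappa>) + of_real (\<rho>\<^sub>R * (1 - \<rho>\<^sub>L)) * contour_value (x - a) \<sigma>\<^sub>M t (\<lambda>\<kappa>. E \<kappa> * L\<^sub>0 \<kappa>) + of_real (1 - \<rho>\<^sub>R) * contour_value (x - a) \<sigma>\<^sub>M t R\<^sub>0"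
    by (rule line_integral_sum) (use x t pos laplace_solution(1) in \<open>auto intro!: bounded_holomorphic_intros simp: algebra_simps\<close>)
  have sum_left: "line_integral (- (x + a)) (\<sigma>\<^sub>M\<^sup>2 * t) (\<lambda>k. laplace (\<lambda>z. f\<^sub>M (- b - z)) (of_real \<sigma>\<^sub>M * k)) = of_real (\<rho>\<^sub>L) * contour_value (- (x + a)) \<sigma>\<^sub>M t A\<^sub>1 + of_real (\<rho>\<^sub>R * \<rho>\<^sub>L) * contour_value (- (x + a)) \<sigma>\<^sub>M t (\<lambda>\<kappa>. E \<kappa> * A\<^sub>2 \<kappa>) + of_real (\<rho>\<^sub>L * (1 - \<rho>\<^sub>R)) * contour_value (- (x + a)) \<sigma>\<^sub>M t (\<lambda>\<kappa>. E \<kappa> * R\<^sub>0 \<kappa>) + of_real (1 - \<rho>\<^sub>L) * contour_value (- (x + a)) \<sigma>\<^sub>M t L\<^sub>0"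
    by (rule line_integral_sum) (use x t pos laplace_solution(2) in \<open>auto intro!: bounded_holomorphic_intros simp: algebra_simps\<close>)
  have right: "of_real (\<sigma>\<^sub>M / (2 * pi)) * line_integral (x - a) (\<sigma>\<^sub>M\<^sup>2 * t) (\<lambda>k. laplace (\<lambda>z. f\<^sub>M (b + z)) (of_real \<sigma>\<^sub>M * k))
    = complex_of_real (LBINT y:{b<..}. heat_kernel t ((x - 0) / \<sigma>\<^sub>M - y) * f\<^sub>M y)"
    by (rule image_line_integral[OF _ t _ bounded_measurable_shifted(3), where e = 1 and c = b])
       (use x pos in \<open>auto simp: indicator_def b_def diff_divide_distrib\<close>)
  have left: "of_real (\<sigma>\<^sub>M / (2 * pi)) * line_integral (- (x + a)) (\<sigma>\<^sub>M\<^sup>2 * t) (\<lambda>k. laplace (\<lambda>z. f\<^sub>M (- b - z)) (of_real \<sigma>\<^sub>M * k))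
    = complex_of_real (LBINT y:{..<- b}. heat_kernel t ((x - 0) / \<sigma>\<^sub>M - y) * f\<^sub>M y)"
  proof (rule image_line_integral[OF _ t _ bounded_measurable_shifted(4), where e = "- 1" and c = "- b"])
    show "- (x + a) / \<sigma>\<^sub>M = - 1 * ((x - 0) / \<sigma>\<^sub>M - - b)" using pos by (simp add: b_def field_simps)
    show "indicator {..<- b} (- b + - 1 * z) * f\<^sub>M (- b + - 1 * z) = indicator {0<..} z * f\<^sub>M (- b - z)" for z
      by (simp add: indicator_def)
  qed (use x pos in auto)
  have data: "1 / (2 * pi) * (LBINT k. exp (\<i> * complex_of_real k * x - (complex_of_real \<sigma>\<^sub>M * k)\<^sup>2 * complex_of_real t) * h\<^sub>M (complex_of_real k))
    = complex_of_real (LBINT y:{- b<..<b}. heat_kernel t ((x - 0) / \<sigma>\<^sub>M - y) * f\<^sub>M y)"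
  proof (rule data_line_integral[OF _ t integrable_data(2)])
    fix y
    have "- a < \<sigma>\<^sub>M * y \<longleftrightarrow> - b < y" "\<sigma>\<^sub>M * y < a \<longleftrightarrow> y < b"
      using pos by (auto simp: b_def field_simps)
    then show "indicator {- a<..<a} (0 + \<sigma>\<^sub>M * y) * u\<^sub>M (0 + \<sigma>\<^sub>M * y) = indicator {- b<..<b} y * f\<^sub>M y"
      by (auto simp: indicator_def f\<^sub>M_middle d\<^sub>M_def)
  qed (use pos in auto)
  have c: "(complex_of_real \<sigma>\<^sub>L + of_real \<sigma>\<^sub>M) * (of_real \<sigma>\<^sub>M - of_real \<sigma>\<^sub>R) / 2 * of_real (\<sigma>\<^sub>M / (pi * S)) = of_real (\<sigma>\<^sub>M / (2 * pi)) * of_real \<rho>\<^sub>R"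
    "(complex_of_real \<sigma>\<^sub>M - of_real \<sigma>\<^sub>L) * (of_real \<sigma>\<^sub>M - of_real \<sigma>\<^sub>R) / 2 * of_real (\<sigma>\<^sub>M / (pi * S)) = of_real (\<sigma>\<^sub>M / (2 * pi)) * of_real (\<rho>\<^sub>R * \<rho>\<^sub>L)"
    "complex_of_real \<sigma>\<^sub>M * (of_real \<sigma>\<^sub>M - of_real \<sigma>\<^sub>R) * of_real (\<sigma>\<^sub>L / (pi * S)) = of_real (\<sigma>\<^sub>M / (2 * pi)) * of_real (\<rho>\<^sub>R * (1 - \<rho>\<^sub>L))"
    "complex_of_real \<sigma>\<^sub>M * (of_real \<sigma>\<^sub>L + of_real \<sigma>\<^sub>M) * of_real (\<sigma>\<^sub>R / (pi * S)) = of_real (\<sigma>\<^sub>M / (2 * pi)) * of_real (1 - \<rho>\<^sub>R)"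
    "(complex_of_real \<sigma>\<^sub>M - of_real \<sigma>\<^sub>L) * (of_real \<sigma>\<^sub>M + of_real \<sigma>\<^sub>R) / 2 * of_real (\<sigma>\<^sub>M / (pi * S)) = of_real (\<sigma>\<^sub>M / (2 * pi)) * of_real \<rho>\<^sub>L"
    "complex_of_real \<sigma>\<^sub>M * (of_real \<sigma>\<^sub>M - of_real \<sigma>\<^sub>L) * of_real (\<sigma>\<^sub>R / (pi * S)) = of_real (\<sigma>\<^sub>M / (2 * pi)) * of_real (\<rho>\<^sub>L * (1 - \<rho>\<^sub>R))"
    "complex_of_real \<sigma>\<^sub>M * (of_real \<sigma>\<^sub>M + of_real \<sigma>\<^sub>R) * of_real (\<sigma>\<^sub>L / (pi * S)) = of_real (\<sigma>\<^sub>M / (2 * pi)) * of_real (1 - \<rho>\<^sub>L)"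
    using coefficients(4-10)[THEN arg_cong[where f = complex_of_real]]
    by (simp_all only: of_real_mult of_real_add of_real_diff of_real_divide of_real_numeral of_real_1)
  have alg: "d - cM * (cM - cR) * - (m1 * y1) + (cL - cM) * (cM - cR) / 2 * - (m2 * y2) + cM * (cM + cR) * (n1 * z1)
      - cM * (cL + cM) * - (m3 * y3) - (cL + cM) * (cM - cR) / 2 * - (m4 * y4) + (cM - cL) * (cM + cR) / 2 * (n2 * z2)
      + (cM - cL) * (cM - cR) / 2 * (n3 * z3) + cM * (cM - cL) * (n4 * z4)
    = d + ((cL + cM) * (cM - cR) / 2 * m4 * y4 + (cM - cL) * (cM - cR) / 2 * m2 * y2 + cM * (cM - cR) * m1 * y1 + cM * (cL + cM) * m3 * y3)
      + ((cM - cL) * (cM + cR) / 2 * n2 * z2 + (cM - cL) * (cM - cR) / 2 * n3 * z3 + cM * (cM - cL) * n4 * z4 + cM * (cM + cR) * n1 * z1)"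
    for d cL cM cR m1 m2 m3 m4 y1 y2 y3 y4 n1 n2 n3 n4 z1 z2 z3 z4 :: complex
    by (simp add: field_simps)
  have "formula_M a \<sigma>\<^sub>L \<sigma>\<^sub>M \<sigma>\<^sub>R h\<^sub>L h\<^sub>M h\<^sub>R (integral_D0_plus r\<^sub>P g\<^sub>P) (integral_D0_minus r\<^sub>N g\<^sub>N) x t
    = complex_of_real (LBINT y:{- b<..<b}. heat_kernel t ((x - 0) / \<sigma>\<^sub>M - y) * f\<^sub>M y)
     + of_real (\<sigma>\<^sub>M / (2 * pi)) * line_integral (x - a) (\<sigma>\<^sub>M\<^sup>2 * t) (\<lambda>k. laplace (\<lambda>z. f\<^sub>M (b + z)) (of_real \<sigma>\<^sub>M * k))
     + of_real (\<sigma>\<^sub>M / (2 * pi)) * line_integral (- (x + a)) (\<sigma>\<^sub>M\<^sup>2 * t) (\<lambda>k. laplace (\<lambda>z. f\<^sub>M (- b - z)) (of_real \<sigma>\<^sub>M * k))"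
    unfolding formula_M_def N1 N2 N3 N4 P1 P2 P3 P4 data alg c sum_right sum_left by (simp only: distrib_left mult.assoc)
  also have "\<dots> = complex_of_real (v\<^sub>M x t)"
    unfolding right left v\<^sub>M_def using M.heat_flow_split[OF t, of "- b" b "(x - 0) / \<sigma>\<^sub>M"] b_pos
    by (simp add: add.commute)
  finally show ?thesis by simp
qed

text \<open>The mirror image of the left layer: \<open>X = - (x - a)\<close>, upper contours, and an
  extension to the left of the interface, which is therefore read with reversed orientation.\<close>

lemma formula_R_eq:
  assumes g: "upper_detour r g" and t: "0 < t" and x: "a < x"
  shows "complex_of_real (v\<^sub>R x t) = formula_R a \<sigma>\<^sub>L \<sigma>\<^sub>M \<sigma>\<^sub>R h\<^sub>L h\<^sub>M h\<^sub>R (integral_D0_plus r g) x t"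
proof -
  have P1: "integral_D0_plus r g (\<lambda>k. exp (\<i> * k * (complex_of_real x - complex_of_real a - 3 * complex_of_real a * complex_of_real \<sigma>\<^sub>R / complex_of_real \<sigma>\<^sub>M) - (\<sigma>\<^sub>R * k)\<^sup>2 * t)
      / Delta_tilde a \<sigma>\<^sub>L \<sigma>\<^sub>M \<sigma>\<^sub>R k * h\<^sub>M (k * \<sigma>\<^sub>R / \<sigma>\<^sub>M))
    = of_real (\<sigma>\<^sub>M / (pi * S)) * contour_value (- (x - a)) \<sigma>\<^sub>R t A\<^sub>2"
    by (rule plus_term[OF g _ t speed_pos(3), where pD = "4 * b" and pe = "3 * b" and ph = b and pT = 0 and T' = "A\<^sub>2"];
          (rule Delta_eqs(3) transforms(2) phase_mult | intro bounded_holomorphic_intros)?)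
       (use x pos in \<open>auto simp: b_def field_simps\<close>)
  have P2: "integral_D0_plus r g (\<lambda>k. exp (\<i> * k * (complex_of_real x - 2 * complex_of_real a) - (\<sigma>\<^sub>R * k)\<^sup>2 * t)
      / Delta_tilde a \<sigma>\<^sub>L \<sigma>\<^sub>M \<sigma>\<^sub>R k * ((complex_of_real \<sigma>\<^sub>R + complex_of_real \<sigma>\<^sub>M) * (complex_of_real \<sigma>\<^sub>M - complex_of_real \<sigma>\<^sub>L) + exp (- 4 * \<i> * k * a * \<sigma>\<^sub>R / \<sigma>\<^sub>M) * (complex_of_real \<sigma>\<^sub>R - complex_of_real \<sigma>\<^sub>M) * (complex_of_real \<sigma>\<^sub>M + complex_of_real \<sigma>\<^sub>L)) * h\<^sub>R (- k))
    = of_real (S * \<sigma>\<^sub>R / (pi * S)) * contour_value (- (x - a)) \<sigma>\<^sub>R t (\<lambda>\<kappa>. (of_real \<rho>\<^sub>L * (E \<kappa> * E \<kappa>) - of_real \<rho>\<^sub>R) * R\<^sub>0 \<kappa>)"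
    unfolding mult.assoc[of "_ / _"]
    by (rule plus_term[OF g _ t speed_pos(3), where pD = "4 * b" and pe = "a / \<sigma>\<^sub>R" and ph = "4 * b - a / \<sigma>\<^sub>R" and pT = 0 and T' = "(\<lambda>\<kappa>. (of_real \<rho>\<^sub>L * (E \<kappa> * E \<kappa>) - of_real \<rho>\<^sub>R) * R\<^sub>0 \<kappa>)"];
          (rule Delta_eqs(3) reflected_data(2) phase_mult | intro bounded_holomorphic_intros)?)
       (use x pos in \<open>auto simp: b_def field_simps\<close>)
  have P3: "integral_D0_plus r g (\<lambda>k. exp (\<i> * k * (complex_of_real x - complex_of_real a - complex_of_real a * complex_of_real \<sigma>\<^sub>R / complex_of_real \<sigma>\<^sub>M) - (\<sigma>\<^sub>R * k)\<^sup>2 * t)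
      / Delta_tilde a \<sigma>\<^sub>L \<sigma>\<^sub>M \<sigma>\<^sub>R k * h\<^sub>M (- k * \<sigma>\<^sub>R / \<sigma>\<^sub>M))
    = of_real (\<sigma>\<^sub>M / (pi * S)) * contour_value (- (x - a)) \<sigma>\<^sub>R t (\<lambda>\<kappa>. E \<kappa> * A\<^sub>1 \<kappa>)"
    by (rule plus_term[OF g _ t speed_pos(3), where pD = "4 * b" and pe = b and ph = b and pT = "- (2 * b)" and T' = "A\<^sub>1"];
          (rule Delta_eqs(3) transforms(1) phase_mult | intro bounded_holomorphic_intros)?)
       (use x pos in \<open>auto simp: b_def field_simps\<close>)
  have P4: "integral_D0_plus r g (\<lambda>k. exp (\<i> * k * (complex_of_real x - complex_of_real a - complex_of_real a * complex_of_real \<sigma>\<^sub>R / complex_of_real \<sigma>\<^sub>L - 2 * complex_of_real a * complex_of_real \<sigma>\<^sub>R / complex_of_real \<sigma>\<^sub>M) - (\<sigma>\<^sub>R * k)\<^sup>2 * t)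
      / Delta_tilde a \<sigma>\<^sub>L \<sigma>\<^sub>M \<sigma>\<^sub>R k * h\<^sub>L (k * \<sigma>\<^sub>R / \<sigma>\<^sub>L))
    = of_real (\<sigma>\<^sub>L / (pi * S)) * contour_value (- (x - a)) \<sigma>\<^sub>R t (\<lambda>\<kappa>. E \<kappa> * L\<^sub>0 \<kappa>)"
    by (rule plus_term[OF g _ t speed_pos(3), where pD = "4 * b" and pe = "a / \<sigma>\<^sub>L + 2 * b" and ph = "- (a / \<sigma>\<^sub>L)" and pT = "- (2 * b)" and T' = "L\<^sub>0"];
          (rule Delta_eqs(3) transforms(3) phase_mult | intro bounded_holomorphic_intros)?)
       (use x pos in \<open>auto simp: b_def field_simps\<close>)
  have sum: "line_integral (- (x - a)) (\<sigma>\<^sub>R\<^sup>2 * t) (\<lambda>k. laplace (\<lambda>z. f\<^sub>R (- z)) (of_real \<sigma>\<^sub>R * k)) = of_real (1 + \<rho>\<^sub>R) * contour_value (- (x - a)) \<sigma>\<^sub>R t A\<^sub>2 + 1 * contour_value (- (x - a)) \<sigma>\<^sub>R t (\<lambda>\<kappa>. (of_real \<rho>\<^sub>L * (E \<kappa> * E \<kappa>) - of_real \<rho>\<^sub>R) * R\<^sub>0 \<kappa>) + of_real ((1 + \<rho>\<^sub>R) * \<rho>\<^sub>L) * contour_value (- (x - a)) \<sigma>\<^sub>R t (\<lambda>\<kappa>. E \<kappa> * A\<^sub>1 \<kappa>) + of_real ((1 + \<rho>\<^sub>R) * (1 - \<rho>\<^sub>L)) * contour_value (- (x - a)) \<sigma>\<^sub>R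 t (\<lambda>\<kappa>. E \<kappa> * L\<^sub>0 \<kappa>)"
    by (rule line_integral_sum) (use x t pos laplace_solution(4) in \<open>auto intro!: bounded_holomorphic_intros simp: algebra_simps\<close>)
  have image: "of_real (\<sigma>\<^sub>R / (2 * pi)) * line_integral (- (x - a)) (\<sigma>\<^sub>R\<^sup>2 * t) (\<lambda>k. laplace (\<lambda>z. f\<^sub>R (- z)) (of_real \<sigma>\<^sub>R * k))
    = complex_of_real (LBINT y:{..<0}. heat_kernel t ((x - a) / \<sigma>\<^sub>R - y) * f\<^sub>R y)"
    by (rule image_line_integral[OF _ t _ bounded_measurable_shifted(5), where e = "- 1" and c = 0])
       (use x pos in \<open>auto simp: indicator_def field_simps\<close>)
  have data: "1 / (2 * pi) * (LBINT k. exp (\<i> * complex_of_real k * x - (complex_of_real \<sigma>\<^sub>R * k)\<^sup>2 * complex_of_real t) * h\<^sub>R (complex_of_real k))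
    = complex_of_real (LBINT y:{0<..}. heat_kernel t ((x - a) / \<sigma>\<^sub>R - y) * f\<^sub>R y)"
  proof (rule data_line_integral[OF _ t integrable_data(3)])
    show "indicator {a<..} (a + \<sigma>\<^sub>R * y) * u\<^sub>R (a + \<sigma>\<^sub>R * y) = indicator {0<..} y * f\<^sub>R y" for y
      using pos by (auto simp: indicator_def f\<^sub>R_def d\<^sub>R_def zero_less_mult_iff)
  qed (use pos in auto)
  have c: "complex_of_real \<sigma>\<^sub>R * (of_real \<sigma>\<^sub>M + of_real \<sigma>\<^sub>L) * of_real (\<sigma>\<^sub>M / (pi * S)) = of_real (\<sigma>\<^sub>R / (2 * pi)) * of_real (1 + \<rho>\<^sub>R)"
    "complex_of_real \<sigma>\<^sub>R * (of_real \<sigma>\<^sub>M - of_real \<sigma>\<^sub>L) * of_real (\<sigma>\<^sub>M / (pi * S)) = of_real (\<sigma>\<^sub>R / (2 * pi)) * of_real ((1 + \<rho>\<^sub>R) * \<rho>\<^sub>L)"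
    "2 * complex_of_real \<sigma>\<^sub>R * of_real \<sigma>\<^sub>M * of_real (\<sigma>\<^sub>L / (pi * S)) = of_real (\<sigma>\<^sub>R / (2 * pi)) * of_real ((1 + \<rho>\<^sub>R) * (1 - \<rho>\<^sub>L))"
    using coefficients(11-13)[THEN arg_cong[where f = complex_of_real]]
    by (simp_all only: of_real_mult of_real_add of_real_diff of_real_numeral of_real_1)
  have c2: "1 / 2 * complex_of_real (S * \<sigma>\<^sub>R / (pi * S)) = of_real (\<sigma>\<^sub>R / (2 * pi)) * 1" using S_pos by simp
  have alg: "d + cR * (cM + cL) * (m1 * y1) + 1 / 2 * (m2 * y2) - cR * (cL - cM) * (m3 * y3) + 2 * cR * cM * (m4 * y4)
    = d + (cR * (cM + cL) * m1 * y1 + 1 / 2 * m2 * y2 + cR * (cM - cL) * m3 * y3 + 2 * cR * cM * m4 * y4)"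
    for d cL cM cR m1 m2 m3 m4 y1 y2 y3 y4 :: complex by (simp add: algebra_simps)
  have "formula_R a \<sigma>\<^sub>L \<sigma>\<^sub>M \<sigma>\<^sub>R h\<^sub>L h\<^sub>M h\<^sub>R (integral_D0_plus r g) x t
    = complex_of_real (LBINT y:{0<..}. heat_kernel t ((x - a) / \<sigma>\<^sub>R - y) * f\<^sub>R y)
     + of_real (\<sigma>\<^sub>R / (2 * pi)) * line_integral (- (x - a)) (\<sigma>\<^sub>R\<^sup>2 * t) (\<lambda>k. laplace (\<lambda>z. f\<^sub>R (- z)) (of_real \<sigma>\<^sub>R * k))"
    unfolding formula_R_def P1 P2 P3 P4 data alg c c2 sum by (simp only: distrib_left mult.assoc)
  also have "\<dots> = complex_of_real (v\<^sub>R x t)"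
    unfolding image v\<^sub>R_def using R.heat_flow_split[OF t, of 0 0 "(x - a) / \<sigma>\<^sub>R"]
    by (simp add: set_lebesgue_integral_def)
  finally show ?thesis by simp
qed

end

theorem proposition5:
  fixes a \<sigma>\<^sub>L \<sigma>\<^sub>M \<sigma>\<^sub>R :: real
    and u\<^sub>0\<^sub>L u\<^sub>0\<^sub>M u\<^sub>0\<^sub>R :: "real \<Rightarrow> real"
    and J :: "real set"
    and r\<^sub>P r\<^sub>N :: real and g\<^sub>P g\<^sub>N :: "real \<Rightarrow> complex"
  assumes pos: "0 < a" "0 < \<sigma>\<^sub>L" "0 < \<sigma>\<^sub>M" "0 < \<sigma>\<^sub>R"
    and data_L: "continuous_on {..- a} u\<^sub>0\<^sub>L" "set_integrable lborel {..- a} u\<^sub>0\<^sub>L" "(u\<^sub>0\<^sub>L \<longlongrightarrow> 0) at_bot"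
    and data_M: "continuous_on {- a..a} u\<^sub>0\<^sub>M"
    and data_R: "continuous_on {a..} u\<^sub>0\<^sub>R" "set_integrable lborel {a..} u\<^sub>0\<^sub>R" "(u\<^sub>0\<^sub>R \<longlongrightarrow> 0) at_top"
    and times: "J = {0<..} \<or> J = {0..} \<and> interface_conditions a \<sigma>\<^sub>L \<sigma>\<^sub>M \<sigma>\<^sub>R u\<^sub>0\<^sub>L u\<^sub>0\<^sub>M u\<^sub>0\<^sub>R"
    and contours: "upper_detour r\<^sub>P g\<^sub>P" "lower_detour r\<^sub>N g\<^sub>N"
  shows "(\<exists>u\<^sub>L u\<^sub>M u\<^sub>R. heat_solution a \<sigma>\<^sub>L \<sigma>\<^sub>M \<sigma>\<^sub>R u\<^sub>0\<^sub>L u\<^sub>0\<^sub>M u\<^sub>0\<^sub>R J u\<^sub>L u\<^sub>M u\<^sub>R) \<and>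
    (\<forall>u\<^sub>L u\<^sub>M u\<^sub>R. heat_solution a \<sigma>\<^sub>L \<sigma>\<^sub>M \<sigma>\<^sub>R u\<^sub>0\<^sub>L u\<^sub>0\<^sub>M u\<^sub>0\<^sub>R J u\<^sub>L u\<^sub>M u\<^sub>R \<longrightarrow>
       (let hL = fourier_on {..<- a} u\<^sub>0\<^sub>L;
            hM = fourier_on {- a<..<a} u\<^sub>0\<^sub>M;
            hR = fourier_on {a<..} u\<^sub>0\<^sub>R;
            P = integral_D0_plus r\<^sub>P g\<^sub>P;
            N = integral_D0_minus r\<^sub>N g\<^sub>N
        in \<forall>t>0.
          (\<forall>x\<in>{..<- a}. complex_of_real (u\<^sub>L x t) = formula_L a \<sigma>\<^sub>L \<sigma>\<^sub>M \<sigma>\<^sub>R hL hM hR N x t) \<and>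
          (\<forall>x\<in>{- a<..<a}. complex_of_real (u\<^sub>M x t) = formula_M a \<sigma>\<^sub>L \<sigma>\<^sub>M \<sigma>\<^sub>R hL hM hR P N x t) \<and>
          (\<forall>x\<in>{a<..}. complex_of_real (u\<^sub>R x t) = formula_R a \<sigma>\<^sub>L \<sigma>\<^sub>M \<sigma>\<^sub>R hL hM hR P x t)))"
proof -
  interpret P: three_layers a \<sigma>\<^sub>L \<sigma>\<^sub>M \<sigma>\<^sub>R u\<^sub>0\<^sub>L u\<^sub>0\<^sub>M u\<^sub>0\<^sub>R
    by unfold_locales (fact pos data_L data_M data_R)+
  have v: "heat_solution a \<sigma>\<^sub>L \<sigma>\<^sub>M \<sigma>\<^sub>R u\<^sub>0\<^sub>L u\<^sub>0\<^sub>M u\<^sub>0\<^sub>R J P.v\<^sub>L P.v\<^sub>M P.v\<^sub>R"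
    by (rule P.heat_solution_v[OF times])
  have J: "{0<..} \<subseteq> J" using times by auto
  show ?thesis
    unfolding Let_def
  proof (intro conjI allI impI ballI)
    show "\<exists>u\<^sub>L u\<^sub>M u\<^sub>R. heat_solution a \<sigma>\<^sub>L \<sigma>\<^sub>M \<sigma>\<^sub>R u\<^sub>0\<^sub>L u\<^sub>0\<^sub>M u\<^sub>0\<^sub>R J u\<^sub>L u\<^sub>M u\<^sub>R" using v by blast
  next
    fix u\<^sub>L u\<^sub>M u\<^sub>R and t x :: real
    assume u: "heat_solution a \<sigma>\<^sub>L \<sigma>\<^sub>M \<sigma>\<^sub>R u\<^sub>0\<^sub>L u\<^sub>0\<^sub>M u\<^sub>0\<^sub>R J u\<^sub>L u\<^sub>M u\<^sub>R" and t: "0 < t"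
    \<comment> \<open>Both orders of the two solutions, so that the inequalities combine to
      equality.\<close>
    note le = heat_solution_le[OF pos J u v t, of x] heat_solution_le[OF pos J v u t, of x]
    show "complex_of_real (u\<^sub>L x t) = formula_L a \<sigma>\<^sub>L \<sigma>\<^sub>M \<sigma>\<^sub>R P.h\<^sub>L P.h\<^sub>M P.h\<^sub>R (integral_D0_minus r\<^sub>N g\<^sub>N) x t"
      if "x \<in> {..<- a}"
    proof -
      have "u\<^sub>L x t = P.v\<^sub>L x t" using le(1,4) that by simp
      then show ?thesis using P.formula_L_eq[OF contours(2) t, of x] that by simp
    qed
    show "complex_of_real (u\<^sub>M x t) = formula_M a \<sigma>\<^sub>L \<sigma>\<^sub>M \<sigma>\<^sub>R P.h\<^sub>L P.h\<^sub>M P.h\<^sub>R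
        (integral_D0_plus r\<^sub>P g\<^sub>P) (integral_D0_minus r\<^sub>N g\<^sub>N) x t"
      if "x \<in> {- a<..<a}"
    proof -
      have "u\<^sub>M x t = P.v\<^sub>M x t" using le(2,5) that by simp
      then show ?thesis using P.formula_M_eq[OF contours t, of x] that by simp
    qed
    show "complex_of_real (u\<^sub>R x t) = formula_R a \<sigma>\<^sub>L \<sigma>\<^sub>M \<sigma>\<^sub>R P.h\<^sub>L P.h\<^sub>M P.h\<^sub>R (integral_D0_plus r\<^sub>P g\<^sub>P) x t"
      if "x \<in> {a<..}"
    proof -
      have "u\<^sub>R x t = P.v\<^sub>R x t" using le(3,6) that by simp
      then show ?thesis using P.formula_R_eq[OF contours(1) t, of x] that by simp
    qed
  qed
qed

end
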